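(* Let $\gamma(t)$ be an ample, equiregular normal geodesic in a sub-Riemannian manifold $(M,\mathcal{E},g)$, with extremal $\lambda(t)$, Young diagram $\mathbb{Y}$ and reduced Young diagram $\mathsf{Y}$ with $\mathsf{d}_1$ rows of lengths $\mathsf{n}_1>\dots>\mathsf{n}_{\mathsf{d}_1}$. Let $\nabla$ be a connection compatible with $(\mathcal{E},g)$, with twist polynomials $P_k$. Let $B=B_0+B_+$ and $C$ be the endomorphisms of $\mathcal{E}_{\gamma(t)}$ defined in the context, and $b^\dagger$ the $g$-dual of an endomorphism $b$ of $\mathcal{E}_{\gamma(t)}$. Define an anti-symmetric linear map $Q(t):\mathcal{E}_{\gamma(t)}\to\mathcal{E}_{\gamma(t)}$ by $$Q=\frac12\sum_{\mathsf{a}=1}^{\mathsf{d}_1}\frac1{\mathsf{n}_{\mathsf{a}}}\mathrm{pr}_{\mathsf{a}}\,(B_0-B_0^\dagger-2A^\sharp)\,\mathrm{pr}_{\mathsf{a}}+(C-B_+)-(C-B_+)^\dagger.$$ Let $\{X_{a,b}\}_{(a,b)\in\mathbb{Y}}$ be the canonical frame along $\gamma$ uniquely determined by initial values $X_{a,1}(0)=u^a\in\Box^{[a,1]}(0)$ (where, for each fixed $\mathsf{a}$, the $u^a$ with $[a,1]=(\mathsf{a},1)$ form an orthonormal basis of $\Box^{\mathsf{a},1}(0)$), and let $S$ be the canonical symmetric tensor along $\gamma$. Then $X_{1,1},\dots,X_{d_1,1}$ are the solutions of $$D_tX_{a,1}=QX_{a,1},\qquad X_{a,1}(0)=u^a.$$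 Furthermore, $$S^\sharp|_{\mathcal{E}}=\frac12(B_0+B_0^\dagger)+B_++B_+^\dagger-\sum_{\mathsf{a}=1}^{\mathsf{d}_1}\big(\mathsf{n}_{\mathsf{a}}(C-B_+)+\mathrm{pr}_{<\mathsf{a}}A^\sharp\big)\mathrm{pr}_{\mathsf{a}}-\Big(\sum_{\mathsf{a}=1}^{\mathsf{d}_1}\big(\mathsf{n}_{\mathsf{a}}(C-B_+)+\mathrm{pr}_{<\mathsf{a}}A^\sharp\big)\mathrm{pr}_{\mathsf{a}}\Big)^\dagger.$$ Finally, if $\wp_1(t):\mathcal{E}_{\gamma(t)}\to T_{\gamma(t)}M$ is defined by $\wp_1=(P_1+A^\sharp+S^\sharp)|_{\mathcal{E}}+Q$ (all evaluated at $\lambda(t)$), then $\wp_1u=0$ for $u\in\Box^{\mathsf{d}_1,1}$, while $\wp_1X_{a,1}=X_{a,2}$ for every $a$ with $n_a>1$.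
   Context: A sub-Riemannian manifold $(M,\mathcal{E},g)$: connected $M$, bracket-generating subbundle $\mathcal{E}\subseteq TM$, metric tensor $g$ on $\mathcal{E}$. $\sharp:T^*M\to\mathcal{E}$, $p(v)=\langle\sharp p,v\rangle_g$ for $v \in \mathcal{E}$; $\pi:T^*M\to M$; $H(p)=\frac12p(\sharp p)$ with Hamiltonian vector field $\vec H$. Normal geodesic: $\gamma(t)=\pi(\lambda(t))$ with extremal $\lambda(t)=e^{t\vec H}(p)$; $\sharp\lambda=\dot\gamma$. Jacobi curve: $\Lambda(t)=(e^{-t\vec H})_*(\ker\pi_* )_{\lambda(t)}$; $\Lambda^{(i)}(t)$ is the span of $\frac{d^j}{dt^j}z(t)$, $0\le j\le i$, $z$ a smooth curve with $z(\tau)\in\Lambda(\tau)$. Ample: for every $t$ some $\Lambda^{(i)}(t)=T_{\lambda(0)}T^*M$. Equiregular: all $k_i=\dim\Lambda^{(i)}(t)$ constant. For such a geodesic $d_j=k_j-k_{j-1}$ is non-increasing, $s$ is the minimal index with $\Lambda^{(s)}=T_{\lambda(0)}T^*M$, and the Young diagram $\mathbb{Y}=\mathbb{Y}(d_1,\dots,d_s)=\{(a,b):1\le b\le s,1\le a\le d_b\}$ has $d_b$ boxes in column $b$. $n_a$ is the length of row $a$; $\mathsf{n}_1>\dots>\mathsf{n}_{\mathsf{d}_1}$ are the distinct row lengths; $\mathsf{Y}=\{(\mathsf{a},\mathsf{b}):1\le\mathsf{a}\le\mathsf{d}_1,1\le\mathsf{b}\le\mathsf{n}_{\mathsf{a}}\}$;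 $[a,b]=(\mathsf{a},\mathsf{b})$ is defined by $\mathsf{b}=b$, $\mathsf{n}_{\mathsf{a}}=n_a$. A connection $\nabla$ on $TM$ is compatible if it preserves $\mathcal{E}$ under parallel transport and is metric for $g$ on $\mathcal{E}$. $T(X,Y)=\nabla_XY-\nabla_YX-[X,Y]$, $R(X,Y)=[\nabla_X,\nabla_Y]-\nabla_{[X,Y]}$, adjoint connection $\hat\nabla_XY=\nabla_XY-T(X,Y)$; $D_t,\hat D_t$ are the covariant derivatives along $\gamma$ of $\nabla,\hat\nabla$. $A_p(v,w)=\frac12p(T(v,w))$, $A^\sharp(v)=\sharp A(v,\cdot)$ (evaluated at $p=\lambda(t)$ along $\gamma$). For a section $E$ of the pull-back to $T^*M$ of a tensor bundle on $M$, $\vec\partial E=(\pi^*\nabla)_{\vec H}E$, i.e. $(\vec\partial E)|_{\lambda(t)}=D_t(E|_{\lambda(t)})$ along extremals. Twist polynomials are the sections of $\pi^*\mathrm{End}(TM)$ given by $P_0=\mathrm{id}$, $P_1|_p=-T(\sharp p,\cdot)$, $P_k=\vec\partial P_{k-1}+P_1P_{k-1}$. $\mathfrak{E}^i_p=\mathrm{span}\{P_j|_pv:v\in\mathcal{E}_{\pi(p)},0\le j\le i-1\}$. For a symmetric two-tensor $S\in\Gamma(\gamma^*\mathrm{Sym}^2T^*M)$ along $\gamma$, $S^\sharp(X)=\sharp S(X,\cdot)$, $D_t^SX=\hat D_tX+A^\sharp_\lambda(X)+S^\sharp(X)$, and $\mathfrak{R}^S_\gamma$ is the symmetric two-tensor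 along $\gamma$ with $$\mathfrak{R}^S_\gamma(X,X)=\lambda R(\dot\gamma,X)X+\lambda(\nabla_XT)(\dot\gamma,X)+|S^\sharp(X)+A^\sharp_\lambda(X)|_g^2-(\hat D_tS)(X,X).$$ The canonical symmetric tensor $S$ is the unique one for which there is a frame $\{X_{a,b}\}_{(a,b)\in\mathbb{Y}}$ of $TM$ along $\gamma$ (a canonical frame, unique up to the choice of the initial orthonormal bases for the vectors $X_{a,1}(0)$ with $[a,1]=(\mathsf{a},1)$, for each $\mathsf a$) such that $D_t^SX_{a,b}=X_{a,b+1}$ for $1\le b<n_a$, $D_t^SX_{a,n_a}=0$, $X_{1,1},\dots,X_{d_1,1}$ is an orthonormal basis of $\mathcal{E}$ along $\gamma$, and for all $(a,b),(i,j)\in\mathbb{Y}$ with $[a,b]=(\mathsf{a},\mathsf{b})$, $[i,j]=(\mathsf{i},\mathsf{j})$: (i) if $\mathsf{a}=\mathsf{i}$ and $b<\mathsf{n}_{\mathsf{a}}$, $\mathfrak{R}^S_\gamma(X_{a,b},X_{i,b+1})=-\mathfrak{R}^S_\gamma(X_{a,b+1},X_{i,b})$; (ii) if $\mathsf{a}=\mathsf{i}$, $\mathsf{j}\notin\{\mathsf{b}-1,\mathsf{b},\mathsf{b}+1\}$, $\mathfrak{R}^S_\gamma(X_{a,b},X_{i,j})=0$; (iii) if $\mathsf{a}<\mathsf{i}$, $\mathsf{j}<\mathsf{n}_{\mathsf{i}}$, $\mathsf{j}\notin\{\mathsf{b},\mathsf{b}+1\}$, $\mathfrak{R}^S_\gamma(X_{a,b},X_{i,j})=0$;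 (iv) if $\mathsf{a}<\mathsf{i}$, $\mathsf{b}<\mathsf{n}_{\mathsf{i}}-1$, $\mathfrak{R}^S_\gamma(X_{a,b},X_{i,n_i})=0$; (v) if $\mathsf{a}<\mathsf{i}$, $\mathsf{n}_{\mathsf{a}}-\mathsf{n}_{\mathsf{i}}\ge\mathsf{b}+\mathsf{j}$, $\mathfrak{R}^S_\gamma(X_{a,b},X_{i,j})=0$. $\Box^{\mathsf{a},\mathsf{b}}(t)=\mathrm{span}\{X_{a,b}(t):[a,b]=(\mathsf{a},\mathsf{b})\}$, so $\mathcal{E}_{\gamma(t)}=\bigoplus_{\mathsf{a}}\Box^{\mathsf{a},1}(t)$ orthogonally; $\mathrm{pr}_{\mathsf{a}}:\mathcal{E}_{\gamma(t)}\to\Box^{\mathsf{a},1}(t)$ are the projections and $\mathrm{pr}_{<\mathsf{a}}=\sum_{\mathsf{i}<\mathsf{a}}\mathrm{pr}_{\mathsf{i}}$. The maps $B,C$ are determined by: for $u\in\Box^{\mathsf{a},1}$, $$P_{\mathsf{n}_{\mathsf{a}}}u=-P_{\mathsf{n}_{\mathsf{a}}-1}(B_0+B_+)u\mod\mathfrak{E}^{\mathsf{n}_{\mathsf{a}}-1}_{\lambda(t)},\qquad P_{\mathsf{n}_{\mathsf{a}}+1}u=-P_{\mathsf{n}_{\mathsf{a}}}Cu\mod\mathfrak{E}^{\mathsf{n}_{\mathsf{a}}}_{\lambda(t)},$$ with $B=B_0+B_+$, $B_0(\Box^{\mathsf{a},1})\subseteq\Box^{\mathsf{a},1}$, $B_+(\Box^{\mathsf{a},1})\subseteq\bigoplus_{\mathsf{i}<\mathsf{a}}\Box^{\mathsf{i},1}$,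 $C(\Box^{\mathsf{a},1})\subseteq\bigoplus_{\mathsf{i}<\mathsf{a}}\Box^{\mathsf{i},1}$. *)

theory Defs
  imports "HOL-Analysis.Analysis"
begin

section \<open>Smooth maps\<close>

primrec Ck_on :: "nat \<Rightarrow> 'a::real_normed_vector set \<Rightarrow> ('a \<Rightarrow> 'b::real_normed_vector) \<Rightarrow> bool" where
  "Ck_on 0 U f \<longleftrightarrow> continuous_on U f"
| "Ck_on (Suc k) U f \<longleftrightarrow>
     (\<forall>x\<in>U. f differentiable (at x)) \<and> (\<forall>v. Ck_on k U (\<lambda>x. frechet_derivative f (at x) v))"

text \<open>Used for open \<open>U\<close> in finite-dimensional spaces only.\<close>

definition smooth_on :: "'a::real_normed_vector set \<Rightarrow> ('a \<Rightarrow> 'b::real_normed_vector) \<Rightarrow> bool" where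
  "smooth_on U f \<longleftrightarrow> (\<forall>k. Ck_on k U f)"

text \<open>For curves the derivatives are taken within the parameter set, so that intervals with
  end points are allowed.\<close>

definition vderiv :: "real set \<Rightarrow> (real \<Rightarrow> 'b::real_normed_vector) \<Rightarrow> real \<Rightarrow> 'b" where
  "vderiv J f t = vector_derivative f (at t within J)"

definition smooth_curve :: "real set \<Rightarrow> (real \<Rightarrow> 'b::real_normed_vector) \<Rightarrow> bool" where
  "smooth_curve J f \<longleftrightarrow> (\<forall>k. \<forall>t\<in>J. ((vderiv J ^^ k) f) differentiable (at t within J))"


section \<open>Manifolds and their tangent bundles\<close>

text \<open>A manifold is a topological space, carried by a whole type \<open>'m\<close>, with a smooth atlas
  modelled on the Euclidean space \<open>'e\<close>; a chart is a pair of its domain and its coordinate map.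
  A choice function selects one chart around each point, and every tangent space
  \<open>T\<^sub>qM\<close> is identified with \<open>'e\<close> by the selected chart at \<open>q\<close>. Thus a vector field
  is a function \<open>'m \<Rightarrow> 'e\<close>; its components in a chart \<open>c\<close> at \<open>q\<close> arise from the value at \<open>q\<close> by the
  differential of the coordinate change (\<open>vcoord\<close> below). Covectors at \<open>q\<close> are
  represented by elements \<open>\<alpha>\<close> of \<open>'e\<close>, acting on a tangent vector \<open>v\<close> by \<open>\<alpha> \<bullet> v\<close>; a point
  of \<open>T\<^sup>*M\<close> is a pair \<open>(q, \<alpha>)\<close>, and the projection \<open>\<pi>\<close> is \<open>fst\<close>.\<close>

type_synonym ('m, 'e) chart = "'m set \<times> ('m \<Rightarrow> 'e)"

definition chart_inv :: "('m, 'e) chart \<Rightarrow> 'e \<Rightarrow> 'm" where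
  "chart_inv c = inv_into (fst c) (snd c)"

definition smooth_atlas ::
  "('m::topological_space, 'e::euclidean_space) chart set \<Rightarrow> bool" where
  "smooth_atlas A \<longleftrightarrow>
     (\<Union>c\<in>A. fst c) = UNIV \<and>
     (\<forall>c\<in>A. open (fst c) \<and> open (snd c ` fst c) \<and>
            homeomorphism (fst c) (snd c ` fst c) (snd c) (chart_inv c)) \<and>
     (\<forall>c\<in>A. \<forall>c'\<in>A. smooth_on (snd c ` (fst c \<inter> fst c')) (\<lambda>x. snd c' (chart_inv c x)))"

text \<open>The data of a sub-Riemannian manifold. Only the values of \<open>gmet M q\<close> on \<open>distr M q\<close> are
  meaningful.\<close>

record ('m, 'e) subriem =
  atlas :: "('m, 'e) chart set"
  distr :: "'m \<Rightarrow> 'e set"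
  gmet :: "'m \<Rightarrow> 'e \<Rightarrow> 'e \<Rightarrow> real"

text \<open>A connection is given on local vector fields: \<open>nabla q v Y\<close> is \<open>\<nabla>\<^sub>v Y\<close> at \<open>q\<close>, for
  \<open>v\<close> tangent at \<open>q\<close> and \<open>Y\<close> smooth near \<open>q\<close>.\<close>

type_synonym ('m, 'e) conn = "'m \<Rightarrow> 'e \<Rightarrow> ('m \<Rightarrow> 'e) \<Rightarrow> 'e"

context
  fixes M :: "('m::{second_countable_topology,t2_space}, 'e::euclidean_space) subriem"
begin

definition chart_at :: "'m \<Rightarrow> ('m, 'e) chart" where
  "chart_at q = (SOME c. c \<in> atlas M \<and> q \<in> fst c)"

text \<open>Components in the chart \<open>c\<close> of a tangent vector at \<open>q\<close>, and the tangent vector at \<open>q\<close> with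
  given components.\<close>

definition vcoord :: "('m, 'e) chart \<Rightarrow> 'm \<Rightarrow> 'e \<Rightarrow> 'e" where
  "vcoord c q = frechet_derivative (\<lambda>x. snd c (chart_inv (chart_at q) x)) (at (snd (chart_at q) q))"

definition vfrom :: "('m, 'e) chart \<Rightarrow> 'm \<Rightarrow> 'e \<Rightarrow> 'e" where
  "vfrom c q = frechet_derivative (\<lambda>x. snd (chart_at q) (chart_inv c x)) (at (snd c q))"

text \<open>The vector field with constant components \<open>w\<close> in the chart \<open>c\<close>.\<close>

definition const_field :: "('m, 'e) chart \<Rightarrow> 'e \<Rightarrow> 'm \<Rightarrow> 'e" where
  "const_field c w = (\<lambda>q. vfrom c q w)"

definition smooth_fun :: "'m set \<Rightarrow> ('m \<Rightarrow> real) \<Rightarrow> bool" where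
  "smooth_fun U f \<longleftrightarrow> (\<forall>c\<in>atlas M. smooth_on (snd c ` (U \<inter> fst c)) (\<lambda>x. f (chart_inv c x)))"

definition vf_coord :: "('m, 'e) chart \<Rightarrow> ('m \<Rightarrow> 'e) \<Rightarrow> 'e \<Rightarrow> 'e" where
  "vf_coord c X x = vcoord c (chart_inv c x) (X (chart_inv c x))"

definition smooth_vf :: "'m set \<Rightarrow> ('m \<Rightarrow> 'e) \<Rightarrow> bool" where
  "smooth_vf U X \<longleftrightarrow> (\<forall>c\<in>atlas M. smooth_on (snd c ` (U \<inter> fst c)) (vf_coord c X))"

definition dfun :: "('m \<Rightarrow> real) \<Rightarrow> 'm \<Rightarrow> 'e \<Rightarrow> real" where
  "dfun f q v =
     frechet_derivative (\<lambda>x. f (chart_inv (chart_at q) x)) (at (snd (chart_at q) q)) v"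

text \<open>\<open>[X, Y]\<^sup>i = X(Y\<^sup>i) - Y(X\<^sup>i)\<close> in the chart at \<open>q\<close>.\<close>

definition lie_bracket :: "('m \<Rightarrow> 'e) \<Rightarrow> ('m \<Rightarrow> 'e) \<Rightarrow> 'm \<Rightarrow> 'e" where
  "lie_bracket X Y q =
     (let c = chart_at q; x = snd c q
      in frechet_derivative (vf_coord c Y) (at x) (X q)
         - frechet_derivative (vf_coord c X) (at x) (Y q))"


section \<open>Sub-Riemannian manifolds\<close>

definition smooth_subbundle :: bool where
  "smooth_subbundle \<longleftrightarrow>
     (\<forall>q. \<exists>U r Y. open U \<and> q \<in> U \<and> (\<forall>i<r::nat. smooth_vf U (Y i)) \<and>
        (\<forall>x\<in>U. inj_on (\<lambda>i. Y i x) {..<r} \<and> independent ((\<lambda>i. Y i x) ` {..<r}) \<and>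
               distr M x = span ((\<lambda>i. Y i x) ` {..<r})))"

definition distr_section :: "'m set \<Rightarrow> ('m \<Rightarrow> 'e) \<Rightarrow> bool" where
  "distr_section U X \<longleftrightarrow> smooth_vf U X \<and> (\<forall>q\<in>U. X q \<in> distr M q)"

definition metric_on_distr :: bool where
  "metric_on_distr \<longleftrightarrow>
     (\<forall>q. \<forall>u\<in>distr M q. \<forall>v\<in>distr M q.
        gmet M q u v = gmet M q v u \<and>
        (\<forall>w\<in>distr M q. gmet M q (u + v) w = gmet M q u w + gmet M q v w) \<and>
        (\<forall>a. gmet M q (a *\<^sub>R u) v = a * gmet M q u v) \<and>
        (u \<noteq> 0 \<longrightarrow> gmet M q u u > 0)) \<and>
     (\<forall>U X Y. open U \<and> distr_section U X \<and> distr_section U Y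
        \<longrightarrow> smooth_fun U (\<lambda>q. gmet M q (X q) (Y q)))"

inductive_set iterated_brackets :: "'m set \<Rightarrow> ('m \<Rightarrow> 'e) set" for U :: "'m set" where
  base: "distr_section U X \<Longrightarrow> X \<in> iterated_brackets U"
| step: "distr_section U X \<Longrightarrow> Y \<in> iterated_brackets U \<Longrightarrow> lie_bracket X Y \<in> iterated_brackets U"

definition bracket_generating :: bool where
  "bracket_generating \<longleftrightarrow>
     (\<forall>q. span {X q |X. \<exists>U. open U \<and> q \<in> U \<and> X \<in> iterated_brackets U} = UNIV)"

definition sub_riemannian :: bool where
  "sub_riemannian \<longleftrightarrow>
     smooth_atlas (atlas M) \<and> connected (UNIV :: 'm set) \<and>
     smooth_subbundle \<and> metric_on_distr \<and> bracket_generating"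

text \<open>\<open>\<sharp>\<close> on linear functionals \<open>p\<close> on \<open>T\<^sub>qM\<close>.\<close>

definition sharp :: "'m \<Rightarrow> ('e \<Rightarrow> real) \<Rightarrow> 'e" where
  "sharp q p = (THE u. u \<in> distr M q \<and> (\<forall>v\<in>distr M q. p v = gmet M q u v))"

definition csharp :: "'m \<times> 'e \<Rightarrow> 'e" where
  "csharp p = sharp (fst p) (\<lambda>v. snd p \<bullet> v)"


section \<open>Vector fields along curves\<close>

definition smooth_curve_in :: "real set \<Rightarrow> (real \<Rightarrow> 'm) \<Rightarrow> bool" where
  "smooth_curve_in I \<gamma> \<longleftrightarrow>
     continuous_on I \<gamma> \<and>
     (\<forall>c\<in>atlas M. smooth_curve {t \<in> I. \<gamma> t \<in> fst c} (\<lambda>t. snd c (\<gamma> t)))"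

definition velocity :: "real set \<Rightarrow> (real \<Rightarrow> 'm) \<Rightarrow> real \<Rightarrow> 'e" where
  "velocity I \<gamma> t = vector_derivative (\<lambda>s. snd (chart_at (\<gamma> t)) (\<gamma> s)) (at t within I)"

definition smooth_along :: "real set \<Rightarrow> (real \<Rightarrow> 'm) \<Rightarrow> (real \<Rightarrow> 'e) \<Rightarrow> bool" where
  "smooth_along I \<gamma> V \<longleftrightarrow>
     (\<forall>c\<in>atlas M. smooth_curve {t \<in> I. \<gamma> t \<in> fst c} (\<lambda>t. vcoord c (\<gamma> t) (V t)))"

definition differentiable_along :: "real set \<Rightarrow> (real \<Rightarrow> 'm) \<Rightarrow> (real \<Rightarrow> 'e) \<Rightarrow> bool" where
  "differentiable_along I \<gamma> V \<longleftrightarrow>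
     (\<forall>t\<in>I. (\<lambda>s. vcoord (chart_at (\<gamma> t)) (\<gamma> s) (V s)) differentiable (at t within I))"

text \<open>The covariant derivative of \<open>V = \<Sum> V\<^sup>i \<partial>\<^sub>i\<close> along \<open>\<gamma>\<close> is
  \<open>\<Sum> (dV\<^sup>i/dt) \<partial>\<^sub>i + V\<^sup>i \<nabla>\<^sub>\<gamma>\<^sub>' \<partial>\<^sub>i\<close>, where \<open>\<partial>\<^sub>i\<close> are the coordinate fields of the chart at
  \<open>\<gamma>(t)\<close>.\<close>

definition cov_deriv ::
  "('m, 'e) conn \<Rightarrow> real set \<Rightarrow> (real \<Rightarrow> 'm) \<Rightarrow> (real \<Rightarrow> 'e) \<Rightarrow> real \<Rightarrow> 'e" where
  "cov_deriv nabla I \<gamma> V t =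
     (let c = chart_at (\<gamma> t)
      in vector_derivative (\<lambda>s. vcoord c (\<gamma> s) (V s)) (at t within I)
         + nabla (\<gamma> t) (velocity I \<gamma> t) (const_field c (V t)))"


section \<open>The Hamiltonian flow on the cotangent bundle\<close>

text \<open>The chart of \<open>T\<^sup>*M\<close> induced by a chart \<open>c\<close> of \<open>M\<close>: canonical coordinates \<open>(x, \<xi>)\<close>, where
  \<open>\<xi> \<bullet> w = \<alpha> \<bullet> vfrom c q w\<close>. Tangent spaces of \<open>T\<^sup>*M\<close> at \<open>p\<close> are identified with \<open>'e \<times> 'e\<close> by
  the chart induced by \<open>chart_at (fst p)\<close>, and \<open>\<pi>\<^sub>*\<close> becomes \<open>fst\<close>.\<close>

definition cchart :: "('m, 'e) chart \<Rightarrow> 'm \<times> 'e \<Rightarrow> 'e \<times> 'e" where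
  "cchart c p = (snd c (fst p), adjoint (vfrom c (fst p)) (snd p))"

definition cchart_inv :: "('m, 'e) chart \<Rightarrow> 'e \<times> 'e \<Rightarrow> 'm \<times> 'e" where
  "cchart_inv c z =
     (chart_inv c (fst z), adjoint (vcoord c (chart_inv c (fst z))) (snd z))"

definition hamiltonian :: "'m \<times> 'e \<Rightarrow> real" where
  "hamiltonian p = (snd p \<bullet> csharp p) / 2"

text \<open>The canonical symplectic form \<open>\<sigma> = d\<xi> \<and> dx\<close>; the Hamiltonian field is determined by
  \<open>dH = \<sigma>(\<cdot>, \<H>)\<close>, i.e. \<open>x' = \<partial>H/\<partial>\<xi>\<close> and \<open>\<xi>' = -\<partial>H/\<partial>x\<close>.\<close>

definition symplectic :: "'e \<times> 'e \<Rightarrow> 'e \<times> 'e \<Rightarrow> real" where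
  "symplectic v w = snd v \<bullet> fst w - snd w \<bullet> fst v"

definition ham_field :: "'m \<times> 'e \<Rightarrow> 'e \<times> 'e" where
  "ham_field p =
     (let c = chart_at (fst p)
      in THE h. \<forall>w. frechet_derivative (\<lambda>z. hamiltonian (cchart_inv c z)) (at (cchart c p)) w
                   = symplectic w h)"

definition integral_curve :: "real set \<Rightarrow> (real \<Rightarrow> 'm \<times> 'e) \<Rightarrow> bool" where
  "integral_curve I lam \<longleftrightarrow>
     continuous_on I (\<lambda>t. fst (lam t)) \<and>
     (\<forall>t\<in>I. ((\<lambda>s. cchart (chart_at (fst (lam t))) (lam s)) has_vector_derivative ham_field (lam t))
              (at t within I))"

definition flow :: "real \<Rightarrow> 'm \<times> 'e \<Rightarrow> 'm \<times> 'e" where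
  "flow t p =
     (THE p'. \<exists>\<mu>. integral_curve (closed_segment 0 t) \<mu> \<and> \<mu> 0 = p \<and> \<mu> t = p')"


section \<open>The Jacobi curve and the Young diagram\<close>

text \<open>In this section and the following ones \<open>lam\<close> is an extremal defined on an interval \<open>I\<close>
  containing \<open>0\<close>. The Jacobi curve lies in \<open>T\<^sub>\<lambda>\<^sub>(\<^sub>0\<^sub>)T\<^sup>*M = 'e \<times> 'e\<close>.\<close>

definition jacobi_curve :: "(real \<Rightarrow> 'm \<times> 'e) \<Rightarrow> real \<Rightarrow> ('e \<times> 'e) set" where
  "jacobi_curve lam t =
     (let c0 = chart_at (fst (lam 0)); ct = chart_at (fst (lam t))
      in frechet_derivative (\<lambda>z. cchart c0 (flow (- t) (cchart_inv ct z))) (at (cchart ct (lam t)))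
         ` {w. fst w = 0})"

definition jacobi_flag :: "real set \<Rightarrow> (real \<Rightarrow> 'm \<times> 'e) \<Rightarrow> nat \<Rightarrow> real \<Rightarrow> ('e \<times> 'e) set" where
  "jacobi_flag I lam i t =
     span {(vderiv I ^^ j) z t |j z. j \<le> i \<and> smooth_curve I z \<and> (\<forall>\<tau>\<in>I. z \<tau> \<in> jacobi_curve lam \<tau>)}"

definition ample :: "real set \<Rightarrow> (real \<Rightarrow> 'm \<times> 'e) \<Rightarrow> bool" where
  "ample I lam \<longleftrightarrow> (\<forall>t\<in>I. \<exists>i. jacobi_flag I lam i t = UNIV)"

definition equiregular :: "real set \<Rightarrow> (real \<Rightarrow> 'm \<times> 'e) \<Rightarrow> bool" where
  "equiregular I lam \<longleftrightarrow>
     (\<forall>i. \<forall>t\<in>I. \<forall>t'\<in>I. dim (jacobi_flag I lam i t) = dim (jacobi_flag I lam i t'))"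

definition dcol :: "real set \<Rightarrow> (real \<Rightarrow> 'm \<times> 'e) \<Rightarrow> nat \<Rightarrow> nat" where
  "dcol I lam j = dim (jacobi_flag I lam j 0) - dim (jacobi_flag I lam (j - 1) 0)"

definition ncols :: "real set \<Rightarrow> (real \<Rightarrow> 'm \<times> 'e) \<Rightarrow> nat" where
  "ncols I lam = (LEAST i. jacobi_flag I lam i 0 = UNIV)"

definition young :: "real set \<Rightarrow> (real \<Rightarrow> 'm \<times> 'e) \<Rightarrow> (nat \<times> nat) set" where
  "young I lam = {(a, b). 1 \<le> b \<and> b \<le> ncols I lam \<and> 1 \<le> a \<and> a \<le> dcol I lam b}"

definition rowlen :: "real set \<Rightarrow> (real \<Rightarrow> 'm \<times> 'e) \<Rightarrow> nat \<Rightarrow> nat" where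
  "rowlen I lam a = card {b. (a, b) \<in> young I lam}"

text \<open>The rows of the reduced Young diagram are numbered \<open>1, \<dots>, nred\<close> in the order of strictly
  decreasing length \<open>redlen\<close>; \<open>redrow a\<close> is the index of the row of \<open>[a, b]\<close>, whose column is
  \<open>b\<close>.\<close>

definition redlens :: "real set \<Rightarrow> (real \<Rightarrow> 'm \<times> 'e) \<Rightarrow> nat list" where
  "redlens I lam = rev (sorted_list_of_set (rowlen I lam ` {1..dcol I lam 1}))"

definition nred :: "real set \<Rightarrow> (real \<Rightarrow> 'm \<times> 'e) \<Rightarrow> nat" where
  "nred I lam = length (redlens I lam)"

definition redlen :: "real set \<Rightarrow> (real \<Rightarrow> 'm \<times> 'e) \<Rightarrow> nat \<Rightarrow> nat" where
  "redlen I lam k = redlens I lam ! (k - 1)"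

definition redrow :: "real set \<Rightarrow> (real \<Rightarrow> 'm \<times> 'e) \<Rightarrow> nat \<Rightarrow> nat" where
  "redrow I lam a = (THE k. k \<in> {1..nred I lam} \<and> redlen I lam k = rowlen I lam a)"


section \<open>Connections\<close>

definition is_connection :: "('m, 'e) conn \<Rightarrow> bool" where
  "is_connection nabla \<longleftrightarrow>
     (\<forall>U. open U \<longrightarrow>
       (\<forall>q\<in>U. \<forall>Y. smooth_vf U Y \<longrightarrow>
          linear (\<lambda>v. nabla q v Y) \<and>
          (\<forall>Z v. smooth_vf U Z \<longrightarrow> nabla q v (\<lambda>x. Y x + Z x) = nabla q v Y + nabla q v Z) \<and>
          (\<forall>f v. smooth_fun U f \<longrightarrow>
             nabla q v (\<lambda>x. f x *\<^sub>R Y x) = dfun f q v *\<^sub>R Y q + f q *\<^sub>R nabla q v Y) \<and>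
          (\<forall>Z v. (\<forall>x\<in>U. Z x = Y x) \<longrightarrow> nabla q v Z = nabla q v Y)) \<and>
       (\<forall>X Y. smooth_vf U X \<and> smooth_vf U Y \<longrightarrow> smooth_vf U (\<lambda>q. nabla q (X q) Y)))"

definition parallel_along ::
  "('m, 'e) conn \<Rightarrow> real set \<Rightarrow> (real \<Rightarrow> 'm) \<Rightarrow> (real \<Rightarrow> 'e) \<Rightarrow> bool" where
  "parallel_along nabla I \<gamma> V \<longleftrightarrow>
     differentiable_along I \<gamma> V \<and> (\<forall>t\<in>I. cov_deriv nabla I \<gamma> V t = 0)"

definition compatible :: "('m, 'e) conn \<Rightarrow> bool" where
  "compatible nabla \<longleftrightarrow>
     (\<forall>a b \<gamma> V. a < b \<and> smooth_curve_in {a..b} \<gamma> \<and> parallel_along nabla {a..b} \<gamma> V \<and>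
        V a \<in> distr M (\<gamma> a) \<longrightarrow> (\<forall>t\<in>{a..b}. V t \<in> distr M (\<gamma> t))) \<and>
     (\<forall>U X Y. open U \<and> distr_section U X \<and> distr_section U Y \<longrightarrow>
        (\<forall>q\<in>U. \<forall>v. dfun (\<lambda>x. gmet M x (X x) (Y x)) q v
                   = gmet M q (nabla q v X) (Y q) + gmet M q (X q) (nabla q v Y)))"

text \<open>Torsion and curvature as operators on vector fields, then as tensors; tangent vectors at
  \<open>q\<close> are extended to the vector fields with constant components in the chart at \<open>q\<close>.\<close>

definition torsion_vf :: "('m, 'e) conn \<Rightarrow> ('m \<Rightarrow> 'e) \<Rightarrow> ('m \<Rightarrow> 'e) \<Rightarrow> 'm \<Rightarrow> 'e" where
  "torsion_vf nabla X Y q = nabla q (X q) Y - nabla q (Y q) X - lie_bracket X Y q"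

definition curvature_vf ::
  "('m, 'e) conn \<Rightarrow> ('m \<Rightarrow> 'e) \<Rightarrow> ('m \<Rightarrow> 'e) \<Rightarrow> ('m \<Rightarrow> 'e) \<Rightarrow> 'm \<Rightarrow> 'e" where
  "curvature_vf nabla X Y Z q =
     nabla q (X q) (\<lambda>x. nabla x (Y x) Z) - nabla q (Y q) (\<lambda>x. nabla x (X x) Z)
     - nabla q (lie_bracket X Y q) Z"

definition ext :: "'m \<Rightarrow> 'e \<Rightarrow> 'm \<Rightarrow> 'e" where
  "ext q v = const_field (chart_at q) v"

definition torsion :: "('m, 'e) conn \<Rightarrow> 'm \<Rightarrow> 'e \<Rightarrow> 'e \<Rightarrow> 'e" where
  "torsion nabla q v w = torsion_vf nabla (ext q v) (ext q w) q"

definition curvature :: "('m, 'e) conn \<Rightarrow> 'm \<Rightarrow> 'e \<Rightarrow> 'e \<Rightarrow> 'e \<Rightarrow> 'e" where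
  "curvature nabla q u v w = curvature_vf nabla (ext q u) (ext q v) (ext q w) q"

definition nabla_torsion :: "('m, 'e) conn \<Rightarrow> 'm \<Rightarrow> 'e \<Rightarrow> 'e \<Rightarrow> 'e \<Rightarrow> 'e" where
  "nabla_torsion nabla q u v w =
     nabla q u (\<lambda>x. torsion nabla x (ext q v x) (ext q w x))
     - torsion nabla q (nabla q u (ext q v)) w - torsion nabla q v (nabla q u (ext q w))"

definition adjoint_conn :: "('m, 'e) conn \<Rightarrow> ('m, 'e) conn" where
  "adjoint_conn nabla q v Y = nabla q v Y - torsion nabla q v (Y q)"

text \<open>\<open>A\<^sup>\<sharp>\<close> at \<open>p\<close>, from \<open>A\<^sub>p(v, w) = p(T(v, w))/2\<close>.\<close>

definition asharp :: "('m, 'e) conn \<Rightarrow> 'm \<times> 'e \<Rightarrow> 'e \<Rightarrow> 'e" where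
  "asharp nabla p v = sharp (fst p) (\<lambda>w. (snd p \<bullet> torsion nabla (fst p) v w) / 2)"


section \<open>Twist polynomials\<close>

text \<open>Sections of \<open>\<pi>\<^sup>*TM\<close> are functions \<open>'m \<times> 'e \<Rightarrow> 'e\<close>. The pull-back connection satisfies
  \<open>(\<pi>\<^sup>*\<nabla>)\<^sub>W \<partial>\<^sub>i = \<nabla>\<^sub>\<pi>\<^sub>*\<^sub>W \<partial>\<^sub>i\<close> on coordinate fields.\<close>

definition pullback_conn :: "('m, 'e) conn \<Rightarrow> 'm \<times> 'e \<Rightarrow> 'e \<times> 'e \<Rightarrow> ('m \<times> 'e \<Rightarrow> 'e) \<Rightarrow> 'e" where
  "pullback_conn nabla p W Y =
     (let c = chart_at (fst p)
      in frechet_derivative (\<lambda>z. vcoord c (fst (cchart_inv c z)) (Y (cchart_inv c z)))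
           (at (cchart c p)) W
         + nabla (fst p) (fst W) (const_field c (Y p)))"

text \<open>The induced derivative \<open>(\<pi>\<^sup>*\<nabla>)\<^sub>\<H> F\<close> on sections of \<open>\<pi>\<^sup>*End(TM)\<close>.\<close>

definition vpartial ::
  "('m, 'e) conn \<Rightarrow> ('m \<times> 'e \<Rightarrow> 'e \<Rightarrow> 'e) \<Rightarrow> 'm \<times> 'e \<Rightarrow> 'e \<Rightarrow> 'e" where
  "vpartial nabla F p v =
     pullback_conn nabla p (ham_field p) (\<lambda>p'. F p' (ext (fst p) v (fst p')))
     - F p (pullback_conn nabla p (ham_field p) (\<lambda>p'. ext (fst p) v (fst p')))"

fun twist :: "('m, 'e) conn \<Rightarrow> nat \<Rightarrow> 'm \<times> 'e \<Rightarrow> 'e \<Rightarrow> 'e" where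
  "twist nabla 0 p v = v"
| "twist nabla (Suc 0) p v = - torsion nabla (fst p) (csharp p) v"
| "twist nabla (Suc (Suc k)) p v =
     vpartial nabla (twist nabla (Suc k)) p v
     + twist nabla (Suc 0) p (twist nabla (Suc k) p v)"

definition twist_flag :: "('m, 'e) conn \<Rightarrow> nat \<Rightarrow> 'm \<times> 'e \<Rightarrow> 'e set" where
  "twist_flag nabla i p = span {twist nabla j p v |j v. j < i \<and> v \<in> distr M (fst p)}"


section \<open>The canonical symmetric tensor and canonical frames\<close>

context
  fixes nabla :: "('m, 'e) conn" and I :: "real set" and lam :: "real \<Rightarrow> 'm \<times> 'e"
begin

definition symmetric_tensor_along :: "(real \<Rightarrow> 'e \<Rightarrow> 'e \<Rightarrow> real) \<Rightarrow> bool" where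
  "symmetric_tensor_along S \<longleftrightarrow>
     (\<forall>t\<in>I. bilinear (S t) \<and> (\<forall>v w. S t v w = S t w v)) \<and>
     (\<forall>c\<in>atlas M. \<forall>v w.
        smooth_curve {t \<in> I. fst (lam t) \<in> fst c}
          (\<lambda>t. S t (const_field c v (fst (lam t))) (const_field c w (fst (lam t)))))"

definition ssharp :: "(real \<Rightarrow> 'e \<Rightarrow> 'e \<Rightarrow> real) \<Rightarrow> real \<Rightarrow> 'e \<Rightarrow> 'e" where
  "ssharp S t v = sharp (fst (lam t)) (S t v)"

abbreviation Dhat :: "(real \<Rightarrow> 'e) \<Rightarrow> real \<Rightarrow> 'e" where
  "Dhat \<equiv> cov_deriv (adjoint_conn nabla) I (\<lambda>t. fst (lam t))"

definition DS :: "(real \<Rightarrow> 'e \<Rightarrow> 'e \<Rightarrow> real) \<Rightarrow> (real \<Rightarrow> 'e) \<Rightarrow> real \<Rightarrow> 'e" where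
  "DS S X t = Dhat X t + asharp nabla (lam t) (X t) + ssharp S t (X t)"

definition Dhat_tensor :: "(real \<Rightarrow> 'e \<Rightarrow> 'e \<Rightarrow> real) \<Rightarrow> real \<Rightarrow> 'e \<Rightarrow> 'e \<Rightarrow> real" where
  "Dhat_tensor S t v w =
     (let V = (\<lambda>s. ext (fst (lam t)) v (fst (lam s))); W = (\<lambda>s. ext (fst (lam t)) w (fst (lam s)))
      in vector_derivative (\<lambda>s. S s (V s) (W s)) (at t within I)
         - S t (Dhat V t) w - S t v (Dhat W t))"

definition RS_quad :: "(real \<Rightarrow> 'e \<Rightarrow> 'e \<Rightarrow> real) \<Rightarrow> real \<Rightarrow> 'e \<Rightarrow> real" where
  "RS_quad S t v =
     (let q = fst (lam t); \<alpha> = snd (lam t); \<gamma>' = velocity I (\<lambda>t. fst (lam t)) t;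
          y = ssharp S t v + asharp nabla (lam t) v
      in \<alpha> \<bullet> curvature nabla q \<gamma>' v v + \<alpha> \<bullet> nabla_torsion nabla q v \<gamma>' v
         + gmet M q y y - Dhat_tensor S t v v)"

text \<open>The symmetric bilinear form with this quadratic form.\<close>

definition RS :: "(real \<Rightarrow> 'e \<Rightarrow> 'e \<Rightarrow> real) \<Rightarrow> real \<Rightarrow> 'e \<Rightarrow> 'e \<Rightarrow> real" where
  "RS S t v w = (RS_quad S t (v + w) - RS_quad S t v - RS_quad S t w) / 2"

definition orthonormal_basis_of :: "'m \<Rightarrow> 'e set \<Rightarrow> nat set \<Rightarrow> (nat \<Rightarrow> 'e) \<Rightarrow> bool" where
  "orthonormal_basis_of q V K u \<longleftrightarrow>
     span (u ` K) = V \<and> (\<forall>a\<in>K. \<forall>b\<in>K. gmet M q (u a) (u b) = (if a = b then 1 else 0))"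

definition frame_along :: "(nat \<Rightarrow> nat \<Rightarrow> real \<Rightarrow> 'e) \<Rightarrow> bool" where
  "frame_along X \<longleftrightarrow>
     (\<forall>(a, b)\<in>young I lam. smooth_along I (\<lambda>t. fst (lam t)) (X a b)) \<and>
     (\<forall>t\<in>I. inj_on (\<lambda>(a, b). X a b t) (young I lam) \<and>
            independent ((\<lambda>(a, b). X a b t) ` young I lam) \<and>
            span ((\<lambda>(a, b). X a b t) ` young I lam) = UNIV)"

text \<open>By uniqueness of the canonical tensor, \<open>S\<close> is the canonical symmetric tensor and \<open>X\<close> is a
  canonical frame along the extremal exactly if \<open>canonical_frame S X\<close> holds.\<close>

definition canonical_frame ::
  "(real \<Rightarrow> 'e \<Rightarrow> 'e \<Rightarrow> real) \<Rightarrow> (nat \<Rightarrow> nat \<Rightarrow> real \<Rightarrow> 'e) \<Rightarrow> bool" where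
  "canonical_frame S X \<longleftrightarrow>
     symmetric_tensor_along S \<and> frame_along X \<and>
     (\<forall>a\<in>{1..dcol I lam 1}. \<forall>t\<in>I.
        (\<forall>b. 1 \<le> b \<and> b < rowlen I lam a \<longrightarrow> DS S (X a b) t = X a (b + 1) t) \<and>
        DS S (X a (rowlen I lam a)) t = 0) \<and>
     (\<forall>t\<in>I. orthonormal_basis_of (fst (lam t)) (distr M (fst (lam t))) {1..dcol I lam 1}
               (\<lambda>a. X a 1 t)) \<and>
     (\<forall>t\<in>I. \<forall>(a, b)\<in>young I lam. \<forall>(i, j)\<in>young I lam.
        let ra = redrow I lam a; ri = redrow I lam i;
            na = redlen I lam ra; ni = redlen I lam ri
        in (ra = ri \<and> b < na \<longrightarrow>
              RS S t (X a b t) (X i (b + 1) t) = - RS S t (X a (b + 1) t) (X i b t)) \<and>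
           (ra = ri \<and> j \<noteq> b - 1 \<and> j \<noteq> b \<and> j \<noteq> b + 1 \<longrightarrow> RS S t (X a b t) (X i j t) = 0) \<and>
           (ra < ri \<and> j < ni \<and> j \<noteq> b \<and> j \<noteq> b + 1 \<longrightarrow> RS S t (X a b t) (X i j t) = 0) \<and>
           (ra < ri \<and> b < ni - 1 \<longrightarrow> RS S t (X a b t) (X i ni t) = 0) \<and>
           (ra < ri \<and> na - ni \<ge> b + j \<longrightarrow> RS S t (X a b t) (X i j t) = 0))"


section \<open>Endomorphisms of the distribution along the curve\<close>

definition endo_on :: "'e set \<Rightarrow> ('e \<Rightarrow> 'e) \<Rightarrow> bool" where
  "endo_on V f \<longleftrightarrow>
     f ` V \<subseteq> V \<and> (\<forall>u\<in>V. \<forall>v\<in>V. f (u + v) = f u + f v) \<and> (\<forall>a. \<forall>u\<in>V. f (a *\<^sub>R u) = a *\<^sub>R f u)"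

definition gdual :: "real \<Rightarrow> ('e \<Rightarrow> 'e) \<Rightarrow> 'e \<Rightarrow> 'e" where
  "gdual t b v =
     (let q = fst (lam t)
      in THE w. w \<in> distr M q \<and> (\<forall>u\<in>distr M q. gmet M q (b u) v = gmet M q u w))"

definition Box :: "(nat \<Rightarrow> nat \<Rightarrow> real \<Rightarrow> 'e) \<Rightarrow> nat \<Rightarrow> nat \<Rightarrow> real \<Rightarrow> 'e set" where
  "Box X k b t = span {X a b t |a. (a, b) \<in> young I lam \<and> redrow I lam a = k}"

text \<open>Projections of the direct sum of the spaces \<open>Box X k 1 t\<close>, \<open>k = 1, \<dots>, nred\<close>.\<close>

definition pr :: "(nat \<Rightarrow> nat \<Rightarrow> real \<Rightarrow> 'e) \<Rightarrow> nat \<Rightarrow> real \<Rightarrow> 'e \<Rightarrow> 'e" where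
  "pr X k t u =
     (THE w. w \<in> Box X k 1 t \<and> u - w \<in> span (\<Union>i\<in>{1..nred I lam} - {k}. Box X i 1 t))"

definition pr_less :: "(nat \<Rightarrow> nat \<Rightarrow> real \<Rightarrow> 'e) \<Rightarrow> nat \<Rightarrow> real \<Rightarrow> 'e \<Rightarrow> 'e" where
  "pr_less X k t u = (\<Sum>i\<in>{1..<k}. pr X i t u)"

text \<open>The conditions determining \<open>B = B0 + Bp\<close> (where \<open>Bp\<close> stands for \<open>B\<^sub>+\<close>) and \<open>C\<close>.\<close>

definition twist_coeffs ::
  "(nat \<Rightarrow> nat \<Rightarrow> real \<Rightarrow> 'e) \<Rightarrow> (real \<Rightarrow> 'e \<Rightarrow> 'e) \<Rightarrow> (real \<Rightarrow> 'e \<Rightarrow> 'e) \<Rightarrow> (real \<Rightarrow> 'e \<Rightarrow> 'e) \<Rightarrow> bool"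
  where
  "twist_coeffs X B0 Bp C \<longleftrightarrow>
     (\<forall>t\<in>I. endo_on (distr M (fst (lam t))) (B0 t) \<and> endo_on (distr M (fst (lam t))) (Bp t) \<and>
        endo_on (distr M (fst (lam t))) (C t) \<and>
        (\<forall>k\<in>{1..nred I lam}. \<forall>u\<in>Box X k 1 t.
           let n = redlen I lam k; p = lam t
           in B0 t u \<in> Box X k 1 t \<and>
              Bp t u \<in> span (\<Union>i\<in>{1..<k}. Box X i 1 t) \<and>
              C t u \<in> span (\<Union>i\<in>{1..<k}. Box X i 1 t) \<and>
              twist nabla n p u + twist nabla (n - 1) p (B0 t u + Bp t u)
                \<in> twist_flag nabla (n - 1) p \<and>
              twist nabla (n + 1) p u + twist nabla n p (C t u) \<in> twist_flag nabla n p))"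

definition Qmap ::
  "(nat \<Rightarrow> nat \<Rightarrow> real \<Rightarrow> 'e) \<Rightarrow> (real \<Rightarrow> 'e \<Rightarrow> 'e) \<Rightarrow> (real \<Rightarrow> 'e \<Rightarrow> 'e) \<Rightarrow> (real \<Rightarrow> 'e \<Rightarrow> 'e)
    \<Rightarrow> real \<Rightarrow> 'e \<Rightarrow> 'e" where
  "Qmap X B0 Bp C t u =
     (1 / 2) *\<^sub>R (\<Sum>k\<in>{1..nred I lam}. (1 / real (redlen I lam k)) *\<^sub>R
        (let v = pr X k t u
         in pr X k t (B0 t v - gdual t (B0 t) v - 2 *\<^sub>R asharp nabla (lam t) v)))
     + (C t u - Bp t u) - gdual t (\<lambda>v. C t v - Bp t v) u"

text \<open>The sum \<open>\<Sum>\<^sub>k (n\<^sub>k (C - B\<^sub>+) + pr\<^sub><\<^sub>k A\<^sup>\<sharp>) pr\<^sub>k\<close>.\<close>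

definition Smap ::
  "(nat \<Rightarrow> nat \<Rightarrow> real \<Rightarrow> 'e) \<Rightarrow> (real \<Rightarrow> 'e \<Rightarrow> 'e) \<Rightarrow> (real \<Rightarrow> 'e \<Rightarrow> 'e) \<Rightarrow> real \<Rightarrow> 'e \<Rightarrow> 'e" where
  "Smap X Bp C t u =
     (\<Sum>k\<in>{1..nred I lam}.
        (let v = pr X k t u
         in real (redlen I lam k) *\<^sub>R (C t v - Bp t v) + pr_less X k t (asharp nabla (lam t) v)))"

definition wp1 ::
  "(real \<Rightarrow> 'e \<Rightarrow> 'e \<Rightarrow> real) \<Rightarrow> (nat \<Rightarrow> nat \<Rightarrow> real \<Rightarrow> 'e) \<Rightarrow> (real \<Rightarrow> 'e \<Rightarrow> 'e)
    \<Rightarrow> (real \<Rightarrow> 'e \<Rightarrow> 'e) \<Rightarrow> (real \<Rightarrow> 'e \<Rightarrow> 'e) \<Rightarrow> real \<Rightarrow> 'e \<Rightarrow> 'e" where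
  "wp1 S X B0 Bp C t u =
     twist nabla 1 (lam t) u + asharp nabla (lam t) u + ssharp S t u + Qmap X B0 Bp C t u"

end

end

end

(* Write V = A# + S# and L = D_t + P_1 along the geodesic, so that the canonical frame satisfies
   L X_{a,b} = X_{a,b+1} - V X_{a,b} with V X_{a,b} in E. Since L (P_k u) = P_{k+1} u + P_k (D_t u),
   induction on k gives, with D_t X_{a,1} and V X_{a,1} expanded in the orthonormal basis X_{i,1},
     P_k X_{a,1} = X_{a,k+1} - sum_i (k D_t X_{a,1} + V X_{a,1})_i X_{i,k}   modulo the span of the X_{i,b}, b < k.
   For k = n_a and k = n_a + 1 the term X_{a,k+1} vanishes, and comparison with the definition of B and C
   yields n_a D_t X_{a,1} + V X_{a,1} = B X_{a,1} on the rows of length at least n_a, and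
   (n_a + 1) D_t X_{a,1} + V X_{a,1} = C X_{a,1} on the strictly longer ones. As D_t preserves orthonormality,
   A# is anti-symmetric and S# is symmetric, these linear equations determine D_t X_{a,1} and S# on E.
   The shortest rows have length 1 because P_1 annihilates the velocity (and vanishes where the velocity
   does). *)

theory Submission
  imports Defs
begin

section \<open>Calculus of smooth maps\<close>

text \<open>Let D, A, S denote the components along X_{b,1} of D_t X_{a,1}, A# X_{a,1}, S# X_{a,1},
  and n the length of row a. For rows of equal length, n D + A + S = B_0 splits into the symmetric
  part S and the antisymmetric part n D + A: hence the factors 1/2 and 1/n. If row b is longer, n D
  + A + S = B_+ and (n + 1) D + A + S = C give D = C - B_+ and S = B_+ - n (C - B_+) - A. The
  entries with row b shorter follow by transposition. The obstacle lies elsewhere: tangent vectors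
  at q are expressed in a chart selected at q, which jumps with q. Whatever is differentiated must
  first be rewritten in one fixed chart, and the result shown independent of it. Christoffel
  symbols, canonical coordinates and their transformation laws serve this end; they make each P_k a
  smooth field of endomorphisms over T*M and justify the product rule for L (P_k u). Moreover the
  frame exists only along the curve, whereas compatibility refers to local sections and parallel
  fields; smooth projections onto the distribution bridge this gap.\<close>

lemma Ck_on_mono: "Ck_on (Suc k) U f \<Longrightarrow> Ck_on k U f"
proof (induction k arbitrary: f)
  case 0
  then show ?case
    by (auto intro!: continuous_at_imp_continuous_on differentiable_imp_continuous_within)
next
  case (Suc k)
  then show ?case
    by (metis Ck_on.simps(2))
qed

lemma Ck_on_cong:
  assumes "open U" "\<And>x. x \<in> U \<Longrightarrow> f x = g x" "Ck_on k U f"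
  shows "Ck_on k U g"
  using assms(2,3)
proof (induction k arbitrary: f g)
  case 0
  then show ?case
    by (metis Ck_on.simps(1) continuous_on_cong)
next
  case (Suc k)
  have d: "frechet_derivative f (at x) = frechet_derivative g (at x)" "g differentiable at x" if "x \<in> U" for x
  proof -
    have df: "f differentiable at x"
      using Suc.prems that by auto
    show "frechet_derivative f (at x) = frechet_derivative g (at x)"
      by (rule frechet_derivative_transform_within_open[OF df assms(1) that]) (use Suc.prems in auto)
    show "g differentiable at x"
      using df unfolding differentiable_def
      by (meson Suc.prems(1) assms(1) has_derivative_transform_within_open that)
  qed
  show ?case
    unfolding Ck_on.simps
  proof (intro conjI ballI allI)
    fix v
    show "Ck_on k U (\<lambda>x. frechet_derivative g (at x) v)"
      by (rule Suc.IH[of "\<lambda>x. frechet_derivative f (at x) v"]) (use d Suc.prems in auto)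
  qed (use d in auto)
qed

lemma smooth_on_cong:
  assumes "open U" "\<And>x. x \<in> U \<Longrightarrow> f x = g x"
  shows "smooth_on U f \<longleftrightarrow> smooth_on U g"
  unfolding smooth_on_def using Ck_on_cong[OF assms(1)] assms(2) by (metis (no_types, lifting))

text \<open>Taking all orders at once turns the recursion for \<open>Ck_on\<close> into a
  fixed-point equation: shifting the order by one gives the derivatives, and
  \<open>Ck_on_mono\<close> recovers the lower order. Differentiation can then be iterated without
  counting orders.\<close>

lemma smooth_on_iff:
  "smooth_on U f \<longleftrightarrow>
     (\<forall>x\<in>U. f differentiable at x) \<and> (\<forall>v. smooth_on U (\<lambda>x. frechet_derivative f (at x) v))"
proof
  assume s: "smooth_on U f"
  then have "Ck_on (Suc k) U f" for k
    unfolding smooth_on_def by blast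
  then show "(\<forall>x\<in>U. f differentiable at x) \<and> (\<forall>v. smooth_on U (\<lambda>x. frechet_derivative f (at x) v))"
    unfolding smooth_on_def by (metis Ck_on.simps(2))
next
  assume s: "(\<forall>x\<in>U. f differentiable at x) \<and> (\<forall>v. smooth_on U (\<lambda>x. frechet_derivative f (at x) v))"
  have "Ck_on (Suc k) U f" for k
    using s unfolding smooth_on_def by auto
  then show "smooth_on U f"
    unfolding smooth_on_def by (metis Ck_on_mono)
qed

lemma smooth_on_has_derivative:
  "smooth_on U f \<Longrightarrow> x \<in> U \<Longrightarrow> (f has_derivative frechet_derivative f (at x)) (at x)"
  using smooth_on_iff frechet_derivative_works by blast

lemma smooth_on_differentiable: "smooth_on U f \<Longrightarrow> x \<in> U \<Longrightarrow> f differentiable at x"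
  using smooth_on_iff by blast

lemma smooth_on_frechet: "smooth_on U f \<Longrightarrow> smooth_on U (\<lambda>x. frechet_derivative f (at x) v)"
  using smooth_on_iff by blast

lemma smooth_on_linear_frechet:
  "smooth_on U f \<Longrightarrow> x \<in> U \<Longrightarrow> linear (frechet_derivative f (at x))"
  by (simp add: linear_frechet_derivative smooth_on_differentiable)

lemma smooth_on_continuous_on: "smooth_on U f \<Longrightarrow> continuous_on U f"
  unfolding smooth_on_def by (metis Ck_on.simps(1))

lemma Ck_on_subset: "V \<subseteq> U \<Longrightarrow> Ck_on k U f \<Longrightarrow> Ck_on k V f"
proof (induction k arbitrary: f)
  case 0
  then show ?case by (auto intro: continuous_on_subset)
next
  case (Suc k)
  then show ?case by auto
qed

lemma smooth_on_subset: "smooth_on U f \<Longrightarrow> V \<subseteq> U \<Longrightarrow> smooth_on V f"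
  unfolding smooth_on_def using Ck_on_subset by blast

text \<open>For maps that have a formula only near each point, such as the Hamiltonian, which is
  expressed through local orthogonal frames of the distribution.\<close>

lemma smooth_on_local:
  assumes "\<And>x. x \<in> U \<Longrightarrow> \<exists>V. open V \<and> x \<in> V \<and> smooth_on V f"
  shows "smooth_on U f"
proof -
  have "Ck_on k U f" if "\<And>x. x \<in> U \<Longrightarrow> \<exists>V. open V \<and> x \<in> V \<and> smooth_on V f" for k
    using that
  proof (induction k arbitrary: f)
    case 0
    show ?case
      unfolding Ck_on.simps
      using 0 by (meson continuous_at_imp_continuous_on continuous_on_eq_continuous_at smooth_on_continuous_on)
  next
    case (Suc k)
    have "f differentiable at x" if "x \<in> U" for x
      using Suc.prems[OF that] smooth_on_differentiable by blast
    moreover have "Ck_on k U (\<lambda>x. frechet_derivative f (at x) v)" for v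
      by (rule Suc.IH) (use Suc.prems smooth_on_frechet in fast)
    ultimately show ?case by auto
  qed
  from this[OF assms] show ?thesis
    by (simp add: smooth_on_def)
qed

lemma Ck_on_const: "Ck_on k U (\<lambda>x. c)"
  by (induction k arbitrary: c) auto

lemma smooth_on_const: "smooth_on U (\<lambda>x. c)"
  unfolding smooth_on_def by (simp add: Ck_on_const)

lemma smooth_on_bounded_linear:
  assumes "bounded_linear f"
  shows "smooth_on U f"
proof -
  have "frechet_derivative f (at x) = f" for x
    using assms bounded_linear_imp_has_derivative frechet_derivative_at by metis
  then show ?thesis
    using assms by (subst smooth_on_iff) (auto simp: smooth_on_const bounded_linear_imp_differentiable)
qed

lemma smooth_on_id: "smooth_on U (\<lambda>x. x)"
  by (rule smooth_on_bounded_linear) (rule bounded_linear_ident)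

lemma Ck_on_add:
  assumes "open U" "Ck_on k U f" "Ck_on k U g"
  shows "Ck_on k U (\<lambda>x. f x + g x)"
  using assms(2,3)
proof (induction k arbitrary: f g)
  case 0
  then show ?case by (auto intro: continuous_on_add)
next
  case (Suc k)
  have "Ck_on k U (\<lambda>x. frechet_derivative (\<lambda>x. f x + g x) (at x) v)" for v
  proof (rule Ck_on_cong[OF assms(1)])
    show "Ck_on k U (\<lambda>x. frechet_derivative f (at x) v + frechet_derivative g (at x) v)"
      using Suc by auto
    show "frechet_derivative f (at x) v + frechet_derivative g (at x) v
        = frechet_derivative (\<lambda>x. f x + g x) (at x) v" if "x \<in> U" for x
    proof -
      have "((\<lambda>x. f x + g x) has_derivative
          (\<lambda>v. frechet_derivative f (at x) v + frechet_derivative g (at x) v)) (at x)"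
        using Suc.prems that by (intro has_derivative_add) (auto simp: frechet_derivative_works)
      from fun_cong[OF frechet_derivative_at[OF this], of v] show ?thesis .
    qed
  qed
  then show ?case using Suc.prems by auto
qed

lemma smooth_on_add: "open U \<Longrightarrow> smooth_on U f \<Longrightarrow> smooth_on U g \<Longrightarrow> smooth_on U (\<lambda>x. f x + g x)"
  unfolding smooth_on_def using Ck_on_add by blast

text \<open>One induction serves scalar multiples, products and inner products. The product rule
  pairs a derivative of order k with an undifferentiated factor of order k + 1, whose order
  \<open>Ck_on_mono\<close> lowers.\<close>

lemma Ck_on_bilinear:
  assumes "bounded_bilinear p" "open U" "Ck_on k U f" "Ck_on k U g"
  shows "Ck_on k U (\<lambda>x. p (f x) (g x))"
  using assms(3,4)
proof (induction k arbitrary: f g)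
  case 0
  then show ?case by (auto intro: bounded_bilinear.continuous_on[OF assms(1)])
next
  case (Suc k)
  have d: "((\<lambda>x. p (f x) (g x)) has_derivative
          (\<lambda>v. p (f x) (frechet_derivative g (at x) v) + p (frechet_derivative f (at x) v) (g x))) (at x)"
    if "x \<in> U" for x
    using Suc.prems that
    by (intro bounded_bilinear.FDERIV[OF assms(1)]) (auto simp: frechet_derivative_works)
  have "Ck_on k U (\<lambda>x. frechet_derivative (\<lambda>x. p (f x) (g x)) (at x) v)" for v
  proof (rule Ck_on_cong[OF assms(2)])
    show "Ck_on k U (\<lambda>x. p (f x) (frechet_derivative g (at x) v) + p (frechet_derivative f (at x) v) (g x))"
      using Suc.prems by (intro Ck_on_add assms Suc.IH) (auto intro: Ck_on_mono)
    show "p (f x) (frechet_derivative g (at x) v) + p (frechet_derivative f (at x) v) (g x)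
        = frechet_derivative (\<lambda>x. p (f x) (g x)) (at x) v" if "x \<in> U" for x
      using fun_cong[OF frechet_derivative_at[OF d[OF that]], of v] .
  qed
  moreover have "(\<lambda>x. p (f x) (g x)) differentiable at x" if "x \<in> U" for x
    using d[OF that] differentiableI by blast
  ultimately show ?case by auto
qed

lemma smooth_on_bilinear:
  "bounded_bilinear p \<Longrightarrow> open U \<Longrightarrow> smooth_on U f \<Longrightarrow> smooth_on U g \<Longrightarrow> smooth_on U (\<lambda>x. p (f x) (g x))"
  unfolding smooth_on_def using Ck_on_bilinear by blast

lemmas smooth_on_scaleR = smooth_on_bilinear[OF bounded_bilinear_scaleR]
lemmas smooth_on_mult = smooth_on_bilinear[OF bounded_bilinear_mult]
lemmas smooth_on_inner = smooth_on_bilinear[OF bounded_bilinear_inner]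

lemma Ck_on_sum:
  "open U \<Longrightarrow> (\<And>i. i \<in> S \<Longrightarrow> Ck_on k U (f i)) \<Longrightarrow> Ck_on k U (\<lambda>x. \<Sum>i\<in>S. f i x)"
  by (induction S rule: infinite_finite_induct) (auto simp: Ck_on_const Ck_on_add)

lemma smooth_on_sum:
  "open U \<Longrightarrow> (\<And>i. i \<in> S \<Longrightarrow> smooth_on U (f i)) \<Longrightarrow> smooth_on U (\<lambda>x. \<Sum>i\<in>S. f i x)"
  unfolding smooth_on_def by (simp add: Ck_on_sum)

lemma smooth_on_uminus: "open U \<Longrightarrow> smooth_on U f \<Longrightarrow> smooth_on U (\<lambda>x. - f x)"
  using smooth_on_scaleR[of U "\<lambda>_. -1" f] by (simp add: smooth_on_const)

lemma smooth_on_diff: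
  "open U \<Longrightarrow> smooth_on U f \<Longrightarrow> smooth_on U g \<Longrightarrow> smooth_on U (\<lambda>x. f x - g x)"
  using smooth_on_add[of U f "\<lambda>x. - g x"] by (simp add: smooth_on_uminus)

lemma linear_euclidean_sum:
  fixes f :: "'a::euclidean_space \<Rightarrow> 'b::real_vector"
  assumes "linear f"
  shows "f v = (\<Sum>b\<in>Basis. (v \<bullet> b) *\<^sub>R f b)"
  by (metis (no_types, lifting) assms euclidean_representation linear_cmul linear_sum sum.cong)

text \<open>\<open>Ck_on\<close> controls derivatives in fixed directions, whereas the chain rule
  evaluates the derivative of \<open>g\<close> in the moving direction
  \<open>frechet_derivative f (at x) v\<close>. Expanding that direction in \<open>Basis\<close>
  leaves finitely many products of \<open>Ck_on k\<close> functions; this is why the intermediate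
  space is Euclidean.\<close>

lemma Ck_on_compose:
  fixes f :: "'a::real_normed_vector \<Rightarrow> 'b::euclidean_space" and g :: "'b \<Rightarrow> 'c::real_normed_vector"
  assumes "open U" "open V" "f ` U \<subseteq> V" "Ck_on k U f" "Ck_on k V g"
  shows "Ck_on k U (\<lambda>x. g (f x))"
  using assms(4,5)
proof (induction k arbitrary: g)
  case 0
  then show ?case
    using assms(3) by (auto intro: continuous_on_compose2)
next
  case (Suc k)
  have dg: "g differentiable at (f x)" if "x \<in> U" for x
    using Suc.prems assms(3) that by auto
  have d: "((\<lambda>x. g (f x)) has_derivative
      (\<lambda>v. frechet_derivative g (at (f x)) (frechet_derivative f (at x) v))) (at x)" if "x \<in> U" for x
    using Suc.prems that dg[OF that]
    by (intro has_derivative_compose[where f=f and g=g]) (auto simp: frechet_derivative_works)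
  have "Ck_on k U (\<lambda>x. frechet_derivative (\<lambda>x. g (f x)) (at x) v)" for v
  proof (rule Ck_on_cong[OF assms(1)])
    show "Ck_on k U (\<lambda>x. \<Sum>b\<in>Basis. (frechet_derivative f (at x) v \<bullet> b) *\<^sub>R frechet_derivative g (at (f x)) b)"
      using Suc.prems
      by (intro Ck_on_sum assms Ck_on_bilinear[OF bounded_bilinear_scaleR]
            Ck_on_bilinear[OF bounded_bilinear_inner] Ck_on_const Suc.IH) (auto intro: Ck_on_mono)
    show "(\<Sum>b\<in>Basis. (frechet_derivative f (at x) v \<bullet> b) *\<^sub>R frechet_derivative g (at (f x)) b)
        = frechet_derivative (\<lambda>x. g (f x)) (at x) v" if "x \<in> U" for x
    proof -
      show ?thesis
        unfolding linear_euclidean_sum[OF linear_frechet_derivative[OF dg[OF that]], symmetric]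
        using fun_cong[OF frechet_derivative_at[OF d[OF that]], of v] .
    qed
  qed
  moreover have "(\<lambda>x. g (f x)) differentiable at x" if "x \<in> U" for x
    using d[OF that] differentiableI by blast
  ultimately show ?case by auto
qed

lemma smooth_on_compose:
  fixes f :: "'a::real_normed_vector \<Rightarrow> 'b::euclidean_space" and g :: "'b \<Rightarrow> 'c::real_normed_vector"
  assumes "smooth_on V g" "smooth_on U f" "open U" "open V" "f ` U \<subseteq> V"
  shows "smooth_on U (\<lambda>x. g (f x))"
proof -
  have "Ck_on k U f" "Ck_on k V g" for k
    using assms(1,2) by (simp_all add: smooth_on_def)
  from Ck_on_compose[OF assms(3-5) this] show ?thesis
    by (simp add: smooth_on_def)
qed

lemma smooth_on_linear_compose:
  fixes f :: "'a::real_normed_vector \<Rightarrow> 'b::euclidean_space"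
  assumes "bounded_linear g" "open U" "smooth_on U f"
  shows "smooth_on U (\<lambda>x. g (f x))"
  by (rule smooth_on_compose[OF smooth_on_bounded_linear[OF assms(1), of UNIV] assms(3,2)]) auto

lemma smooth_on_fst: "open U \<Longrightarrow> smooth_on U f \<Longrightarrow> smooth_on U (\<lambda>x. fst (f x :: 'b::euclidean_space \<times> 'c::euclidean_space))"
  by (rule smooth_on_linear_compose[OF bounded_linear_fst])

lemma smooth_on_snd: "open U \<Longrightarrow> smooth_on U f \<Longrightarrow> smooth_on U (\<lambda>x. snd (f x :: 'b::euclidean_space \<times> 'c::euclidean_space))"
  by (rule smooth_on_linear_compose[OF bounded_linear_snd])

lemma smooth_on_Pair:
  fixes f :: "'a::real_normed_vector \<Rightarrow> 'b::euclidean_space" and g :: "'a \<Rightarrow> 'c::euclidean_space"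
  assumes "open U" "smooth_on U f" "smooth_on U g"
  shows "smooth_on U (\<lambda>x. (f x, g x))"
proof -
  have "bounded_linear (\<lambda>x::'b. (x, 0::'c))" "bounded_linear (\<lambda>x::'c. (0::'b, x))"
    by (auto intro: bounded_linear_Pair bounded_linear_ident bounded_linear_zero)
  then have "smooth_on U (\<lambda>x. (f x, 0::'c))" "smooth_on U (\<lambda>x. (0::'b, g x))"
    using smooth_on_linear_compose assms by blast+
  from smooth_on_add[OF assms(1) this] show ?thesis by simp
qed

lemma Ck_on_inverse:
  fixes f :: "'a::real_normed_vector \<Rightarrow> real"
  assumes "open U" "Ck_on k U f" "\<And>x. x \<in> U \<Longrightarrow> f x \<noteq> 0"
  shows "Ck_on k U (\<lambda>x. inverse (f x))"
  using assms(2)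
proof (induction k)
  case 0
  then show ?case using assms(3) by (auto intro: continuous_on_inverse)
next
  case (Suc k)
  have i: "Ck_on k U (\<lambda>x. inverse (f x))"
    using Suc Ck_on_mono by blast
  have d: "((\<lambda>x. inverse (f x)) has_derivative
          (\<lambda>v. - (inverse (f x) * frechet_derivative f (at x) v * inverse (f x)))) (at x)" if "x \<in> U" for x
    using Suc.prems that assms(3)
    by (intro Deriv.has_derivative_inverse) (auto simp: frechet_derivative_works)
  have "Ck_on k U (\<lambda>x. frechet_derivative (\<lambda>x. inverse (f x)) (at x) v)" for v
  proof (rule Ck_on_cong[OF assms(1)])
    show "Ck_on k U (\<lambda>x. (-1) * (inverse (f x) * frechet_derivative f (at x) v * inverse (f x)))"
      using Suc.prems
      by (intro Ck_on_bilinear[OF bounded_bilinear_mult] assms i Ck_on_const) auto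
    show "(-1) * (inverse (f x) * frechet_derivative f (at x) v * inverse (f x))
        = frechet_derivative (\<lambda>x. inverse (f x)) (at x) v" if "x \<in> U" for x
      using fun_cong[OF frechet_derivative_at[OF d[OF that]], of v] by simp
  qed
  moreover have "(\<lambda>x. inverse (f x)) differentiable at x" if "x \<in> U" for x
    using d[OF that] differentiableI by blast
  ultimately show ?case by auto
qed

lemma smooth_on_divide:
  fixes f g :: "'a::real_normed_vector \<Rightarrow> real"
  assumes "open U" "smooth_on U f" "smooth_on U g" "\<And>x. x \<in> U \<Longrightarrow> g x \<noteq> 0"
  shows "smooth_on U (\<lambda>x. f x / g x)"
proof -
  have "smooth_on U (\<lambda>x. inverse (g x))"
    using Ck_on_inverse assms unfolding smooth_on_def by blast
  from smooth_on_mult[OF assms(1,2) this] show ?thesis by (simp add: divide_inverse)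
qed

text \<open>The same basis expansion for linear maps that depend on a parameter. Jacobians,
  Christoffel symbols and endomorphism fields enter later arguments in this form: linear in the
  vector, smooth in the point for each fixed vector.\<close>

lemma smooth_on_linear_apply:
  fixes L :: "'a::real_normed_vector \<Rightarrow> 'b::euclidean_space \<Rightarrow> 'c::real_normed_vector"
  assumes "open U" "\<And>x. x \<in> U \<Longrightarrow> linear (L x)" "\<And>b. b \<in> Basis \<Longrightarrow> smooth_on U (\<lambda>x. L x b)" "smooth_on U f"
  shows "smooth_on U (\<lambda>x. L x (f x))"
proof -
  have "smooth_on U (\<lambda>x. \<Sum>b\<in>Basis. (f x \<bullet> b) *\<^sub>R L x b)"
    by (intro smooth_on_sum smooth_on_scaleR smooth_on_inner assms smooth_on_const)
  moreover have "(\<Sum>b\<in>Basis. (f x \<bullet> b) *\<^sub>R L x b) = L x (f x)" if "x \<in> U" for x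
    using linear_euclidean_sum[OF assms(2)[OF that], of "f x"] by simp
  ultimately show ?thesis
    using smooth_on_cong[OF assms(1)] by (metis (no_types, lifting))
qed


text \<open>Product rule for a moving linear map applied to a moving vector, again by expansion in
  \<open>Basis\<close>. Linearity is asked only near t, because a chart covers a curve only
  locally.\<close>

lemma has_vector_derivative_linear_family:
  fixes L :: "real \<Rightarrow> 'b::euclidean_space \<Rightarrow> 'c::real_normed_vector"
  assumes L: "\<forall>\<^sub>F s in at t within S. linear (L s)" "linear (L t)" "t \<in> S" "at t within S \<noteq> bot"
    and d: "\<And>w. ((\<lambda>s. L s w) has_vector_derivative L' w) (at t within S)"
    and v: "(v has_vector_derivative v') (at t within S)"
  shows "((\<lambda>s. L s (v s)) has_vector_derivative (L' (v t) + L t v')) (at t within S)"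
proof -
  have sum: "((\<lambda>s. L s (f s)) has_vector_derivative
      (\<Sum>b\<in>Basis. (f t \<bullet> b) *\<^sub>R L' b + (f' \<bullet> b) *\<^sub>R L t b)) (at t within S)"
    if f: "(f has_vector_derivative f') (at t within S)" for f f'
  proof -
    have fb: "((\<lambda>s. f s \<bullet> b) has_real_derivative (f' \<bullet> b)) (at t within S)" for b
      using bounded_linear.has_vector_derivative[OF bounded_linear_inner_left f]
      by (simp add: has_real_derivative_iff_has_vector_derivative)
    have "((\<lambda>s. \<Sum>b\<in>Basis. (f s \<bullet> b) *\<^sub>R L s b) has_vector_derivative
      (\<Sum>b\<in>Basis. (f t \<bullet> b) *\<^sub>R L' b + (f' \<bullet> b) *\<^sub>R L t b)) (at t within S)"
      by (intro has_vector_derivative_sum has_vector_derivative_scaleR fb d)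
    moreover have "\<forall>\<^sub>F s in at t within S. (\<Sum>b\<in>Basis. (f s \<bullet> b) *\<^sub>R L s b) = L s (f s)"
      using L(1) by eventually_elim (rule linear_euclidean_sum[symmetric])
    moreover have "(\<Sum>b\<in>Basis. (f t \<bullet> b) *\<^sub>R L t b) = L t (f t)"
      by (rule linear_euclidean_sum[OF L(2), symmetric])
    ultimately show ?thesis
      unfolding has_vector_derivative_def by (rule has_derivative_transform_eventually[OF _ _ _ L(3)])
  qed
  \<comment> \<open>Linearity of \<open>L'\<close> comes from uniqueness of derivatives: the formula
    above, applied to the constant curve \<open>w\<close>, must return \<open>L' w\<close>.\<close>
  have "L' w = (\<Sum>b\<in>Basis. (w \<bullet> b) *\<^sub>R L' b)" for w
  proof -
    have "((\<lambda>s. L s w) has_vector_derivative (\<Sum>b\<in>Basis. (w \<bullet> b) *\<^sub>R L' b + (0 \<bullet> b) *\<^sub>R L t b)) (at t within S)"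
      by (rule sum) (rule has_vector_derivative_const)
    then show ?thesis
      using vector_derivative_unique_within[OF L(4) d] by simp
  qed
  then have "L' (v t) + L t v' = (\<Sum>b\<in>Basis. (v t \<bullet> b) *\<^sub>R L' b + (v' \<bullet> b) *\<^sub>R L t b)"
    unfolding sum.distrib linear_euclidean_sum[OF L(2), symmetric] by (rule arg_cong)
  with sum[OF v] show ?thesis by simp
qed

lemma has_vector_derivative_chain:
  assumes "f differentiable at (z t)" "(z has_vector_derivative z') (at t within S)"
  shows "((\<lambda>s. f (z s)) has_vector_derivative frechet_derivative f (at (z t)) z') (at t within S)"
proof -
  have d: "(f has_derivative frechet_derivative f (at (z t))) (at (z t))"
    using assms(1) by (simp add: frechet_derivative_works)
  have "(z has_derivative (\<lambda>h. h *\<^sub>R z')) (at t within S)"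
    using assms(2) by (simp add: has_vector_derivative_def)
  from has_derivative_compose[OF this d] show ?thesis
    by (simp add: has_vector_derivative_def linear_cmul[OF linear_frechet_derivative[OF assms(1)]])
qed

lemma has_vector_derivative_linear_apply:
  fixes L :: "'a::real_normed_vector \<Rightarrow> 'b::euclidean_space \<Rightarrow> 'c::real_normed_vector"
  assumes L: "\<forall>\<^sub>F y in nhds (z t). linear (L y)" "t \<in> S" "at t within S \<noteq> bot"
    and d: "\<And>w. (\<lambda>y. L y w) differentiable at (z t)"
    and z: "(z has_vector_derivative z') (at t within S)"
    and v: "(v has_vector_derivative v') (at t within S)"
  shows "((\<lambda>s. L (z s) (v s)) has_vector_derivative
    (frechet_derivative (\<lambda>y. L y (v t)) (at (z t)) z' + L (z t) v')) (at t within S)"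
proof (rule has_vector_derivative_linear_family[OF _ _ L(2,3) _ v])
  have "(z \<longlongrightarrow> z t) (at t within S)"
    using z has_vector_derivative_continuous continuous_within by blast
  with L(1) show "\<forall>\<^sub>F s in at t within S. linear (L (z s))"
    by (rule eventually_compose_filterlim)
  show "linear (L (z t))"
    using L(1) by (rule eventually_nhds_x_imp_x)
  show "((\<lambda>s. L (z s) w) has_vector_derivative frechet_derivative (\<lambda>y. L y w) (at (z t)) z') (at t within S)" for w
    by (rule has_vector_derivative_chain[OF d z])
qed

text \<open>Ensures that the derivative of a field of endomorphisms consists again of linear
  maps.\<close>

lemma linear_frechet_param:
  fixes L :: "'a::real_normed_vector \<Rightarrow> 'b::real_vector \<Rightarrow> 'c::real_normed_vector"
  assumes U: "open U" "x \<in> U" and L: "\<And>y. y \<in> U \<Longrightarrow> linear (L y)"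
    and d: "\<And>w. (\<lambda>y. L y w) differentiable at x"
  shows "linear (\<lambda>w. frechet_derivative (\<lambda>y. L y w) (at x) h)"
proof (rule linearI)
  note dw = d[unfolded frechet_derivative_works]
  fix a b
  have "((\<lambda>y. L y (a + b)) has_derivative
      (\<lambda>h. frechet_derivative (\<lambda>y. L y a) (at x) h + frechet_derivative (\<lambda>y. L y b) (at x) h)) (at x)"
    by (rule has_derivative_transform_within_open[OF has_derivative_add[OF dw dw] U])
      (simp add: linear_add L)
  from fun_cong[OF frechet_derivative_at[OF this], of h]
  show "frechet_derivative (\<lambda>y. L y (a + b)) (at x) h
      = frechet_derivative (\<lambda>y. L y a) (at x) h + frechet_derivative (\<lambda>y. L y b) (at x) h"
    by simp
next
  note dw = d[unfolded frechet_derivative_works]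
  fix r a
  have "((\<lambda>y. L y (r *\<^sub>R a)) has_derivative
      (\<lambda>h. r *\<^sub>R frechet_derivative (\<lambda>y. L y a) (at x) h)) (at x)"
    by (rule has_derivative_transform_within_open[OF has_derivative_scaleR_right[OF dw] U])
      (simp add: linear_cmul L)
  from fun_cong[OF frechet_derivative_at[OF this], of h]
  show "frechet_derivative (\<lambda>y. L y (r *\<^sub>R a)) (at x) h = r *\<^sub>R frechet_derivative (\<lambda>y. L y a) (at x) h"
    by simp
qed

text \<open>Mean value theorem twice: first in the direction a for the difference of f over the step
  in b, then in the direction b for the derivative along a. The second difference is symmetric in a
  and b, the right-hand side a priori not.\<close>

lemma second_difference_mean_value:
  fixes f :: "'a::euclidean_space \<Rightarrow> real"
  assumes f: "smooth_on (ball x e) f" and h: "0 < h" "h * norm a + h * norm b < e"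
  shows "\<exists>y\<in>cball x (h * norm a + h * norm b).
      f (x + h *\<^sub>R a + h *\<^sub>R b) - f (x + h *\<^sub>R a) - f (x + h *\<^sub>R b) + f x
      = h * h * frechet_derivative (\<lambda>y. frechet_derivative f (at y) a) (at y) b"
proof -
  let ?r = "h * norm a + h * norm b"
  have inB: "x + s *\<^sub>R a + t *\<^sub>R b \<in> cball x ?r" if "0 \<le> s" "s \<le> h" "0 \<le> t" "t \<le> h" for s t
  proof -
    have "norm (s *\<^sub>R a + t *\<^sub>R b) \<le> norm (s *\<^sub>R a) + norm (t *\<^sub>R b)"
      by (rule norm_triangle_ineq)
    also have "\<dots> = s * norm a + t * norm b"
      using that by simp
    also have "\<dots> \<le> ?r"
      using that by (intro add_mono mult_right_mono) auto
    finally have "norm (s *\<^sub>R a + t *\<^sub>R b) \<le> ?r" .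
    moreover have "x - (x + s *\<^sub>R a + t *\<^sub>R b) = - (s *\<^sub>R a + t *\<^sub>R b)"
      by (simp add: algebra_simps)
    ultimately show ?thesis
      by (simp only: mem_cball dist_norm norm_minus_cancel)
  qed
  have B: "cball x ?r \<subseteq> ball x e"
    using h by auto
  have lin: "((\<lambda>s. p + s *\<^sub>R q) has_derivative (\<lambda>k. k *\<^sub>R q)) (at s)" for p q :: 'a and s
    by (auto intro!: derivative_eq_intros)
  have der: "((\<lambda>s. g (p + s *\<^sub>R q)) has_real_derivative frechet_derivative g (at (p + s *\<^sub>R q)) q) (at s)"
    if g: "smooth_on (ball x e) g" and "p + s *\<^sub>R q \<in> cball x ?r" for g :: "'a \<Rightarrow> real" and p q s
  proof -
    have "p + s *\<^sub>R q \<in> ball x e"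
      using that B by blast
    note dg = smooth_on_has_derivative[OF g this] and lg = smooth_on_linear_frechet[OF g this]
    have "((\<lambda>s. g (p + s *\<^sub>R q)) has_derivative (\<lambda>k. frechet_derivative g (at (p + s *\<^sub>R q)) (k *\<^sub>R q))) (at s)"
      by (rule has_derivative_compose[OF lin dg])
    then show ?thesis
      by (simp add: has_field_derivative_def linear_cmul[OF lg] mult_commute_abs)
  qed
  let ?D = "\<lambda>y. frechet_derivative f (at y) a"
  have sD: "smooth_on (ball x e) ?D"
    using f by (rule smooth_on_frechet)
  have "\<exists>s. 0 < s \<and> s < h \<and>
     (f ((x + h *\<^sub>R b) + h *\<^sub>R a) - f (x + h *\<^sub>R a)) - (f ((x + h *\<^sub>R b) + 0 *\<^sub>R a) - f (x + 0 *\<^sub>R a))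
       = (h - 0) * (?D ((x + h *\<^sub>R b) + s *\<^sub>R a) - ?D (x + s *\<^sub>R a))"
  proof (rule MVT2)
    show "0 < h" by fact
    fix s assume s: "0 \<le> s" "s \<le> h"
    have "x + s *\<^sub>R a \<in> cball x ?r"
      using inB[OF s, of 0] h by simp
    moreover have "x + h *\<^sub>R b + s *\<^sub>R a \<in> cball x ?r"
      using inB[OF s, of h] h by (simp add: add_ac)
    ultimately show "((\<lambda>s. f (x + h *\<^sub>R b + s *\<^sub>R a) - f (x + s *\<^sub>R a)) has_real_derivative
         ?D (x + h *\<^sub>R b + s *\<^sub>R a) - ?D (x + s *\<^sub>R a)) (at s)"
      by (intro DERIV_diff der f)
  qed
  then obtain s where s: "0 < s" "s < h" and 1:
     "(f ((x + h *\<^sub>R b) + h *\<^sub>R a) - f (x + h *\<^sub>R a)) - (f (x + h *\<^sub>R b) - f x)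
       = h * (?D ((x + h *\<^sub>R b) + s *\<^sub>R a) - ?D (x + s *\<^sub>R a))"
    by auto
  have "\<exists>t. 0 < t \<and> t < h \<and>
     ?D ((x + s *\<^sub>R a) + h *\<^sub>R b) - ?D ((x + s *\<^sub>R a) + 0 *\<^sub>R b)
       = (h - 0) * frechet_derivative ?D (at ((x + s *\<^sub>R a) + t *\<^sub>R b)) b"
  proof (rule MVT2)
    show "0 < h" by fact
    fix t assume t: "0 \<le> t" "t \<le> h"
    show "((\<lambda>t. ?D (x + s *\<^sub>R a + t *\<^sub>R b)) has_real_derivative
         frechet_derivative ?D (at (x + s *\<^sub>R a + t *\<^sub>R b)) b) (at t)"
      using inB[of s t] s t by (intro der sD) auto
  qed
  then obtain t where t: "0 < t" "t < h" and 2: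
     "?D ((x + s *\<^sub>R a) + h *\<^sub>R b) - ?D (x + s *\<^sub>R a)
       = h * frechet_derivative ?D (at ((x + s *\<^sub>R a) + t *\<^sub>R b)) b"
    by auto
  show ?thesis
  proof
    show "x + s *\<^sub>R a + t *\<^sub>R b \<in> cball x ?r"
      using inB[of s t] s t by auto
    have "x + h *\<^sub>R b + s *\<^sub>R a = x + s *\<^sub>R a + h *\<^sub>R b" "x + h *\<^sub>R b + h *\<^sub>R a = x + h *\<^sub>R a + h *\<^sub>R b"
      by (simp_all add: add_ac)
    with 1 2 have "(f (x + h *\<^sub>R a + h *\<^sub>R b) - f (x + h *\<^sub>R a)) - (f (x + h *\<^sub>R b) - f x)
        = h * (h * frechet_derivative ?D (at (x + s *\<^sub>R a + t *\<^sub>R b)) b)"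
      by metis
    then show "f (x + h *\<^sub>R a + h *\<^sub>R b) - f (x + h *\<^sub>R a) - f (x + h *\<^sub>R b) + f x
        = h * h * frechet_derivative ?D (at (x + s *\<^sub>R a + t *\<^sub>R b)) b"
      by (simp add: mult.assoc)
  qed
qed

text \<open>Schwarz's theorem: the second difference divided by h^2 is close to either mixed
  derivative at x by continuity. Applied to coordinate changes it makes the torsion a tensor and the
  cotangent lift symplectic.\<close>

lemma symmetric_second_derivative_real:
  fixes f :: "'a::euclidean_space \<Rightarrow> real"
  assumes U: "open U" "x \<in> U" and f: "smooth_on U f"
  shows "frechet_derivative (\<lambda>y. frechet_derivative f (at y) a) (at x) b
       = frechet_derivative (\<lambda>y. frechet_derivative f (at y) b) (at x) a"
proof -
  define D2 where "D2 a b y = frechet_derivative (\<lambda>y. frechet_derivative f (at y) a) (at y) b" for a b y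
  have cD2: "continuous (at x) (D2 a b)" for a b
    unfolding D2_def using smooth_on_continuous_on[OF smooth_on_frechet[OF smooth_on_frechet[OF f]]] U
    by (metis (no_types, lifting) continuous_on_eq_continuous_at)
  obtain e where e: "e > 0" "ball x e \<subseteq> U"
    using U openE by blast
  have bound: "\<bar>D2 a b x - D2 b a x\<bar> \<le> \<epsilon>" if eps: "\<epsilon> > 0" for \<epsilon>
  proof -
    obtain d1 where d1: "d1 > 0" "\<And>y. dist y x < d1 \<Longrightarrow> dist (D2 a b y) (D2 a b x) < \<epsilon> / 2"
      using cD2[of a b] half_gt_zero[OF eps] unfolding continuous_at_eps_delta by blast
    obtain d2 where d2: "d2 > 0" "\<And>y. dist y x < d2 \<Longrightarrow> dist (D2 b a y) (D2 b a x) < \<epsilon> / 2"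
      using cD2[of b a] half_gt_zero[OF eps] unfolding continuous_at_eps_delta by blast
    define d where "d = min (min d1 d2) e"
    have d: "d > 0" "d \<le> d1" "d \<le> d2" "d \<le> e"
      using d1 d2 e by (auto simp: d_def)
    \<comment> \<open>The summand 1 keeps the denominator positive for a = b = 0 and puts the
      parallelogram strictly inside the ball of radius d.\<close>
    define h where "h = d / (norm a + norm b + 1)"
    have N: "norm a + norm b + 1 > 0"
      by (simp add: add_nonneg_pos)
    have h: "h > 0"
      using d N by (simp add: h_def)
    have "h * (norm a + norm b + 1) = d"
      using N by (simp add: h_def)
    then have hd: "h * norm a + h * norm b < d"
      using h by (simp add: algebra_simps)
    have f': "smooth_on (ball x e) f"
      using f e(2) by (rule smooth_on_subset)
    let ?\<Delta> = "f (x + h *\<^sub>R a + h *\<^sub>R b) - f (x + h *\<^sub>R a) - f (x + h *\<^sub>R b) + f x"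
    have mv: "\<exists>y. dist y x < d \<and>
        f (x + h *\<^sub>R a + h *\<^sub>R b) - f (x + h *\<^sub>R a) - f (x + h *\<^sub>R b) + f x = h * h * D2 a b y"
      if hab: "h * norm a + h * norm b < d" for a b
    proof -
      obtain y where "y \<in> cball x (h * norm a + h * norm b)"
        "f (x + h *\<^sub>R a + h *\<^sub>R b) - f (x + h *\<^sub>R a) - f (x + h *\<^sub>R b) + f x = h * h * D2 a b y"
        using second_difference_mean_value[OF f' h, of a b] less_le_trans[OF hab d(4)] unfolding D2_def by auto
      then show ?thesis
        using hab by (intro exI[of _ y]) (auto simp: dist_commute)
    qed
    obtain y1 where y1: "dist y1 x < d" "?\<Delta> = h * h * D2 a b y1"
      using mv[OF hd] by blast
    obtain y2 where y2: "dist y2 x < d"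
        "f (x + h *\<^sub>R b + h *\<^sub>R a) - f (x + h *\<^sub>R b) - f (x + h *\<^sub>R a) + f x = h * h * D2 b a y2"
      using mv[of b a] hd by (auto simp: add.commute)
    have "f (x + h *\<^sub>R b + h *\<^sub>R a) = f (x + h *\<^sub>R a + h *\<^sub>R b)"
      by (simp add: add_ac)
    with y1(2) y2(2) have "h * h * D2 a b y1 = h * h * D2 b a y2"
      by linarith
    then have "D2 a b y1 = D2 b a y2"
      using h by simp
    moreover have "dist (D2 a b y1) (D2 a b x) < \<epsilon> / 2" "dist (D2 b a y2) (D2 b a x) < \<epsilon> / 2"
      using d1(2)[of y1] d2(2)[of y2] y1(1) y2(1) d by linarith+
    ultimately show ?thesis
      unfolding dist_real_def by arith
  qed
  have "\<bar>D2 a b x - D2 b a x\<bar> \<le> 0"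
  proof (rule field_le_epsilon)
    fix e :: real assume "0 < e"
    from bound[OF this] show "\<bar>D2 a b x - D2 b a x\<bar> \<le> 0 + e" by simp
  qed
  then show ?thesis
    by (simp add: D2_def)
qed

lemma symmetric_second_derivative:
  fixes f :: "'a::euclidean_space \<Rightarrow> 'b::euclidean_space"
  assumes U: "open U" "x \<in> U" and f: "smooth_on U f"
  shows "frechet_derivative (\<lambda>y. frechet_derivative f (at y) a) (at x) b
       = frechet_derivative (\<lambda>y. frechet_derivative f (at y) b) (at x) a"
proof (rule euclidean_eqI)
  fix i :: 'b assume i: "i \<in> Basis"
  have c: "frechet_derivative (\<lambda>y. g y \<bullet> i) (at y) v = frechet_derivative g (at y) v \<bullet> i"
    if "smooth_on U g" "y \<in> U" for g :: "'a \<Rightarrow> 'b" and y v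
    using fun_cong[OF frechet_derivative_at[OF has_derivative_inner_left[OF smooth_on_has_derivative[OF that]]], of v i]
    by simp
  have fi: "smooth_on U (\<lambda>y. f y \<bullet> i)"
    by (intro smooth_on_inner U f smooth_on_const)
  have "frechet_derivative (\<lambda>y. frechet_derivative (\<lambda>y. f y \<bullet> i) (at y) a) (at x) b
      = frechet_derivative (\<lambda>y. frechet_derivative f (at y) a) (at x) b \<bullet> i" for a b
  proof -
    have "frechet_derivative (\<lambda>y. frechet_derivative (\<lambda>y. f y \<bullet> i) (at y) a) (at x)
      = frechet_derivative (\<lambda>y. frechet_derivative f (at y) a \<bullet> i) (at x)"
      by (rule frechet_derivative_transform_within_open[OF _ U])
        (use c[OF f] smooth_on_differentiable[OF smooth_on_frechet[OF fi] U(2)] in auto)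
    then show ?thesis
      using c[OF smooth_on_frechet[OF f] U(2)] by simp
  qed
  then show "frechet_derivative (\<lambda>y. frechet_derivative f (at y) a) (at x) b \<bullet> i
       = frechet_derivative (\<lambda>y. frechet_derivative f (at y) b) (at x) a \<bullet> i"
    using symmetric_second_derivative_real[OF U fi, of a b] by simp
qed


section \<open>Families of vectors depending continuously on a parameter\<close>

lemma in_span_image_iff:
  fixes f :: "'i \<Rightarrow> 'a::real_vector"
  assumes "finite K"
  shows "v \<in> span (f ` K) \<longleftrightarrow> (\<exists>c. v = (\<Sum>i\<in>K. c i *\<^sub>R f i))"
proof
  let ?R = "{v. \<exists>c. v = (\<Sum>i\<in>K. c i *\<^sub>R f i)}"
  have "subspace ?R"
    unfolding subspace_def
  proof (safe)
    show "\<exists>c. 0 = (\<Sum>i\<in>K. c i *\<^sub>R f i)"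
      by (rule exI[of _ "\<lambda>_. 0"]) simp
    show "\<exists>c''. (\<Sum>i\<in>K. c i *\<^sub>R f i) + (\<Sum>i\<in>K. c' i *\<^sub>R f i) = (\<Sum>i\<in>K. c'' i *\<^sub>R f i)" for c c'
      by (rule exI[of _ "\<lambda>i. c i + c' i"]) (simp add: sum.distrib scaleR_add_left)
    show "\<exists>c'. r *\<^sub>R (\<Sum>i\<in>K. c i *\<^sub>R f i) = (\<Sum>i\<in>K. c' i *\<^sub>R f i)" for r c
      by (rule exI[of _ "\<lambda>i. r * c i"]) (simp add: scaleR_sum_right)
  qed
  moreover have "f ` K \<subseteq> ?R"
  proof
    fix v assume "v \<in> f ` K"
    then obtain j where "j \<in> K" "v = f j" by blast
    then have "v = (\<Sum>i\<in>K. (if i = j then 1 else 0) *\<^sub>R f i)"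
      using assms by (simp add: if_distrib[of "\<lambda>x. x *\<^sub>R _"] cong: if_cong)
    then show "v \<in> ?R"
      by (intro CollectI exI)
  qed
  moreover assume "v \<in> span (f ` K)"
  ultimately show "\<exists>c. v = (\<Sum>i\<in>K. c i *\<^sub>R f i)"
    using span_minimal by blast
next
  assume "\<exists>c. v = (\<Sum>i\<in>K. c i *\<^sub>R f i)"
  then show "v \<in> span (f ` K)"
    by (elim exE) (simp add: span_sum span_scale span_base)
qed

text \<open>Frames are indexed families that move with a parameter, while \<open>independent\<close>
  speaks of sets; injectivity of the indexing is the part of linear independence that the image set
  forgets.\<close>

lemma indexed_independent_iff:
  fixes f :: "'i \<Rightarrow> 'a::real_vector"
  assumes "finite K"
  shows "inj_on f K \<and> independent (f ` K) \<longleftrightarrow>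
    (\<forall>c. (\<Sum>i\<in>K. c i *\<^sub>R f i) = 0 \<longrightarrow> (\<forall>i\<in>K. c i = 0))"
proof (intro iffI conjI allI impI ballI)
  fix c i
  assume a: "inj_on f K \<and> independent (f ` K)" "(\<Sum>i\<in>K. c i *\<^sub>R f i) = 0" "i \<in> K"
  then have "(\<Sum>v\<in>f ` K. c (inv_into K f v) *\<^sub>R v) = 0"
    by (simp add: sum.reindex)
  then have "c (inv_into K f (f i)) = 0"
    using a assms independentD[of "f ` K" "f ` K" "\<lambda>v. c (inv_into K f v)" "f i"] by auto
  then show "c i = 0"
    using a by simp
next
  assume a: "\<forall>c. (\<Sum>i\<in>K. c i *\<^sub>R f i) = 0 \<longrightarrow> (\<forall>i\<in>K. c i = 0)"
  show inj: "inj_on f K"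
  proof (rule inj_onI, rule ccontr)
    fix i j assume ij: "i \<in> K" "j \<in> K" "f i = f j" "i \<noteq> j"
    \<comment> \<open>If two members coincided, the coefficients 1 at i and -1 at j would form a
      nontrivial relation.\<close>
    let ?c = "\<lambda>k. (if k = i then 1 else 0) - (if k = j then 1 else (0::real))"
    have "(\<Sum>k\<in>K. ?c k *\<^sub>R f k) = 0"
      using ij assms
      by (simp add: scaleR_diff_left sum_subtractf if_distrib[of "\<lambda>x. x *\<^sub>R _"] cong: if_cong)
    then have "?c i = 0"
      by (rule a[rule_format]) (rule ij(1))
    then show False
      using ij(4) by simp
  qed
  show "independent (f ` K)"
  proof
    assume "dependent (f ` K)"
    then obtain u v where uv: "v \<in> f ` K" "u v \<noteq> 0" "(\<Sum>v\<in>f ` K. u v *\<^sub>R v) = 0"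
      using assms by (auto simp: dependent_finite)
    then have "(\<Sum>i\<in>K. u (f i) *\<^sub>R f i) = 0"
      using inj by (simp add: sum.reindex)
    then have "\<forall>i\<in>K. u (f i) = 0"
      using spec[OF a, of "\<lambda>i. u (f i)"] by simp
    then show False
      using uv by blast
  qed
qed

lemma dual_vectors_exist:
  fixes y :: "'i \<Rightarrow> 'a::euclidean_space"
  assumes "inj_on y K" "independent (y ` K)"
  obtains d where "\<And>i j. i \<in> K \<Longrightarrow> j \<in> K \<Longrightarrow> d i \<bullet> y j = (if i = j then 1 else 0 :: real)"
proof -
  have "\<exists>d. \<forall>j\<in>K. d \<bullet> y j = (if i = j then 1 else 0 :: real)" for i
  proof -
    obtain g :: "'a \<Rightarrow> real" where g: "linear g" "\<forall>v\<in>y ` K. g v = (if i = inv_into K y v then 1 else 0)"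
      using linear_independent_extend[OF assms(2), of "\<lambda>v. if i = inv_into K y v then 1 else 0"] by blast
    \<comment> \<open>The coordinate functional \<open>g\<close> is represented by a vector through
      the Euclidean inner product.\<close>
    have "(\<Sum>b\<in>Basis. g b *\<^sub>R b) \<bullet> v = g v" for v
      using linear_euclidean_sum[OF g(1), of v]
      by (simp add: inner_sum_left inner_commute[of v] mult.commute)
    then show ?thesis
      using g(2) assms(1) by (intro exI[of _ "\<Sum>b\<in>Basis. g b *\<^sub>R b"]) auto
  qed
  then show ?thesis
    using that by metis
qed

text \<open>Dual vectors bound each coefficient by the norm of the combination itself, so replacing
  \<open>y\<close> by a nearby family \<open>z\<close> changes the combination by a small multiple
  of its own norm. Both stability results below rest on this relative estimate.\<close>

lemma combination_perturbation:
  fixes y :: "'i \<Rightarrow> 'a::euclidean_space" and c :: "'i \<Rightarrow> real"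
  assumes d: "\<And>i j. i \<in> K \<Longrightarrow> j \<in> K \<Longrightarrow> d i \<bullet> y j = (if i = j then 1 else 0)" and K: "finite K"
  shows "norm ((\<Sum>i\<in>K. c i *\<^sub>R z i) - (\<Sum>i\<in>K. c i *\<^sub>R y i))
    \<le> (\<Sum>i\<in>K. norm (d i) * norm (z i - y i)) * norm (\<Sum>i\<in>K. c i *\<^sub>R y i)"
    and "i \<in> K \<Longrightarrow> (\<Sum>i\<in>K. c i *\<^sub>R y i) = 0 \<Longrightarrow> c i = 0"
proof -
  let ?w = "\<Sum>i\<in>K. c i *\<^sub>R y i"
  have c: "c i = d i \<bullet> ?w" if "i \<in> K" for i
    using that K by (simp add: inner_sum_right d if_distrib cong: if_cong)
  then show "i \<in> K \<Longrightarrow> ?w = 0 \<Longrightarrow> c i = 0"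
    by simp
  have "norm ((\<Sum>i\<in>K. c i *\<^sub>R z i) - ?w) = norm (\<Sum>i\<in>K. c i *\<^sub>R (z i - y i))"
    by (simp add: scaleR_diff_right sum_subtractf)
  also have "\<dots> \<le> (\<Sum>i\<in>K. \<bar>c i\<bar> * norm (z i - y i))"
    by (rule order_trans[OF norm_sum]) simp
  also have "\<dots> \<le> (\<Sum>i\<in>K. (norm (d i) * norm ?w) * norm (z i - y i))"
    by (intro sum_mono mult_right_mono) (simp_all add: c Cauchy_Schwarz_ineq2)
  finally show "norm ((\<Sum>i\<in>K. c i *\<^sub>R z i) - ?w)
    \<le> (\<Sum>i\<in>K. norm (d i) * norm (z i - y i)) * norm ?w"
    by (simp only: sum_distrib_right mult.assoc mult.commute[of "norm (z _ - y _)"])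
qed

lemma perturbation_tendsto_0:
  fixes Y :: "'i \<Rightarrow> 'b \<Rightarrow> 'a::real_normed_vector"
  assumes "\<And>i. i \<in> K \<Longrightarrow> (Y i \<longlongrightarrow> y i) F"
  shows "((\<lambda>s. \<Sum>i\<in>K. norm (d i) * norm (Y i s - y i)) \<longlongrightarrow> 0) F"
proof -
  have "((\<lambda>s. \<Sum>i\<in>K. norm (d i) * norm (Y i s - y i)) \<longlongrightarrow> (\<Sum>i\<in>K. norm (d i) * norm (y i - y i))) F"
    by (intro tendsto_sum tendsto_mult tendsto_const tendsto_norm tendsto_diff assms)
  then show ?thesis by simp
qed

text \<open>A relation among the perturbed vectors would bound the norm of the unperturbed
  combination by its own perturbation, which is impossible for a nonzero vector once the relative
  error is below 1.\<close>

lemma eventually_independent: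
  fixes Y :: "'i \<Rightarrow> 'b \<Rightarrow> 'a::euclidean_space"
  assumes K: "finite K" and y: "inj_on y K" "independent (y ` K)"
    and Y: "\<And>i. i \<in> K \<Longrightarrow> (Y i \<longlongrightarrow> y i) F"
  shows "\<forall>\<^sub>F s in F. inj_on (\<lambda>i. Y i s) K \<and> independent ((\<lambda>i. Y i s) ` K)"
proof -
  obtain d where d: "\<And>i j. i \<in> K \<Longrightarrow> j \<in> K \<Longrightarrow> d i \<bullet> y j = (if i = j then 1 else 0 :: real)"
    using dual_vectors_exist[OF y] by blast
  have "\<forall>\<^sub>F s in F. (\<Sum>i\<in>K. norm (d i) * norm (Y i s - y i)) < 1"
    by (rule order_tendstoD(2)[OF perturbation_tendsto_0]) (auto intro: Y)
  then show ?thesis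
  proof eventually_elim
    fix s assume s: "(\<Sum>i\<in>K. norm (d i) * norm (Y i s - y i)) < 1"
    show "inj_on (\<lambda>i. Y i s) K \<and> independent ((\<lambda>i. Y i s) ` K)"
      unfolding indexed_independent_iff[OF K]
    proof (intro allI impI ballI)
      fix c i assume c: "(\<Sum>i\<in>K. c i *\<^sub>R Y i s) = 0" "i \<in> K"
      let ?w = "\<Sum>i\<in>K. c i *\<^sub>R y i"
      have le: "norm ?w \<le> (\<Sum>i\<in>K. norm (d i) * norm (Y i s - y i)) * norm ?w"
        using combination_perturbation(1)[OF d K, of c "\<lambda>i. Y i s"] c by simp
      have "norm ?w = 0"
      proof (rule ccontr)
        assume "norm ?w \<noteq> 0"
        then have "(\<Sum>i\<in>K. norm (d i) * norm (Y i s - y i)) * norm ?w < 1 * norm ?w"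
          using s by (intro mult_strict_right_mono) auto
        with le show False by simp
      qed
      then show "c i = 0"
        using combination_perturbation(2)[OF d K c(2)] by simp
    qed
  qed
qed

text \<open>The coefficients of \<open>w s\<close>, applied to the limit vectors \<open>y\<close>,
  give \<open>w' s\<close> in a fixed closed subspace, and the relative estimate makes
  \<open>w s - w' s\<close> tend to 0. Convergence of the coefficients themselves never
  enters.\<close>

lemma tendsto_in_span:
  fixes Y :: "'i \<Rightarrow> 'b \<Rightarrow> 'a::euclidean_space"
  assumes K: "finite K" and y: "inj_on y K" "independent (y ` K)"
    and Y: "\<And>i. i \<in> K \<Longrightarrow> (Y i \<longlongrightarrow> y i) F"
    and w: "(w \<longlongrightarrow> l) F" "\<forall>\<^sub>F s in F. w s \<in> span ((\<lambda>i. Y i s) ` K)" and F: "F \<noteq> bot"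
  shows "l \<in> span (y ` K)"
proof -
  obtain d where d: "\<And>i j. i \<in> K \<Longrightarrow> j \<in> K \<Longrightarrow> d i \<bullet> y j = (if i = j then 1 else 0 :: real)"
    using dual_vectors_exist[OF y] by blast
  define E where "E s = (\<Sum>i\<in>K. norm (d i) * norm (Y i s - y i))" for s
  have E0: "(E \<longlongrightarrow> 0) F"
    unfolding E_def by (rule perturbation_tendsto_0) (rule Y)
  define c where "c s = (SOME c. w s = (\<Sum>i\<in>K. c i *\<^sub>R Y i s))" for s
  define w' where "w' s = (\<Sum>i\<in>K. c s i *\<^sub>R y i)" for s
  \<comment> \<open>Below 1/2 the error can be absorbed: the norm of \<open>w' s\<close> is then at
    most twice that of \<open>w s\<close>, so the bound can be stated in terms of the convergent
    \<open>w\<close>.\<close>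
  have "\<forall>\<^sub>F s in F. E s < 1 / 2"
    using order_tendstoD(2)[OF E0, of "1/2"] by simp
  then have ev: "\<forall>\<^sub>F s in F. norm (w s - w' s) \<le> 2 * E s * norm (w s)"
    using w(2)
  proof eventually_elim
    fix s assume s: "E s < 1 / 2" "w s \<in> span ((\<lambda>i. Y i s) ` K)"
    have "w s = (\<Sum>i\<in>K. c s i *\<^sub>R Y i s)"
      using s(2) unfolding in_span_image_iff[OF K] c_def by (rule someI_ex)
    then have 1: "norm (w s - w' s) \<le> E s * norm (w' s)"
      using combination_perturbation(1)[OF d K, of "c s" "\<lambda>i. Y i s"] by (simp add: w'_def E_def)
    have "E s \<ge> 0"
      by (auto simp: E_def intro!: sum_nonneg)
    have "norm (w' s) \<le> norm (w s) + norm (w s - w' s)"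
      by (metis norm_triangle_sub norm_minus_commute add.commute)
    also have "norm (w s - w' s) \<le> (1 / 2) * norm (w' s)"
      using 1 s(1) by (meson less_imp_le mult_right_mono norm_ge_zero order_trans)
    finally have "norm (w' s) \<le> 2 * norm (w s)"
      by simp
    then have "E s * norm (w' s) \<le> E s * (2 * norm (w s))"
      using \<open>E s \<ge> 0\<close> by (rule mult_left_mono)
    with 1 show "norm (w s - w' s) \<le> 2 * E s * norm (w s)"
      by simp
  qed
  have "((\<lambda>s. 2 * E s * norm (w s)) \<longlongrightarrow> 2 * 0 * norm l) F"
    by (intro tendsto_intros E0 w)
  then have "((\<lambda>s. w s - w' s) \<longlongrightarrow> 0) F"
    using ev by (intro Lim_null_comparison[OF ev]) simp
  from tendsto_diff[OF w(1) this] have "(w' \<longlongrightarrow> l) F"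
    by simp
  moreover have "w' s \<in> span (y ` K)" for s
    unfolding w'_def by (intro span_sum span_scale span_base) auto
  ultimately show ?thesis
    by (intro Lim_in_closed_set[OF closed_subspace[OF subspace_span] _ F]) auto
qed

lemma has_vector_derivative_difference_quotient:
  assumes "(w has_vector_derivative w') (at t within S)"
  shows "((\<lambda>s. (w s - w t) /\<^sub>R (s - t)) \<longlongrightarrow> w') (at t within S)"
proof -
  have "((\<lambda>s. (w s - (w t + (s - t) *\<^sub>R w')) /\<^sub>R \<bar>s - t\<bar>) \<longlongrightarrow> 0) (at t within S)"
    using assms unfolding has_vector_derivative_def has_derivative_within by (simp add: divide_inverse)
  then have "((\<lambda>s. norm ((w s - (w t + (s - t) *\<^sub>R w')) /\<^sub>R \<bar>s - t\<bar>)) \<longlongrightarrow> 0) (at t within S)"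
    by (rule tendsto_norm_zero)
  moreover have "\<forall>\<^sub>F s in at t within S. norm ((w s - (w t + (s - t) *\<^sub>R w')) /\<^sub>R \<bar>s - t\<bar>)
      = norm ((w s - w t) /\<^sub>R (s - t) - w')"
    unfolding eventually_at_filter
  proof (rule eventuallyI, intro impI)
    fix s assume "s \<noteq> t"
    moreover have "(w s - (w t + (s - t) *\<^sub>R w')) /\<^sub>R (s - t)
        = (w s - w t) /\<^sub>R (s - t) - ((s - t) *\<^sub>R w') /\<^sub>R (s - t)"
      by (simp only: diff_diff_eq[symmetric] scaleR_diff_right)
    ultimately have "(w s - w t) /\<^sub>R (s - t) - w' = (w s - (w t + (s - t) *\<^sub>R w')) /\<^sub>R (s - t)"
      by simp
    then show "norm ((w s - (w t + (s - t) *\<^sub>R w')) /\<^sub>R \<bar>s - t\<bar>) = norm ((w s - w t) /\<^sub>R (s - t) - w')"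
      by simp
  qed
  ultimately have "((\<lambda>s. norm ((w s - w t) /\<^sub>R (s - t) - w')) \<longlongrightarrow> 0) (at t within S)"
    by (rule Lim_transform_eventually)
  from LIM_zero_cancel[OF tendsto_norm_zero_cancel[OF this]] show ?thesis .
qed

text \<open>As \<open>w t = 0\<close>, the difference quotients of \<open>w\<close> at t lie in the
  moving span, hence their limit lies in the span at t. The flag of the Jacobi curve and the columns
  of the canonical frame are both treated in this way, without differentiating coefficient
  functions.\<close>

lemma vector_derivative_in_span:
  fixes Y :: "'i \<Rightarrow> real \<Rightarrow> 'a::euclidean_space"
  assumes K: "finite K" and y: "inj_on (\<lambda>i. Y i t) K" "independent ((\<lambda>i. Y i t) ` K)"
    and Y: "\<And>i. i \<in> K \<Longrightarrow> (Y i \<longlongrightarrow> Y i t) (at t within S)"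
    and w: "(w has_vector_derivative w') (at t within S)" "w t = 0"
      "\<forall>\<^sub>F s in at t within S. w s \<in> span ((\<lambda>i. Y i s) ` K)"
    and S: "at t within S \<noteq> bot"
  shows "w' \<in> span ((\<lambda>i. Y i t) ` K)"
proof (rule tendsto_in_span[OF K y Y _ _ S])
  show "((\<lambda>s. (w s - w t) /\<^sub>R (s - t)) \<longlongrightarrow> w') (at t within S)"
    by (rule has_vector_derivative_difference_quotient[OF w(1)])
  show "\<forall>\<^sub>F s in at t within S. (w s - w t) /\<^sub>R (s - t) \<in> span ((\<lambda>i. Y i s) ` K)"
    using w(3) by eventually_elim (simp add: w(2) span_scale)
qed

text \<open>Gram-Schmidt without normalization, so that the only nonlinear operation is division by
  positive smooth functions. \<open>G\<close> is a scalar product on the fibres \<open>E x\<close>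
  only, as the sub-Riemannian metric is; its smoothness is accordingly demanded along sections of
  \<open>E\<close>.\<close>

lemma smooth_orthogonalization:
  fixes y :: "nat \<Rightarrow> 'a::real_normed_vector \<Rightarrow> 'e::real_normed_vector" and G :: "'a \<Rightarrow> 'e \<Rightarrow> 'e \<Rightarrow> real"
  assumes U: "open U" and y: "\<And>i. i < r \<Longrightarrow> smooth_on U (y i)"
    "\<And>x. x \<in> U \<Longrightarrow> inj_on (\<lambda>i. y i x) {..<r}" "\<And>x. x \<in> U \<Longrightarrow> independent ((\<lambda>i. y i x) ` {..<r})"
    and E: "\<And>x. x \<in> U \<Longrightarrow> subspace (E x)" "\<And>i x. i < r \<Longrightarrow> x \<in> U \<Longrightarrow> y i x \<in> E x"
    and G: "\<And>x u v. x \<in> U \<Longrightarrow> u \<in> E x \<Longrightarrow> v \<in> E x \<Longrightarrow> G x u v = G x v u"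
      "\<And>x u v w. x \<in> U \<Longrightarrow> u \<in> E x \<Longrightarrow> v \<in> E x \<Longrightarrow> w \<in> E x \<Longrightarrow> G x (u + v) w = G x u w + G x v w"
      "\<And>x u v a. x \<in> U \<Longrightarrow> u \<in> E x \<Longrightarrow> v \<in> E x \<Longrightarrow> G x (a *\<^sub>R u) v = a * G x u v"
      "\<And>x u. x \<in> U \<Longrightarrow> u \<in> E x \<Longrightarrow> u \<noteq> 0 \<Longrightarrow> G x u u > 0"
      "\<And>f g. smooth_on U f \<Longrightarrow> smooth_on U g \<Longrightarrow> (\<And>x. x \<in> U \<Longrightarrow> f x \<in> E x) \<Longrightarrow> (\<And>x. x \<in> U \<Longrightarrow> g x \<in> E x)
         \<Longrightarrow> smooth_on U (\<lambda>x. G x (f x) (g x))"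
  shows "\<exists>z. (\<forall>i<r. smooth_on U (z i)) \<and>
    (\<forall>x\<in>U. span ((\<lambda>i. z i x) ` {..<r}) = span ((\<lambda>i. y i x) ` {..<r}) \<and>
       (\<forall>i<r. z i x \<noteq> 0) \<and> (\<forall>i<r. \<forall>j<r. i \<noteq> j \<longrightarrow> G x (z i x) (z j x) = 0))"
proof -
  have "\<exists>z. (\<forall>i<k. smooth_on U (z i)) \<and>
    (\<forall>x\<in>U. span ((\<lambda>i. z i x) ` {..<k}) = span ((\<lambda>i. y i x) ` {..<k}) \<and>
       (\<forall>i<k. z i x \<noteq> 0) \<and> (\<forall>i<k. \<forall>j<k. i \<noteq> j \<longrightarrow> G x (z i x) (z j x) = 0))" if "k \<le> r" for k
    using that
  proof (induction k)
    case 0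
    show ?case by simp
  next
    case (Suc k)
    then have kr: "k < r" "k \<le> r"
      by simp_all
    from Suc.IH[OF kr(2)] obtain z where z: "\<And>i. i < k \<Longrightarrow> smooth_on U (z i)"
      and sp: "\<And>x. x \<in> U \<Longrightarrow> span ((\<lambda>i. z i x) ` {..<k}) = span ((\<lambda>i. y i x) ` {..<k})"
      and nz: "\<And>x i. x \<in> U \<Longrightarrow> i < k \<Longrightarrow> z i x \<noteq> 0"
      and og: "\<And>x i j. x \<in> U \<Longrightarrow> i < k \<Longrightarrow> j < k \<Longrightarrow> i \<noteq> j \<Longrightarrow> G x (z i x) (z j x) = 0"
      by (elim exE conjE) blast
    have zE: "z i x \<in> E x" if "i < k" "x \<in> U" for i x
    proof -
      have "z i x \<in> span ((\<lambda>i. y i x) ` {..<k})"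
        using that sp by (metis (no_types, lifting) imageI lessThan_iff span_base)
      moreover have "span ((\<lambda>i. y i x) ` {..<k}) \<subseteq> E x"
        using that kr E by (intro span_minimal) auto
      ultimately show ?thesis by blast
    qed
    define p where "p x = (\<Sum>i<k. (G x (y k x) (z i x) / G x (z i x) (z i x)) *\<^sub>R z i x)" for x
    define zk where "zk x = y k x - p x" for x
    have pE: "p x \<in> E x" if "x \<in> U" for x
      unfolding p_def using that E zE by (intro subspace_sum subspace_scale) auto
    have zkE: "zk x \<in> E x" if "x \<in> U" for x
      unfolding zk_def using that E pE kr by (intro subspace_diff) auto
    have gz: "G x (z i x) (z i x) > 0" if "x \<in> U" "i < k" for x i
      using that by (intro G zE nz)
    have sk: "smooth_on U zk"
      unfolding zk_def p_def
      by (intro smooth_on_diff smooth_on_sum smooth_on_scaleR smooth_on_divide U G z y kr E zE)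
        (use gz zE in \<open>force+\<close>)
    have psp: "p x \<in> span ((\<lambda>i. z i x) ` {..<k})" if "x \<in> U" for x
      unfolding p_def by (intro span_sum span_scale span_base) auto
    \<comment> \<open>A vanishing remainder would put the next vector into the span of its
      predecessors.\<close>
    have nk: "zk x \<noteq> 0" if x: "x \<in> U" for x
    proof
      assume "zk x = 0"
      then have "y k x \<in> span ((\<lambda>i. y i x) ` {..<k})"
        using psp[OF x] sp[OF x] by (simp add: zk_def)
      moreover have "independent ((\<lambda>i. y i x) ` {..<Suc k})"
        by (rule independent_mono[OF y(3)[OF x]]) (use kr in auto)
      moreover have "y k x \<notin> (\<lambda>i. y i x) ` {..<k}"
        using y(2)[OF x] kr by (force simp: inj_on_def)
      ultimately show False
        by (simp add: lessThan_Suc independent_insert)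
    qed
    have Gsum: "G x (\<Sum>i\<in>S. c i *\<^sub>R z i x) w = (\<Sum>i\<in>S. c i * G x (z i x) w)"
      if "x \<in> U" "w \<in> E x" "S \<subseteq> {..<k}" for x w S and c :: "nat \<Rightarrow> real"
    proof -
      have "finite S" using that(3) finite_subset by blast
      then show ?thesis
        using that
      proof (induction S rule: finite_induct)
        case empty
        have "G x (0 *\<^sub>R w) w = 0 * G x w w"
          by (rule G(3)) (use empty in auto)
        then show ?case by simp
      next
        case (insert i S)
        have "(\<Sum>i\<in>S. c i *\<^sub>R z i x) \<in> E x" "z i x \<in> E x" "c i *\<^sub>R z i x \<in> E x"
          using insert by (auto intro!: subspace_sum subspace_scale E zE)
        then show ?case
          using insert by (simp add: G(2,3))
      qed
    qed
    have ok: "G x (zk x) (z j x) = 0" if "x \<in> U" "j < k" for x j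
    proof -
      have zj: "z j x \<in> E x" using that zE by blast
      have "G x (p x) (z j x) = (\<Sum>i<k. (G x (y k x) (z i x) / G x (z i x) (z i x)) * G x (z i x) (z j x))"
        unfolding p_def by (rule Gsum[OF that(1) zj]) simp
      also have "\<dots> = (\<Sum>i<k. if i = j then G x (y k x) (z j x) else 0)"
        using that og gz[of x j] by (intro sum.cong) auto
      also have "\<dots> = G x (y k x) (z j x)"
        using that by simp
      finally have "G x (p x) (z j x) = G x (y k x) (z j x)" .
      moreover have "G x (zk x + p x) (z j x) = G x (zk x) (z j x) + G x (p x) (z j x)"
        using that pE zkE zj by (intro G) auto
      ultimately show ?thesis
        by (simp add: zk_def)
    qed
    let ?z = "z(k := zk)"
    show ?case
    proof (intro exI[of _ ?z] conjI allI impI ballI)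
      show "smooth_on U (?z i)" if "i < Suc k" for i
        using that z sk by (auto simp: less_Suc_eq)
      fix x assume x: "x \<in> U"
      show "?z i x \<noteq> 0" if "i < Suc k" for i
        using that nz[OF x] nk[OF x] by (auto simp: less_Suc_eq)
      show "G x (?z i x) (?z j x) = 0" if "i < Suc k" "j < Suc k" "i \<noteq> j" for i j
        using that og[OF x] ok[OF x] G(1)[OF x _ zkE[OF x]] zE[OF _ x] by (auto simp: less_Suc_eq)
      let ?Z = "(\<lambda>i. z i x) ` {..<k}" and ?Y = "(\<lambda>i. y i x) ` {..<k}"
      have "(\<lambda>i. ?z i x) ` {..<Suc k} = insert (zk x) ?Z"
        by (auto simp: lessThan_Suc)
      moreover have "span (insert (zk x) ?Z) = span (insert (y k x) ?Y)"
      proof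
        have "y k x \<in> span (insert (y k x) ?Y)" "p x \<in> span (insert (y k x) ?Y)"
          using psp[OF x] sp[OF x] span_mono[of ?Y "insert (y k x) ?Y"] by (auto intro: span_base)
        then have "zk x \<in> span (insert (y k x) ?Y)"
          unfolding zk_def by (rule span_diff)
        moreover have "?Z \<subseteq> span (insert (y k x) ?Y)"
          using span_superset[of ?Z] sp[OF x] span_mono[of ?Y "insert (y k x) ?Y"] by auto
        ultimately show "span (insert (zk x) ?Z) \<subseteq> span (insert (y k x) ?Y)"
          by (intro span_minimal) auto
        have "zk x \<in> span (insert (zk x) ?Z)" "p x \<in> span (insert (zk x) ?Z)"
          using psp[OF x] span_mono[of ?Z "insert (zk x) ?Z"] by (auto intro: span_base)
        then have "zk x + p x \<in> span (insert (zk x) ?Z)"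
          by (rule span_add)
        then have "y k x \<in> span (insert (zk x) ?Z)"
          by (simp add: zk_def)
        moreover have "?Y \<subseteq> span (insert (zk x) ?Z)"
          using span_superset[of ?Y] sp[OF x] span_mono[of ?Z "insert (zk x) ?Z"] by auto
        ultimately show "span (insert (y k x) ?Y) \<subseteq> span (insert (zk x) ?Z)"
          by (intro span_minimal) auto
      qed
      ultimately show "span ((\<lambda>i. ?z i x) ` {..<Suc k}) = span ((\<lambda>i. y i x) ` {..<Suc k})"
        by (simp add: lessThan_Suc)
    qed
  qed
  then show ?thesis by blast
qed

section \<open>Linear differential equations\<close>

lemma linear_family_bounded:
  fixes A :: "real \<Rightarrow> 'a::euclidean_space \<Rightarrow> 'b::real_normed_vector"
  assumes "\<And>t. t \<in> {0..T} \<Longrightarrow> linear (A t)" "\<And>b. continuous_on {0..T} (\<lambda>t. A t b)"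
  obtains B where "B > 0" "\<And>t v. t \<in> {0..T} \<Longrightarrow> norm (A t v) \<le> B * norm v"
proof -
  have "\<exists>B. \<forall>t\<in>{0..T}. norm (A t b) \<le> B" for b
    using compact_imp_bounded[OF compact_continuous_image[OF assms(2) compact_Icc]]
    by (fastforce simp: bounded_iff)
  then obtain m where m: "\<And>b t. t \<in> {0..T} \<Longrightarrow> norm (A t b) \<le> m b"
    by metis
  define B where "B = (\<Sum>b\<in>Basis. \<bar>m b\<bar>) + 1"
  have "norm (A t v) \<le> B * norm v" if t: "t \<in> {0..T}" for t v
  proof -
    have "norm (A t v) = norm (\<Sum>b\<in>Basis. (v \<bullet> b) *\<^sub>R A t b)"
      using linear_euclidean_sum[OF assms(1)[OF t], of v] by simp
    also have "\<dots> \<le> (\<Sum>b\<in>Basis. norm v * \<bar>m b\<bar>)"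
    proof (rule sum_norm_le)
      fix b :: 'a assume b: "b \<in> Basis"
      have "norm (A t b) \<le> \<bar>m b\<bar>"
        using m[OF t, of b] by linarith
      then show "norm ((v \<bullet> b) *\<^sub>R A t b) \<le> norm v * \<bar>m b\<bar>"
        using Basis_le_norm[OF b, of v] by (auto intro!: mult_mono)
    qed
    also have "\<dots> \<le> B * norm v"
      by (simp add: B_def sum_distrib_left[symmetric] algebra_simps)
    finally show ?thesis .
  qed
  moreover have "B > 0"
    by (auto simp: B_def add_nonneg_pos sum_nonneg)
  ultimately show ?thesis
    using that by blast
qed

text \<open>Picard iteration. A short interval suffices, because the solution serves as a parallel
  field of which the derivative at the initial point is wanted.\<close>

lemma linear_ode_exists:
  fixes A :: "real \<Rightarrow> 'a::euclidean_space \<Rightarrow> 'a"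
  assumes T: "T > 0"
    and A: "\<And>t. t \<in> {0..T} \<Longrightarrow> linear (A t)" "\<And>b. continuous_on {0..T} (\<lambda>t. A t b)"
  obtains \<epsilon> v where "0 < \<epsilon>" "\<epsilon> \<le> T" "v 0 = v0"
    "\<And>t. t \<in> {0..\<epsilon>} \<Longrightarrow> (v has_vector_derivative A t (v t)) (at t within {0..\<epsilon>})"
proof -
  obtain B where B: "B > 0" "\<And>t v. t \<in> {0..T} \<Longrightarrow> norm (A t v) \<le> B * norm v"
    using linear_family_bounded[OF A] by blast
  \<comment> \<open>The integral operator contracts by the factor \<epsilon> times B, which is at
    most 1/2 for this choice.\<close>
  define \<epsilon> where "\<epsilon> = min T (1 / (2 * B))"
  have e: "0 < \<epsilon>" "\<epsilon> \<le> T" "\<epsilon> * B \<le> 1 / 2"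
  proof -
    show "0 < \<epsilon>" "\<epsilon> \<le> T" using T B(1) by (auto simp: \<epsilon>_def)
    have "\<epsilon> * B \<le> (1 / (2 * B)) * B"
      using B(1) by (intro mult_right_mono) (auto simp: \<epsilon>_def)
    then show "\<epsilon> * B \<le> 1 / 2" using B(1) by simp
  qed
  have cont: "continuous_on {0..\<epsilon>} (\<lambda>s. A s (f s))" if "continuous_on {0..\<epsilon>} f" for f
  proof -
    have "continuous_on {0..\<epsilon>} (\<lambda>s. \<Sum>b\<in>Basis. (f s \<bullet> b) *\<^sub>R A s b)"
      using e by (intro continuous_intros that continuous_on_subset[OF A(2)]) auto
    moreover have "(\<Sum>b\<in>Basis. (f s \<bullet> b) *\<^sub>R A s b) = A s (f s)" if "s \<in> {0..\<epsilon>}" for s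
      using that e by (subst linear_euclidean_sum[OF A(1), of s "f s"]) auto
    ultimately show ?thesis
      by (rule continuous_on_eq) auto
  qed
  \<comment> \<open>Clamping the time extends functions on [0, \<epsilon>] by constants to the whole
    line, so that the contraction acts on the complete space of bounded continuous
    functions.\<close>
  define cl where "cl t = max 0 (min \<epsilon> t)" for t :: real
  have cl: "cl t \<in> {0..\<epsilon>}" "t \<in> {0..\<epsilon>} \<Longrightarrow> cl t = t" for t
    using e by (auto simp: cl_def)
  define J where "J f t = v0 + integral {0..cl t} (\<lambda>s. A s (apply_bcontfun f s))" for f :: "real \<Rightarrow>\<^sub>C 'a" and t
  have c1: "continuous_on {0..\<epsilon>} (\<lambda>s. A s (apply_bcontfun f s))" for f :: "real \<Rightarrow>\<^sub>C 'a"
    by (rule cont) (simp add: continuous_on_apply_bcontfun)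
  have int: "(\<lambda>s. A s (apply_bcontfun f s)) integrable_on {0..cl t}" for f :: "real \<Rightarrow>\<^sub>C 'a" and t
    by (rule integrable_continuous_real, rule continuous_on_subset[OF c1]) (use cl[of t] in auto)
  have J: "J f \<in> bcontfun" for f
  proof -
    have "continuous_on {0..\<epsilon>} (\<lambda>t. integral {0..t} (\<lambda>s. A s (apply_bcontfun f s)))"
      by (intro indefinite_integral_continuous_1 integrable_continuous_real c1)
    then have c2: "continuous_on {0..\<epsilon>} (\<lambda>t. v0 + integral {0..t} (\<lambda>s. A s (apply_bcontfun f s)))"
      by (intro continuous_intros)
    have "continuous_on UNIV (\<lambda>t. J f t)"
      unfolding J_def using cl
      by (intro continuous_on_compose2[OF c2, of UNIV cl]) (auto simp: cl_def intro!: continuous_intros)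
    moreover have "bounded (range (J f))"
    proof (rule bounded_subset)
      show "bounded ((\<lambda>t. v0 + integral {0..t} (\<lambda>s. A s (apply_bcontfun f s))) ` {0..\<epsilon>})"
        by (intro compact_imp_bounded compact_continuous_image c2 compact_Icc)
      show "range (J f) \<subseteq> (\<lambda>t. v0 + integral {0..t} (\<lambda>s. A s (apply_bcontfun f s))) ` {0..\<epsilon>}"
        unfolding J_def using cl by auto
    qed
    ultimately show ?thesis
      by (simp add: bcontfun_def)
  qed
  define \<Phi> where "\<Phi> f = Bcontfun (J f)" for f
  have \<Phi>: "apply_bcontfun (\<Phi> f) t = J f t" for f t
    by (simp add: \<Phi>_def Bcontfun_inverse[OF J])
  have "\<exists>!f\<in>UNIV. \<Phi> f = f"
  proof (rule Banach_fix[of UNIV "1/2"])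
    show "dist (\<Phi> f) (\<Phi> g) \<le> 1 / 2 * dist f g" if "f \<in> UNIV" "g \<in> UNIV" for f g
    proof (rule dist_bound)
      fix t
      have "J f t - J g t = integral {0..cl t} (\<lambda>s. A s (apply_bcontfun f s - apply_bcontfun g s))"
      proof -
        have "J f t - J g t = integral {0..cl t} (\<lambda>s. A s (apply_bcontfun f s) - A s (apply_bcontfun g s))"
          by (simp add: J_def integral_diff[OF int int])
        also have "\<dots> = integral {0..cl t} (\<lambda>s. A s (apply_bcontfun f s - apply_bcontfun g s))"
          by (rule integral_cong) (use cl[of t] e A(1) in \<open>auto simp: linear_diff\<close>)
        finally show ?thesis .
      qed
      also have "norm \<dots> \<le> (B * dist f g) * (cl t - 0)"
      proof (rule integral_bound)
        show "0 \<le> cl t" using cl[of t] by simp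
        show "continuous_on {0..cl t} (\<lambda>s. A s (apply_bcontfun f s - apply_bcontfun g s))"
          by (rule continuous_on_subset[OF cont]) (use cl[of t] in \<open>auto intro!: continuous_intros\<close>)
        fix s assume s: "s \<in> {0..cl t}"
        then have "norm (A s (apply_bcontfun f s - apply_bcontfun g s)) \<le> B * norm (apply_bcontfun f s - apply_bcontfun g s)"
          using cl[of t] e by (intro B) auto
        also have "\<dots> \<le> B * dist f g"
          using B(1) dist_bounded[of f s g] by (intro mult_left_mono) (auto simp: dist_norm)
        finally show "norm (A s (apply_bcontfun f s - apply_bcontfun g s)) \<le> B * dist f g" .
      qed
      also have "\<dots> \<le> (B * dist f g) * \<epsilon>"
        using cl[of t] B(1) by (intro mult_left_mono) auto
      also have "\<dots> = (\<epsilon> * B) * dist f g" by simp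
      also have "\<dots> \<le> 1 / 2 * dist f g"
        by (intro mult_right_mono e) auto
      finally show "dist (apply_bcontfun (\<Phi> f) t) (apply_bcontfun (\<Phi> g) t) \<le> 1 / 2 * dist f g"
        by (simp add: \<Phi> dist_norm)
    qed
  qed (auto simp: complete_UNIV)
  then obtain f where f: "\<Phi> f = f" by blast
  let ?v = "apply_bcontfun f"
  have v: "?v t = v0 + integral {0..t} (\<lambda>s. A s (?v s))" if "t \<in> {0..\<epsilon>}" for t
    using \<Phi>[of f t] that by (simp add: f J_def cl)
  show ?thesis
  proof (rule that[OF e(1,2)])
    show "?v 0 = v0"
      using v[of 0] e by simp
    fix t assume t: "t \<in> {0..\<epsilon>}"
    have "((\<lambda>t. integral {0..t} (\<lambda>s. A s (?v s))) has_vector_derivative A t (?v t)) (at t within {0..\<epsilon>})"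
      by (rule integral_has_vector_derivative[OF c1 t])
    then have "((\<lambda>t. v0 + integral {0..t} (\<lambda>s. A s (?v s))) has_vector_derivative 0 + A t (?v t)) (at t within {0..\<epsilon>})"
      by (intro has_vector_derivative_add has_vector_derivative_const)
    then show "(?v has_vector_derivative A t (?v t)) (at t within {0..\<epsilon>})"
      using t v has_vector_derivative_transform[of t "{0..\<epsilon>}" ?v] by simp
  qed
qed

section \<open>Coordinate changes\<close>

definition transition :: "('m, 'e) chart \<Rightarrow> ('m, 'e) chart \<Rightarrow> 'e \<Rightarrow> 'e" where
  "transition c c' x = snd c' (chart_inv c x)"

definition jac :: "('m, 'e::real_normed_vector) chart \<Rightarrow> ('m, 'e) chart \<Rightarrow> 'e \<Rightarrow> 'e \<Rightarrow> 'e" where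
  "jac c c' x = frechet_derivative (transition c c') (at x)"

locale manifold =
  fixes M :: "('m::{second_countable_topology,t2_space}, 'e::euclidean_space) subriem"
  assumes atlas: "smooth_atlas (atlas M)"
begin

lemma chart_homeomorphism:
  "c \<in> atlas M \<Longrightarrow> homeomorphism (fst c) (snd c ` fst c) (snd c) (chart_inv c)"
  using atlas by (simp add: smooth_atlas_def)

lemma open_chart: "c \<in> atlas M \<Longrightarrow> open (fst c)"
  using atlas by (simp add: smooth_atlas_def)

lemma open_chart_image: "c \<in> atlas M \<Longrightarrow> open (snd c ` fst c)"
  using atlas by (simp add: smooth_atlas_def)

lemma chart_inv_left [simp]: "c \<in> atlas M \<Longrightarrow> q \<in> fst c \<Longrightarrow> chart_inv c (snd c q) = q"
  using chart_homeomorphism homeomorphism_apply1 by blast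

lemma chart_inv_right [simp]: "c \<in> atlas M \<Longrightarrow> x \<in> snd c ` fst c \<Longrightarrow> snd c (chart_inv c x) = x"
  using chart_homeomorphism homeomorphism_apply2 by blast

lemma chart_inv_in: "c \<in> atlas M \<Longrightarrow> x \<in> snd c ` fst c \<Longrightarrow> chart_inv c x \<in> fst c"
  by auto

lemma continuous_chart_inv: "c \<in> atlas M \<Longrightarrow> continuous_on (snd c ` fst c) (chart_inv c)"
  using chart_homeomorphism homeomorphism_cont2 by blast

lemma open_image:
  assumes "c \<in> atlas M" "open U"
  shows "open (snd c ` (U \<inter> fst c))"
proof -
  have "openin (top_of_set (fst c)) (U \<inter> fst c)"
    using assms(2) by (metis inf_commute openin_open_Int)
  from homeomorphism_imp_open_map[OF chart_homeomorphism[OF assms(1)] this] show ?thesis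
    using open_chart_image[OF assms(1)] openin_open_trans by blast
qed

lemma open_image': "c \<in> atlas M \<Longrightarrow> open U \<Longrightarrow> U \<subseteq> fst c \<Longrightarrow> open (snd c ` U)"
  using open_image[of c U] by (simp add: Int_absorb2)

lemma open_overlap: "c \<in> atlas M \<Longrightarrow> c' \<in> atlas M \<Longrightarrow> open (snd c ` (fst c \<inter> fst c'))"
  using open_image[of c "fst c'"] open_chart by (simp add: Int_commute)

lemma chart_at_atlas [simp]: "chart_at M q \<in> atlas M"
  and chart_at_dom [simp]: "q \<in> fst (chart_at M q)"
proof -
  have "\<exists>c. c \<in> atlas M \<and> q \<in> fst c"
    using atlas unfolding smooth_atlas_def by blast
  from someI_ex[OF this] show "chart_at M q \<in> atlas M" "q \<in> fst (chart_at M q)"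
    by (simp_all add: chart_at_def)
qed

lemma trans_chart [simp]: "c \<in> atlas M \<Longrightarrow> q \<in> fst c \<Longrightarrow> transition c c' (snd c q) = snd c' q"
  by (simp add: transition_def)

lemma smooth_trans: "c \<in> atlas M \<Longrightarrow> c' \<in> atlas M \<Longrightarrow> smooth_on (snd c ` (fst c \<inter> fst c')) (transition c c')"
  using atlas unfolding transition_def smooth_atlas_def by blast

lemma trans_has_derivative:
  "c \<in> atlas M \<Longrightarrow> c' \<in> atlas M \<Longrightarrow> q \<in> fst c \<Longrightarrow> q \<in> fst c' \<Longrightarrow>
    (transition c c' has_derivative jac c c' (snd c q)) (at (snd c q))"
  unfolding jac_def by (rule smooth_on_has_derivative[OF smooth_trans]) auto

lemma linear_jac:
  "c \<in> atlas M \<Longrightarrow> c' \<in> atlas M \<Longrightarrow> q \<in> fst c \<Longrightarrow> q \<in> fst c' \<Longrightarrow> linear (jac c c' (snd c q))"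
  using trans_has_derivative has_derivative_linear by blast

lemma smooth_jac:
  "c \<in> atlas M \<Longrightarrow> c' \<in> atlas M \<Longrightarrow> smooth_on (snd c ` (fst c \<inter> fst c')) (\<lambda>x. jac c c' x w)"
  unfolding jac_def by (rule smooth_on_frechet[OF smooth_trans])

text \<open>Chain rule for transition maps. Since \<open>vcoord\<close> and \<open>vfrom\<close> are
  the Jacobians to and from the chart selected at the point, the conversion rules below are
  instances of it.\<close>

lemma jac_jac:
  assumes c: "c \<in> atlas M" "c' \<in> atlas M" "c'' \<in> atlas M" and q: "q \<in> fst c" "q \<in> fst c'" "q \<in> fst c''"
  shows "jac c' c'' (snd c' q) (jac c c' (snd c q) w) = jac c c'' (snd c q) w"
proof -
  have "(transition c' c'' has_derivative jac c' c'' (snd c' q)) (at (transition c c' (snd c q)))"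
    using trans_has_derivative[OF c(2,3) q(2,3)] c q by simp
  from has_derivative_compose[OF trans_has_derivative[OF c(1,2) q(1,2)] this]
  have "((\<lambda>x. transition c' c'' (transition c c' x)) has_derivative
      (\<lambda>w. jac c' c'' (snd c' q) (jac c c' (snd c q) w))) (at (snd c q))" .
  then have "(transition c c'' has_derivative (\<lambda>w. jac c' c'' (snd c' q) (jac c c' (snd c q) w))) (at (snd c q))"
    by (rule has_derivative_transform_within_open[OF _ open_overlap[OF c(1,2)]]) (use c q in auto)
  from fun_cong[OF frechet_derivative_at[OF this], of w] show ?thesis
    by (simp add: jac_def)
qed

lemma jac_self:
  assumes c: "c \<in> atlas M" and q: "q \<in> fst c"
  shows "jac c c (snd c q) w = w"
proof -
  have "(transition c c has_derivative (\<lambda>w. w)) (at (snd c q))"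
    by (rule has_derivative_transform_within_open[OF has_derivative_ident open_chart_image[OF c]])
      (use c q in auto)
  from fun_cong[OF frechet_derivative_at[OF this], of w] show ?thesis
    by (simp add: jac_def)
qed

lemma vcoord_eq: "vcoord M c q = jac (chart_at M q) c (snd (chart_at M q) q)"
  by (simp add: vcoord_def jac_def transition_def[abs_def])

lemma vfrom_eq: "vfrom M c q = jac c (chart_at M q) (snd c q)"
  by (simp add: vfrom_def jac_def transition_def[abs_def])

lemma linear_vcoord: "c \<in> atlas M \<Longrightarrow> q \<in> fst c \<Longrightarrow> linear (vcoord M c q)"
  unfolding vcoord_eq by (rule linear_jac) auto

lemma linear_vfrom: "c \<in> atlas M \<Longrightarrow> q \<in> fst c \<Longrightarrow> linear (vfrom M c q)"
  unfolding vfrom_eq by (rule linear_jac) auto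

lemma vcoord_vfrom:
  "c \<in> atlas M \<Longrightarrow> c' \<in> atlas M \<Longrightarrow> q \<in> fst c \<Longrightarrow> q \<in> fst c' \<Longrightarrow>
    vcoord M c' q (vfrom M c q w) = jac c c' (snd c q) w"
  unfolding vcoord_eq vfrom_eq by (rule jac_jac) auto

lemma vcoord_vfrom_self [simp]: "c \<in> atlas M \<Longrightarrow> q \<in> fst c \<Longrightarrow> vcoord M c q (vfrom M c q w) = w"
  by (simp add: vcoord_vfrom jac_self)

lemma vfrom_vcoord [simp]: "c \<in> atlas M \<Longrightarrow> q \<in> fst c \<Longrightarrow> vfrom M c q (vcoord M c q v) = v"
  unfolding vcoord_eq vfrom_eq by (subst jac_jac) (auto intro: jac_self)

lemma jac_vcoord:
  "c \<in> atlas M \<Longrightarrow> c' \<in> atlas M \<Longrightarrow> q \<in> fst c \<Longrightarrow> q \<in> fst c' \<Longrightarrow>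
    jac c c' (snd c q) (vcoord M c q v) = vcoord M c' q v"
  unfolding vcoord_eq by (rule jac_jac) auto

lemma vfrom_jac:
  "c \<in> atlas M \<Longrightarrow> c' \<in> atlas M \<Longrightarrow> q \<in> fst c \<Longrightarrow> q \<in> fst c' \<Longrightarrow>
    vfrom M c' q (jac c c' (snd c q) w) = vfrom M c q w"
  unfolding vfrom_eq by (rule jac_jac) auto

lemma vcoord_chart_at [simp]: "vcoord M (chart_at M q) q v = v"
  unfolding vcoord_eq by (rule jac_self) auto

lemma vfrom_chart_at [simp]: "vfrom M (chart_at M q) q v = v"
  unfolding vfrom_eq by (rule jac_self) auto

lemma vcoord_eq_iff:
  "c \<in> atlas M \<Longrightarrow> q \<in> fst c \<Longrightarrow> vcoord M c q v = vcoord M c q w \<longleftrightarrow> v = w"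
  by (metis vfrom_vcoord)


section \<open>Smooth functions and vector fields in a chart\<close>

lemma trans_maps:
  assumes "c \<in> atlas M" "c' \<in> atlas M" "U \<subseteq> fst c"
  shows "transition c' c ` (snd c' ` (U \<inter> fst c')) \<subseteq> snd c ` U"
  using assms by auto

lemma smooth_fun_chart:
  assumes c: "c \<in> atlas M" and U: "open U" "U \<subseteq> fst c"
    and f: "smooth_on (snd c ` U) (\<lambda>x. f (chart_inv c x))"
  shows "smooth_fun M U f"
  unfolding smooth_fun_def
proof
  fix c' assume c': "c' \<in> atlas M"
  note o = open_image[OF c' U(1)]
  have "smooth_on (snd c' ` (U \<inter> fst c')) (\<lambda>x. f (chart_inv c (transition c' c x)))"
    by (rule smooth_on_compose[OF f smooth_on_subset[OF smooth_trans[OF c' c]] o open_image'[OF c U] trans_maps[OF c c' U(2)]])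
      (use U in auto)
  then show "smooth_on (snd c' ` (U \<inter> fst c')) (\<lambda>x. f (chart_inv c' x))"
    by (rule smooth_on_cong[OF o, THEN iffD1, rotated 1]) (use c c' U in auto)
qed

lemma smooth_fun_chartD:
  "smooth_fun M U f \<Longrightarrow> c \<in> atlas M \<Longrightarrow> smooth_on (snd c ` (U \<inter> fst c)) (\<lambda>x. f (chart_inv c x))"
  by (simp add: smooth_fun_def)

text \<open>Smoothness is defined through all charts; one chart containing \<open>U\<close>
  suffices, because the components in another chart arise by a Jacobian that varies
  smoothly.\<close>

lemma smooth_vf_chart:
  assumes c: "c \<in> atlas M" and U: "open U" "U \<subseteq> fst c"
    and X: "smooth_on (snd c ` U) (vf_coord M c X)"
  shows "smooth_vf M U X"
  unfolding smooth_vf_def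
proof
  fix c' assume c': "c' \<in> atlas M"
  note o = open_image[OF c' U(1)]
  note st = smooth_on_subset[OF smooth_trans[OF c' c], of "snd c' ` (U \<inter> fst c')"]
  have st: "smooth_on (snd c' ` (U \<inter> fst c')) (transition c' c)"
    by (rule st) (use U in auto)
  note comp = smooth_on_compose[OF _ st o open_image'[OF c U] trans_maps[OF c c' U(2)]]
  have s1: "smooth_on (snd c' ` (U \<inter> fst c')) (\<lambda>x. vf_coord M c X (transition c' c x))"
    by (rule comp[OF X])
  have s2: "smooth_on (snd c' ` (U \<inter> fst c')) (\<lambda>x. jac c c' (transition c' c x) b)" for b
    by (rule smooth_on_compose[OF smooth_jac[OF c c'] st o open_overlap[OF c c']])
      (use c c' U in auto)
  have "smooth_on (snd c' ` (U \<inter> fst c')) (\<lambda>x. jac c c' (transition c' c x) (vf_coord M c X (transition c' c x)))"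
  proof (rule smooth_on_linear_apply[OF o _ s2 s1])
    fix x assume "x \<in> snd c' ` (U \<inter> fst c')"
    then obtain q where "q \<in> U" "q \<in> fst c'" "x = snd c' q" by blast
    then show "linear (jac c c' (transition c' c x))"
      using c c' U linear_jac[of c c' q] by auto
  qed
  then show "smooth_on (snd c' ` (U \<inter> fst c')) (vf_coord M c' X)"
    by (rule smooth_on_cong[OF o, THEN iffD1, rotated 1])
      (use c c' U in \<open>auto simp: vf_coord_def jac_vcoord subset_iff\<close>)
qed

lemma smooth_vf_chartD:
  "smooth_vf M U X \<Longrightarrow> c \<in> atlas M \<Longrightarrow> smooth_on (snd c ` (U \<inter> fst c)) (vf_coord M c X)"
  by (simp add: smooth_vf_def)

lemma smooth_vf_subset: "smooth_vf M U X \<Longrightarrow> V \<subseteq> U \<Longrightarrow> smooth_vf M V X"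
  unfolding smooth_vf_def by (meson Int_mono image_mono order_refl smooth_on_subset)

lemma smooth_vf_cong:
  assumes "open U" "\<And>x. x \<in> U \<Longrightarrow> X x = Y x" "smooth_vf M U X"
  shows "smooth_vf M U Y"
  unfolding smooth_vf_def
proof
  fix c assume c: "c \<in> atlas M"
  show "smooth_on (snd c ` (U \<inter> fst c)) (vf_coord M c Y)"
    by (rule smooth_on_cong[OF open_image[OF c assms(1)], THEN iffD1, OF _ smooth_vf_chartD[OF assms(3) c]])
      (use assms(2) c in \<open>auto simp: vf_coord_def\<close>)
qed

text \<open>Inverse to \<open>vf_coord\<close>: makes a vector field on the manifold from a
  component function in the chart c, so that families constructed in coordinates can be fed to a
  connection.\<close>

definition vfld :: "('m, 'e) chart \<Rightarrow> ('e \<Rightarrow> 'e) \<Rightarrow> 'm \<Rightarrow> 'e" where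
  "vfld c Y q = vfrom M c q (Y (snd c q))"

lemma smooth_vfld:
  assumes c: "c \<in> atlas M" and U: "open U" "U \<subseteq> fst c" and Y: "smooth_on (snd c ` U) Y"
  shows "smooth_vf M U (vfld c Y)"
proof (rule smooth_vf_chart[OF c U])
  show "smooth_on (snd c ` U) (vf_coord M c (vfld c Y))"
    by (rule smooth_on_cong[OF open_image'[OF c U], THEN iffD1, OF _ Y])
      (use U c in \<open>auto simp: vf_coord_def vfld_def subset_iff\<close>)
qed

lemma const_field_eq: "const_field M c w = vfld c (\<lambda>_. w)"
  by (rule ext) (simp add: const_field_def vfld_def)

lemma const_field_at: "const_field M c w q = vfrom M c q w"
  by (simp add: const_field_def)

lemma smooth_const_field: "c \<in> atlas M \<Longrightarrow> smooth_vf M (fst c) (const_field M c w)"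
  unfolding const_field_eq by (intro smooth_vfld open_chart smooth_on_const) auto

lemma dfun_chart:
  assumes f: "smooth_fun M U f" and U: "open U" "q \<in> U" and c: "c \<in> atlas M" "q \<in> fst c"
  shows "dfun M f q v = frechet_derivative (\<lambda>x. f (chart_inv c x)) (at (snd c q)) (vcoord M c q v)"
proof -
  let ?c = "chart_at M q"
  have d: "((\<lambda>x. f (chart_inv c x)) has_derivative
      frechet_derivative (\<lambda>x. f (chart_inv c x)) (at (snd c q))) (at (transition ?c c (snd ?c q)))"
    using smooth_on_has_derivative[OF smooth_fun_chartD[OF f c(1)], of "snd c q"] U c by auto
  have "((\<lambda>x. f (chart_inv c (transition ?c c x))) has_derivative
      (\<lambda>v. frechet_derivative (\<lambda>x. f (chart_inv c x)) (at (snd c q)) (jac ?c c (snd ?c q) v))) (at (snd ?c q))"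
    by (rule has_derivative_compose[OF trans_has_derivative d]) (use c in auto)
  then have "((\<lambda>x. f (chart_inv ?c x)) has_derivative
      (\<lambda>v. frechet_derivative (\<lambda>x. f (chart_inv c x)) (at (snd c q)) (jac ?c c (snd ?c q) v))) (at (snd ?c q))"
    by (rule has_derivative_transform_within_open[OF _ open_overlap[of ?c c]]) (use c in auto)
  from fun_cong[OF frechet_derivative_at[OF this], of v] show ?thesis
    by (simp add: dfun_def vcoord_eq)
qed

end

section \<open>Connections in a chart\<close>

locale manifold_connection = manifold M
  for M :: "('m::{second_countable_topology,t2_space}, 'e::euclidean_space) subriem" +
  fixes nabla :: "('m, 'e) conn"
  assumes connection: "is_connection M nabla"
begin

lemma nabla_axioms:
  assumes "open U" "q \<in> U" "smooth_vf M U Y"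
  shows "linear (\<lambda>v. nabla q v Y)"
    and "\<forall>Z v. smooth_vf M U Z \<longrightarrow> nabla q v (\<lambda>x. Y x + Z x) = nabla q v Y + nabla q v Z"
    and "\<forall>f v. smooth_fun M U f \<longrightarrow>
      nabla q v (\<lambda>x. f x *\<^sub>R Y x) = dfun M f q v *\<^sub>R Y q + f q *\<^sub>R nabla q v Y"
    and "\<forall>Z v. (\<forall>x\<in>U. Z x = Y x) \<longrightarrow> nabla q v Z = nabla q v Y"
  using conjunct1[OF spec[OF connection[unfolded is_connection_def], THEN mp, OF assms(1)],
      THEN bspec, OF assms(2), THEN spec, THEN mp, OF assms(3)]
  by blast+

lemmas nabla_linear = nabla_axioms(1)

lemma nabla_add:
  "open U \<Longrightarrow> q \<in> U \<Longrightarrow> smooth_vf M U Y \<Longrightarrow> smooth_vf M U Z \<Longrightarrow>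
    nabla q v (\<lambda>x. Y x + Z x) = nabla q v Y + nabla q v Z"
  by (rule nabla_axioms(2)[rule_format])

lemma nabla_scale:
  "open U \<Longrightarrow> q \<in> U \<Longrightarrow> smooth_vf M U Y \<Longrightarrow> smooth_fun M U f \<Longrightarrow>
    nabla q v (\<lambda>x. f x *\<^sub>R Y x) = dfun M f q v *\<^sub>R Y q + f q *\<^sub>R nabla q v Y"
  by (rule nabla_axioms(3)[rule_format])

lemma nabla_cong:
  "open U \<Longrightarrow> q \<in> U \<Longrightarrow> smooth_vf M U Y \<Longrightarrow> (\<And>x. x \<in> U \<Longrightarrow> Z x = Y x) \<Longrightarrow> nabla q v Z = nabla q v Y"
  by (rule nabla_axioms(4)[rule_format]) auto

lemma nabla_smooth:
  assumes "open U" "smooth_vf M U X" "smooth_vf M U Y"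
  shows "smooth_vf M U (\<lambda>q. nabla q (X q) Y)"
  using conjunct2[OF spec[OF connection[unfolded is_connection_def], THEN mp, OF assms(1)]] assms(2,3)
  by (elim allE impE) (rule conjI)

text \<open>The Christoffel symbols of the chart c at x as a bilinear map on components:
  \<open>a\<close> is the direction, \<open>w\<close> the constant components of the differentiated
  field.\<close>

definition Gam :: "('m, 'e) chart \<Rightarrow> 'e \<Rightarrow> 'e \<Rightarrow> 'e \<Rightarrow> 'e" where
  "Gam c x a w = (let q = chart_inv c x in vcoord M c q (nabla q (vfrom M c q a) (const_field M c w)))"

lemma vcoord_nabla_const_field:
  "c \<in> atlas M \<Longrightarrow> q \<in> fst c \<Longrightarrow>
    vcoord M c q (nabla q v (const_field M c w)) = Gam c (snd c q) (vcoord M c q v) w"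
  by (simp add: Gam_def)

lemma Gam_linear_left:
  assumes "c \<in> atlas M" "x \<in> snd c ` fst c"
  shows "linear (\<lambda>a. Gam c x a w)"
proof -
  have q: "chart_inv c x \<in> fst c" using assms by auto
  have "linear (\<lambda>v. nabla (chart_inv c x) v (const_field M c w))"
    by (rule nabla_linear[OF open_chart[OF assms(1)] q smooth_const_field[OF assms(1)]])
  from linear_compose[OF linear_compose[OF linear_vfrom[OF assms(1) q] this] linear_vcoord[OF assms(1) q]]
  show ?thesis by (simp add: Gam_def Let_def o_def)
qed

lemma nabla_zero: "nabla q v (\<lambda>_. 0) = 0"
proof -
  have "smooth_vf M UNIV (\<lambda>_. 0)"
    unfolding smooth_vf_def
  proof
    fix c assume c: "c \<in> atlas M"
    show "smooth_on (snd c ` (UNIV \<inter> fst c)) (vf_coord M c (\<lambda>_. 0))"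
      by (rule smooth_on_cong[OF open_image[OF c], THEN iffD1, OF _ _ smooth_on_const[of _ 0]])
        (use c linear_0[OF linear_vcoord[OF c]] in \<open>auto simp: vf_coord_def\<close>)
  qed
  from nabla_add[OF open_UNIV UNIV_I this this, of q v] show ?thesis by simp
qed

lemma smooth_fun_const: "open U \<Longrightarrow> smooth_fun M U (\<lambda>_. r)"
  by (simp add: smooth_fun_def smooth_on_const)

lemma dfun_const: "dfun M (\<lambda>_. r) q v = 0"
  by (simp add: dfun_def)

lemma Gam_linear_right:
  assumes "c \<in> atlas M" "x \<in> snd c ` fst c"
  shows "linear (Gam c x a)"
proof -
  let ?q = "chart_inv c x"
  have q: "?q \<in> fst c" using assms by auto
  note lin = linear_vcoord[OF assms(1) q] and o = open_chart[OF assms(1)]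
  note s = smooth_const_field[OF assms(1)]
  show ?thesis
  proof (rule linearI)
    fix w w'
    let ?v = "vfrom M c ?q a"
    have "nabla ?q ?v (const_field M c (w + w')) = nabla ?q ?v (\<lambda>p. const_field M c w p + const_field M c w' p)"
      by (rule nabla_cong[OF o q s, symmetric])
        (simp add: const_field_def linear_add[OF linear_vfrom[OF assms(1)]])
    then show "Gam c x a (w + w') = Gam c x a w + Gam c x a w'"
      by (simp add: Gam_def Let_def nabla_add[OF o q s s] linear_add[OF lin])
  next
    fix r w
    let ?v = "vfrom M c ?q a"
    have "nabla ?q ?v (const_field M c (r *\<^sub>R w)) = nabla ?q ?v (\<lambda>p. r *\<^sub>R const_field M c w p)"
      by (rule nabla_cong[OF o q s, symmetric])
        (simp add: const_field_def linear_cmul[OF linear_vfrom[OF assms(1)]])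
    then show "Gam c x a (r *\<^sub>R w) = r *\<^sub>R Gam c x a w"
      by (simp add: Gam_def Let_def nabla_scale[OF o q s smooth_fun_const[OF o]] dfun_const linear_cmul[OF lin])
  qed
qed

lemma smooth_Gam:
  assumes "c \<in> atlas M"
  shows "smooth_on (snd c ` fst c) (\<lambda>x. Gam c x a w)"
proof -
  have "smooth_vf M (fst c) (\<lambda>q. nabla q (const_field M c a q) (const_field M c w))"
    using assms by (intro nabla_smooth open_chart smooth_const_field)
  from smooth_vf_chartD[OF this assms]
  have "smooth_on (snd c ` fst c) (vf_coord M c (\<lambda>q. nabla q (const_field M c a q) (const_field M c w)))"
    by simp
  moreover have "vf_coord M c (\<lambda>q. nabla q (const_field M c a q) (const_field M c w)) = (\<lambda>x. Gam c x a w)"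
    by (rule ext) (simp add: vf_coord_def Gam_def const_field_def Let_def)
  ultimately show ?thesis by simp
qed

text \<open>Additivity of a connection is available for smooth summands, and the induction splits
  off one summand at a time; hence the assumption on all partial sums.\<close>

lemma nabla_sum:
  assumes "open U" "q \<in> U" "finite S" "\<And>b. b \<in> S \<Longrightarrow> smooth_vf M U (Z b)"
    and "\<And>T. T \<subseteq> S \<Longrightarrow> smooth_vf M U (\<lambda>x. \<Sum>b\<in>T. Z b x)"
  shows "nabla q v (\<lambda>x. \<Sum>b\<in>S. Z b x) = (\<Sum>b\<in>S. nabla q v (Z b))"
  using assms(3,4,5)
proof (induction S rule: finite_induct)
  case empty
  then show ?case by (simp add: nabla_zero)
next
  case (insert b S)
  have "nabla q v (\<lambda>x. Z b x + (\<Sum>b\<in>S. Z b x)) = nabla q v (Z b) + nabla q v (\<lambda>x. \<Sum>b\<in>S. Z b x)"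
    by (rule nabla_add[OF assms(1,2)]) (use insert.prems in blast)+
  moreover have "nabla q v (\<lambda>x. \<Sum>b\<in>S. Z b x) = (\<Sum>b\<in>S. nabla q v (Z b))"
    by (rule insert.IH) (use insert.prems in blast)+
  ultimately show ?case
    using insert.hyps by simp
qed

text \<open>Expanding the component function in fields with constant components reduces the claim to
  the Leibniz rule: the derivatives of the coefficients assemble to the derivative of
  \<open>Y\<close>, the derivatives of the constant fields to the Christoffel term.\<close>

lemma nabla_vfld:
  assumes c: "c \<in> atlas M" and U: "open U" "U \<subseteq> fst c" "q \<in> U" and Y: "smooth_on (snd c ` U) Y"
  shows "vcoord M c q (nabla q v (vfld c Y))
    = frechet_derivative Y (at (snd c q)) (vcoord M c q v) + Gam c (snd c q) (vcoord M c q v) (Y (snd c q))"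
proof -
  have q: "q \<in> fst c" using U by blast
  note lc = linear_vcoord[OF c q]
  have oU: "open (snd c ` U)" by (rule open_image'[OF c U(1,2)])
  have sc: "smooth_on (snd c ` U) (\<lambda>x. Y x \<bullet> b)" for b
    by (intro smooth_on_inner oU Y smooth_on_const)
  have f: "smooth_fun M U (\<lambda>p. Y (snd c p) \<bullet> b)" for b
    by (rule smooth_fun_chart[OF c U(1,2)], rule smooth_on_cong[OF oU, THEN iffD1, OF _ sc])
      (use c U in \<open>auto simp: subset_iff\<close>)
  have s: "smooth_vf M U (const_field M c b)" for b
    using smooth_vf_subset[OF smooth_const_field[OF c] U(2)] .
  have scf: "(Y (snd c p) \<bullet> b) *\<^sub>R const_field M c b p = vfld c (\<lambda>x. (Y x \<bullet> b) *\<^sub>R b) p" if "p \<in> U" for b p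
    using that U c by (simp add: const_field_def vfld_def linear_cmul[OF linear_vfrom] subset_iff)
  have sT: "smooth_vf M U (\<lambda>p. \<Sum>b\<in>T. (Y (snd c p) \<bullet> b) *\<^sub>R const_field M c b p)" for T
  proof (rule smooth_vf_cong[OF U(1)])
    show "smooth_vf M U (vfld c (\<lambda>x. \<Sum>b\<in>T. (Y x \<bullet> b) *\<^sub>R b))"
      by (intro smooth_vfld c U smooth_on_sum smooth_on_scaleR sc oU smooth_on_const)
    show "vfld c (\<lambda>x. \<Sum>b\<in>T. (Y x \<bullet> b) *\<^sub>R b) p = (\<Sum>b\<in>T. (Y (snd c p) \<bullet> b) *\<^sub>R const_field M c b p)" if "p \<in> U" for p
      using that U c by (simp add: const_field_def vfld_def linear_sum[OF linear_vfrom] linear_cmul[OF linear_vfrom] subset_iff)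
  qed
  have "nabla q v (vfld c Y) = nabla q v (\<lambda>p. \<Sum>b\<in>Basis. (Y (snd c p) \<bullet> b) *\<^sub>R const_field M c b p)"
  proof (rule nabla_cong[OF U(1,3) sT])
    fix p assume "p \<in> U"
    then have p: "p \<in> fst c" using U by blast
    show "vfld c Y p = (\<Sum>b\<in>Basis. (Y (snd c p) \<bullet> b) *\<^sub>R const_field M c b p)"
      unfolding vfld_def const_field_def by (rule linear_euclidean_sum[OF linear_vfrom[OF c p]])
  qed
  also have "\<dots> = (\<Sum>b\<in>Basis. nabla q v (\<lambda>p. (Y (snd c p) \<bullet> b) *\<^sub>R const_field M c b p))"
  proof (rule nabla_sum[OF U(1,3)])
    show "smooth_vf M U (\<lambda>p. (Y (snd c p) \<bullet> b) *\<^sub>R const_field M c b p)" for b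
      using sT[of "{b}"] by simp
  qed (use sT in auto)
  also have "\<dots> = (\<Sum>b\<in>Basis. (frechet_derivative Y (at (snd c q)) (vcoord M c q v) \<bullet> b) *\<^sub>R const_field M c b q
      + (Y (snd c q) \<bullet> b) *\<^sub>R nabla q v (const_field M c b))"
  proof (rule sum.cong[OF refl])
    fix b :: 'e
    have "frechet_derivative (\<lambda>x. Y (snd c (chart_inv c x)) \<bullet> b) (at (snd c q))
        = frechet_derivative (\<lambda>x. Y x \<bullet> b) (at (snd c q))"
    proof (rule frechet_derivative_transform_within_open[OF _ oU, symmetric])
      show "(\<lambda>x. Y x \<bullet> b) differentiable at (snd c q)"
        by (rule smooth_on_differentiable[OF sc]) (use U in auto)
    qed (use U c in \<open>auto simp: subset_iff\<close>)
    moreover have "((\<lambda>x. Y x \<bullet> b) has_derivative (\<lambda>h. frechet_derivative Y (at (snd c q)) h \<bullet> b)) (at (snd c q))"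
      by (intro has_derivative_inner_left smooth_on_has_derivative[OF Y]) (use U in auto)
    ultimately have "dfun M (\<lambda>p. Y (snd c p) \<bullet> b) q v = frechet_derivative Y (at (snd c q)) (vcoord M c q v) \<bullet> b"
      using dfun_chart[OF f U(1,3) c q, of b v] frechet_derivative_at by metis
    then show "nabla q v (\<lambda>p. (Y (snd c p) \<bullet> b) *\<^sub>R const_field M c b p)
      = (frechet_derivative Y (at (snd c q)) (vcoord M c q v) \<bullet> b) *\<^sub>R const_field M c b q
      + (Y (snd c q) \<bullet> b) *\<^sub>R nabla q v (const_field M c b)"
      by (simp add: nabla_scale[OF U(1,3) s f])
  qed
  finally have "vcoord M c q (nabla q v (vfld c Y))
    = (\<Sum>b\<in>Basis. (frechet_derivative Y (at (snd c q)) (vcoord M c q v) \<bullet> b) *\<^sub>R b)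
      + (\<Sum>b\<in>Basis. (Y (snd c q) \<bullet> b) *\<^sub>R Gam c (snd c q) (vcoord M c q v) b)"
    using c q by (simp add: linear_sum[OF lc] linear_add[OF lc] linear_cmul[OF lc] sum.distrib
        vcoord_nabla_const_field const_field_at)
  moreover have "(\<Sum>b\<in>Basis. (Y (snd c q) \<bullet> b) *\<^sub>R Gam c (snd c q) (vcoord M c q v) b)
      = Gam c (snd c q) (vcoord M c q v) (Y (snd c q))"
    using q by (intro linear_euclidean_sum[OF Gam_linear_right[OF c], symmetric]) auto
  ultimately show ?thesis
    by (simp add: euclidean_representation)
qed

lemma nabla_chart:
  assumes c: "c \<in> atlas M" "q \<in> fst c" and U: "open U" "q \<in> U" and X: "smooth_vf M U X"
  shows "vcoord M c q (nabla q v X)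
    = frechet_derivative (vf_coord M c X) (at (snd c q)) (vcoord M c q v)
      + Gam c (snd c q) (vcoord M c q v) (vcoord M c q (X q))"
proof -
  let ?V = "U \<inter> fst c"
  have V: "open ?V" "?V \<subseteq> fst c" "q \<in> ?V"
    using U c open_chart[OF c(1)] by auto
  note sX = smooth_vf_chartD[OF X c(1)]
  have "nabla q v X = nabla q v (vfld c (vf_coord M c X))"
    by (rule nabla_cong[OF V(1,3) smooth_vfld[OF c(1) V(1,2) sX]])
      (use c in \<open>auto simp: vfld_def vf_coord_def\<close>)
  then show ?thesis
    using nabla_vfld[OF c(1) V sX, of v] c by (simp add: vf_coord_def)
qed

text \<open>A field with constant components in c is differentiated in both charts. In c' its
  components are the Jacobian applied to \<open>w\<close>, and the derivative of this Jacobian is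
  the inhomogeneous term.\<close>

lemma Gam_transform:
  assumes c: "c \<in> atlas M" "c' \<in> atlas M" and q: "q \<in> fst c" "q \<in> fst c'"
  shows "jac c c' (snd c q) (Gam c (snd c q) a w)
    = frechet_derivative (\<lambda>x. jac c c' x w) (at (snd c q)) a
      + Gam c' (snd c' q) (jac c c' (snd c q) a) (jac c c' (snd c q) w)"
proof -
  let ?x = "snd c q" and ?x' = "snd c' q" and ?J = "jac c c' (snd c q)"
  define v where "v = vfrom M c q a"
  have va: "vcoord M c q v = a" "vcoord M c' q v = ?J a"
    using c q by (simp_all add: v_def vcoord_vfrom)
  have "vcoord M c' q (nabla q v (const_field M c w))
    = frechet_derivative (vf_coord M c' (const_field M c w)) (at ?x') (?J a)
      + Gam c' ?x' (?J a) (?J w)"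
    using nabla_chart[OF c(2) q(2) open_chart[OF c(1)] q(1) smooth_const_field[OF c(1)], of v w] c q
    by (simp add: va const_field_def vcoord_vfrom)
  moreover have "vcoord M c' q (nabla q v (const_field M c w)) = ?J (Gam c ?x a w)"
    using jac_vcoord[OF c q, of "nabla q v (const_field M c w)"] vcoord_nabla_const_field[OF c(1) q(1), of v w]
    by (simp add: va)
  moreover have "frechet_derivative (vf_coord M c' (const_field M c w)) (at ?x') (?J a)
    = frechet_derivative (\<lambda>x. jac c c' x w) (at ?x) a"
  proof -
    have "((\<lambda>x. jac c c' x w) has_derivative frechet_derivative (\<lambda>x. jac c c' x w) (at ?x)) (at (transition c' c ?x'))"
      using smooth_on_has_derivative[OF smooth_jac[OF c], of ?x] c q by auto
    from has_derivative_compose[OF trans_has_derivative[OF c(2,1) q(2,1)] this]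
    have "((\<lambda>x. jac c c' (transition c' c x) w) has_derivative
        (\<lambda>h. frechet_derivative (\<lambda>x. jac c c' x w) (at ?x) (jac c' c ?x' h))) (at ?x')" .
    then have "(vf_coord M c' (const_field M c w) has_derivative
        (\<lambda>h. frechet_derivative (\<lambda>x. jac c c' x w) (at ?x) (jac c' c ?x' h))) (at ?x')"
      by (rule has_derivative_transform_within_open[OF _ open_overlap[OF c(2,1)]])
        (use c q in \<open>auto simp: vf_coord_def const_field_def vcoord_vfrom\<close>)
    from fun_cong[OF frechet_derivative_at[OF this], of "?J a"] show ?thesis
      using jac_jac[OF c c(1) q q(1), of a] by (simp add: jac_self[OF c(1) q(1)])
  qed
  ultimately show ?thesis by simp
qed

lemma ext_eq [simp]: "Defs.ext M q v q = v"
  by (simp add: Defs.ext_def const_field_def)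

section \<open>Torsion in an arbitrary chart\<close>

lemma lie_bracket_ext: "lie_bracket M (Defs.ext M q v) (Defs.ext M q w) q = 0"
proof -
  let ?c = "chart_at M q"
  have "(vf_coord M ?c (Defs.ext M q v) has_derivative (\<lambda>_. 0)) (at (snd ?c q))" for v
    by (rule has_derivative_transform_within_open[OF has_derivative_const open_chart_image[of ?c]])
      (auto simp: vf_coord_def Defs.ext_def const_field_def)
  then have "frechet_derivative (vf_coord M ?c (Defs.ext M q v)) (at (snd ?c q)) = (\<lambda>_. 0)" for v
    using frechet_derivative_at by metis
  then show ?thesis
    by (simp add: lie_bracket_def Let_def)
qed

lemma torsion_chart_at:
  "torsion M nabla q v w
    = Gam (chart_at M q) (snd (chart_at M q) q) v w - Gam (chart_at M q) (snd (chart_at M q) q) w v"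
proof -
  have "Gam (chart_at M q) (snd (chart_at M q) q) v w = nabla q v (Defs.ext M q w)" for v w
    using vcoord_nabla_const_field[of "chart_at M q" q v w] by (simp add: Defs.ext_def)
  then show ?thesis
    by (simp add: torsion_def torsion_vf_def lie_bracket_ext)
qed

text \<open>The inhomogeneous terms of \<open>Gam_transform\<close> are second derivatives of the
  transition map, hence symmetric in the two vectors, and cancel in the antisymmetrization.\<close>

lemma torsion_chart:
  assumes c: "c \<in> atlas M" and q: "q \<in> fst c"
  shows "vcoord M c q (torsion M nabla q v w)
    = Gam c (snd c q) (vcoord M c q v) (vcoord M c q w) - Gam c (snd c q) (vcoord M c q w) (vcoord M c q v)"
proof -
  let ?c = "chart_at M q"
  let ?J = "jac ?c c (snd ?c q)" and ?x = "snd ?c q"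
  note tr = Gam_transform[of ?c c q, OF _ c _ q]
  have lJ: "linear ?J"
    by (rule linear_jac) (use c q in auto)
  have sym: "frechet_derivative (\<lambda>x. jac ?c c x w) (at ?x) v = frechet_derivative (\<lambda>x. jac ?c c x v) (at ?x) w"
    unfolding jac_def
    by (rule symmetric_second_derivative[OF open_overlap[of ?c c] _ smooth_trans]) (use c q in auto)
  have "vcoord M c q (torsion M nabla q v w) = ?J (Gam ?c ?x v w) - ?J (Gam ?c ?x w v)"
    by (simp add: torsion_chart_at linear_diff[OF lJ] vcoord_eq)
  also have "\<dots> = Gam c (snd c q) (?J v) (?J w) - Gam c (snd c q) (?J w) (?J v)"
    using tr[of v w] tr[of w v] sym by simp
  finally show ?thesis
    by (simp add: vcoord_eq)
qed

lemma torsion_antisym: "torsion M nabla q v w = - torsion M nabla q w v"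
  by (simp add: torsion_chart_at)

lemma torsion_linear: "linear (torsion M nabla q v)"
  unfolding torsion_chart_at[abs_def] by (intro linear_compose_sub Gam_linear_left Gam_linear_right) auto

end

section \<open>The distribution and its metric in a chart\<close>

locale subriemannian = manifold M
  for M :: "('m::{second_countable_topology,t2_space}, 'e::euclidean_space) subriem" +
  assumes subbundle: "smooth_subbundle M" and metric: "metric_on_distr M"
begin

lemma local_frame:
  "\<exists>U r Y. open U \<and> q \<in> U \<and> (\<forall>i<r::nat. smooth_vf M U (Y i)) \<and>
     (\<forall>x\<in>U. inj_on (\<lambda>i. Y i x) {..<r} \<and> independent ((\<lambda>i. Y i x) ` {..<r}) \<and>
        distr M x = span ((\<lambda>i. Y i x) ` {..<r}))"
  by (rule spec[OF subbundle[unfolded smooth_subbundle_def]])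

lemma subspace_distr: "subspace (distr M q)"
proof -
  obtain A where "distr M q = span A"
    using local_frame[of q] by (elim exE conjE) blast
  then show ?thesis by simp
qed

lemma metric_axioms:
  assumes "u \<in> distr M q" "v \<in> distr M q"
  shows gmet_sym: "gmet M q u v = gmet M q v u"
    and gmet_add_left: "w \<in> distr M q \<Longrightarrow> gmet M q (u + v) w = gmet M q u w + gmet M q v w"
    and gmet_scale_left: "gmet M q (a *\<^sub>R u) v = a * gmet M q u v"
    and gmet_pos: "u \<noteq> 0 \<Longrightarrow> gmet M q u u > 0"
  using conjunct1[OF metric[unfolded metric_on_distr_def], THEN spec, THEN bspec, OF assms(1), THEN bspec, OF assms(2)]
  by blast+

lemma gmet_smooth:
  "open U \<Longrightarrow> distr_section M U X \<Longrightarrow> distr_section M U Y \<Longrightarrow> smooth_fun M U (\<lambda>q. gmet M q (X q) (Y q))"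
  using conjunct2[OF metric[unfolded metric_on_distr_def]] by blast

lemma gmet_zero_left: "v \<in> distr M q \<Longrightarrow> gmet M q 0 v = 0"
  using gmet_scale_left[of v q v 0] by simp

lemma gmet_diff_left:
  assumes "u \<in> distr M q" "v \<in> distr M q" "w \<in> distr M q"
  shows "gmet M q (u - v) w = gmet M q u w - gmet M q v w"
  using gmet_add_left[of "u - v" q v w] assms subspace_diff[OF subspace_distr] by simp

lemma gmet_sum_left:
  assumes "\<And>i. i \<in> S \<Longrightarrow> u i \<in> distr M q" "v \<in> distr M q"
  shows "gmet M q (\<Sum>i\<in>S. c i *\<^sub>R u i) v = (\<Sum>i\<in>S. c i * gmet M q (u i) v)"
  using assms(1)
proof (induction S rule: infinite_finite_induct)
  case (insert i S)
  have "c i *\<^sub>R u i \<in> distr M q" "(\<Sum>i\<in>S. c i *\<^sub>R u i) \<in> distr M q" "u i \<in> distr M q"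
    using insert.prems by (auto intro!: subspace_sum subspace_scale subspace_distr)
  then show ?case
    using insert assms(2) by (simp add: gmet_add_left gmet_scale_left)
qed (simp_all add: gmet_zero_left[OF assms(2)])

lemma gmet_sum_right:
  assumes "\<And>i. i \<in> S \<Longrightarrow> u i \<in> distr M q" "v \<in> distr M q"
  shows "gmet M q v (\<Sum>i\<in>S. c i *\<^sub>R u i) = (\<Sum>i\<in>S. c i * gmet M q v (u i))"
proof -
  have "(\<Sum>i\<in>S. c i *\<^sub>R u i) \<in> distr M q"
    using assms by (auto intro!: subspace_sum subspace_scale subspace_distr)
  then show ?thesis
    using assms gmet_sum_left[OF assms] by (simp add: gmet_sym[OF assms(2)])
qed

text \<open>The fibre of the distribution in the component space of one fixed chart. The sets
  \<open>distr M q\<close> are expressed in the chart selected at q, so smooth dependence on the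
  point can be formulated only for this version; \<open>Gc\<close> is its metric.\<close>

definition Ec :: "('m, 'e) chart \<Rightarrow> 'e \<Rightarrow> 'e set" where
  "Ec c x = vcoord M c (chart_inv c x) ` distr M (chart_inv c x)"

definition Gc :: "('m, 'e) chart \<Rightarrow> 'e \<Rightarrow> 'e \<Rightarrow> 'e \<Rightarrow> real" where
  "Gc c x a b = gmet M (chart_inv c x) (vfrom M c (chart_inv c x) a) (vfrom M c (chart_inv c x) b)"

lemma Ec_iff: "c \<in> atlas M \<Longrightarrow> q \<in> fst c \<Longrightarrow> vcoord M c q v \<in> Ec c (snd c q) \<longleftrightarrow> v \<in> distr M q"
  by (auto simp: Ec_def vcoord_eq_iff)

lemma Ec_iff': "c \<in> atlas M \<Longrightarrow> q \<in> fst c \<Longrightarrow> w \<in> Ec c (snd c q) \<longleftrightarrow> vfrom M c q w \<in> distr M q"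
  using Ec_iff[of c q "vfrom M c q w"] by simp

lemma Gc_vcoord: "c \<in> atlas M \<Longrightarrow> q \<in> fst c \<Longrightarrow> Gc c (snd c q) (vcoord M c q v) (vcoord M c q w) = gmet M q v w"
  by (simp add: Gc_def)

lemma subspace_Ec: "c \<in> atlas M \<Longrightarrow> x \<in> snd c ` fst c \<Longrightarrow> subspace (Ec c x)"
  unfolding Ec_def by (intro linear_subspace_image linear_vcoord subspace_distr) auto

lemma Gc_axioms:
  assumes c: "c \<in> atlas M" "x \<in> snd c ` fst c" and a: "a \<in> Ec c x" "b \<in> Ec c x"
  shows "Gc c x a b = Gc c x b a"
    "w \<in> Ec c x \<Longrightarrow> Gc c x (a + b) w = Gc c x a w + Gc c x b w"
    "Gc c x (r *\<^sub>R a) b = r * Gc c x a b"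
    "a \<noteq> 0 \<Longrightarrow> Gc c x a a > 0"
proof -
  obtain q where q: "q \<in> fst c" "x = snd c q" using c by blast
  note l = linear_vfrom[OF c(1) q(1)]
  have d: "v \<in> Ec c x \<longleftrightarrow> vfrom M c q v \<in> distr M q" for v
    using Ec_iff' c q by simp
  have G: "Gc c x a b = gmet M q (vfrom M c q a) (vfrom M c q b)" for a b
    using c q by (simp add: Gc_def)
  show "Gc c x a b = Gc c x b a"
    using a unfolding d G by (rule gmet_sym)
  show "w \<in> Ec c x \<Longrightarrow> Gc c x (a + b) w = Gc c x a w + Gc c x b w"
    using a unfolding d G linear_add[OF l] by (intro gmet_add_left)
  show "Gc c x (r *\<^sub>R a) b = r * Gc c x a b"
    using a unfolding d G linear_cmul[OF l] by (rule gmet_scale_left)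
  show "Gc c x a a > 0" if "a \<noteq> 0"
  proof -
    have "vfrom M c q a \<noteq> 0"
      using that vcoord_vfrom_self[OF c(1) q(1), of a] linear_0[OF linear_vcoord[OF c(1) q(1)]] by metis
    then show ?thesis
      using a unfolding d G by (intro gmet_pos)
  qed
qed

text \<open>Smoothness of the metric is given along sections of the distribution; component
  functions with values in \<open>Ec\<close> are converted into such sections by
  \<open>vfld\<close>.\<close>

lemma Gc_smooth:
  assumes c: "c \<in> atlas M" and U: "open U" "U \<subseteq> fst c"
    and f: "smooth_on (snd c ` U) f" "\<And>x. x \<in> snd c ` U \<Longrightarrow> f x \<in> Ec c x"
    and g: "smooth_on (snd c ` U) g" "\<And>x. x \<in> snd c ` U \<Longrightarrow> g x \<in> Ec c x"
  shows "smooth_on (snd c ` U) (\<lambda>x. Gc c x (f x) (g x))"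
proof -
  have "distr_section M U (vfld c h)" if "smooth_on (snd c ` U) h" "\<And>x. x \<in> snd c ` U \<Longrightarrow> h x \<in> Ec c x" for h
    unfolding distr_section_def
  proof (intro conjI ballI)
    show "smooth_vf M U (vfld c h)"
      by (rule smooth_vfld[OF c U that(1)])
    show "vfld c h q \<in> distr M q" if "q \<in> U" for q
      using that U c \<open>\<And>x. x \<in> snd c ` U \<Longrightarrow> h x \<in> Ec c x\<close>[of "snd c q"]
      by (auto simp: vfld_def Ec_iff' subset_iff)
  qed
  from gmet_smooth[OF U(1) this[OF f] this[OF g]]
  have "smooth_on (snd c ` (U \<inter> fst c)) (\<lambda>x. gmet M (chart_inv c x) (vfld c f (chart_inv c x)) (vfld c g (chart_inv c x)))"
    using smooth_fun_chartD c by blast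
  then have "smooth_on (snd c ` U) (\<lambda>x. gmet M (chart_inv c x) (vfld c f (chart_inv c x)) (vfld c g (chart_inv c x)))"
    using U(2) by (simp add: Int_absorb2)
  then show ?thesis
    by (rule smooth_on_cong[OF open_image'[OF c U], THEN iffD1, rotated 1])
      (use U c in \<open>auto simp: Gc_def vfld_def subset_iff\<close>)
qed

lemma chart_frame:
  assumes c: "c \<in> atlas M" and q: "q \<in> fst c"
  shows "\<exists>U r y. open U \<and> q \<in> U \<and> U \<subseteq> fst c \<and> (\<forall>i<r::nat. smooth_on (snd c ` U) (y i)) \<and>
    (\<forall>x\<in>snd c ` U. inj_on (\<lambda>i. y i x) {..<r} \<and> independent ((\<lambda>i. y i x) ` {..<r}) \<and>
      Ec c x = span ((\<lambda>i. y i x) ` {..<r}))"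
proof -
  obtain U0 r Y where *: "open U0 \<and> q \<in> U0 \<and> (\<forall>i<r::nat. smooth_vf M U0 (Y i)) \<and>
     (\<forall>x\<in>U0. inj_on (\<lambda>i. Y i x) {..<r} \<and> independent ((\<lambda>i. Y i x) ` {..<r}) \<and>
        distr M x = span ((\<lambda>i. Y i x) ` {..<r}))"
    using local_frame[of q] by (elim exE) (rule that)
  have U0: "open U0" "q \<in> U0" and Y: "\<And>i. i < (r::nat) \<Longrightarrow> smooth_vf M U0 (Y i)"
    "\<And>x. x \<in> U0 \<Longrightarrow> inj_on (\<lambda>i. Y i x) {..<r}" "\<And>x. x \<in> U0 \<Longrightarrow> independent ((\<lambda>i. Y i x) ` {..<r})"
    "\<And>x. x \<in> U0 \<Longrightarrow> distr M x = span ((\<lambda>i. Y i x) ` {..<r})"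
    using * by simp_all
  let ?U = "U0 \<inter> fst c"
  show ?thesis
  proof (intro exI[of _ ?U] exI[of _ r] exI[of _ "\<lambda>i. vf_coord M c (Y i)"] conjI allI impI ballI)
    show "open ?U" using U0 open_chart[OF c] by auto
    show "q \<in> ?U" "?U \<subseteq> fst c" using U0 q by auto
    show "smooth_on (snd c ` ?U) (vf_coord M c (Y i))" if "i < r" for i
      by (rule smooth_vf_chartD[OF Y(1)[OF that] c])
    fix x assume "x \<in> snd c ` ?U"
    then obtain p where p: "p \<in> U0" "p \<in> fst c" "x = snd c p" by blast
    have inj: "inj (vcoord M c p)"
      using vcoord_eq_iff[OF c p(2)] by (auto intro: injI)
    note l = linear_vcoord[OF c p(2)]
    have e: "vf_coord M c (Y i) x = vcoord M c p (Y i p)" for i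
      using c p by (simp add: vf_coord_def)
    show "inj_on (\<lambda>i. vf_coord M c (Y i) x) {..<r}"
      unfolding e using Y(2)[OF p(1)] inj by (auto simp: inj_on_def)
    have im: "(\<lambda>i. vf_coord M c (Y i) x) ` {..<r} = vcoord M c p ` ((\<lambda>i. Y i p) ` {..<r})"
      unfolding e by (simp add: image_image)
    show "independent ((\<lambda>i. vf_coord M c (Y i) x) ` {..<r})"
      unfolding im by (rule linear_independent_injective_image[OF l Y(3)[OF p(1)]]) (use inj inj_on_subset in blast)
    show "Ec c x = span ((\<lambda>i. vf_coord M c (Y i) x) ` {..<r})"
      unfolding im linear_span_image[OF l] using c p Y(4)[OF p(1)] by (simp add: Ec_def)
  qed
qed

text \<open>The product \<open>G\<close> is a parameter because two are needed: the Euclidean one of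
  the chart yields projections onto the distribution, the metric \<open>Gc\<close> yields a formula
  for the sharp operator.\<close>

definition orth_frame :: "('m, 'e) chart \<Rightarrow> ('e \<Rightarrow> 'e \<Rightarrow> 'e \<Rightarrow> real) \<Rightarrow> 'm \<Rightarrow> 'm set \<Rightarrow> nat \<Rightarrow> (nat \<Rightarrow> 'e \<Rightarrow> 'e) \<Rightarrow> bool" where
  "orth_frame c G q U r z \<longleftrightarrow> open U \<and> q \<in> U \<and> U \<subseteq> fst c \<and> (\<forall>i<r. smooth_on (snd c ` U) (z i)) \<and>
     (\<forall>x\<in>snd c ` U. Ec c x = span ((\<lambda>i. z i x) ` {..<r}) \<and> (\<forall>i<r. z i x \<noteq> 0) \<and>
        (\<forall>i<r. \<forall>j<r. i \<noteq> j \<longrightarrow> G x (z i x) (z j x) = 0))"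

lemma orth_frameD:
  assumes "orth_frame c G q U r z"
  shows "open U" "q \<in> U" "U \<subseteq> fst c" "\<And>i. i < r \<Longrightarrow> smooth_on (snd c ` U) (z i)"
    "\<And>x. x \<in> snd c ` U \<Longrightarrow> Ec c x = span ((\<lambda>i. z i x) ` {..<r})"
    "\<And>x i. x \<in> snd c ` U \<Longrightarrow> i < r \<Longrightarrow> z i x \<noteq> 0"
    "\<And>x i j. x \<in> snd c ` U \<Longrightarrow> i < r \<Longrightarrow> j < r \<Longrightarrow> i \<noteq> j \<Longrightarrow> G x (z i x) (z j x) = 0"
  using assms unfolding orth_frame_def by blast+

lemma orthogonal_frame:
  assumes c: "c \<in> atlas M" and q: "q \<in> fst c"
    and G: "\<And>x u v. x \<in> snd c ` fst c \<Longrightarrow> u \<in> Ec c x \<Longrightarrow> v \<in> Ec c x \<Longrightarrow> G x u v = G x v u"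
      "\<And>x u v w. x \<in> snd c ` fst c \<Longrightarrow> u \<in> Ec c x \<Longrightarrow> v \<in> Ec c x \<Longrightarrow> w \<in> Ec c x \<Longrightarrow> G x (u + v) w = G x u w + G x v w"
      "\<And>x u v a. x \<in> snd c ` fst c \<Longrightarrow> u \<in> Ec c x \<Longrightarrow> v \<in> Ec c x \<Longrightarrow> G x (a *\<^sub>R u) v = a * G x u v"
      "\<And>x u. x \<in> snd c ` fst c \<Longrightarrow> u \<in> Ec c x \<Longrightarrow> u \<noteq> 0 \<Longrightarrow> G x u u > (0::real)"
      "\<And>U f g. open U \<Longrightarrow> U \<subseteq> fst c \<Longrightarrow> smooth_on (snd c ` U) f \<Longrightarrow> smooth_on (snd c ` U) g \<Longrightarrow>
         (\<And>x. x \<in> snd c ` U \<Longrightarrow> f x \<in> Ec c x) \<Longrightarrow> (\<And>x. x \<in> snd c ` U \<Longrightarrow> g x \<in> Ec c x)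
         \<Longrightarrow> smooth_on (snd c ` U) (\<lambda>x. G x (f x) (g x))"
  obtains U r z where "orth_frame c G q U r z"
proof -
  obtain U r y where *: "open U \<and> q \<in> U \<and> U \<subseteq> fst c \<and> (\<forall>i<r::nat. smooth_on (snd c ` U) (y i)) \<and>
    (\<forall>x\<in>snd c ` U. inj_on (\<lambda>i. y i x) {..<r} \<and> independent ((\<lambda>i. y i x) ` {..<r}) \<and>
      Ec c x = span ((\<lambda>i. y i x) ` {..<r}))"
    using chart_frame[OF c q] by (elim exE) (rule that)
  have U: "open U" "q \<in> U" "U \<subseteq> fst c" and y: "\<And>i. i < (r::nat) \<Longrightarrow> smooth_on (snd c ` U) (y i)"
    "\<And>x. x \<in> snd c ` U \<Longrightarrow> inj_on (\<lambda>i. y i x) {..<r}"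
    "\<And>x. x \<in> snd c ` U \<Longrightarrow> independent ((\<lambda>i. y i x) ` {..<r})"
    "\<And>x. x \<in> snd c ` U \<Longrightarrow> Ec c x = span ((\<lambda>i. y i x) ` {..<r})"
    using * by blast+
  have sub: "x \<in> snd c ` fst c" if "x \<in> snd c ` U" for x
    using that U by blast
  have "\<exists>z. (\<forall>i<r. smooth_on (snd c ` U) (z i)) \<and>
    (\<forall>x\<in>snd c ` U. span ((\<lambda>i. z i x) ` {..<r}) = span ((\<lambda>i. y i x) ` {..<r}) \<and>
       (\<forall>i<r. z i x \<noteq> 0) \<and> (\<forall>i<r. \<forall>j<r. i \<noteq> j \<longrightarrow> G x (z i x) (z j x) = 0))"
  proof (rule smooth_orthogonalization[where E = "Ec c" and G = G])
    show "open (snd c ` U)" by (rule open_image'[OF c U(1,3)])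
    show "smooth_on (snd c ` U) (y i)" if "i < r" for i
      by (rule y(1)[OF that])
    fix x assume x: "x \<in> snd c ` U"
    show "inj_on (\<lambda>i. y i x) {..<r}" "independent ((\<lambda>i. y i x) ` {..<r})"
      by (rule y(2)[OF x], rule y(3)[OF x])
    show "subspace (Ec c x)"
      by (rule subspace_Ec[OF c sub[OF x]])
    show "y i x \<in> Ec c x" if "i < r" for i
      unfolding y(4)[OF x] using that by (intro span_base) auto
    show "G x u v = G x v u" if "u \<in> Ec c x" "v \<in> Ec c x" for u v
      by (rule G(1)[OF sub[OF x] that])
    show "G x (u + v) w = G x u w + G x v w" if "u \<in> Ec c x" "v \<in> Ec c x" "w \<in> Ec c x" for u v w
      by (rule G(2)[OF sub[OF x] that])
    show "G x (a *\<^sub>R u) v = a * G x u v" if "u \<in> Ec c x" "v \<in> Ec c x" for u v a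
      by (rule G(3)[OF sub[OF x] that])
    show "G x u u > 0" if "u \<in> Ec c x" "u \<noteq> 0" for u
      by (rule G(4)[OF sub[OF x] that])
  next
    show "smooth_on (snd c ` U) (\<lambda>x. G x (f x) (g x))"
      if "smooth_on (snd c ` U) f" "smooth_on (snd c ` U) g"
        "\<And>x. x \<in> snd c ` U \<Longrightarrow> f x \<in> Ec c x" "\<And>x. x \<in> snd c ` U \<Longrightarrow> g x \<in> Ec c x" for f g
      by (rule G(5)[OF U(1,3) that])
  qed
  then obtain z where z: "(\<forall>i<r. smooth_on (snd c ` U) (z i)) \<and>
    (\<forall>x\<in>snd c ` U. span ((\<lambda>i. z i x) ` {..<r}) = span ((\<lambda>i. y i x) ` {..<r}) \<and>
       (\<forall>i<r. z i x \<noteq> 0) \<and> (\<forall>i<r. \<forall>j<r. i \<noteq> j \<longrightarrow> G x (z i x) (z j x) = 0))"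
    by (elim exE) (rule that)
  show ?thesis
  proof (rule that[of U r z])
    show "orth_frame c G q U r z"
      using z U y(4) by (simp add: orth_frame_def)
  qed
qed

lemma euclidean_frame:
  assumes c: "c \<in> atlas M" and q: "q \<in> fst c"
  obtains U r z where "orth_frame c (\<lambda>_. (\<bullet>)) q U r z"
proof (rule orthogonal_frame[OF c q, where G = "\<lambda>_. (\<bullet>)"])
  show "smooth_on (snd c ` U) (\<lambda>x. f x \<bullet> g x)"
    if "open U" "U \<subseteq> fst c" "smooth_on (snd c ` U) f" "smooth_on (snd c ` U) g" for U and f g :: "'e \<Rightarrow> 'e"
    by (intro smooth_on_inner open_image' c that)
  show "orth_frame c (\<lambda>_. (\<bullet>)) q U r z \<Longrightarrow> thesis" for U r z
    by (rule that)
  show "u \<bullet> v = v \<bullet> u" "(u + v) \<bullet> w = u \<bullet> w + v \<bullet> w" "(a *\<^sub>R u) \<bullet> v = a * (u \<bullet> v)"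
    "u \<noteq> 0 \<Longrightarrow> u \<bullet> u > 0" for u v w :: 'e and a
    by (rule inner_commute) (simp_all add: inner_add_left)
qed

lemma metric_frame:
  assumes c: "c \<in> atlas M" and q: "q \<in> fst c"
  obtains U r z where "orth_frame c (Gc c) q U r z"
proof (rule orthogonal_frame[OF c q, where G = "Gc c"])
  show "smooth_on (snd c ` U) (\<lambda>x. Gc c x (f x) (g x))"
    if "open U" "U \<subseteq> fst c" "smooth_on (snd c ` U) f" "smooth_on (snd c ` U) g"
      "\<And>x. x \<in> snd c ` U \<Longrightarrow> f x \<in> Ec c x" "\<And>x. x \<in> snd c ` U \<Longrightarrow> g x \<in> Ec c x" for U f g
    by (rule Gc_smooth[OF c that(1,2,3,5,4,6)])
  fix x u v assume x: "x \<in> snd c ` fst c" "u \<in> Ec c x"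
  show "Gc c x u u > 0" if "u \<noteq> 0"
    by (rule Gc_axioms(4)[OF c x x(2) that])
  assume v: "v \<in> Ec c x"
  show "Gc c x u v = Gc c x v u"
    by (rule Gc_axioms(1)[OF c x v])
  show "Gc c x (a *\<^sub>R u) v = a * Gc c x u v" for a
    by (rule Gc_axioms(3)[OF c x v])
  show "Gc c x (u + v) w = Gc c x u w + Gc c x v w" if "w \<in> Ec c x" for w
    by (rule Gc_axioms(2)[OF c x v that])
qed (rule that)

text \<open>The metric has no meaning off the distribution, so the projection is orthogonal for the
  Euclidean product of the chart. It characterizes sections \<open>w\<close> by
  \<open>P x w = w\<close>, an equation that can be differentiated, and extends vectors and the
  metric smoothly off a point or fibre.\<close>

lemma euclidean_projection:
  assumes c: "c \<in> atlas M" and q: "q \<in> fst c"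
  obtains U P where "open U" "q \<in> U" "U \<subseteq> fst c"
    "\<And>v. smooth_on (snd c ` U) (\<lambda>x. P x v)" "\<And>x. linear (P x)"
    "\<And>x v. x \<in> snd c ` U \<Longrightarrow> P x v \<in> Ec c x"
    "\<And>x v. x \<in> snd c ` U \<Longrightarrow> v \<in> Ec c x \<Longrightarrow> P x v = v"
proof -
  obtain U r z where f: "orth_frame c (\<lambda>_. (\<bullet>)) q U r z"
    by (rule euclidean_frame[OF c q])
  note U = orth_frameD(1-3)[OF f] and z = orth_frameD(4-7)[OF f]
  note o = open_image'[OF c U(1,3)]
  define P where "P x v = (\<Sum>i<r. ((v \<bullet> z i x) / (z i x \<bullet> z i x)) *\<^sub>R z i x)" for x v
  show ?thesis
  proof (rule that[OF U, of P])
    show "smooth_on (snd c ` U) (\<lambda>x. P x v)" for v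
      unfolding P_def
      by (intro smooth_on_sum smooth_on_scaleR smooth_on_divide smooth_on_inner o smooth_on_const z)
        (use z(3) in auto)
    show "linear (P x)" for x
      unfolding P_def
      by (rule linearI) (simp_all add: inner_add_left add_divide_distrib scaleR_add_left sum.distrib scaleR_sum_right)
    fix x v assume x: "x \<in> snd c ` U"
    show "P x v \<in> Ec c x"
      unfolding z(2)[OF x] P_def by (intro span_sum span_scale span_base) auto
    assume "v \<in> Ec c x"
    then obtain a where a: "v = (\<Sum>j<r. a j *\<^sub>R z j x)"
      unfolding z(2)[OF x] in_span_image_iff[OF finite_lessThan] by blast
    have "v \<bullet> z i x = a i * (z i x \<bullet> z i x)" if i: "i < r" for i
    proof -
      have "v \<bullet> z i x = (\<Sum>j<r. a j * (z j x \<bullet> z i x))"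
        by (simp add: a inner_sum_left)
      also have "\<dots> = (\<Sum>j<r. if j = i then a i * (z i x \<bullet> z i x) else 0)"
        using z(4)[OF x _ i] by (intro sum.cong) auto
      finally show ?thesis using i by simp
    qed
    then have "P x v = (\<Sum>i<r. a i *\<^sub>R z i x)"
      unfolding P_def using z(3)[OF x] by (intro sum.cong) auto
    then show "P x v = v" by (simp add: a)
  qed
qed


section \<open>The Hamiltonian in canonical coordinates\<close>

text \<open>In an orthogonal basis \<open>z\<close> the sharp of \<open>p\<close> is the sum of
  \<open>p(z_i) / |z_i|^2\<close> times \<open>z_i\<close>. The formula gives existence for the
  definite description in \<open>sharp\<close> and exhibits the dependence on the point; uniqueness
  is definiteness of the metric.\<close>

lemma sharp_frame:
  assumes c: "c \<in> atlas M" and q: "q \<in> fst c" and p: "linear p"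
    and z: "Ec c (snd c q) = span ((\<lambda>i. z i) ` {..<r::nat})" "\<And>i. i < r \<Longrightarrow> z i \<noteq> 0"
    "\<And>i j. i < r \<Longrightarrow> j < r \<Longrightarrow> i \<noteq> j \<Longrightarrow> Gc c (snd c q) (z i) (z j) = 0"
  defines "u \<equiv> vfrom M c q (\<Sum>i<r. (p (vfrom M c q (z i)) / Gc c (snd c q) (z i) (z i)) *\<^sub>R z i)"
  shows "u \<in> distr M q" "\<And>v. v \<in> distr M q \<Longrightarrow> p v = gmet M q u v"
    "\<And>u'. u' \<in> distr M q \<Longrightarrow> (\<And>v. v \<in> distr M q \<Longrightarrow> p v = gmet M q u' v) \<Longrightarrow> u' = u"
proof -
  note l = linear_vfrom[OF c q]
  let ?z = "\<lambda>i. vfrom M c q (z i)"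
  have zi: "z i \<in> Ec c (snd c q)" if "i < r" for i
    unfolding z(1) using that by (intro span_base) auto
  have zE: "?z i \<in> distr M q" if "i < r" for i
    using zi[OF that] c q by (simp add: Ec_iff')
  have G: "Gc c (snd c q) (z i) (z j) = gmet M q (?z i) (?z j)" for i j
    using c q by (simp add: Gc_def)
  have pos: "gmet M q (?z i) (?z i) > 0" if "i < r" for i
    using Gc_axioms(4)[OF c _ zi[OF that] zi[OF that] z(2)[OF that]] q by (simp add: G)
  have u: "u = (\<Sum>i<r. (p (?z i) / gmet M q (?z i) (?z i)) *\<^sub>R ?z i)"
    by (simp add: u_def linear_sum[OF l] linear_cmul[OF l] G)
  show uE: "u \<in> distr M q"
    unfolding u by (intro subspace_sum subspace_scale subspace_distr zE) auto
  show pu: "p v = gmet M q u v" if "v \<in> distr M q" for v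
  proof -
    have "vcoord M c q v \<in> Ec c (snd c q)"
      using that c q by (simp add: Ec_iff)
    then obtain a where "vcoord M c q v = (\<Sum>j<r. a j *\<^sub>R z j)"
      unfolding z(1) in_span_image_iff[OF finite_lessThan] by blast
    then have v: "v = (\<Sum>j<r. a j *\<^sub>R ?z j)"
      using vfrom_vcoord[OF c q, of v] by (simp add: linear_sum[OF l] linear_cmul[OF l])
    have uj: "gmet M q u (?z j) = p (?z j)" if j: "j < r" for j
    proof -
      have "gmet M q u (?z j) = (\<Sum>i<r. (p (?z i) / gmet M q (?z i) (?z i)) * gmet M q (?z i) (?z j))"
        unfolding u by (rule gmet_sum_left) (use zE j in auto)
      also have "\<dots> = (\<Sum>i<r. if i = j then p (?z j) else 0)"
        using z(3)[OF _ j] pos[OF j] by (intro sum.cong) (auto simp: G)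
      finally show ?thesis using j by simp
    qed
    have "gmet M q u v = (\<Sum>j<r. a j * gmet M q u (?z j))"
      unfolding v by (rule gmet_sum_right) (use zE uE in auto)
    also have "\<dots> = (\<Sum>j<r. a j * p (?z j))"
      using uj by (intro sum.cong) auto
    finally show ?thesis
      by (simp add: v linear_sum[OF p] linear_cmul[OF p])
  qed
  show "u' = u" if u': "u' \<in> distr M q" "\<And>v. v \<in> distr M q \<Longrightarrow> p v = gmet M q u' v" for u'
  proof (rule ccontr)
    assume "u' \<noteq> u"
    have d: "u' - u \<in> distr M q"
      by (intro subspace_diff subspace_distr uE u')
    have "gmet M q (u' - u) (u' - u) = 0"
      using gmet_diff_left[OF u'(1) uE d] u'(2)[OF d] pu[OF d] by simp
    then show False
      using gmet_pos[OF d d] \<open>u' \<noteq> u\<close> by simp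
  qed
qed

lemma sharp_frame_eq:
  assumes "c \<in> atlas M" "q \<in> fst c" "linear p"
    and "Ec c (snd c q) = span ((\<lambda>i. z i) ` {..<r::nat})" "\<And>i. i < r \<Longrightarrow> z i \<noteq> 0"
    "\<And>i j. i < r \<Longrightarrow> j < r \<Longrightarrow> i \<noteq> j \<Longrightarrow> Gc c (snd c q) (z i) (z j) = 0"
  shows "sharp M q p = vfrom M c q (\<Sum>i<r. (p (vfrom M c q (z i)) / Gc c (snd c q) (z i) (z i)) *\<^sub>R z i)"
  unfolding sharp_def by (rule the_equality) (use sharp_frame[OF assms] in blast)+

lemma sharp_works:
  assumes "linear p"
  shows sharp_in: "sharp M q p \<in> distr M q"
    and sharp_eq: "\<And>v. v \<in> distr M q \<Longrightarrow> gmet M q (sharp M q p) v = p v"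
    and sharp_unique: "\<And>u. u \<in> distr M q \<Longrightarrow> (\<And>v. v \<in> distr M q \<Longrightarrow> p v = gmet M q u v) \<Longrightarrow> u = sharp M q p"
proof -
  let ?c = "chart_at M q"
  obtain U r z where f: "orth_frame ?c (Gc ?c) q U r z"
    by (rule metric_frame[OF chart_at_atlas chart_at_dom])
  note U = orth_frameD(2,5-7)[OF f]
  have x: "snd ?c q \<in> snd ?c ` U" using U by blast
  note sf = sharp_frame[OF chart_at_atlas chart_at_dom assms U(2)[OF x] U(3)[OF x] U(4)[OF x]]
  have e: "sharp M q p = vfrom M ?c q (\<Sum>i<r. (p (vfrom M ?c q (z i (snd ?c q))) /
      Gc ?c (snd ?c q) (z i (snd ?c q)) (z i (snd ?c q))) *\<^sub>R z i (snd ?c q))"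
    by (rule sharp_frame_eq[OF chart_at_atlas chart_at_dom assms U(2)[OF x] U(3)[OF x] U(4)[OF x]])
  show "sharp M q p \<in> distr M q"
    unfolding e by (rule sf(1))
  show "gmet M q (sharp M q p) v = p v" if "v \<in> distr M q" for v
  proof -
    have "p v = gmet M q (sharp M q p) v"
      unfolding e by (rule sf(2)) (use that in auto)
    then show ?thesis by simp
  qed
  show "u = sharp M q p" if "u \<in> distr M q" "\<And>v. v \<in> distr M q \<Longrightarrow> p v = gmet M q u v" for u
    unfolding e by (rule sf(3)) (use that in auto)
qed

lemma csharp_in: "csharp M p \<in> distr M (fst p)"
  unfolding csharp_def by (rule sharp_in) (simp add: bounded_linear.linear bounded_linear_inner_right)

section \<open>The Hamiltonian and its vector field in the canonical coordinates of a fixed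
  chart\<close>

abbreviation cdom :: "('m, 'e) chart \<Rightarrow> ('e \<times> 'e) set" where
  "cdom c \<equiv> (snd c ` fst c) \<times> UNIV"

definition Hc :: "('m, 'e) chart \<Rightarrow> 'e \<times> 'e \<Rightarrow> real" where
  "Hc c z = hamiltonian M (cchart_inv M c z)"

lemma open_cdom: "c \<in> atlas M \<Longrightarrow> open (cdom c)"
  by (intro open_Times open_chart_image) auto

lemma cchart_inv_pairing:
  "c \<in> atlas M \<Longrightarrow> z \<in> cdom c \<Longrightarrow> snd (cchart_inv M c z) \<bullet> v = snd z \<bullet> vcoord M c (chart_inv c (fst z)) v"
  using adjoint_works[OF linear_vcoord, of c "chart_inv c (fst z)" v "snd z"]
  by (auto simp: cchart_inv_def inner_commute)

lemma fst_cchart_inv [simp]: "fst (cchart_inv M c z) = chart_inv c (fst z)"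
  by (simp add: cchart_inv_def)

lemma fst_cchart [simp]: "fst (cchart M c p) = snd c (fst p)"
  by (simp add: cchart_def)

lemma cchart_pairing:
  "c \<in> atlas M \<Longrightarrow> fst p \<in> fst c \<Longrightarrow> snd (cchart M c p) \<bullet> w = snd p \<bullet> vfrom M c (fst p) w"
  using adjoint_works[OF linear_vfrom, of c "fst p" w "snd p"]
  by (simp add: cchart_def inner_commute)

lemma cchart_in: "fst p \<in> fst c \<Longrightarrow> cchart M c p \<in> cdom c"
  by (simp add: cchart_def)

lemma cchart_inv_cchart:
  assumes "c \<in> atlas M" "fst p \<in> fst c"
  shows "cchart_inv M c (cchart M c p) = p"
proof (rule prod_eqI)
  have "snd (cchart_inv M c (cchart M c p)) \<bullet> v = snd p \<bullet> v" for v
    using assms by (simp add: cchart_inv_pairing[OF assms(1) cchart_in[OF assms(2)]] cchart_pairing)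
  then show "snd (cchart_inv M c (cchart M c p)) = snd p"
    using vector_eq_rdot by blast
qed (use assms in simp)

lemma cchart_cchart_inv:
  assumes "c \<in> atlas M" "z \<in> cdom c"
  shows "cchart M c (cchart_inv M c z) = z"
proof (rule prod_eqI)
  have q: "fst (cchart_inv M c z) \<in> fst c"
    using assms by auto
  have "snd (cchart M c (cchart_inv M c z)) \<bullet> v = snd z \<bullet> v" for v
    using assms q by (simp add: cchart_pairing[OF assms(1) q] cchart_inv_pairing)
  then show "snd (cchart M c (cchart_inv M c z)) = snd z"
    using vector_eq_rdot by blast
qed (use assms in auto)

text \<open>In an orthogonal frame \<open>y\<close> the Hamiltonian is a quadratic form in the
  momentum whose coefficients \<open>k\<close>, the reciprocal squared lengths of the frame vectors,
  depend smoothly on the point. The matching formula for the sharp is recorded in order to identify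
  the momentum derivative.\<close>

lemma Hc_local:
  assumes c: "c \<in> atlas M" and q: "q \<in> fst c"
  obtains U r y k where "open U" "q \<in> U" "U \<subseteq> fst c" "\<And>i. i < (r::nat) \<Longrightarrow> smooth_on (snd c ` U) (y i)"
    "\<And>i. i < r \<Longrightarrow> smooth_on (snd c ` U) (k i)"
    "\<And>z. z \<in> snd c ` U \<times> UNIV \<Longrightarrow> Hc c z = (\<Sum>i<r. k i (fst z) * (snd z \<bullet> y i (fst z)) * (snd z \<bullet> y i (fst z))) / 2"
    "\<And>z. z \<in> snd c ` U \<times> UNIV \<Longrightarrow> vcoord M c (chart_inv c (fst z)) (csharp M (cchart_inv M c z))
       = (\<Sum>i<r. (k i (fst z) * (snd z \<bullet> y i (fst z))) *\<^sub>R y i (fst z))"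
proof -
  obtain U r y where f: "orth_frame c (Gc c) q U r y"
    by (rule metric_frame[OF c q])
  note U = orth_frameD(1-3)[OF f] and y = orth_frameD(4-7)[OF f]
  note o = open_image'[OF c U(1,3)]
  have yE: "y i x \<in> Ec c x" if "x \<in> snd c ` U" "i < r" for x i
    unfolding y(2)[OF that(1)] using that by (intro span_base) auto
  define k where "k i x = 1 / Gc c x (y i x) (y i x)" for i x
  have cs: "vcoord M c (chart_inv c (fst z)) (csharp M (cchart_inv M c z))
       = (\<Sum>i<r. (k i (fst z) * (snd z \<bullet> y i (fst z))) *\<^sub>R y i (fst z))"
    if z: "z \<in> snd c ` U \<times> UNIV" for z
  proof -
    obtain p where p: "p \<in> U" "fst z = snd c p" using z by auto
    then have pc: "p \<in> fst c" using U by blast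
    have x: "snd c p \<in> snd c ` U" using p by blast
    have zc: "z \<in> cdom c" using z U by auto
    let ?p = "\<lambda>v. snd (cchart_inv M c z) \<bullet> v"
    have "linear ?p" by (simp add: bounded_linear.linear bounded_linear_inner_right)
    from sharp_frame_eq[OF c pc this y(2)[OF x] y(3)[OF x] y(4)[OF x]]
    have "csharp M (cchart_inv M c z) =
        vfrom M c p (\<Sum>i<r. (?p (vfrom M c p (y i (snd c p))) / Gc c (snd c p) (y i (snd c p)) (y i (snd c p))) *\<^sub>R y i (snd c p))"
      using c pc by (simp add: csharp_def p)
    then show ?thesis
      using c pc by (simp add: p cchart_inv_pairing[OF c zc] k_def)
  qed
  show ?thesis
  proof (rule that[of U r y k])
    show "open U" "q \<in> U" "U \<subseteq> fst c"
      by (fact U)+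
    show "smooth_on (snd c ` U) (y i)" if "i < r" for i
      by (rule y(1)[OF that])
    show "smooth_on (snd c ` U) (k i)" if "i < r" for i
      unfolding k_def
    proof (intro smooth_on_divide o smooth_on_const)
      show "smooth_on (snd c ` U) (\<lambda>x. Gc c x (y i x) (y i x))"
        by (rule Gc_smooth[OF c U(1,3)]) (use y that yE in auto)
      show "Gc c x (y i x) (y i x) \<noteq> 0" if "x \<in> snd c ` U" for x
        using Gc_axioms(4)[OF c _ yE[OF that \<open>i < r\<close>] yE[OF that \<open>i < r\<close>] y(3)[OF that \<open>i < r\<close>]] that U by force
    qed
    show "Hc c z = (\<Sum>i<r. k i (fst z) * (snd z \<bullet> y i (fst z)) * (snd z \<bullet> y i (fst z))) / 2"
      if z: "z \<in> snd c ` U \<times> UNIV" for z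
    proof -
      have zc: "z \<in> cdom c" using z U by auto
      show ?thesis
        by (simp add: Hc_def hamiltonian_def cchart_inv_pairing[OF c zc] cs[OF z] inner_sum_right)
    qed
  qed (rule cs)
qed

lemma smooth_on_fst_comp:
  fixes f :: "'e \<Rightarrow> 'b::real_normed_vector"
  assumes "smooth_on A f" "open A"
  shows "smooth_on (A \<times> (UNIV :: 'e set)) (\<lambda>z. f (fst z))"
  by (rule smooth_on_compose[OF assms(1) smooth_on_fst[OF _ smooth_on_id] _ assms(2)])
    (use assms(2) in \<open>auto intro: open_Times\<close>)

lemma smooth_Hc:
  assumes c: "c \<in> atlas M"
  shows "smooth_on (cdom c) (Hc c)"
proof (rule smooth_on_local)
  fix z assume "z \<in> cdom c"
  then obtain q where q: "q \<in> fst c" "fst z = snd c q" by auto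
  obtain U r y k where U: "open U" "q \<in> U" "U \<subseteq> fst c" and y: "\<And>i. i < (r::nat) \<Longrightarrow> smooth_on (snd c ` U) (y i)"
    "\<And>i. i < r \<Longrightarrow> smooth_on (snd c ` U) (k i)"
    "\<And>z. z \<in> snd c ` U \<times> UNIV \<Longrightarrow> Hc c z = (\<Sum>i<r. k i (fst z) * (snd z \<bullet> y i (fst z)) * (snd z \<bullet> y i (fst z))) / 2"
    by (rule Hc_local[OF c q(1)]) blast
  note o = open_image'[OF c U(1,3)]
  have oV: "open (snd c ` U \<times> (UNIV :: 'e set))" by (intro open_Times o open_UNIV)
  have "smooth_on (snd c ` U \<times> (UNIV :: 'e set))
      (\<lambda>z. (\<Sum>i<r. k i (fst z) * (snd z \<bullet> y i (fst z)) * (snd z \<bullet> y i (fst z))) / 2)"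
    by (intro smooth_on_divide smooth_on_sum smooth_on_mult smooth_on_inner oV smooth_on_const
        smooth_on_snd smooth_on_id smooth_on_fst_comp y o) auto
  then have "smooth_on (snd c ` U \<times> UNIV) (Hc c)"
    by (rule smooth_on_cong[OF oV, THEN iffD1, rotated 1]) (rule y(3)[symmetric])
  moreover have "z \<in> snd c ` U \<times> UNIV"
    using q U by (cases z) auto
  ultimately show "\<exists>V. open V \<and> z \<in> V \<and> smooth_on V (Hc c)"
    using oV by blast
qed

text \<open>One half of Hamilton's equations: the momentum derivative of the quadratic form is the
  sharp, the factor 2 cancelling the 1/2 in H. Thus an extremal has velocity
  \<open>csharp M (lam t)\<close>.\<close>

lemma Hc_derivative_vertical:
  assumes c: "c \<in> atlas M" and z: "z \<in> cdom c"
  shows "frechet_derivative (Hc c) (at z) (0, b) = b \<bullet> vcoord M c (chart_inv c (fst z)) (csharp M (cchart_inv M c z))"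
proof -
  obtain q where q: "q \<in> fst c" "fst z = snd c q" using z by auto
  obtain U r y k where U: "open U" "q \<in> U" "U \<subseteq> fst c" and y:
    "\<And>z. z \<in> snd c ` U \<times> UNIV \<Longrightarrow> Hc c z = (\<Sum>i<(r::nat). k i (fst z) * (snd z \<bullet> y i (fst z)) * (snd z \<bullet> y i (fst z))) / 2"
    "\<And>z. z \<in> snd c ` U \<times> UNIV \<Longrightarrow> vcoord M c (chart_inv c (fst z)) (csharp M (cchart_inv M c z))
       = (\<Sum>i<r. (k i (fst z) * (snd z \<bullet> y i (fst z))) *\<^sub>R y i (fst z))"
    by (rule Hc_local[OF c q(1)]) blast
  have zU: "z \<in> snd c ` U \<times> UNIV" using q U by (cases z) auto
  let ?g = "\<lambda>\<xi>. (fst z, \<xi>)"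
  have "(?g has_derivative (\<lambda>b. (0, b))) (at (snd z))"
    by (intro has_derivative_Pair has_derivative_const has_derivative_ident)
  moreover have "(Hc c has_derivative frechet_derivative (Hc c) (at z)) (at (?g (snd z)))"
    using smooth_on_has_derivative[OF smooth_Hc[OF c] z] by simp
  ultimately have d1: "((\<lambda>\<xi>. Hc c (?g \<xi>)) has_derivative (\<lambda>b. frechet_derivative (Hc c) (at z) (0, b))) (at (snd z))"
    by (rule has_derivative_compose)
  have e1: "(\<lambda>\<xi>. Hc c (?g \<xi>)) = (\<lambda>\<xi>. (\<Sum>i<r. k i (fst z) * (\<xi> \<bullet> y i (fst z)) * (\<xi> \<bullet> y i (fst z))) / 2)"
    using y(1) zU by (intro ext) (auto simp: mem_Times_iff)
  have d2: "((\<lambda>\<xi>. (\<Sum>i<r. k i (fst z) * (\<xi> \<bullet> y i (fst z)) * (\<xi> \<bullet> y i (fst z))) / 2) has_derivative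
      (\<lambda>b. (\<Sum>i<r. k i (fst z) * (snd z \<bullet> y i (fst z)) * (b \<bullet> y i (fst z)) + k i (fst z) * (b \<bullet> y i (fst z)) * (snd z \<bullet> y i (fst z))) / 2)) (at (snd z))"
    by (auto intro!: derivative_eq_intros)
  have "(\<lambda>b. frechet_derivative (Hc c) (at z) (0, b)) = (\<lambda>b. (\<Sum>i<r. k i (fst z) * (snd z \<bullet> y i (fst z)) * (b \<bullet> y i (fst z)) + k i (fst z) * (b \<bullet> y i (fst z)) * (snd z \<bullet> y i (fst z))) / 2)"
    by (rule has_derivative_unique[OF d1[unfolded e1] d2])
  from fun_cong[OF this, of b] have "frechet_derivative (Hc c) (at z) (0, b)
      = (\<Sum>i<r. 2 * (k i (fst z) * (snd z \<bullet> y i (fst z)) * (b \<bullet> y i (fst z)))) / 2"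
    by (simp add: mult_ac)
  then show ?thesis
    by (simp add: y(2)[OF zU] inner_sum_right sum_distrib_left[symmetric])
qed

text \<open>The Hamiltonian vector field in the canonical coordinates of one fixed chart; in
  contrast to \<open>ham_field\<close>, this can be differentiated in z.\<close>

definition hv :: "('m, 'e) chart \<Rightarrow> 'e \<times> 'e \<Rightarrow> 'e \<times> 'e" where
  "hv c z = (\<Sum>b\<in>Basis. frechet_derivative (Hc c) (at z) (0, b) *\<^sub>R b,
     - (\<Sum>b\<in>Basis. frechet_derivative (Hc c) (at z) (b, 0) *\<^sub>R b))"

text \<open>Nondegeneracy of the symplectic form: testing with vertical and with horizontal vectors
  recovers both components of \<open>h\<close>.\<close>

lemma hv_unique:
  assumes c: "c \<in> atlas M" and z: "z \<in> cdom c"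
  shows "(\<forall>w. frechet_derivative (Hc c) (at z) w = symplectic w h) \<longleftrightarrow> h = hv c z"
proof -
  let ?D = "frechet_derivative (Hc c) (at z)"
  have l: "linear ?D"
    by (rule smooth_on_linear_frechet[OF smooth_Hc[OF c] z])
  have 1: "?D w = symplectic w (hv c z)" for w
  proof -
    have l1: "linear (\<lambda>b. ?D (b, 0))" "linear (\<lambda>b. ?D (0, b))"
      using linear_add[OF l, of "(_, 0)" "(_, 0)"] linear_add[OF l, of "(0, _)" "(0, _)"]
        linear_cmul[OF l, of _ "(_, 0)"] linear_cmul[OF l, of _ "(0, _)"]
      by (auto intro!: linearI)
    have "w = (fst w, 0) + (0, snd w)"
      by (simp add: prod_eq_iff)
    then have "?D w = ?D (fst w, 0) + ?D (0, snd w)"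
      using linear_add[OF l] by metis
    also have "\<dots> = (\<Sum>b\<in>Basis. (fst w \<bullet> b) * ?D (b, 0)) + (\<Sum>b\<in>Basis. (snd w \<bullet> b) * ?D (0, b))"
      using linear_euclidean_sum[OF l1(1), of "fst w"] linear_euclidean_sum[OF l1(2), of "snd w"] by simp
    also have "\<dots> = symplectic w (hv c z)"
      by (simp add: symplectic_def hv_def inner_sum_right inner_commute[of _ "fst w"] mult.commute)
    finally show ?thesis .
  qed
  have "h = hv c z" if h: "\<And>w. ?D w = symplectic w h" for h
  proof (rule prod_eqI)
    have e: "symplectic w h = symplectic w (hv c z)" for w
      using h 1 by metis
    have "fst h \<bullet> b = fst (hv c z) \<bullet> b" for b
      using e[of "(0, b)"] by (simp add: symplectic_def inner_commute)
    then show "fst h = fst (hv c z)" using vector_eq_rdot by blast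
    have "snd h \<bullet> b = snd (hv c z) \<bullet> b" for b
      using e[of "(b, 0)"] by (simp add: symplectic_def inner_commute)
    then show "snd h = snd (hv c z)" using vector_eq_rdot by blast
  qed
  with 1 show ?thesis by blast
qed

lemma hv_symplectic: "c \<in> atlas M \<Longrightarrow> z \<in> cdom c \<Longrightarrow> frechet_derivative (Hc c) (at z) w = symplectic w (hv c z)"
  using hv_unique by blast

lemma fst_hv:
  assumes "c \<in> atlas M" "z \<in> cdom c"
  shows "fst (hv c z) = vcoord M c (chart_inv c (fst z)) (csharp M (cchart_inv M c z))"
  by (simp add: hv_def Hc_derivative_vertical[OF assms] inner_commute[of _ "vcoord M c (chart_inv c (fst z)) (csharp M (cchart_inv M c z))"] euclidean_representation)

lemma smooth_hv:
  assumes c: "c \<in> atlas M"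
  shows "smooth_on (cdom c) (hv c)"
  unfolding hv_def
  by (intro smooth_on_Pair smooth_on_uminus smooth_on_sum smooth_on_scaleR smooth_on_frechet smooth_Hc
      smooth_on_const open_cdom c)

lemma ham_field_eq: "ham_field M p = hv (chart_at M (fst p)) (cchart M (chart_at M (fst p)) p)"
proof -
  let ?c = "chart_at M (fst p)"
  have "(\<lambda>z. hamiltonian M (cchart_inv M ?c z)) = Hc ?c"
    by (rule ext) (simp add: Hc_def)
  then show ?thesis
    using hv_unique[of ?c "cchart M ?c p"] cchart_in[of p ?c] by (simp add: ham_field_def Let_def)
qed


section \<open>Cotangent lifts of coordinate changes are symplectic\<close>

text \<open>The coordinate change of the cotangent bundle. The momentum is transformed by the
  transpose of the inverse Jacobian, written as a sum over \<open>Basis\<close> so that its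
  smoothness follows from closure rules.\<close>

definition ctrans :: "('m, 'e) chart \<Rightarrow> ('m, 'e) chart \<Rightarrow> 'e \<times> 'e \<Rightarrow> 'e \<times> 'e" where
  "ctrans c c' z = (transition c c' (fst z), \<Sum>b\<in>Basis. (snd z \<bullet> jac c' c (transition c c' (fst z)) b) *\<^sub>R b)"

abbreviation cov2 :: "('m, 'e) chart \<Rightarrow> ('m, 'e) chart \<Rightarrow> ('e \<times> 'e) set" where
  "cov2 c c' \<equiv> (snd c ` (fst c \<inter> fst c')) \<times> UNIV"

lemma open_cov2: "c \<in> atlas M \<Longrightarrow> c' \<in> atlas M \<Longrightarrow> open (cov2 c c')"
  by (intro open_Times open_overlap open_UNIV)

lemma smooth_ctrans:
  assumes c: "c \<in> atlas M" "c' \<in> atlas M"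
  shows "smooth_on (cov2 c c') (ctrans c c')"
proof -
  note o = open_overlap[OF c]
  have "smooth_on (snd c ` (fst c \<inter> fst c')) (\<lambda>x. jac c' c (transition c c' x) b)" for b
    by (rule smooth_on_compose[OF smooth_jac[OF c(2,1)] smooth_trans[OF c] o open_overlap[OF c(2,1)]])
      (use c in auto)
  from smooth_on_fst_comp[OF this o]
  show ?thesis
    unfolding ctrans_def
    by (intro smooth_on_Pair smooth_on_sum smooth_on_scaleR smooth_on_inner smooth_on_const open_cov2 c
        smooth_on_snd smooth_on_id smooth_on_fst_comp[OF smooth_trans[OF c] o])
qed

lemma ctrans_pairing:
  assumes c: "c \<in> atlas M" "c' \<in> atlas M" and q: "q \<in> fst c" "q \<in> fst c'"
  shows "snd (ctrans c c' (snd c q, \<xi>)) \<bullet> jac c c' (snd c q) w = \<xi> \<bullet> w"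
proof -
  have l: "linear (jac c' c (snd c' q))"
    by (rule linear_jac) (use c q in auto)
  have "snd (ctrans c c' (snd c q, \<xi>)) \<bullet> v = \<xi> \<bullet> jac c' c (snd c' q) v" for v
    using linear_euclidean_sum[OF l, of v] c q
    by (simp add: ctrans_def inner_sum_left inner_sum_right inner_commute[of v] mult.commute)
  then show ?thesis
    using c q by (simp add: jac_jac jac_self)
qed

lemma cchart_inv_ctrans:
  assumes c: "c \<in> atlas M" "c' \<in> atlas M" and z: "z \<in> cov2 c c'"
  shows "cchart_inv M c' (ctrans c c' z) = cchart_inv M c z" "ctrans c c' z \<in> cdom c'"
proof -
  obtain q where q: "q \<in> fst c" "q \<in> fst c'" "fst z = snd c q" using z by auto
  have f: "fst (ctrans c c' z) = snd c' q"
    using c q by (simp add: ctrans_def)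
  then show z': "ctrans c c' z \<in> cdom c'"
    using q by (simp add: mem_Times_iff)
  have zc: "z \<in> cdom c" using z by auto
  have "snd (cchart_inv M c' (ctrans c c' z)) \<bullet> v = snd (cchart_inv M c z) \<bullet> v" for v
  proof -
    have "z = (snd c q, snd z)"
      by (simp add: prod_eq_iff q(3))
    then have "snd (ctrans c c' z) \<bullet> vcoord M c' q v = snd z \<bullet> vcoord M c q v"
      using ctrans_pairing[OF c q(1,2), of "snd z" "vcoord M c q v"] jac_vcoord[OF c q(1,2), of v] by metis
    then show ?thesis
      using c q(1,2) by (simp add: cchart_inv_pairing[OF c(2) z'] cchart_inv_pairing[OF c(1) zc] f q(3))
  qed
  then have "snd (cchart_inv M c' (ctrans c c' z)) = snd (cchart_inv M c z)"
    using vector_eq_rdot by blast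
  then show "cchart_inv M c' (ctrans c c' z) = cchart_inv M c z"
    using c q by (intro prod_eqI) (simp_all add: f)
qed

text \<open>The momentum part is obtained by differentiating the invariance of the pairing,
  \<open>ctrans_pairing\<close>, which avoids derivatives of the inverse Jacobian.\<close>

lemma ctrans_derivative:
  assumes c: "c \<in> atlas M" "c' \<in> atlas M" and z: "z \<in> cov2 c c'"
  defines "D \<equiv> frechet_derivative (ctrans c c') (at z)"
  shows "fst (D h) = jac c c' (fst z) (fst h)"
    and "snd (D h) \<bullet> jac c c' (fst z) w
      = snd h \<bullet> w - snd (ctrans c c' z) \<bullet> frechet_derivative (\<lambda>x. jac c c' x w) (at (fst z)) (fst h)"
proof -
  obtain q where q: "q \<in> fst c" "q \<in> fst c'" "fst z = snd c q" using z by auto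
  have x: "fst z \<in> snd c ` (fst c \<inter> fst c')" using z by auto
  have d: "(ctrans c c' has_derivative D) (at z)"
    unfolding D_def by (rule smooth_on_has_derivative[OF smooth_ctrans[OF c] z])
  have "((\<lambda>z. transition c c' (fst z)) has_derivative (\<lambda>h. jac c c' (fst z) (fst h))) (at z)"
    using has_derivative_compose[OF has_derivative_fst[OF has_derivative_ident]
        smooth_on_has_derivative[OF smooth_trans[OF c] x]] by (simp add: jac_def)
  moreover have "((\<lambda>z. transition c c' (fst z)) has_derivative (\<lambda>h. fst (D h))) (at z)"
    using has_derivative_fst[OF d] by (simp add: ctrans_def)
  ultimately show "fst (D h) = jac c c' (fst z) (fst h)"
    using has_derivative_unique by metis
  have "((\<lambda>z. jac c c' (fst z) w) has_derivative
      (\<lambda>h. frechet_derivative (\<lambda>x. jac c c' x w) (at (fst z)) (fst h))) (at z)"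
    by (rule has_derivative_compose[OF has_derivative_fst[OF has_derivative_ident]
          smooth_on_has_derivative[OF smooth_jac[OF c] x]])
  from has_derivative_inner[OF has_derivative_snd[OF d] this]
  have "((\<lambda>z. snd (ctrans c c' z) \<bullet> jac c c' (fst z) w) has_derivative
      (\<lambda>h. snd (ctrans c c' z) \<bullet> frechet_derivative (\<lambda>x. jac c c' x w) (at (fst z)) (fst h)
        + snd (D h) \<bullet> jac c c' (fst z) w)) (at z)" .
  moreover have "((\<lambda>z. snd (ctrans c c' z) \<bullet> jac c c' (fst z) w) has_derivative (\<lambda>h. snd h \<bullet> w)) (at z)"
  proof (rule has_derivative_transform_within_open[OF _ open_cov2[OF c] z])
    show "((\<lambda>z. snd z \<bullet> w) has_derivative (\<lambda>h. snd h \<bullet> w)) (at z)"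
      by (intro has_derivative_inner_left has_derivative_snd has_derivative_ident)
    fix z' assume "z' \<in> cov2 c c'"
    then obtain p \<xi> where "p \<in> fst c" "p \<in> fst c'" "z' = (snd c p, \<xi>)" by auto
    then show "snd z' \<bullet> w = snd (ctrans c c' z') \<bullet> jac c c' (fst z') w"
      using ctrans_pairing[OF c, of p \<xi> w] by simp
  qed
  ultimately have "(\<lambda>h. snd (ctrans c c' z) \<bullet> frechet_derivative (\<lambda>x. jac c c' x w) (at (fst z)) (fst h)
        + snd (D h) \<bullet> jac c c' (fst z) w) = (\<lambda>h. snd h \<bullet> w)"
    by (rule has_derivative_unique)
  from fun_cong[OF this, of h] show "snd (D h) \<bullet> jac c c' (fst z) w
      = snd h \<bullet> w - snd (ctrans c c' z) \<bullet> frechet_derivative (\<lambda>x. jac c c' x w) (at (fst z)) (fst h)"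
    by simp
qed

text \<open>The two correction terms pair the momentum with a second derivative of the transition
  map and cancel by Schwarz's theorem.\<close>

lemma ctrans_symplectic:
  assumes c: "c \<in> atlas M" "c' \<in> atlas M" and z: "z \<in> cov2 c c'"
  shows "symplectic (frechet_derivative (ctrans c c') (at z) v) (frechet_derivative (ctrans c c') (at z) w)
    = symplectic v w"
proof -
  have x: "fst z \<in> snd c ` (fst c \<inter> fst c')" using z by auto
  have "frechet_derivative (\<lambda>x. jac c c' x (fst w)) (at (fst z)) (fst v)
      = frechet_derivative (\<lambda>x. jac c c' x (fst v)) (at (fst z)) (fst w)"
    unfolding jac_def by (rule symmetric_second_derivative[OF open_overlap[OF c] x smooth_trans[OF c]])
  then show ?thesis
    by (simp add: symplectic_def ctrans_derivative[OF assms])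
qed

text \<open>The Hamiltonian is one function on the cotangent bundle and the coordinate change is
  symplectic, so the fields defined by the two coordinate expressions correspond.\<close>

lemma hv_ctrans:
  assumes c: "c \<in> atlas M" "c' \<in> atlas M" and z: "z \<in> cov2 c c'"
  shows "hv c' (ctrans c c' z) = frechet_derivative (ctrans c c') (at z) (hv c z)"
proof -
  let ?D = "frechet_derivative (ctrans c c') (at z)"
  note d = smooth_on_has_derivative[OF smooth_ctrans[OF c] z]
  have zc: "z \<in> cdom c" using z by auto
  note z' = cchart_inv_ctrans(2)[OF assms]
  have l: "linear ?D" using d has_derivative_linear by blast
  \<comment> \<open>A map preserving a nondegenerate form is injective, hence surjective in equal
    finite dimension. Surjectivity lets the defining equation of \<open>hv c'\<close> be tested on
    vectors \<open>?D w\<close> alone.\<close>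
  have "inj ?D"
  proof (rule injI)
    fix v w assume "?D v = ?D w"
    then have "symplectic v u = symplectic w u" for u
      using ctrans_symplectic[OF assms, of v u] ctrans_symplectic[OF assms, of w u] by simp
    from this[of "(b, 0)" for b] this[of "(0, b)" for b]
    have "snd v \<bullet> b = snd w \<bullet> b" "fst v \<bullet> b = fst w \<bullet> b" for b
      by (simp_all add: symplectic_def inner_commute)
    then have "snd v = snd w" "fst v = fst w"
      using vector_eq_rdot by blast+
    then show "v = w" by (rule prod_eqI[rotated])
  qed
  then have "surj ?D"
    using l linear_injective_imp_surjective by blast
  have "(Hc c' has_derivative frechet_derivative (Hc c') (at (ctrans c c' z))) (at (ctrans c c' z))"
    by (rule smooth_on_has_derivative[OF smooth_Hc[OF c(2)] z'])
  from has_derivative_compose[OF d this]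
  have "((\<lambda>z. Hc c' (ctrans c c' z)) has_derivative (\<lambda>w. frechet_derivative (Hc c') (at (ctrans c c' z)) (?D w))) (at z)" .
  then have "(Hc c has_derivative (\<lambda>w. frechet_derivative (Hc c') (at (ctrans c c' z)) (?D w))) (at z)"
    by (rule has_derivative_transform_within_open[OF _ open_cov2[OF c] z])
      (simp add: Hc_def cchart_inv_ctrans[OF c])
  from fun_cong[OF frechet_derivative_at[OF this]]
  have e: "frechet_derivative (Hc c') (at (ctrans c c' z)) (?D w) = symplectic w (hv c z)" for w
    by (simp add: hv_symplectic[OF c(1) zc])
  have "frechet_derivative (Hc c') (at (ctrans c c' z)) w' = symplectic w' (?D (hv c z))" for w'
  proof -
    obtain w where "w' = ?D w" using \<open>surj ?D\<close> by (metis surjD)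
    then show ?thesis using e[of w] ctrans_symplectic[OF assms] by simp
  qed
  then show ?thesis
    using hv_unique[OF c(2) z'] by metis
qed

end

section \<open>Twist polynomials in a chart\<close>

locale subriemannian_connection = subriemannian M + manifold_connection M nabla
  for M :: "('m::{second_countable_topology,t2_space}, 'e::euclidean_space) subriem"
    and nabla :: "('m, 'e) conn" +
  assumes compatible: "compatible M nabla"
begin

text \<open>An endomorphism field over the cotangent bundle in the canonical coordinates of a fixed
  chart; like \<open>Ec\<close>, the version for which smoothness makes sense.\<close>

definition ec :: "('m \<times> 'e \<Rightarrow> 'e \<Rightarrow> 'e) \<Rightarrow> ('m, 'e) chart \<Rightarrow> 'e \<times> 'e \<Rightarrow> 'e \<Rightarrow> 'e" where
  "ec T c z w = vcoord M c (chart_inv c (fst z)) (T (cchart_inv M c z) (vfrom M c (chart_inv c (fst z)) w))"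

definition smooth_endo :: "('m \<times> 'e \<Rightarrow> 'e \<Rightarrow> 'e) \<Rightarrow> bool" where
  "smooth_endo T \<longleftrightarrow> (\<forall>c\<in>atlas M. (\<forall>z\<in>cdom c. linear (ec T c z)) \<and> (\<forall>w. smooth_on (cdom c) (\<lambda>z. ec T c z w)))"

lemma smooth_endo_linear: "smooth_endo T \<Longrightarrow> c \<in> atlas M \<Longrightarrow> z \<in> cdom c \<Longrightarrow> linear (ec T c z)"
  unfolding smooth_endo_def by blast

lemma smooth_endo_smooth: "smooth_endo T \<Longrightarrow> c \<in> atlas M \<Longrightarrow> smooth_on (cdom c) (\<lambda>z. ec T c z w)"
  by (simp add: smooth_endo_def)

lemma vcoord_endo:
  "c \<in> atlas M \<Longrightarrow> fst p \<in> fst c \<Longrightarrow> vcoord M c (fst p) (T p v) = ec T c (cchart M c p) (vcoord M c (fst p) v)"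
  by (simp add: ec_def cchart_inv_cchart)

lemma ec_ctrans:
  assumes c: "c \<in> atlas M" "c' \<in> atlas M" and z: "z \<in> cov2 c c'"
  shows "ec T c' (ctrans c c' z) (jac c c' (fst z) w) = jac c c' (fst z) (ec T c z w)"
proof -
  obtain q where q: "q \<in> fst c" "q \<in> fst c'" "fst z = snd c q" using z by auto
  have f: "fst (ctrans c c' z) = snd c' q"
    using c q by (simp add: ctrans_def)
  show ?thesis
    using c q by (simp add: ec_def f cchart_inv_ctrans[OF assms] vfrom_jac jac_vcoord)
qed

text \<open>Covariant derivative of an endomorphism along the Hamiltonian field in a chart: the
  derivative of the matrix plus its commutator with the Christoffel matrix of the velocity.\<close>

definition chart_vpartial :: "('m, 'e) chart \<Rightarrow> ('e \<times> 'e \<Rightarrow> 'e \<Rightarrow> 'e) \<Rightarrow> 'e \<times> 'e \<Rightarrow> 'e \<Rightarrow> 'e" where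
  "chart_vpartial c F z w = frechet_derivative (\<lambda>z. F z w) (at z) (hv c z)
     + Gam c (fst z) (fst (hv c z)) (F z w) - F z (Gam c (fst z) (fst (hv c z)) w)"

text \<open>In the chart selected at the base point the extension of \<open>v\<close> has constant
  components, so its derivative reduces to the Christoffel term.\<close>

lemma vpartial_chart_at:
  fixes p :: "'m \<times> 'e"
  defines "c \<equiv> chart_at M (fst p)"
  shows "vpartial M nabla T p v = chart_vpartial c (ec T c) (cchart M c p) v"
proof -
  have c: "c \<in> atlas M" "fst p \<in> fst c"
    by (simp_all add: c_def)
  let ?q = "fst p" and ?z = "cchart M c p"
  have z: "?z \<in> cdom c"
    by (rule cchart_in[OF c(2)])
  have vc: "vcoord M c ?q u = u" "vfrom M c ?q u = u" for u
    by (simp_all add: c_def)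
  have h: "ham_field M p = hv c ?z"
    by (simp add: ham_field_eq c_def)
  have pc: "pullback_conn M nabla p (ham_field M p) Y
      = frechet_derivative (\<lambda>z. vcoord M c (fst (cchart_inv M c z)) (Y (cchart_inv M c z))) (at ?z) (hv c ?z)
        + Gam c (snd c ?q) (fst (hv c ?z)) (Y p)" for Y
    using vcoord_nabla_const_field[OF c, of "fst (hv c ?z)" "Y p"]
    by (simp add: pullback_conn_def Let_def h c_def)
  have e1: "frechet_derivative (\<lambda>z. vcoord M c (fst (cchart_inv M c z)) (T (cchart_inv M c z) (Defs.ext M ?q v (fst (cchart_inv M c z))))) (at ?z)
      = frechet_derivative (\<lambda>z. ec T c z v) (at ?z)"
    by (simp add: ec_def Defs.ext_def const_field_def c_def)
  have "((\<lambda>z. vcoord M c (fst (cchart_inv M c z)) (Defs.ext M ?q v (fst (cchart_inv M c z)))) has_derivative (\<lambda>_. 0)) (at ?z)"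
    by (rule has_derivative_transform_within_open[OF has_derivative_const open_cdom[OF c(1)] z, of v])
      (use c in \<open>auto simp: Defs.ext_def const_field_def simp flip: c_def\<close>)
  from frechet_derivative_at[OF this]
  have e2: "frechet_derivative (\<lambda>z. vcoord M c (fst (cchart_inv M c z)) (Defs.ext M ?q v (fst (cchart_inv M c z)))) (at ?z) = (\<lambda>_. 0)"
    by simp
  have Tp: "T p u = ec T c ?z u" for u
    using vcoord_endo[OF c, of T u] by (simp add: vc)
  show ?thesis
    unfolding vpartial_def pc e1 e2 by (simp add: chart_vpartial_def Tp)
qed

text \<open>Both sides of \<open>ec_ctrans\<close> are differentiated in the Hamiltonian direction,
  which is the same in the two charts by \<open>hv_ctrans\<close>. The derivatives of the Jacobian
  produced by the product rule cancel against the inhomogeneous terms of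
  \<open>Gam_transform\<close>.\<close>

lemma chart_vpartial_ctrans:
  assumes T: "smooth_endo T" and c: "c \<in> atlas M" "c' \<in> atlas M" and z: "z \<in> cov2 c c'"
  shows "chart_vpartial c' (ec T c') (ctrans c c' z) (jac c c' (fst z) w)
    = jac c c' (fst z) (chart_vpartial c (ec T c) z w)"
proof -
  obtain q where q: "q \<in> fst c" "q \<in> fst c'" "fst z = snd c q" using z by auto
  let ?F = "ec T c" and ?F' = "ec T c'" and ?z' = "ctrans c c' z"
  let ?J = "jac c c' (fst z)" and ?h = "hv c z" and ?x = "fst z"
  let ?D2 = "\<lambda>u. frechet_derivative (\<lambda>x. jac c c' x u) (at ?x) (fst ?h)"
  note z' = cchart_inv_ctrans(2)[OF c z]
  have zc: "z \<in> cdom c" using z by auto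
  have x: "?x \<in> snd c ` (fst c \<inter> fst c')" using z by auto
  have fz': "fst ?z' = snd c' q"
    using c q by (simp add: ctrans_def)
  have lJ: "linear ?J"
    unfolding q(3) by (rule linear_jac[OF c q(1,2)])
  have lF': "linear (?F' ?z')"
    by (rule smooth_endo_linear[OF T c(2) z'])
  have h': "hv c' ?z' = frechet_derivative (ctrans c c') (at z) ?h"
    by (rule hv_ctrans[OF c z])
  have sig: "fst (hv c' ?z') = ?J (fst ?h)"
    unfolding h' by (rule ctrans_derivative(1)[OF c z])
  \<comment> \<open>A straight segment in canonical coordinates with the Hamiltonian vector as
    velocity; the first-order behaviour at s = 0 is all that matters, so no integral curve is
    needed.\<close>
  have line: "((\<lambda>s. z + s *\<^sub>R ?h) has_vector_derivative ?h) (at 0)"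
    by (auto simp: has_vector_derivative_def intro!: derivative_eq_intros)
  have line1: "((\<lambda>s. fst (z + s *\<^sub>R ?h)) has_vector_derivative fst ?h) (at 0)"
    using bounded_linear.has_vector_derivative[OF bounded_linear_fst line] .
  have cl: "((\<lambda>s. ctrans c c' (z + s *\<^sub>R ?h)) has_vector_derivative hv c' ?z') (at 0)"
    unfolding h' using has_vector_derivative_chain[of "ctrans c c'" "\<lambda>s. z + s *\<^sub>R ?h" 0 ?h UNIV]
      smooth_on_differentiable[OF smooth_ctrans[OF c] z] line by simp
  have nF': "\<forall>\<^sub>F y in nhds ?z'. linear (?F' y)"
    using eventually_nhds_in_open[OF open_cdom[OF c(2)] z']
    by eventually_elim (rule smooth_endo_linear[OF T c(2)])
  have nJ: "\<forall>\<^sub>F y in nhds ?x. linear (jac c c' y)"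
    using eventually_nhds_in_open[OF open_overlap[OF c] x]
    by eventually_elim (use linear_jac[OF c] in auto)
  have dJ: "((\<lambda>s. jac c c' (fst (z + s *\<^sub>R ?h)) u) has_vector_derivative ?D2 u) (at 0)" for u
    using has_vector_derivative_chain[of "\<lambda>x. jac c c' x u" "\<lambda>s. fst (z + s *\<^sub>R ?h)" 0 "fst ?h" UNIV]
      smooth_on_differentiable[OF smooth_jac[OF c] x, of u] line1 by simp
  have dF: "((\<lambda>s. ?F (z + s *\<^sub>R ?h) w) has_vector_derivative frechet_derivative (\<lambda>z. ?F z w) (at z) ?h) (at 0)"
    using has_vector_derivative_chain[of "\<lambda>z. ?F z w" "\<lambda>s. z + s *\<^sub>R ?h" 0 ?h UNIV]
      smooth_on_differentiable[OF smooth_endo_smooth[OF T c(1)] zc, of w] line by simp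
  have 1: "((\<lambda>s. ?F' (ctrans c c' (z + s *\<^sub>R ?h)) (jac c c' (fst (z + s *\<^sub>R ?h)) w)) has_vector_derivative
      frechet_derivative (\<lambda>y. ?F' y (?J w)) (at ?z') (hv c' ?z') + ?F' ?z' (?D2 w)) (at 0)"
    using has_vector_derivative_linear_apply[of ?F' "\<lambda>s. ctrans c c' (z + s *\<^sub>R ?h)" 0 UNIV, OF _ _ _ _ cl dJ[of w]]
      nF' smooth_on_differentiable[OF smooth_endo_smooth[OF T c(2)] z'] by simp
  have 2: "((\<lambda>s. jac c c' (fst (z + s *\<^sub>R ?h)) (?F (z + s *\<^sub>R ?h) w)) has_vector_derivative
      ?D2 (?F z w) + ?J (frechet_derivative (\<lambda>z. ?F z w) (at z) ?h)) (at 0)"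
    using has_vector_derivative_linear_apply[of "jac c c'" "\<lambda>s. fst (z + s *\<^sub>R ?h)" 0 UNIV, OF _ _ _ _ line1 dF]
      nJ smooth_on_differentiable[OF smooth_jac[OF c] x] by simp
  have "\<forall>\<^sub>F s in nhds 0. z + s *\<^sub>R ?h \<in> cov2 c c'"
  proof -
    have "((\<lambda>s. z + s *\<^sub>R ?h) \<longlongrightarrow> z + 0 *\<^sub>R ?h) (nhds 0)"
      by (intro tendsto_intros filterlim_ident)
    from topological_tendstoD[OF this open_cov2[OF c]] z show ?thesis by simp
  qed
  then have "\<forall>\<^sub>F s in nhds 0. ?F' (ctrans c c' (z + s *\<^sub>R ?h)) (jac c c' (fst (z + s *\<^sub>R ?h)) w)
      = jac c c' (fst (z + s *\<^sub>R ?h)) (?F (z + s *\<^sub>R ?h) w)"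
    by eventually_elim (rule ec_ctrans[OF c])
  then obtain e where e: "e > 0" "\<And>s. dist s 0 < e \<Longrightarrow> ?F' (ctrans c c' (z + s *\<^sub>R ?h)) (jac c c' (fst (z + s *\<^sub>R ?h)) w)
      = jac c c' (fst (z + s *\<^sub>R ?h)) (?F (z + s *\<^sub>R ?h) w)"
    unfolding eventually_nhds_metric by blast
  have "((\<lambda>s. jac c c' (fst (z + s *\<^sub>R ?h)) (?F (z + s *\<^sub>R ?h) w)) has_vector_derivative
      frechet_derivative (\<lambda>y. ?F' y (?J w)) (at ?z') (hv c' ?z') + ?F' ?z' (?D2 w)) (at 0)"
    by (rule has_vector_derivative_transform_within[OF 1 e(1)]) (use e(2) in auto)
  from vector_derivative_unique_at[OF this 2]
  have key: "frechet_derivative (\<lambda>y. ?F' y (?J w)) (at ?z') (hv c' ?z') + ?F' ?z' (?D2 w)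
      = ?D2 (?F z w) + ?J (frechet_derivative (\<lambda>z. ?F z w) (at z) ?h)" .
  have G: "Gam c' (fst ?z') (fst (hv c' ?z')) (?J u) = ?J (Gam c ?x (fst ?h) u) - ?D2 u" for u
    using Gam_transform[OF c q(1,2), of "fst ?h" u] by (simp add: sig fz' q(3))
  have "chart_vpartial c' ?F' ?z' (?J w)
    = frechet_derivative (\<lambda>y. ?F' y (?J w)) (at ?z') (hv c' ?z')
      + (?J (Gam c ?x (fst ?h) (?F z w)) - ?D2 (?F z w)) - ?F' ?z' (?J (Gam c ?x (fst ?h) w) - ?D2 w)"
    by (simp add: chart_vpartial_def G ec_ctrans[OF c z])
  also have "\<dots> = ?J (frechet_derivative (\<lambda>z. ?F z w) (at z) ?h) + ?J (Gam c ?x (fst ?h) (?F z w))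
      - ?J (?F z (Gam c ?x (fst ?h) w))"
    using key by (simp add: linear_diff[OF lF'] ec_ctrans[OF c z] algebra_simps)
  finally show ?thesis
    by (simp add: chart_vpartial_def linear_add[OF lJ] linear_diff[OF lJ])
qed

text \<open>Removes the moving chart from the definition of \<open>vpartial\<close>: the coordinate
  formula holds in one fixed chart at all nearby points, so the result can be differentiated
  again.\<close>

lemma vcoord_vpartial:
  assumes T: "smooth_endo T" and c: "c \<in> atlas M" "fst p \<in> fst c"
  shows "vcoord M c (fst p) (vpartial M nabla T p v)
    = chart_vpartial c (ec T c) (cchart M c p) (vcoord M c (fst p) v)"
proof -
  let ?c = "chart_at M (fst p)"
  let ?z = "cchart M ?c p"
  have zc: "?z \<in> cov2 ?c c"
    using c by (simp add: cchart_def)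
  have ct: "ctrans ?c c ?z = cchart M c p"
  proof -
    have "cchart_inv M c (ctrans ?c c ?z) = p"
      using cchart_inv_ctrans(1)[OF chart_at_atlas c(1) zc] by (simp add: cchart_inv_cchart)
    then show ?thesis
      using cchart_cchart_inv[OF c(1) cchart_inv_ctrans(2)[OF chart_at_atlas c(1) zc]] by simp
  qed
  have J: "jac ?c c (fst ?z) = vcoord M c (fst p)"
    by (simp add: vcoord_eq)
  show ?thesis
    using chart_vpartial_ctrans[OF T chart_at_atlas c(1) zc, of v]
    unfolding ct J vpartial_chart_at by simp
qed

lemma smooth_on_frechet_apply:
  fixes f :: "'a::euclidean_space \<Rightarrow> 'b::real_normed_vector"
  assumes "open U" "smooth_on U f" "smooth_on U g"
  shows "smooth_on U (\<lambda>x. frechet_derivative f (at x) (g x))"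
  by (rule smooth_on_linear_apply[OF assms(1) smooth_on_linear_frechet[OF assms(2)] smooth_on_frechet[OF assms(2)] assms(3)])

lemma smooth_Gam_apply:
  assumes c: "c \<in> atlas M" and f: "smooth_on (cdom c) f" and g: "smooth_on (cdom c) g"
  shows "smooth_on (cdom c) (\<lambda>z. Gam c (fst z) (f z) (g z))"
proof (rule smooth_on_linear_apply[OF open_cdom[OF c] _ _ f])
  show "linear (\<lambda>a. Gam c (fst z) a (g z))" if "z \<in> cdom c" for z
    by (rule Gam_linear_left[OF c]) (use that in auto)
  show "smooth_on (cdom c) (\<lambda>z. Gam c (fst z) b (g z))" for b
  proof (rule smooth_on_linear_apply[OF open_cdom[OF c] _ _ g])
    show "linear (Gam c (fst z) b)" if "z \<in> cdom c" for z
      by (rule Gam_linear_right[OF c]) (use that in auto)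
    show "smooth_on (cdom c) (\<lambda>z. Gam c (fst z) b b')" for b'
      by (rule smooth_on_fst_comp[OF smooth_Gam[OF c] open_chart_image[OF c]])
  qed
qed

lemma smooth_fst_hv: "c \<in> atlas M \<Longrightarrow> smooth_on (cdom c) (\<lambda>z. fst (hv c z))"
  by (rule smooth_on_fst[OF open_cdom smooth_hv])

lemma smooth_endo_vpartial:
  assumes T: "smooth_endo T"
  shows "smooth_endo (vpartial M nabla T)"
  unfolding smooth_endo_def
proof (intro ballI allI conjI)
  fix c assume c: "c \<in> atlas M"
  have e: "ec (vpartial M nabla T) c z w = chart_vpartial c (ec T c) z w" if z: "z \<in> cdom c" for z w
  proof -
    have q: "chart_inv c (fst z) \<in> fst c" using z c by auto
    show ?thesis
      using vcoord_vpartial[OF T c, of "cchart_inv M c z" "vfrom M c (chart_inv c (fst z)) w"] q c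
      by (simp add: ec_def cchart_cchart_inv[OF c z])
  qed
  note lT = smooth_endo_linear[OF T c] and sT = smooth_endo_smooth[OF T c]
  fix z assume z: "z \<in> cdom c"
  have x: "fst z \<in> snd c ` fst c" using z by auto
  have "linear (chart_vpartial c (ec T c) z)"
    unfolding chart_vpartial_def[abs_def]
    by (intro linear_compose_add linear_compose_sub
        linear_frechet_param[OF open_cdom[OF c] z lT smooth_on_differentiable[OF sT z]]
        linear_compose[OF lT[OF z] Gam_linear_right[OF c x], unfolded o_def]
        linear_compose[OF Gam_linear_right[OF c x] lT[OF z], unfolded o_def])
  moreover have "ec (vpartial M nabla T) c z = chart_vpartial c (ec T c) z"
    by (rule ext) (rule e[OF z])
  ultimately show "linear (ec (vpartial M nabla T) c z)" by simp
next
  fix c w assume c: "c \<in> atlas M"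
  note lT = smooth_endo_linear[OF T c] and sT = smooth_endo_smooth[OF T c]
  note o = open_cdom[OF c]
  have e: "ec (vpartial M nabla T) c z w = chart_vpartial c (ec T c) z w" if z: "z \<in> cdom c" for z
  proof -
    have q: "chart_inv c (fst z) \<in> fst c" using z c by auto
    show ?thesis
      using vcoord_vpartial[OF T c, of "cchart_inv M c z" "vfrom M c (chart_inv c (fst z)) w"] q c
      by (simp add: ec_def cchart_cchart_inv[OF c z])
  qed
  have "smooth_on (cdom c) (\<lambda>z. chart_vpartial c (ec T c) z w)"
    unfolding chart_vpartial_def
    by (intro smooth_on_add smooth_on_diff o smooth_on_frechet_apply sT smooth_hv c
        smooth_Gam_apply smooth_fst_hv smooth_on_linear_apply[OF o lT sT] smooth_on_const)
  then show "smooth_on (cdom c) (\<lambda>z. ec (vpartial M nabla T) c z w)"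
    by (rule smooth_on_cong[OF o, THEN iffD1, rotated 1]) (simp add: e)
qed

lemma smooth_endo_add:
  assumes "smooth_endo S" "smooth_endo T"
  shows "smooth_endo (\<lambda>p v. S p v + T p v)"
  unfolding smooth_endo_def
proof (intro ballI allI conjI)
  fix c assume c: "c \<in> atlas M"
  have e: "ec (\<lambda>p v. S p v + T p v) c z w = ec S c z w + ec T c z w" if "z \<in> cdom c" for z w
    using that linear_add[OF linear_vcoord[OF c chart_inv_in[OF c]]] by (auto simp: ec_def)
  show "linear (ec (\<lambda>p v. S p v + T p v) c z)" if z: "z \<in> cdom c" for z
    unfolding e[OF z, abs_def]
    by (intro linear_compose_add smooth_endo_linear[OF assms(1) c z] smooth_endo_linear[OF assms(2) c z])
  show "smooth_on (cdom c) (\<lambda>z. ec (\<lambda>p v. S p v + T p v) c z w)" for w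
    by (rule smooth_on_cong[OF open_cdom[OF c], THEN iffD1, OF _
          smooth_on_add[OF open_cdom[OF c] smooth_endo_smooth[OF assms(1) c] smooth_endo_smooth[OF assms(2) c]]])
      (rule e[symmetric])
qed

lemma smooth_endo_compose:
  assumes "smooth_endo S" "smooth_endo T"
  shows "smooth_endo (\<lambda>p v. S p (T p v))"
  unfolding smooth_endo_def
proof (intro ballI allI conjI)
  fix c assume c: "c \<in> atlas M"
  have e: "ec (\<lambda>p v. S p (T p v)) c z w = ec S c z (ec T c z w)" if "z \<in> cdom c" for z w
    using that c by (auto simp: ec_def)
  show "linear (ec (\<lambda>p v. S p (T p v)) c z)" if z: "z \<in> cdom c" for z
    unfolding e[OF z, abs_def]
    by (rule linear_compose[OF smooth_endo_linear[OF assms(2) c z] smooth_endo_linear[OF assms(1) c z], unfolded o_def])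
  show "smooth_on (cdom c) (\<lambda>z. ec (\<lambda>p v. S p (T p v)) c z w)" for w
    by (rule smooth_on_cong[OF open_cdom[OF c], THEN iffD1, OF _
          smooth_on_linear_apply[OF open_cdom[OF c] smooth_endo_linear[OF assms(1) c]
            smooth_endo_smooth[OF assms(1) c] smooth_endo_smooth[OF assms(2) c]]])
      (auto simp: e)
qed

lemma smooth_endo_twist1: "smooth_endo (twist M nabla (Suc 0))"
  unfolding smooth_endo_def
proof (intro ballI allI conjI)
  fix c assume c: "c \<in> atlas M"
  have e: "ec (twist M nabla (Suc 0)) c z w
      = Gam c (fst z) w (fst (hv c z)) - Gam c (fst z) (fst (hv c z)) w" if z: "z \<in> cdom c" for z w
  proof -
    have q: "chart_inv c (fst z) \<in> fst c" using z c by auto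
    have "snd c (chart_inv c (fst z)) = fst z" using z c by auto
    then show ?thesis
      using torsion_chart[OF c q, of "csharp M (cchart_inv M c z)" "vfrom M c (chart_inv c (fst z)) w"] c q
      by (simp add: ec_def fst_hv[OF c z] linear_neg[OF linear_vcoord])
  qed
  show "linear (ec (twist M nabla (Suc 0)) c z)" if z: "z \<in> cdom c" for z
  proof -
    have x: "fst z \<in> snd c ` fst c" using z by auto
    have "ec (twist M nabla (Suc 0)) c z = (\<lambda>w. Gam c (fst z) w (fst (hv c z)) - Gam c (fst z) (fst (hv c z)) w)"
      by (rule ext) (rule e[OF z])
    then show ?thesis
      using linear_compose_sub[OF Gam_linear_left[OF c x] Gam_linear_right[OF c x]] by simp
  qed
  show "smooth_on (cdom c) (\<lambda>z. ec (twist M nabla (Suc 0)) c z w)" for w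
  proof (rule smooth_on_cong[OF open_cdom[OF c], THEN iffD1])
    show "smooth_on (cdom c) (\<lambda>z. Gam c (fst z) w (fst (hv c z)) - Gam c (fst z) (fst (hv c z)) w)"
      by (intro smooth_on_diff open_cdom c smooth_Gam_apply smooth_fst_hv smooth_on_const)
  qed (rule e[symmetric])
qed

text \<open>The recursion for \<open>twist\<close> has the two base cases 0 and 1, hence the strong
  induction. The step rests on \<open>vpartial\<close> preserving smoothness, the reason for proving
  its chart independence.\<close>

lemma smooth_endo_twist: "smooth_endo (twist M nabla k)"
proof (induction k rule: less_induct)
  case (less k)
  consider "k = 0" | "k = Suc 0" | j where "k = Suc (Suc j)"
    by (metis not0_implies_Suc)
  then show ?case
  proof cases
    case 1
    have e: "ec (twist M nabla 0) c z w = w" if "c \<in> atlas M" "z \<in> cdom c" for c z w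
      using that by (auto simp: ec_def)
    show ?thesis
      unfolding smooth_endo_def 1
    proof (intro ballI conjI allI)
      fix c assume c: "c \<in> atlas M"
      show "linear (ec (twist M nabla 0) c z)" if "z \<in> cdom c" for z
        using e[OF c that] by (intro linearI) simp_all
      show "smooth_on (cdom c) (\<lambda>z. ec (twist M nabla 0) c z w)" for w
        by (rule smooth_on_cong[OF open_cdom[OF c], THEN iffD1, OF _ smooth_on_const[of _ w]]) (simp add: e[OF c])
    qed
  next
    case 2
    show ?thesis unfolding 2 by (rule smooth_endo_twist1)
  next
    case 3
    have s: "smooth_endo (twist M nabla (Suc j))"
      using less 3 by simp
    have "twist M nabla k = (\<lambda>p v. vpartial M nabla (twist M nabla (Suc j)) p v
        + twist M nabla (Suc 0) p (twist M nabla (Suc j) p v))"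
      unfolding 3 by (intro ext) simp
    then show ?thesis
      using smooth_endo_add[OF smooth_endo_vpartial[OF s] smooth_endo_compose[OF smooth_endo_twist1 s]] by simp
  qed
qed

lemma linear_twist: "linear (twist M nabla k p)"
proof -
  let ?c = "chart_at M (fst p)"
  have "twist M nabla k p v = ec (twist M nabla k) ?c (cchart M ?c p) v" for v
    using vcoord_endo[of ?c p "twist M nabla k" v] by simp
  then have "twist M nabla k p = ec (twist M nabla k) ?c (cchart M ?c p)"
    by blast
  then show ?thesis
    using smooth_endo_linear[OF smooth_endo_twist chart_at_atlas cchart_in[OF chart_at_dom]] by metis
qed

end

section \<open>Covariant derivatives along curves\<close>

lemma has_vector_derivative_transform_eventually:
  assumes "(f has_vector_derivative f') (at t within S)"
    and "\<forall>\<^sub>F s in at t within S. f s = g s" "t \<in> S" "f t = g t"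
  shows "(g has_vector_derivative f') (at t within S)"
  using has_derivative_transform_eventually assms unfolding has_vector_derivative_def by blast

context subriemannian_connection
begin

lemma eventually_in_chart:
  assumes "c \<in> atlas M" "(\<gamma> \<longlongrightarrow> \<gamma> t) (at t within J)" "\<gamma> t \<in> fst c"
  shows "\<forall>\<^sub>F s in at t within J. \<gamma> s \<in> fst c"
  using topological_tendstoD[OF assms(2) open_chart[OF assms(1)] assms(3)] .

lemma chart_curve_change:
  assumes c: "c \<in> atlas M" "c' \<in> atlas M" and q: "\<gamma> t \<in> fst c" "\<gamma> t \<in> fst c'"
    and J: "t \<in> J" and cont: "(\<gamma> \<longlongrightarrow> \<gamma> t) (at t within J)"
    and x: "((\<lambda>s. snd c (\<gamma> s)) has_vector_derivative x') (at t within J)"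
  shows "((\<lambda>s. snd c' (\<gamma> s)) has_vector_derivative jac c c' (snd c (\<gamma> t)) x') (at t within J)"
proof (rule has_vector_derivative_transform_eventually[OF _ _ J])
  have "snd c (\<gamma> t) \<in> snd c ` (fst c \<inter> fst c')" using q by blast
  from has_vector_derivative_chain[where f = "transition c c'" and z = "\<lambda>s. snd c (\<gamma> s)", OF smooth_on_differentiable[OF smooth_trans[OF c] this] x]
  show "((\<lambda>s. transition c c' (snd c (\<gamma> s))) has_vector_derivative jac c c' (snd c (\<gamma> t)) x') (at t within J)"
    by (simp add: jac_def)
  show "\<forall>\<^sub>F s in at t within J. transition c c' (snd c (\<gamma> s)) = snd c' (\<gamma> s)"
    using eventually_in_chart[OF c(1) cont q(1)] by eventually_elim (simp add: c)
qed (simp add: c q)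

lemma vcoord_curve_change:
  assumes c: "c \<in> atlas M" "c' \<in> atlas M" and q: "\<gamma> t \<in> fst c" "\<gamma> t \<in> fst c'"
    and J: "t \<in> J" "at t within J \<noteq> bot" and cont: "(\<gamma> \<longlongrightarrow> \<gamma> t) (at t within J)"
    and x: "((\<lambda>s. snd c (\<gamma> s)) has_vector_derivative x') (at t within J)"
    and v: "((\<lambda>s. vcoord M c (\<gamma> s) (V s)) has_vector_derivative v') (at t within J)"
  shows "((\<lambda>s. vcoord M c' (\<gamma> s) (V s)) has_vector_derivative
     frechet_derivative (\<lambda>x. jac c c' x (vcoord M c (\<gamma> t) (V t))) (at (snd c (\<gamma> t))) x'
     + jac c c' (snd c (\<gamma> t)) v') (at t within J)"
proof (rule has_vector_derivative_transform_eventually[OF _ _ J(1)])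
  have xt: "snd c (\<gamma> t) \<in> snd c ` (fst c \<inter> fst c')" using q by blast
  have "\<forall>\<^sub>F y in nhds (snd c (\<gamma> t)). linear (jac c c' y)"
    using eventually_nhds_in_open[OF open_overlap[OF c] xt]
    by eventually_elim (use linear_jac[OF c] in auto)
  then show "((\<lambda>s. jac c c' (snd c (\<gamma> s)) (vcoord M c (\<gamma> s) (V s))) has_vector_derivative
     frechet_derivative (\<lambda>x. jac c c' x (vcoord M c (\<gamma> t) (V t))) (at (snd c (\<gamma> t))) x'
     + jac c c' (snd c (\<gamma> t)) v') (at t within J)"
    by (rule has_vector_derivative_linear_apply[where z = "\<lambda>s. snd c (\<gamma> s)", OF _ J _ x v])
      (rule smooth_on_differentiable[OF smooth_jac[OF c] xt])
  show "\<forall>\<^sub>F s in at t within J. jac c c' (snd c (\<gamma> s)) (vcoord M c (\<gamma> s) (V s)) = vcoord M c' (\<gamma> s) (V s)"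
    using eventually_in_chart[OF c(1) cont q(1)] eventually_in_chart[OF c(2) cont q(2)]
    by eventually_elim (simp add: c jac_vcoord)
qed (simp add: c q jac_vcoord)

text \<open>The definition of \<open>cov_deriv\<close> uses the chart selected at the point. In
  passing to c, the derivative of the Jacobian along the curve cancels the inhomogeneous term in the
  transformation of the Christoffel symbols.\<close>

lemma cov_deriv_chart:
  assumes c: "c \<in> atlas M" and q: "\<gamma> t \<in> fst c"
    and J: "t \<in> J" "at t within J \<noteq> bot" and cont: "(\<gamma> \<longlongrightarrow> \<gamma> t) (at t within J)"
    and x: "((\<lambda>s. snd c (\<gamma> s)) has_vector_derivative x') (at t within J)"
    and v: "((\<lambda>s. vcoord M c (\<gamma> s) (V s)) has_vector_derivative v') (at t within J)"
  shows "vcoord M c (\<gamma> t) (cov_deriv M nabla J \<gamma> V t) = v' + Gam c (snd c (\<gamma> t)) x' (vcoord M c (\<gamma> t) (V t))"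
proof -
  let ?c = "chart_at M (\<gamma> t)" and ?J = "jac c (chart_at M (\<gamma> t)) (snd c (\<gamma> t))"
  have vel: "velocity M J \<gamma> t = ?J x'"
    unfolding velocity_def
    by (rule vector_derivative_within[OF J(2) chart_curve_change[where c' = ?c, OF c _ q _ J(1) cont x]]) auto
  have d: "vector_derivative (\<lambda>s. vcoord M ?c (\<gamma> s) (V s)) (at t within J)
      = frechet_derivative (\<lambda>x. jac c ?c x (vcoord M c (\<gamma> t) (V t))) (at (snd c (\<gamma> t))) x' + ?J v'"
    by (rule vector_derivative_within[OF J(2) vcoord_curve_change[where c' = ?c, OF c _ q _ J cont x v]]) auto
  have lJ: "linear ?J"
    by (rule linear_jac) (use c q in auto)
  have "nabla (\<gamma> t) (?J x') (const_field M ?c (V t)) = Gam ?c (snd ?c (\<gamma> t)) (?J x') (V t)"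
    using vcoord_nabla_const_field[of ?c "\<gamma> t" "?J x'" "V t"] by simp
  also have "\<dots> = ?J (Gam c (snd c (\<gamma> t)) x' (vcoord M c (\<gamma> t) (V t)))
      - frechet_derivative (\<lambda>x. jac c ?c x (vcoord M c (\<gamma> t) (V t))) (at (snd c (\<gamma> t))) x'"
    using Gam_transform[of c ?c "\<gamma> t" x' "vcoord M c (\<gamma> t) (V t)"] c q by (simp add: jac_vcoord)
  finally have "cov_deriv M nabla J \<gamma> V t = ?J (v' + Gam c (snd c (\<gamma> t)) x' (vcoord M c (\<gamma> t) (V t)))"
    by (simp add: cov_deriv_def Let_def vel d linear_add[OF lJ])
  then show ?thesis
    using c q by (simp flip: vfrom_eq)
qed

section \<open>Compatibility of the connection with the distribution and the metric, for local
  sections and for fields along curves\<close>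

lemma smooth_curve_line:
  fixes g :: "'e \<Rightarrow> 'e"
  assumes O: "open O'" and g: "smooth_on O' g" and J: "J = {t \<in> {0..T}. x0 + t *\<^sub>R v \<in> O'}" and T: "0 < T"
    and f: "\<And>t. t \<in> J \<Longrightarrow> f t = g (x0 + t *\<^sub>R v)"
  shows "smooth_curve J f"
proof -
  \<comment> \<open>\<open>J\<close> is relatively open in \<open>{0..T}\<close>, so derivatives
    within \<open>J\<close> are those within the interval and are unique.\<close>
  have at: "at t within J = at t within {0..T}" if "t \<in> J" for t
  proof (rule at_within_nhd)
    show "open ((\<lambda>t. x0 + t *\<^sub>R v) -` O')"
      by (intro open_vimage O continuous_intros)
  qed (use that J in auto)
  have nb: "at t within J \<noteq> bot" if "t \<in> J" for t
  proof -
    have "t \<in> {0..T}" using that J by simp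
    then show ?thesis
      unfolding at[OF that] using T by (simp add: trivial_limit_within islimpt_Icc)
  qed
  have line: "((\<lambda>s. x0 + s *\<^sub>R v) has_vector_derivative v) (at t within J)" for t
    by (auto simp: has_vector_derivative_def intro!: derivative_eq_intros)
  have der: "(f has_vector_derivative frechet_derivative g (at (x0 + t *\<^sub>R v)) v) (at t within J)"
    if g: "smooth_on O' g" and f: "\<And>t. t \<in> J \<Longrightarrow> f t = g (x0 + t *\<^sub>R v)" and t: "t \<in> J" for f g t
  proof (rule has_vector_derivative_transform[OF t])
    have "x0 + t *\<^sub>R v \<in> O'" using t J by simp
    from has_vector_derivative_chain[where z = "\<lambda>s. x0 + s *\<^sub>R v", OF smooth_on_differentiable[OF g this] line]
    show "((\<lambda>s. g (x0 + s *\<^sub>R v)) has_vector_derivative frechet_derivative g (at (x0 + t *\<^sub>R v)) v) (at t within J)" .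
  qed (use f in auto)
  have "\<exists>g. smooth_on O' g \<and> (\<forall>t\<in>J. (vderiv J ^^ k) f t = g (x0 + t *\<^sub>R v))" for k
  proof (induction k)
    case 0
    then show ?case using g f by auto
  next
    case (Suc k)
    then obtain h where h: "smooth_on O' h" "\<And>t. t \<in> J \<Longrightarrow> (vderiv J ^^ k) f t = h (x0 + t *\<^sub>R v)" by blast
    have "(vderiv J ^^ Suc k) f t = frechet_derivative h (at (x0 + t *\<^sub>R v)) v" if "t \<in> J" for t
      using vector_derivative_within[OF nb[OF that] der[OF h that]] by (simp add: vderiv_def)
    then show ?case
      using smooth_on_frechet[OF h(1)] by blast
  qed
  then show ?thesis
    unfolding smooth_curve_def using der differentiableI_vector by blast
qed

text \<open>Differentiate the identity \<open>P x w = w\<close> along the curve: as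
  \<open>w t = 0\<close>, the term with the derivative of \<open>P\<close> drops out, leaving
  \<open>w' = P w'\<close>.\<close>

lemma Ec_vector_derivative:
  assumes c: "c \<in> atlas M" and q: "\<gamma> t \<in> fst c"
    and J: "t \<in> J" "at t within J \<noteq> bot" and cont: "(\<gamma> \<longlongrightarrow> \<gamma> t) (at t within J)"
    and x: "((\<lambda>s. snd c (\<gamma> s)) has_vector_derivative x') (at t within J)"
    and w: "(w has_vector_derivative w') (at t within J)" "w t = 0"
      "\<forall>\<^sub>F s in at t within J. w s \<in> Ec c (snd c (\<gamma> s))"
  shows "w' \<in> Ec c (snd c (\<gamma> t))"
proof -
  obtain U P where U: "open U" "\<gamma> t \<in> U" "U \<subseteq> fst c" and P:
    "\<And>v. smooth_on (snd c ` U) (\<lambda>x. P x v)" "\<And>x. linear (P x)"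
    "\<And>x v. x \<in> snd c ` U \<Longrightarrow> P x v \<in> Ec c x"
    "\<And>x v. x \<in> snd c ` U \<Longrightarrow> v \<in> Ec c x \<Longrightarrow> P x v = v"
    by (rule euclidean_projection[OF c q]) blast
  have xt: "snd c (\<gamma> t) \<in> snd c ` U" using U by blast
  have ev: "\<forall>\<^sub>F s in at t within J. \<gamma> s \<in> U"
    by (rule topological_tendstoD[OF cont U(1,2)])
  have "((\<lambda>s. P (snd c (\<gamma> s)) (w s)) has_vector_derivative
     frechet_derivative (\<lambda>x. P x (w t)) (at (snd c (\<gamma> t))) x' + P (snd c (\<gamma> t)) w') (at t within J)"
    by (rule has_vector_derivative_linear_apply[where z = "\<lambda>s. snd c (\<gamma> s)", OF _ J _ x w(1)])
      (auto simp: P(2) intro: smooth_on_differentiable[OF P(1) xt])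
  moreover have "\<forall>\<^sub>F s in at t within J. P (snd c (\<gamma> s)) (w s) = w s"
    using ev w(3) by eventually_elim (simp add: P(4))
  ultimately have "(w has_vector_derivative
     frechet_derivative (\<lambda>x. P x (w t)) (at (snd c (\<gamma> t))) x' + P (snd c (\<gamma> t)) w') (at t within J)"
    by (rule has_vector_derivative_transform_eventually) (simp_all add: J w(2) linear_0[OF P(2)])
  from vector_derivative_unique_within[OF J(2) w(1) this] have "w' = P (snd c (\<gamma> t)) w'"
    by (simp add: w(2) linear_0[OF P(2)])
  then show ?thesis
    using P(3)[OF xt] by metis
qed

text \<open>Compare the section with the parallel field along a coordinate line that has the same initial
  value: the difference lies in the distribution and vanishes at the initial point.\<close>

lemma nabla_distr:
  assumes U: "open U" "q \<in> U" and Z: "distr_section M U Z"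
  shows "nabla q v Z \<in> distr M q"
proof -
  let ?c = "chart_at M q"
  let ?x0 = "snd ?c q"
  have c: "?c \<in> atlas M" "q \<in> fst ?c" by simp_all
  have Zs: "smooth_vf M U Z" and ZE: "\<And>p. p \<in> U \<Longrightarrow> Z p \<in> distr M p"
    using Z by (auto simp: distr_section_def)
  let ?O = "snd ?c ` (U \<inter> fst ?c)"
  have O: "open ?O" "?x0 \<in> ?O"
    using open_image[OF c(1) U(1)] U c by auto
  have "((\<lambda>t. ?x0 + t *\<^sub>R v) \<longlongrightarrow> ?x0 + 0 *\<^sub>R v) (nhds 0)"
    by (intro tendsto_intros filterlim_ident)
  from topological_tendstoD[OF this O(1)] O(2) have "\<forall>\<^sub>F t in nhds 0. ?x0 + t *\<^sub>R v \<in> ?O"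
    by simp
  then obtain e where e: "e > 0" "\<And>t. dist t 0 < e \<Longrightarrow> ?x0 + t *\<^sub>R v \<in> ?O"
    unfolding eventually_nhds_metric by blast
  \<comment> \<open>Half of the bound, so that the closed interval stays where the coordinate line
    remains in the domain.\<close>
  define T where "T = e / 2"
  have T: "T > 0" "\<And>t. t \<in> {0..T} \<Longrightarrow> ?x0 + t *\<^sub>R v \<in> ?O"
    using e by (auto simp: T_def intro!: e(2))
  have Oc: "x \<in> snd ?c ` fst ?c" if "x \<in> ?O" for x using that by blast
  have l1: "linear (\<lambda>w. - Gam ?c (?x0 + t *\<^sub>R v) v w)" if "t \<in> {0..T}" for t
    by (rule linear_compose_neg[OF Gam_linear_right[OF c(1) Oc[OF T(2)[OF that]]]])
  have l2: "continuous_on {0..T} (\<lambda>t. - Gam ?c (?x0 + t *\<^sub>R v) v b)" for b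
    by (intro continuous_on_minus continuous_on_compose2[OF smooth_on_continuous_on[OF smooth_Gam[OF c(1)]]] continuous_intros)
      (use T(2) Oc in blast)
  obtain \<epsilon> w where w: "0 < \<epsilon>" "\<epsilon> \<le> T" "w 0 = Z q"
    "\<And>t. t \<in> {0..\<epsilon>} \<Longrightarrow> (w has_vector_derivative - Gam ?c (?x0 + t *\<^sub>R v) v (w t)) (at t within {0..\<epsilon>})"
    by (rule linear_ode_exists[of T "\<lambda>t w. - Gam ?c (?x0 + t *\<^sub>R v) v w" "Z q", OF T(1) l1 l2]) blast+
  define \<gamma> where "\<gamma> t = chart_inv ?c (?x0 + t *\<^sub>R v)" for t
  define V where "V t = vfrom M ?c (\<gamma> t) (w t)" for t
  have g: "\<gamma> t \<in> fst ?c" "snd ?c (\<gamma> t) = ?x0 + t *\<^sub>R v" "\<gamma> t \<in> U" if "t \<in> {0..\<epsilon>}" for t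
  proof -
    have "?x0 + t *\<^sub>R v \<in> ?O" using that w(2) by (intro T(2)) auto
    then show "\<gamma> t \<in> fst ?c" "snd ?c (\<gamma> t) = ?x0 + t *\<^sub>R v" "\<gamma> t \<in> U"
      by (auto simp: \<gamma>_def c)
  qed
  have g0: "\<gamma> 0 = q" by (simp add: \<gamma>_def)
  have nb: "at t within {0..\<epsilon>} \<noteq> bot" if "t \<in> {0..\<epsilon>}" for t
    using that w(1) by (simp add: trivial_limit_within islimpt_Icc)
  have contg: "continuous_on {0..\<epsilon>} \<gamma>"
    unfolding \<gamma>_def
    by (rule continuous_on_compose2[OF continuous_chart_inv[OF c(1)]])
      (use T(2) w(2) Oc in \<open>auto intro!: continuous_intros\<close>)
  then have cont: "(\<gamma> \<longlongrightarrow> \<gamma> t) (at t within {0..\<epsilon>})" if "t \<in> {0..\<epsilon>}" for t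
    using that by (simp add: continuous_on_def)
  have gx: "((\<lambda>s. snd ?c (\<gamma> s)) has_vector_derivative v) (at t within {0..\<epsilon>})" if "t \<in> {0..\<epsilon>}" for t
    by (rule has_vector_derivative_transform[OF that, of _ "\<lambda>s. ?x0 + s *\<^sub>R v"])
      (use g(2) in \<open>auto simp: has_vector_derivative_def intro!: derivative_eq_intros\<close>)
  have Vc: "vcoord M ?c (\<gamma> t) (V t) = w t" if "t \<in> {0..\<epsilon>}" for t
    using g(1)[OF that] by (simp add: V_def)
  have gV: "((\<lambda>s. vcoord M ?c (\<gamma> s) (V s)) has_vector_derivative - Gam ?c (?x0 + t *\<^sub>R v) v (w t)) (at t within {0..\<epsilon>})"
    if "t \<in> {0..\<epsilon>}" for t
    by (rule has_vector_derivative_transform[OF that _ w(4)[OF that]]) (use Vc in auto)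
  \<comment> \<open>\<open>compatible\<close> speaks of smooth curves: in every chart the coordinate
    line is a transition map restricted to a segment.\<close>
  have "smooth_curve_in M {0..\<epsilon>} \<gamma>"
    unfolding smooth_curve_in_def
  proof (intro conjI contg ballI)
    fix c' assume c': "c' \<in> atlas M"
    have "{t \<in> {0..\<epsilon>}. \<gamma> t \<in> fst c'} = {t \<in> {0..\<epsilon>}. ?x0 + t *\<^sub>R v \<in> snd ?c ` (fst ?c \<inter> fst c')}"
    proof (intro Collect_cong conj_cong refl)
      fix t assume t: "t \<in> {0..\<epsilon>}"
      have "?x0 + t *\<^sub>R v = snd ?c (\<gamma> t)" using g(2)[OF t] by simp
      then show "\<gamma> t \<in> fst c' \<longleftrightarrow> ?x0 + t *\<^sub>R v \<in> snd ?c ` (fst ?c \<inter> fst c')"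
        using g(1)[OF t] chart_inv_left[OF c(1)] by (auto simp: image_iff) (metis chart_inv_left[OF c(1)])
    qed
    from smooth_curve_line[OF open_overlap[OF c(1) c'] smooth_trans[OF c(1) c'] this w(1), of "\<lambda>t. snd c' (\<gamma> t)"]
    show "smooth_curve {t \<in> {0..\<epsilon>}. \<gamma> t \<in> fst c'} (\<lambda>t. snd c' (\<gamma> t))"
      by (simp add: transition_def \<gamma>_def)
  qed
  moreover have "parallel_along M nabla {0..\<epsilon>} \<gamma> V"
    unfolding parallel_along_def differentiable_along_def
  proof (intro conjI ballI)
    fix t assume t: "t \<in> {0..\<epsilon>}"
    show "(\<lambda>s. vcoord M (chart_at M (\<gamma> t)) (\<gamma> s) (V s)) differentiable at t within {0..\<epsilon>}"
      by (rule differentiableI_vector,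
          rule vcoord_curve_change[where c' = "chart_at M (\<gamma> t)", OF c(1) _ g(1)[OF t] _ t nb[OF t] cont[OF t] gx[OF t] gV[OF t]])
        auto
    have "vcoord M ?c (\<gamma> t) (cov_deriv M nabla {0..\<epsilon>} \<gamma> V t) = 0"
      using cov_deriv_chart[OF c(1) g(1)[OF t] t nb[OF t] cont[OF t] gx[OF t] gV[OF t]] Vc[OF t] g(2)[OF t] by simp
    then show "cov_deriv M nabla {0..\<epsilon>} \<gamma> V t = 0"
      using vfrom_vcoord[OF c(1) g(1)[OF t]] linear_0[OF linear_vfrom[OF c(1) g(1)[OF t]]] by metis
  qed
  moreover have "V 0 \<in> distr M (\<gamma> 0)"
    using ZE[OF U(2)] by (simp add: V_def g0 w(3))
  ultimately have VE: "V t \<in> distr M (\<gamma> t)" if "t \<in> {0..\<epsilon>}" for t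
    using conjunct1[OF compatible[unfolded compatible_def], THEN spec, THEN spec, THEN spec, THEN spec, of 0 \<epsilon> \<gamma> V] w(1) that
    by blast
  have z: "0 \<in> {0..\<epsilon>}" using w(1) by simp
  let ?Z = "vf_coord M ?c Z"
  \<comment> \<open>Derivative at 0 of the parallel field minus \<open>Z\<close> in components; by
    \<open>nabla_chart\<close> it is the negative of the covariant derivative of \<open>Z\<close>
    along v.\<close>
  let ?w' = "- Gam ?c ?x0 v (Z q) - frechet_derivative ?Z (at ?x0) v"
  have "?w' \<in> Ec ?c (snd ?c (\<gamma> 0))"
  proof (rule Ec_vector_derivative[OF c(1) _ z nb[OF z] cont[OF z] gx[OF z]])
    show "\<gamma> 0 \<in> fst ?c" by (rule g(1)[OF z])
    have "((\<lambda>s. ?Z (snd ?c (\<gamma> s))) has_vector_derivative frechet_derivative ?Z (at (snd ?c (\<gamma> 0))) v) (at 0 within {0..\<epsilon>})"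
      by (rule has_vector_derivative_chain[OF smooth_on_differentiable[OF smooth_vf_chartD[OF Zs c(1)]] gx[OF z]])
        (use g0 O(2) in simp)
    moreover have "(w has_vector_derivative - Gam ?c ?x0 v (Z q)) (at 0 within {0..\<epsilon>})"
      using w(4)[OF z] w(3) by simp
    ultimately show "((\<lambda>s. w s - ?Z (snd ?c (\<gamma> s))) has_vector_derivative ?w') (at 0 within {0..\<epsilon>})"
      unfolding g0 by (intro has_vector_derivative_diff)
    show "w 0 - ?Z (snd ?c (\<gamma> 0)) = 0"
      by (simp add: w(3) g0 vf_coord_def)
    show "\<forall>\<^sub>F s in at 0 within {0..\<epsilon>}. w s - ?Z (snd ?c (\<gamma> s)) \<in> Ec ?c (snd ?c (\<gamma> s))"
      unfolding eventually_at_filter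
    proof (rule eventuallyI, intro impI)
      fix s assume s: "s \<in> {0..\<epsilon>}"
      note gs = g(1)[OF s]
      have "w s - ?Z (snd ?c (\<gamma> s)) = vcoord M ?c (\<gamma> s) (V s) - vcoord M ?c (\<gamma> s) (Z (\<gamma> s))"
        using gs by (simp add: Vc[OF s] vf_coord_def)
      also have "\<dots> \<in> Ec ?c (snd ?c (\<gamma> s))"
        by (rule subspace_diff[OF subspace_Ec[OF c(1)]])
          (use gs VE[OF s] ZE[OF g(3)[OF s]] in \<open>auto simp: Ec_iff\<close>)
      finally show "w s - ?Z (snd ?c (\<gamma> s)) \<in> Ec ?c (snd ?c (\<gamma> s))" .
    qed
  qed
  then have "?w' \<in> distr M q"
    by (simp add: g0 Ec_iff'[OF c])
  then have "- ?w' \<in> distr M q"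
    by (rule subspace_neg[OF subspace_distr])
  moreover have "nabla q v Z = - ?w'"
    using nabla_chart[OF c U Zs, of v] by simp
  ultimately show ?thesis by simp
qed

lemma compatible_metric:
  "open U \<Longrightarrow> distr_section M U X \<Longrightarrow> distr_section M U Y \<Longrightarrow> q \<in> U \<Longrightarrow>
    dfun M (\<lambda>x. gmet M x (X x) (Y x)) q v = gmet M q (nabla q v X) (Y q) + gmet M q (X q) (nabla q v Y)"
  using conjunct2[OF compatible[unfolded compatible_def], THEN spec, THEN spec, THEN spec, of U X Y] by blast

text \<open>A field along the curve need not be the restriction of a local section, to which
  \<open>compatible\<close> refers. So its value at t is extended to the section with components
  \<open>P x u\<close>; the remaining change of the field lies in the image of \<open>P\<close> and
  enters both sides only algebraically.\<close>

lemma cov_deriv_metric: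
  assumes c: "c \<in> atlas M" and q: "\<gamma> t \<in> fst c"
    and J: "t \<in> J" "at t within J \<noteq> bot" and cont: "(\<gamma> \<longlongrightarrow> \<gamma> t) (at t within J)"
    and x: "((\<lambda>s. snd c (\<gamma> s)) has_vector_derivative x') (at t within J)"
    and v: "((\<lambda>s. vcoord M c (\<gamma> s) (V s)) has_vector_derivative v') (at t within J)"
    and w: "((\<lambda>s. vcoord M c (\<gamma> s) (W s)) has_vector_derivative w') (at t within J)"
    and E: "\<And>s. s \<in> J \<Longrightarrow> V s \<in> distr M (\<gamma> s)" "\<And>s. s \<in> J \<Longrightarrow> W s \<in> distr M (\<gamma> s)"
  shows "cov_deriv M nabla J \<gamma> V t \<in> distr M (\<gamma> t)"
    and "((\<lambda>s. gmet M (\<gamma> s) (V s) (W s)) has_vector_derivative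
      gmet M (\<gamma> t) (cov_deriv M nabla J \<gamma> V t) (W t) + gmet M (\<gamma> t) (V t) (cov_deriv M nabla J \<gamma> W t)) (at t within J)"
proof -
  let ?q = "\<gamma> t" and ?x = "snd c (\<gamma> t)"
  obtain U P where U: "open U" "?q \<in> U" "U \<subseteq> fst c" and P:
    "\<And>v. smooth_on (snd c ` U) (\<lambda>x. P x v)" "\<And>x. linear (P x)"
    "\<And>x v. x \<in> snd c ` U \<Longrightarrow> P x v \<in> Ec c x"
    "\<And>x v. x \<in> snd c ` U \<Longrightarrow> v \<in> Ec c x \<Longrightarrow> P x v = v"
    by (rule euclidean_projection[OF c q]) blast
  have xU: "?x \<in> snd c ` U" using U by blast
  have xc: "?x \<in> snd c ` fst c" using q by blast
  have oU: "open (snd c ` U)" by (rule open_image'[OF c U(1,3)])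
  have ev: "\<forall>\<^sub>F s in at t within J. \<gamma> s \<in> U \<and> s \<in> J"
    using topological_tendstoD[OF cont U(1,2)] by (auto simp: eventually_at_filter elim: eventually_mono)
  \<comment> \<open>For u in the fibre at t, \<open>N u\<close> below gives the components of the
    covariant derivative, along the velocity, of the section with components
    \<open>P x u\<close>.\<close>
  define DP where "DP u = frechet_derivative (\<lambda>x. P x u) (at ?x) x'" for u
  define N where "N u = DP u + Gam c ?x x' u" for u
  note sE = subspace_Ec[OF c xc]
  have sec: "distr_section M U (vfld c (\<lambda>x. P x u))" for u
    unfolding distr_section_def
  proof (intro conjI ballI)
    show "smooth_vf M U (vfld c (\<lambda>x. P x u))"
      by (rule smooth_vfld[OF c U(1,3) P(1)])
    fix p assume "p \<in> U"
    then show "vfld c (\<lambda>x. P x u) p \<in> distr M p"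
      using P(3)[of "snd c p" u] U(3) c by (auto simp: vfld_def Ec_iff' subset_iff)
  qed
  let ?xi = "vfrom M c ?q x'"
  have nab: "vcoord M c ?q (nabla ?q ?xi (vfld c (\<lambda>x. P x u))) = N u" if "u \<in> Ec c ?x" for u
    using nabla_vfld[OF c U(1,3,2) P(1), of ?xi u] c q by (simp add: N_def DP_def P(4)[OF xU that])
  have NE: "N u \<in> Ec c ?x" if "u \<in> Ec c ?x" for u
    unfolding nab[OF that, symmetric] Ec_iff[OF c q] by (rule nabla_distr[OF U(1,2) sec])
  \<comment> \<open>Differentiating \<open>P x F = F\<close> along the curve splits the covariant
    derivative of a field into that of the extended section and the projected component derivative.
    Both summands lie in the distribution.\<close>
  have split: "f' + Gam c ?x x' (vcoord M c ?q (F t)) = N (vcoord M c ?q (F t)) + P ?x f'"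
    if f: "((\<lambda>s. vcoord M c (\<gamma> s) (F s)) has_vector_derivative f') (at t within J)"
      and FE: "\<And>s. s \<in> J \<Longrightarrow> F s \<in> distr M (\<gamma> s)" for F f'
  proof -
    have "((\<lambda>s. P (snd c (\<gamma> s)) (vcoord M c (\<gamma> s) (F s))) has_vector_derivative
       DP (vcoord M c ?q (F t)) + P ?x f') (at t within J)"
      unfolding DP_def
      by (rule has_vector_derivative_linear_apply[where z = "\<lambda>s. snd c (\<gamma> s)", OF _ J _ x f])
        (auto simp: P(2) intro: smooth_on_differentiable[OF P(1) xU])
    moreover have "\<forall>\<^sub>F s in at t within J. P (snd c (\<gamma> s)) (vcoord M c (\<gamma> s) (F s)) = vcoord M c (\<gamma> s) (F s)"
      using ev
    proof eventually_elim
      fix s assume s: "\<gamma> s \<in> U \<and> s \<in> J"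
      then have "\<gamma> s \<in> fst c" using U by blast
      then show "P (snd c (\<gamma> s)) (vcoord M c (\<gamma> s) (F s)) = vcoord M c (\<gamma> s) (F s)"
        using s FE[of s] c by (intro P(4)) (auto simp: Ec_iff)
    qed
    moreover have "P ?x (vcoord M c ?q (F t)) = vcoord M c ?q (F t)"
      using FE[OF J(1)] by (intro P(4) xU) (simp add: Ec_iff c q)
    ultimately have "((\<lambda>s. vcoord M c (\<gamma> s) (F s)) has_vector_derivative DP (vcoord M c ?q (F t)) + P ?x f') (at t within J)"
      by (rule has_vector_derivative_transform_eventually[OF _ _ J(1)])
    from vector_derivative_unique_within[OF J(2) f this] show ?thesis
      by (simp add: N_def)
  qed
  note cV = cov_deriv_chart[OF c q J cont x v] and cW = cov_deriv_chart[OF c q J cont x w]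
  let ?v = "vcoord M c ?q (V t)" and ?w = "vcoord M c ?q (W t)"
  have sV: "v' + Gam c ?x x' ?v = N ?v + P ?x v'"
    by (rule split[OF v E(1)])
  have sW: "w' + Gam c ?x x' ?w = N ?w + P ?x w'"
    by (rule split[OF w E(2)])
  have vE: "?v \<in> Ec c ?x" "?w \<in> Ec c ?x"
    using E J by (simp_all add: Ec_iff c q)
  have DE: "vcoord M c ?q (cov_deriv M nabla J \<gamma> V t) \<in> Ec c ?x" "vcoord M c ?q (cov_deriv M nabla J \<gamma> W t) \<in> Ec c ?x"
    unfolding cV cW sV sW
    using subspace_add[OF sE NE[OF vE(1)] P(3)[OF xU]] subspace_add[OF sE NE[OF vE(2)] P(3)[OF xU]] by blast+
  then show "cov_deriv M nabla J \<gamma> V t \<in> distr M ?q"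
    by (simp add: Ec_iff c q)
  \<comment> \<open>Composing with the projection extends the metric bilinearly to all vectors, so
    that the product rules for linear families apply.\<close>
  define G where "G x a b = Gc c x (P x a) (P x b)" for x a b
  have lG: "linear (\<lambda>a. G x a b)" "linear (\<lambda>a. G x b a)" if "x \<in> snd c ` U" for x b
  proof -
    have xc: "x \<in> snd c ` fst c" using that U by blast
    note PE = P(3)[OF that] and ax = Gc_axioms[OF c xc]
    show 1: "linear (\<lambda>a. G x a b)"
      unfolding G_def by (rule linearI) (simp_all add: linear_add[OF P(2)] linear_cmul[OF P(2)] ax(2)[OF PE PE PE] ax(3)[OF PE PE])
    have "(\<lambda>a. G x b a) = (\<lambda>a. G x a b)"
      unfolding G_def using ax(1)[OF PE PE] by blast
    then show "linear (\<lambda>a. G x b a)" using 1 by simp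
  qed
  have sG: "smooth_on (snd c ` U) (\<lambda>x. G x a b)" for a b
    unfolding G_def by (rule Gc_smooth[OF c U(1,3) P(1) P(3) P(1) P(3)])
  have nG: "\<forall>\<^sub>F y in nhds ?x. linear (G y a)" for a
    using eventually_nhds_in_open[OF oU xU] by eventually_elim (use lG(2) in simp)
  have evx: "\<forall>\<^sub>F s in at t within J. snd c (\<gamma> s) \<in> snd c ` U"
    using ev by eventually_elim blast
  define DG where "DG a b = frechet_derivative (\<lambda>x. G x a b) (at ?x) x'" for a b
  have 1: "((\<lambda>s. G (snd c (\<gamma> s)) a (vcoord M c (\<gamma> s) (W s))) has_vector_derivative DG a ?w + G ?x a w') (at t within J)" for a
    unfolding DG_def
    by (rule has_vector_derivative_linear_apply[where z = "\<lambda>s. snd c (\<gamma> s)", OF nG J _ x w])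
      (rule smooth_on_differentiable[OF sG xU])
  have 2: "((\<lambda>s. G (snd c (\<gamma> s)) (vcoord M c (\<gamma> s) (V s)) (vcoord M c (\<gamma> s) (W s))) has_vector_derivative
      (DG ?v ?w + G ?x ?v w') + G ?x v' ?w) (at t within J)"
    by (rule has_vector_derivative_linear_family[where L = "\<lambda>s a. G (snd c (\<gamma> s)) a (vcoord M c (\<gamma> s) (W s))", OF _ _ J 1 v])
      (use evx lG(1) xU in \<open>auto elim: eventually_mono\<close>)
  have DG: "DG a b = Gc c ?x (N a) b + Gc c ?x a (N b)" if ab: "a \<in> Ec c ?x" "b \<in> Ec c ?x" for a b
  proof -
    let ?X = "vfld c (\<lambda>x. P x a)" and ?Y = "vfld c (\<lambda>x. P x b)"
    have X: "vcoord M c ?q (?X ?q) = a" "vcoord M c ?q (?Y ?q) = b"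
      using c q by (simp_all add: vfld_def P(4)[OF xU ab(1)] P(4)[OF xU ab(2)])
    have "frechet_derivative (\<lambda>x. gmet M (chart_inv c x) (?X (chart_inv c x)) (?Y (chart_inv c x))) (at ?x)
        = frechet_derivative (\<lambda>x. G x a b) (at ?x)"
      by (rule frechet_derivative_transform_within_open[OF _ oU xU, symmetric])
        (use smooth_on_differentiable[OF sG xU] U(3) c in \<open>auto simp: G_def Gc_def vfld_def subset_iff\<close>)
    then have "DG a b = dfun M (\<lambda>x. gmet M x (?X x) (?Y x)) ?q ?xi"
      unfolding DG_def using dfun_chart[OF gmet_smooth[OF U(1) sec sec] U(1,2) c q, of a b ?xi] c q by simp
    also have "\<dots> = gmet M ?q (nabla ?q ?xi ?X) (?Y ?q) + gmet M ?q (?X ?q) (nabla ?q ?xi ?Y)"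
      by (rule compatible_metric[OF U(1) sec sec U(2)])
    also have "\<dots> = Gc c ?x (N a) b + Gc c ?x a (N b)"
      unfolding Gc_vcoord[OF c q, symmetric] nab[OF ab(1)] nab[OF ab(2)] X ..
    finally show ?thesis .
  qed
  note ax = Gc_axioms[OF c xc]
  have Gp: "G ?x v' ?w = Gc c ?x (P ?x v') ?w" "G ?x ?v w' = Gc c ?x ?v (P ?x w')"
    by (simp_all add: G_def P(4)[OF xU] vE)
  have "(DG ?v ?w + G ?x ?v w') + G ?x v' ?w
      = Gc c ?x (N ?v + P ?x v') ?w + Gc c ?x ?v (N ?w + P ?x w')"
  proof -
    have "Gc c ?x (N ?v + P ?x v') ?w = Gc c ?x (N ?v) ?w + Gc c ?x (P ?x v') ?w"
      by (rule ax(2)[OF NE[OF vE(1)] P(3)[OF xU] vE(2)])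
    moreover have "Gc c ?x ?v (N ?w + P ?x w') = Gc c ?x ?v (N ?w) + Gc c ?x ?v (P ?x w')"
      using ax(2)[OF NE[OF vE(2)] P(3)[OF xU] vE(1), of w']
        ax(1)[OF vE(1) subspace_add[OF sE NE[OF vE(2)] P(3)[OF xU]], of w'] ax(1)[OF vE(1) NE[OF vE(2)]]
        ax(1)[OF vE(1) P(3)[OF xU], of w'] by simp
    ultimately show ?thesis by (simp add: DG[OF vE] Gp)
  qed
  also have "\<dots> = gmet M ?q (cov_deriv M nabla J \<gamma> V t) (W t) + gmet M ?q (V t) (cov_deriv M nabla J \<gamma> W t)"
    unfolding Gc_vcoord[OF c q, symmetric] cV cW sV sW ..
  finally have 3: "((\<lambda>s. G (snd c (\<gamma> s)) (vcoord M c (\<gamma> s) (V s)) (vcoord M c (\<gamma> s) (W s))) has_vector_derivative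
      gmet M ?q (cov_deriv M nabla J \<gamma> V t) (W t) + gmet M ?q (V t) (cov_deriv M nabla J \<gamma> W t)) (at t within J)"
    using 2 by simp
  have Geq: "G (snd c (\<gamma> s)) (vcoord M c (\<gamma> s) (V s)) (vcoord M c (\<gamma> s) (W s)) = gmet M (\<gamma> s) (V s) (W s)"
    if s: "\<gamma> s \<in> U" "s \<in> J" for s
  proof -
    have gs: "\<gamma> s \<in> fst c" using s U by blast
    have "P (snd c (\<gamma> s)) (vcoord M c (\<gamma> s) (V s)) = vcoord M c (\<gamma> s) (V s)"
      "P (snd c (\<gamma> s)) (vcoord M c (\<gamma> s) (W s)) = vcoord M c (\<gamma> s) (W s)"
      using s gs E[OF s(2)] by (auto intro!: P(4) simp: Ec_iff c)
    then show ?thesis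
      by (simp add: G_def Gc_vcoord[OF c gs])
  qed
  show "((\<lambda>s. gmet M (\<gamma> s) (V s) (W s)) has_vector_derivative
      gmet M ?q (cov_deriv M nabla J \<gamma> V t) (W t) + gmet M ?q (V t) (cov_deriv M nabla J \<gamma> W t)) (at t within J)"
  proof (rule has_vector_derivative_transform_eventually[OF 3 _ J(1)])
    show "\<forall>\<^sub>F s in at t within J. G (snd c (\<gamma> s)) (vcoord M c (\<gamma> s) (V s)) (vcoord M c (\<gamma> s) (W s)) = gmet M (\<gamma> s) (V s) (W s)"
      using ev by eventually_elim (use Geq in blast)
    show "G ?x ?v ?w = gmet M ?q (V t) (W t)"
      by (rule Geq[OF U(2) J(1)])
  qed
qed

end

section \<open>The Young diagram\<close>

lemma at_within_interval_nontrivial: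
  fixes I :: "real set"
  assumes "is_interval I" "interior I \<noteq> {}" "t \<in> I"
  shows "at t within I \<noteq> bot"
proof -
  have "\<nexists>x. I = {x}"
  proof
    assume "\<exists>x. I = {x}"
    then show False using assms(2) by (auto simp: interior_singleton)
  qed
  then show ?thesis
    using connected_imp_perfect[OF is_interval_connected[OF assms(1)] assms(3)]
    by (simp add: trivial_limit_within)
qed

definition admissible :: "('m::{second_countable_topology,t2_space}, 'e::euclidean_space) subriem \<Rightarrow> real set \<Rightarrow>
    (real \<Rightarrow> 'm \<times> 'e) \<Rightarrow> (real \<Rightarrow> 'e \<times> 'e) \<Rightarrow> bool" where
  "admissible M I lam z \<longleftrightarrow> smooth_curve I z \<and> (\<forall>\<tau>\<in>I. z \<tau> \<in> jacobi_curve M lam \<tau>)"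

lemma jacobi_flag_eq:
  "jacobi_flag M I lam i t = span {(vderiv I ^^ j) z t |j z. j \<le> i \<and> admissible M I lam z}"
  by (simp add: jacobi_flag_def admissible_def)

lemma jacobi_flag_base:
  "j \<le> i \<Longrightarrow> admissible M I lam z \<Longrightarrow> (vderiv I ^^ j) z t \<in> jacobi_flag M I lam i t"
  unfolding jacobi_flag_eq by (rule span_base) blast

lemma subspace_jacobi_flag: "subspace (jacobi_flag M I lam i t)"
  by (simp add: jacobi_flag_eq)

lemma jacobi_flag_mono: "i \<le> k \<Longrightarrow> jacobi_flag M I lam i t \<subseteq> jacobi_flag M I lam k t"
  unfolding jacobi_flag_eq by (rule span_mono) (auto intro: order_trans)

lemma admissible_derivative:
  assumes "admissible M I lam z" "t \<in> I" "at t within I \<noteq> bot"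
  shows "((vderiv I ^^ j) z has_vector_derivative (vderiv I ^^ Suc j) z t) (at t within I)"
  using assms unfolding admissible_def smooth_curve_def
  by (simp add: vderiv_def vector_derivative_works)

text \<open>A section of the flag that vanishes at \<open>t\<close> has its derivative at \<open>t\<close> in the flag, because the
  dimension of the flag is constant.\<close>

lemma flag_vector_derivative:
  assumes I: "is_interval I" "interior I \<noteq> {}" "t \<in> I" and eq: "equiregular M I lam"
    and w: "(w has_vector_derivative w') (at t within I)" "w t = 0" "\<And>s. s \<in> I \<Longrightarrow> w s \<in> jacobi_flag M I lam i s"
  shows "w' \<in> jacobi_flag M I lam i t"
proof -
  note nb = at_within_interval_nontrivial[OF I]
  obtain B where B: "B \<subseteq> {(vderiv I ^^ j) z t |j z. j \<le> i \<and> admissible M I lam z}" "independent B"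
      "{(vderiv I ^^ j) z t |j z. j \<le> i \<and> admissible M I lam z} \<subseteq> span B"
    using maximal_independent_subset by blast
  have spB: "span B = jacobi_flag M I lam i t"
    unfolding jacobi_flag_eq using B by (metis (no_types, lifting) span_mono span_span subset_antisym)
  have fB: "finite B" using B(2) independent_imp_finite by blast
  have "\<forall>b\<in>B. \<exists>j z. b = (vderiv I ^^ j) z t \<and> j \<le> i \<and> admissible M I lam z"
    using B(1) by blast
  then obtain j z where jz: "\<And>b. b \<in> B \<Longrightarrow> b = (vderiv I ^^ j b) (z b) t"
      "\<And>b. b \<in> B \<Longrightarrow> j b \<le> i" "\<And>b. b \<in> B \<Longrightarrow> admissible M I lam (z b)"
    by metis
  define Y where "Y b s = (vderiv I ^^ j b) (z b) s" for b s
  have Yt: "Y b t = b" if "b \<in> B" for b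
    using jz(1)[OF that] by (simp add: Y_def)
  have im: "(\<lambda>b. Y b t) ` B = B" using Yt by force
  have inj: "inj_on (\<lambda>b. Y b t) B" using Yt by (simp add: inj_on_def)
  have Yc: "(Y b \<longlongrightarrow> Y b t) (at t within I)" if "b \<in> B" for b
  proof -
    have "(Y b has_vector_derivative (vderiv I ^^ Suc (j b)) (z b) t) (at t within I)"
      unfolding Y_def[abs_def] by (rule admissible_derivative[OF jz(3)[OF that] I(3) nb])
    then show ?thesis
      using has_vector_derivative_continuous continuous_within by blast
  qed
  have "\<forall>\<^sub>F s in at t within I. inj_on (\<lambda>b. Y b s) B \<and> independent ((\<lambda>b. Y b s) ` B)"
    by (rule eventually_independent[OF fB inj]) (use im B(2) Yc in auto)
  moreover have "\<forall>\<^sub>F s in at t within I. s \<in> I"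
    by (simp add: eventually_at_filter)
  ultimately have "\<forall>\<^sub>F s in at t within I. w s \<in> span ((\<lambda>b. Y b s) ` B)"
  proof eventually_elim
    fix s assume s: "inj_on (\<lambda>b. Y b s) B \<and> independent ((\<lambda>b. Y b s) ` B)" "s \<in> I"
    have sub: "(\<lambda>b. Y b s) ` B \<subseteq> jacobi_flag M I lam i s"
      using jz by (auto simp: Y_def intro!: jacobi_flag_base)
    have "dim (span ((\<lambda>b. Y b s) ` B)) = card B"
      using s(1) by (simp add: dim_eq_card_independent card_image)
    also have "\<dots> = dim (jacobi_flag M I lam i t)"
      unfolding spB[symmetric] using B(2) by (simp add: dim_eq_card_independent)
    also have "\<dots> = dim (jacobi_flag M I lam i s)"
      using eq I(3) s(2) unfolding equiregular_def by blast
    finally have "span ((\<lambda>b. Y b s) ` B) = jacobi_flag M I lam i s"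
      using subspace_dim_equal[OF subspace_span subspace_jacobi_flag span_minimal[OF sub subspace_jacobi_flag]] by simp
    then show "w s \<in> span ((\<lambda>b. Y b s) ` B)"
      using w(3)[OF s(2)] by simp
  qed
  from vector_derivative_in_span[OF fB inj _ Yc w(1,2) this nb] show ?thesis
    unfolding im spB using B(2) by blast
qed

text \<open>The combination agrees at t with one of generators of order at most k. Their difference
  vanishes at t, so its derivative stays in the flag of order k + 1, and so do the derivatives of
  those generators. In other words, differentiation induces a map between successive quotients of
  the flag.\<close>

lemma flag_derivative_combination:
  assumes I: "is_interval I" "interior I \<noteq> {}" "t \<in> I" and eq: "equiregular M I lam"
    and z: "\<And>b. b \<in> D \<Longrightarrow> admissible M I lam (z b)"
    and c: "(\<Sum>b\<in>D. c b *\<^sub>R (vderiv I ^^ Suc k) (z b) t) \<in> jacobi_flag M I lam k t"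
  shows "(\<Sum>b\<in>D. c b *\<^sub>R (vderiv I ^^ Suc (Suc k)) (z b) t) \<in> jacobi_flag M I lam (Suc k) t"
proof -
  note nb = at_within_interval_nontrivial[OF I]
  let ?G = "{(vderiv I ^^ j) z t |j z. j \<le> k \<and> admissible M I lam z}"
  obtain A r where A: "finite A" "A \<subseteq> ?G" "(\<Sum>b\<in>D. c b *\<^sub>R (vderiv I ^^ Suc k) (z b) t) = (\<Sum>v\<in>A. r v *\<^sub>R v)"
    using c unfolding jacobi_flag_eq span_explicit by blast
  have "\<forall>b\<in>A. \<exists>j z. b = (vderiv I ^^ j) z t \<and> j \<le> k \<and> admissible M I lam z"
    using A(2) by blast
  then obtain j y where jy: "\<And>b. b \<in> A \<Longrightarrow> b = (vderiv I ^^ j b) (y b) t"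
      "\<And>b. b \<in> A \<Longrightarrow> j b \<le> k" "\<And>b. b \<in> A \<Longrightarrow> admissible M I lam (y b)"
    by metis
  let ?z' = "\<Sum>b\<in>D. c b *\<^sub>R (vderiv I ^^ Suc (Suc k)) (z b) t"
  let ?y' = "\<Sum>v\<in>A. r v *\<^sub>R (vderiv I ^^ Suc (j v)) (y v) t"
  have scal: "((\<lambda>s. a *\<^sub>R f s) has_vector_derivative a *\<^sub>R f') (at t within I)"
    if "(f has_vector_derivative f') (at t within I)" for a and f :: "real \<Rightarrow> 'b \<times> 'b" and f'
    using bounded_linear.has_vector_derivative[OF bounded_linear_scaleR_right that] .
  have "?z' - ?y' \<in> jacobi_flag M I lam (Suc k) t"
  proof (rule flag_vector_derivative[OF I eq])
    show "((\<lambda>s. (\<Sum>b\<in>D. c b *\<^sub>R (vderiv I ^^ Suc k) (z b) s) - (\<Sum>v\<in>A. r v *\<^sub>R (vderiv I ^^ j v) (y v) s))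
        has_vector_derivative ?z' - ?y') (at t within I)"
      by (intro has_vector_derivative_diff has_vector_derivative_sum scal admissible_derivative[where M = M and lam = lam] I nb z jy)
    have "(\<Sum>v\<in>A. r v *\<^sub>R v) = (\<Sum>v\<in>A. r v *\<^sub>R (vderiv I ^^ j v) (y v) t)"
      by (rule sum.cong) (use jy(1) in auto)
    then show "(\<Sum>b\<in>D. c b *\<^sub>R (vderiv I ^^ Suc k) (z b) t) - (\<Sum>v\<in>A. r v *\<^sub>R (vderiv I ^^ j v) (y v) t) = 0"
      using A(3) by simp
    show "(\<Sum>b\<in>D. c b *\<^sub>R (vderiv I ^^ Suc k) (z b) s) - (\<Sum>v\<in>A. r v *\<^sub>R (vderiv I ^^ j v) (y v) s)
        \<in> jacobi_flag M I lam (Suc k) s" for s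
      by (intro subspace_diff subspace_sum subspace_scale subspace_jacobi_flag jacobi_flag_base z jy)
        (use jy(2) in \<open>auto intro: le_SucI\<close>)
  qed
  moreover have "?y' \<in> jacobi_flag M I lam (Suc k) t"
    by (intro subspace_sum subspace_scale subspace_jacobi_flag jacobi_flag_base jy) (use jy(2) in auto)
  ultimately show ?thesis
    using subspace_add[OF subspace_jacobi_flag] by fastforce
qed

text \<open>That induced map is onto the next quotient, whence the inequality of dimensions.
  Quotient spaces are avoided: derivatives of order k + 2 that extend a basis of flag k + 1 are
  lowered by one order, and the lowered vectors are shown independent modulo flag k.\<close>

lemma dcol_Suc_le:
  fixes M :: "('m::{second_countable_topology,t2_space}, 'e::euclidean_space) subriem"
  assumes I: "is_interval I" "interior I \<noteq> {}" "0 \<in> I" and eq: "equiregular M I lam"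
  shows "dcol M I lam (Suc (Suc k)) \<le> dcol M I lam (Suc k)"
proof -
  let ?F = "\<lambda>i. jacobi_flag M I lam i 0"
  let ?D = "{(vderiv I ^^ Suc (Suc k)) z 0 |z. admissible M I lam z}"
  obtain B1 where B1: "B1 \<subseteq> ?F (Suc k)" "independent B1" "?F (Suc k) \<subseteq> span B1" "card B1 = dim (?F (Suc k))"
    using basis_exists by blast
  have sp1: "span B1 = ?F (Suc k)"
    using B1 by (metis span_minimal subset_antisym subspace_jacobi_flag)
  obtain B where B: "B1 \<subseteq> B" "B \<subseteq> B1 \<union> ?D" "independent B" "B1 \<union> ?D \<subseteq> span B"
    using maximal_independent_subset_extend[of B1 "B1 \<union> ?D"] B1(2) by blast
  have fin: "finite B" using B(3) independent_imp_finite by blast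
  have "{(vderiv I ^^ j) z 0 |j z. j \<le> Suc (Suc k) \<and> admissible M I lam z} \<subseteq> span B"
  proof
    fix v assume "v \<in> {(vderiv I ^^ j) z 0 |j z. j \<le> Suc (Suc k) \<and> admissible M I lam z}"
    then obtain j z where jz: "v = (vderiv I ^^ j) z 0" "j \<le> Suc (Suc k)" "admissible M I lam z" by blast
    show "v \<in> span B"
    proof (cases "j = Suc (Suc k)")
      case True
      then show ?thesis using jz B(4) by blast
    next
      case False
      then have "v \<in> span B1"
        using jz jacobi_flag_base[of j "Suc k" M I lam z 0] by (simp add: sp1)
      then show ?thesis using span_mono[OF B(1)] by blast
    qed
  qed
  then have "?F (Suc (Suc k)) \<subseteq> span B"
    unfolding jacobi_flag_eq by (simp add: span_minimal)
  moreover have "B \<subseteq> ?F (Suc (Suc k))"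
  proof
    fix v assume "v \<in> B"
    then have "v \<in> B1 \<or> v \<in> ?D" using B(2) by blast
    then show "v \<in> ?F (Suc (Suc k))"
    proof
      assume "v \<in> B1"
      then show ?thesis
        using B1(1) jacobi_flag_mono[of "Suc k" "Suc (Suc k)" M I lam 0, OF le_SucI[OF order_refl]] by blast
    next
      assume "v \<in> ?D"
      then show ?thesis
        using jacobi_flag_base[of "Suc (Suc k)" "Suc (Suc k)" M I lam _ 0] by fastforce
    qed
  qed
  ultimately have dim2: "dim (?F (Suc (Suc k))) = card B"
    using B(3) basis_card_eq_dim by metis
  define D where "D = B - B1"
  have fD: "finite D" using fin by (simp add: D_def)
  have cD: "card B = card B1 + card D"
    using B(1) fin by (simp add: D_def card_Diff_subset finite_subset card_mono)
  have "\<forall>b\<in>D. \<exists>z. b = (vderiv I ^^ Suc (Suc k)) z 0 \<and> admissible M I lam z"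
    using B(2) by (auto simp: D_def)
  then obtain z where z: "\<And>b. b \<in> D \<Longrightarrow> b = (vderiv I ^^ Suc (Suc k)) (z b) 0"
      "\<And>b. b \<in> D \<Longrightarrow> admissible M I lam (z b)"
    by metis
  obtain B0 where B0: "B0 \<subseteq> ?F k" "independent B0" "?F k \<subseteq> span B0" "card B0 = dim (?F k)"
    using basis_exists by blast
  have fB0: "finite B0" using B0(2) independent_imp_finite by blast
  \<comment> \<open>A basis of flag k together with the lowered derivatives of order k + 1. The
    disjoint sum keeps the indices apart even if vectors should coincide.\<close>
  define f where "f = case_sum (\<lambda>v. v) (\<lambda>b. (vderiv I ^^ Suc k) (z b) 0)"
  let ?K = "B0 <+> D"
  have fK: "finite ?K" using fB0 fD by simp
  have "inj_on f ?K \<and> independent (f ` ?K)"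
    unfolding indexed_independent_iff[OF fK]
  proof (intro allI impI)
    fix c assume "(\<Sum>i\<in>?K. c i *\<^sub>R f i) = 0"
    then have sum0: "(\<Sum>v\<in>B0. c (Inl v) *\<^sub>R v) + (\<Sum>b\<in>D. c (Inr b) *\<^sub>R (vderiv I ^^ Suc k) (z b) 0) = 0"
      using fB0 fD by (simp add: sum.Plus f_def)
    have "- (\<Sum>v\<in>B0. c (Inl v) *\<^sub>R v) \<in> ?F k"
      using B0(1) by (intro subspace_neg subspace_sum subspace_scale subspace_jacobi_flag) auto
    then have "(\<Sum>b\<in>D. c (Inr b) *\<^sub>R (vderiv I ^^ Suc k) (z b) 0) \<in> ?F k"
      using sum0 by (simp add: eq_neg_iff_add_eq_0 add.commute flip: neg_eq_iff_add_eq_0)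
    from flag_derivative_combination[OF I eq z(2) this]
    have "(\<Sum>b\<in>D. c (Inr b) *\<^sub>R (vderiv I ^^ Suc (Suc k)) (z b) 0) \<in> ?F (Suc k)"
      by simp
    moreover have "(\<Sum>b\<in>D. c (Inr b) *\<^sub>R (vderiv I ^^ Suc (Suc k)) (z b) 0) = (\<Sum>b\<in>D. c (Inr b) *\<^sub>R b)"
      by (rule sum.cong) (use z(1) in auto)
    ultimately have "(\<Sum>b\<in>D. c (Inr b) *\<^sub>R b) \<in> span ((\<lambda>v. v) ` B1)"
      by (simp add: sp1)
    moreover have fB1: "finite B1" using B(1) fin finite_subset by blast
    ultimately obtain a where a: "(\<Sum>b\<in>D. c (Inr b) *\<^sub>R b) = (\<Sum>v\<in>B1. a v *\<^sub>R v)"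
      unfolding in_span_image_iff[OF fB1] by blast
    \<comment> \<open>The differentiated relation as a single coefficient family over the basis
      \<open>B\<close>; its part from flag k + 1 is moved to the left, hence the sign.\<close>
    define u where "u v = (if v \<in> D then c (Inr v) else - a v)" for v
    have "(\<Sum>v\<in>B. u v *\<^sub>R v) = (\<Sum>v\<in>D. u v *\<^sub>R v) + (\<Sum>v\<in>B1. u v *\<^sub>R v)"
      using sum.subset_diff[OF B(1) fin, of "\<lambda>v. u v *\<^sub>R v"] by (simp add: D_def)
    also have "(\<Sum>v\<in>D. u v *\<^sub>R v) = (\<Sum>b\<in>D. c (Inr b) *\<^sub>R b)"
      by (rule sum.cong) (auto simp: u_def)
    also have "(\<Sum>v\<in>B1. u v *\<^sub>R v) = - (\<Sum>v\<in>B1. a v *\<^sub>R v)"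
      unfolding sum_negf[symmetric] by (rule sum.cong) (auto simp: u_def D_def)
    finally have "(\<Sum>v\<in>B. u v *\<^sub>R v) = 0" by (simp add: a)
    then have "\<forall>v\<in>B. u v = 0"
      using B(3) fin independentD[OF B(3) fin subset_refl] by blast
    then have cD0: "c (Inr b) = 0" if "b \<in> D" for b
      using that by (auto simp: u_def D_def split: if_splits)
    then have "(\<Sum>v\<in>B0. c (Inl v) *\<^sub>R v) = 0"
      using sum0 by simp
    then have "c (Inl v) = 0" if "v \<in> B0" for v
      using independentD[OF B0(2) fB0 subset_refl, of "\<lambda>v. c (Inl v)"] that by blast
    then show "\<forall>i\<in>?K. c i = 0"
      using cD0 by auto
  qed
  moreover have "f ` ?K \<subseteq> ?F (Suc k)"
  proof (rule image_subsetI)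
    fix i assume "i \<in> ?K"
    then consider (l) v where "i = Inl v" "v \<in> B0" | (r) b where "i = Inr b" "b \<in> D"
      by blast
    then show "f i \<in> ?F (Suc k)"
    proof cases
      case l
      then have "v \<in> ?F k" using B0(1) by blast
      then show ?thesis
        using jacobi_flag_mono[of k "Suc k" M I lam 0, OF le_SucI[OF order_refl]] by (simp add: f_def l subsetD)
    next
      case r
      then show ?thesis
        using jacobi_flag_base[OF order_refl z(2), of b "Suc k" 0] by (simp add: f_def)
    qed
  qed
  ultimately have "card ?K \<le> dim (?F (Suc k))"
    using independent_card_le_dim card_image by metis
  then have "card D + dim (?F k) \<le> dim (?F (Suc k))"
    using fB0 fD B0(4) by (simp add: card_Plus)
  then show ?thesis
    unfolding dcol_def using dim2 cD B1(4) by simp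
qed

lemma dcol_antimono:
  assumes "is_interval I" "interior I \<noteq> {}" "0 \<in> I" "equiregular M I lam" "1 \<le> i" "i \<le> j"
  shows "dcol M I lam j \<le> dcol M I lam i"
  using assms(6)
proof (induction j rule: dec_induct)
  case (step n)
  then obtain k where "n = Suc k" using assms(5) by (metis Suc_le_D One_nat_def order_trans)
  then show ?case
    using dcol_Suc_le[OF assms(1-4), of k] step by simp
qed simp

text \<open>\<open>rowlen\<close> counts boxes. As columns do not grow, the boxes of a row form an
  initial segment, so the count is also the index of the last column.\<close>

lemma young_row:
  assumes "is_interval I" "interior I \<noteq> {}" "0 \<in> I" "equiregular M I lam"
  shows "(a, b) \<in> young M I lam \<longleftrightarrow> a \<in> {1..dcol M I lam 1} \<and> 1 \<le> b \<and> b \<le> rowlen M I lam a"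
proof -
  let ?R = "\<lambda>a. {b. (a, b) \<in> young M I lam}"
  have down: "b' \<in> ?R a" if "b \<in> ?R a" "1 \<le> b'" "b' \<le> b" for a b b'
    using that dcol_antimono[OF assms that(2,3)] by (auto simp: young_def)
  have fin: "finite (?R a)" for a
    by (rule finite_subset[of _ "{..ncols M I lam}"]) (auto simp: young_def)
  have R: "?R a = {1..card (?R a)}" for a
  proof (cases "?R a = {}")
    case False
    define m where "m = Max (?R a)"
    have m: "m \<in> ?R a" "\<And>b. b \<in> ?R a \<Longrightarrow> b \<le> m"
      using Max_in[OF fin False] Max_ge[OF fin] by (auto simp: m_def)
    have "?R a = {1..m}"
    proof (intro equalityI subsetI)
      fix b assume b: "b \<in> ?R a"
      then have "1 \<le> b" by (simp add: young_def)
      then show "b \<in> {1..m}" using m(2)[OF b] by simp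
    next
      fix b assume "b \<in> {1..m}"
      then show "b \<in> ?R a" using down[OF m(1), of b] by simp
    qed
    moreover from this have "card (?R a) = m"
      by (metis card_atLeastAtMost diff_Suc_1)
    ultimately show ?thesis by (simp only:)
  qed simp
  have 1: "a \<in> {1..dcol M I lam 1}" if "(a, b) \<in> young M I lam"
    using that dcol_antimono[OF assms order_refl, of b] by (auto simp: young_def)
  have "b \<in> ?R a \<longleftrightarrow> b \<in> {1..card (?R a)}"
    by (rule arg_cong[OF R])
  then have "(a, b) \<in> young M I lam \<longleftrightarrow> 1 \<le> b \<and> b \<le> rowlen M I lam a"
    by (simp add: rowlen_def)
  then show ?thesis
    using 1 by blast
qed

section \<open>The rows of the reduced Young diagram\<close>

lemma redlen_strict_decreasing:
  assumes "1 \<le> k" "k < k'" "k' \<le> nred M I lam"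
  shows "redlen M I lam k' < redlen M I lam k"
proof -
  let ?S = "rowlen M I lam ` {1..dcol M I lam 1}"
  let ?l = "sorted_list_of_set ?S"
  have "sorted_wrt (<) ?l" by simp
  then have "sorted_wrt (>) (rev ?l)"
    by (simp add: sorted_wrt_rev)
  moreover have "k - 1 < k' - 1" "k' - 1 < length (rev ?l)"
    using assms unfolding nred_def redlens_def by linarith+
  ultimately have "rev ?l ! (k - 1) > rev ?l ! (k' - 1)"
    by (rule sorted_wrt_nth_less)
  then show ?thesis
    by (simp add: redlen_def redlens_def)
qed

text \<open>Strict decrease makes the index of a given row length unique, so the definite
  description in \<open>redrow\<close> denotes.\<close>

lemma redrow_works:
  assumes "a \<in> {1..dcol M I lam 1}"
  shows "redrow M I lam a \<in> {1..nred M I lam}" "redlen M I lam (redrow M I lam a) = rowlen M I lam a"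
proof -
  have "rowlen M I lam a \<in> set (redlens M I lam)"
    using assms by (simp add: redlens_def)
  then obtain j where j: "j < nred M I lam" "redlens M I lam ! j = rowlen M I lam a"
    by (auto simp: in_set_conv_nth nred_def)
  have "\<exists>!k. k \<in> {1..nred M I lam} \<and> redlen M I lam k = rowlen M I lam a"
  proof (rule ex1I[of _ "Suc j"])
    show "Suc j \<in> {1..nred M I lam} \<and> redlen M I lam (Suc j) = rowlen M I lam a"
      using j by (simp add: redlen_def)
    fix k assume k: "k \<in> {1..nred M I lam} \<and> redlen M I lam k = rowlen M I lam a"
    show "k = Suc j"
      using k j redlen_strict_decreasing[of k "Suc j" M I lam] redlen_strict_decreasing[of "Suc j" k M I lam]
      by (cases k "Suc j" rule: linorder_cases) (auto simp: redlen_def)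
  qed
  from theI'[OF this] show "redrow M I lam a \<in> {1..nred M I lam}" "redlen M I lam (redrow M I lam a) = rowlen M I lam a"
    by (simp_all add: redrow_def)
qed

lemma rowlen_le_iff:
  assumes "a \<in> {1..dcol M I lam 1}" "b \<in> {1..dcol M I lam 1}"
  shows "rowlen M I lam a \<le> rowlen M I lam b \<longleftrightarrow> redrow M I lam b \<le> redrow M I lam a"
  using redrow_works[OF assms(1)] redrow_works[OF assms(2)]
    redlen_strict_decreasing[of "redrow M I lam a" "redrow M I lam b" M I lam]
    redlen_strict_decreasing[of "redrow M I lam b" "redrow M I lam a" M I lam]
  by (cases "redrow M I lam a" "redrow M I lam b" rule: linorder_cases) auto


section \<open>Endomorphisms and graded orthonormal bases\<close>

lemma endo_onD:
  assumes "endo_on V f"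
  shows "u \<in> V \<Longrightarrow> f u \<in> V" "u \<in> V \<Longrightarrow> v \<in> V \<Longrightarrow> f (u + v) = f u + f v" "u \<in> V \<Longrightarrow> f (a *\<^sub>R u) = a *\<^sub>R f u"
  using assms by (auto simp: endo_on_def)

lemma endo_onI:
  assumes "\<And>u. u \<in> V \<Longrightarrow> f u \<in> V" "\<And>u v. u \<in> V \<Longrightarrow> v \<in> V \<Longrightarrow> f (u + v) = f u + f v"
    "\<And>a u. u \<in> V \<Longrightarrow> f (a *\<^sub>R u) = a *\<^sub>R f u"
  shows "endo_on V f"
  using assms by (auto simp: endo_on_def)

lemma endo_on_cong: "(\<And>u. u \<in> V \<Longrightarrow> f u = g u) \<Longrightarrow> subspace V \<Longrightarrow> endo_on V f \<Longrightarrow> endo_on V g"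
  by (rule endo_onI) (metis endo_onD subspace_add subspace_scale)+

lemma endo_on_add: "subspace V \<Longrightarrow> endo_on V f \<Longrightarrow> endo_on V g \<Longrightarrow> endo_on V (\<lambda>u. f u + g u)"
  by (rule endo_onI) (simp_all add: endo_onD subspace_add algebra_simps)

lemma endo_on_diff: "subspace V \<Longrightarrow> endo_on V f \<Longrightarrow> endo_on V g \<Longrightarrow> endo_on V (\<lambda>u. f u - g u)"
  by (rule endo_onI) (simp_all add: endo_onD subspace_diff algebra_simps)

lemma endo_on_scale: "subspace V \<Longrightarrow> endo_on V f \<Longrightarrow> endo_on V (\<lambda>u. r *\<^sub>R f u)"
  by (rule endo_onI) (simp_all add: endo_onD subspace_scale algebra_simps)

lemma endo_on_compose: "endo_on V f \<Longrightarrow> endo_on V g \<Longrightarrow> endo_on V (\<lambda>u. f (g u))"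
  by (rule endo_onI) (simp_all add: endo_onD)

lemma endo_on_zero: "subspace V \<Longrightarrow> endo_on V (\<lambda>u. 0)"
  by (rule endo_onI) (simp_all add: subspace_0)

lemma endo_on_sum: "subspace V \<Longrightarrow> (\<And>i. i \<in> S \<Longrightarrow> endo_on V (f i)) \<Longrightarrow> endo_on V (\<lambda>u. \<Sum>i\<in>S. f i u)"
  by (induction S rule: infinite_finite_induct) (auto intro: endo_on_zero endo_on_add)

lemma endo_on_0: "subspace V \<Longrightarrow> endo_on V f \<Longrightarrow> f 0 = 0"
  using endo_onD(3)[of V f 0 0] by (simp add: subspace_0)

lemma endo_on_linear_sum:
  assumes "subspace V" "endo_on V f" "\<And>i. i \<in> S \<Longrightarrow> v i \<in> V"
  shows "f (\<Sum>i\<in>S. c i *\<^sub>R v i) = (\<Sum>i\<in>S. c i *\<^sub>R f (v i))"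
  using assms(3)
proof (induction S rule: infinite_finite_induct)
  case (insert i S)
  have "(\<Sum>i\<in>S. c i *\<^sub>R v i) \<in> V" "c i *\<^sub>R v i \<in> V"
    using insert assms(1) by (auto intro!: subspace_sum subspace_scale)
  then show ?case
    using insert assms(2) by (simp add: endo_onD)
qed (simp_all add: endo_on_0[OF assms(1,2)])

text \<open>One fibre of the distribution with the frame vectors X_{a,1}, sorted by reduced row. The
  laws for \<open>g\<close> are restricted to \<open>V\<close>, where alone the metric is
  meaningful, and identities between endomorphisms of \<open>V\<close> are reduced to their matrix
  entries by \<open>endo_eqI\<close>.\<close>

locale graded_orthonormal =
  fixes V :: "'e::euclidean_space set" and g :: "'e \<Rightarrow> 'e \<Rightarrow> real" and K :: "nat set"
    and e :: "nat \<Rightarrow> 'e" and row :: "nat \<Rightarrow> nat" and m :: nat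
  assumes sub: "subspace V" and finK: "finite K"
    and g_sym: "\<And>u v. u \<in> V \<Longrightarrow> v \<in> V \<Longrightarrow> g u v = g v u"
    and g_sum: "\<And>c u v. (\<And>i. i \<in> K \<Longrightarrow> u i \<in> V) \<Longrightarrow> v \<in> V \<Longrightarrow> g (\<Sum>i\<in>K. c i *\<^sub>R u i) v = (\<Sum>i\<in>K. c i * g (u i) v)"
    and g_add: "\<And>u v w. u \<in> V \<Longrightarrow> v \<in> V \<Longrightarrow> w \<in> V \<Longrightarrow> g (u + v) w = g u w + g v w"
    and g_scale: "\<And>c u v. u \<in> V \<Longrightarrow> v \<in> V \<Longrightarrow> g (c *\<^sub>R u) v = c * g u v"
    and spanV: "span (e ` K) = V"
    and orth: "\<And>a b. a \<in> K \<Longrightarrow> b \<in> K \<Longrightarrow> g (e a) (e b) = (if a = b then 1 else 0)"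
    and row: "\<And>a. a \<in> K \<Longrightarrow> row a \<in> {1..m}"
begin

lemma e_in: "a \<in> K \<Longrightarrow> e a \<in> V"
  unfolding spanV[symmetric] by (simp add: span_base)

lemma expand: "u \<in> V \<Longrightarrow> u = (\<Sum>a\<in>K. g u (e a) *\<^sub>R e a)"
proof -
  assume u: "u \<in> V"
  then obtain c where c: "u = (\<Sum>a\<in>K. c a *\<^sub>R e a)"
    unfolding spanV[symmetric] in_span_image_iff[OF finK] by blast
  have "g u (e b) = c b" if "b \<in> K" for b
  proof -
    have "g u (e b) = (\<Sum>a\<in>K. c a * g (e a) (e b))"
      unfolding c by (rule g_sum) (auto intro: e_in that)
    also have "\<dots> = (\<Sum>a\<in>K. if a = b then c b else 0)"
      by (rule sum.cong) (auto simp: orth that)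
    finally show ?thesis using that finK by simp
  qed
  then show ?thesis by (simp add: c cong: sum.cong)
qed

lemma coords_eqI: "u \<in> V \<Longrightarrow> v \<in> V \<Longrightarrow> (\<And>a. a \<in> K \<Longrightarrow> g u (e a) = g v (e a)) \<Longrightarrow> u = v"
  using expand[of u] expand[of v] by (simp cong: sum.cong)

lemma g_diff: "u \<in> V \<Longrightarrow> v \<in> V \<Longrightarrow> w \<in> V \<Longrightarrow> g (u - v) w = g u w - g v w"
  using g_add[of "u - v" v w] subspace_diff[OF sub] by simp

lemma endo_eqI:
  assumes "endo_on V f" "endo_on V f'" "\<And>a b. a \<in> K \<Longrightarrow> b \<in> K \<Longrightarrow> g (f (e a)) (e b) = g (f' (e a)) (e b)" "u \<in> V"
  shows "f u = f' u"
proof -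
  have "f (e a) = f' (e a)" if "a \<in> K" for a
    by (rule coords_eqI[OF endo_onD(1)[OF assms(1) e_in[OF that]] endo_onD(1)[OF assms(2) e_in[OF that]]])
      (rule assms(3)[OF that])
  note fe = this
  have "f (\<Sum>a\<in>K. g u (e a) *\<^sub>R e a) = (\<Sum>a\<in>K. g u (e a) *\<^sub>R f (e a))"
    by (rule endo_on_linear_sum[OF sub assms(1)]) (rule e_in)
  also have "\<dots> = (\<Sum>a\<in>K. g u (e a) *\<^sub>R f' (e a))"
    by (rule sum.cong) (use fe in auto)
  also have "\<dots> = f' (\<Sum>a\<in>K. g u (e a) *\<^sub>R e a)"
    by (rule endo_on_linear_sum[OF sub assms(2), symmetric]) (rule e_in)
  finally have "f (\<Sum>a\<in>K. g u (e a) *\<^sub>R e a) = f' (\<Sum>a\<in>K. g u (e a) *\<^sub>R e a)" .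
  then show ?thesis
    using expand[OF assms(4)] by simp
qed

lemma g_endo:
  assumes "endo_on V f" "u \<in> V" "v \<in> V"
  shows "g (f u) v = (\<Sum>a\<in>K. \<Sum>b\<in>K. g u (e a) * g v (e b) * g (f (e a)) (e b))"
proof -
  have fe: "f (e a) \<in> V" if "a \<in> K" for a
    using endo_onD(1)[OF assms(1)] e_in that by blast
  have "f u = f (\<Sum>a\<in>K. g u (e a) *\<^sub>R e a)"
    using expand[OF assms(2)] by simp
  also have "\<dots> = (\<Sum>a\<in>K. g u (e a) *\<^sub>R f (e a))"
    by (rule endo_on_linear_sum[OF sub assms(1)]) (rule e_in)
  finally have 1: "g (f u) v = (\<Sum>a\<in>K. g u (e a) * g (f (e a)) v)"
    using g_sum[of "\<lambda>a. f (e a)" v] fe assms(3) by simp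
  have "g w v = (\<Sum>b\<in>K. g v (e b) * g w (e b))" if w: "w \<in> V" for w
  proof -
    have "g w v = g v w" by (rule g_sym[OF w assms(3)])
    also have "\<dots> = g (\<Sum>b\<in>K. g v (e b) *\<^sub>R e b) w"
      using expand[OF assms(3)] by simp
    also have "\<dots> = (\<Sum>b\<in>K. g v (e b) * g (e b) w)"
      by (rule g_sum) (auto intro: e_in w)
    also have "\<dots> = (\<Sum>b\<in>K. g v (e b) * g w (e b))"
      by (rule sum.cong) (auto simp: g_sym[OF e_in w])
    finally show ?thesis .
  qed
  then have "g (f (e a)) v = (\<Sum>b\<in>K. g v (e b) * g (f (e a)) (e b))" if "a \<in> K" for a
    using fe that by blast
  with 1 show ?thesis
    by (simp add: sum_distrib_left mult.assoc cong: sum.cong)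
qed

text \<open>In an orthonormal basis the dual is the transposed matrix; the coordinates of any
  candidate are prescribed by testing with basis vectors.\<close>

lemma dual_unique:
  assumes f: "endo_on V f" and v: "v \<in> V"
  shows "(THE w. w \<in> V \<and> (\<forall>u\<in>V. g (f u) v = g u w)) = (\<Sum>a\<in>K. g (f (e a)) v *\<^sub>R e a)"
proof (rule the_equality)
  let ?w = "\<Sum>a\<in>K. g (f (e a)) v *\<^sub>R e a"
  have fe: "f (e a) \<in> V" if "a \<in> K" for a
    using endo_onD(1)[OF f] e_in that by blast
  have w: "?w \<in> V"
    by (intro subspace_sum subspace_scale sub e_in)
  have "g (f u) v = g u ?w" if u: "u \<in> V" for u
  proof -
    have "f u = f (\<Sum>a\<in>K. g u (e a) *\<^sub>R e a)"
      using expand[OF u] by simp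
    also have "\<dots> = (\<Sum>a\<in>K. g u (e a) *\<^sub>R f (e a))"
      by (rule endo_on_linear_sum[OF sub f]) (rule e_in)
    finally have "g (f u) v = (\<Sum>a\<in>K. g u (e a) * g (f (e a)) v)"
      using g_sum[of "\<lambda>a. f (e a)" v] fe v by simp
    also have "\<dots> = (\<Sum>a\<in>K. g (f (e a)) v * g (e a) u)"
      by (rule sum.cong) (auto simp: g_sym[OF e_in u])
    also have "\<dots> = g ?w u"
      by (rule g_sum[symmetric]) (auto intro: e_in u)
    finally show ?thesis using g_sym[OF w u] by simp
  qed
  then show "?w \<in> V \<and> (\<forall>u\<in>V. g (f u) v = g u ?w)"
    using w by blast
  fix w' assume w': "w' \<in> V \<and> (\<forall>u\<in>V. g (f u) v = g u w')"
  show "w' = ?w"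
  proof (rule coords_eqI)
    fix a assume a: "a \<in> K"
    have "g w' (e a) = g (f (e a)) v"
      using w' a e_in g_sym by metis
    also have "\<dots> = g ?w (e a)"
      using \<open>\<And>u. u \<in> V \<Longrightarrow> g (f u) v = g u ?w\<close>[OF e_in[OF a]] g_sym[OF w e_in[OF a]] by simp
    finally show "g w' (e a) = g ?w (e a)" .
  qed (use w w' in auto)
qed

lemma sum_coord:
  assumes "b \<in> K"
  shows "g (\<Sum>a\<in>K. c a *\<^sub>R e a) (e b) = c b"
proof -
  have "g (\<Sum>a\<in>K. c a *\<^sub>R e a) (e b) = (\<Sum>a\<in>K. c a * g (e a) (e b))"
    by (rule g_sum) (auto intro: e_in assms)
  also have "\<dots> = (\<Sum>a\<in>K. if a = b then c b else 0)"
    by (rule sum.cong) (auto simp: orth assms)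
  finally show ?thesis using assms finK by simp
qed

definition box :: "nat \<Rightarrow> 'e set" where
  "box k = span (e ` {a \<in> K. row a = k})"

lemma span_boxes: "span (\<Union>k\<in>A. box k) = span (e ` {a \<in> K. row a \<in> A})"
proof (rule subset_antisym)
  have "box k \<subseteq> span (e ` {a \<in> K. row a \<in> A})" if "k \<in> A" for k
    unfolding box_def using that by (intro span_mono) auto
  then show "span (\<Union>k\<in>A. box k) \<subseteq> span (e ` {a \<in> K. row a \<in> A})"
    by (intro span_minimal) auto
  have "e a \<in> box (row a)" if "a \<in> K" for a
    unfolding box_def using that by (intro span_base) auto
  then show "span (e ` {a \<in> K. row a \<in> A}) \<subseteq> span (\<Union>k\<in>A. box k)"
    by (intro span_mono) blast
qed

lemma in_span_rows:
  "u \<in> span (e ` {a \<in> K. row a \<in> A}) \<longleftrightarrow> u \<in> V \<and> (\<forall>a\<in>K. row a \<notin> A \<longrightarrow> g u (e a) = 0)"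
proof
  assume u: "u \<in> span (e ` {a \<in> K. row a \<in> A})"
  have uV: "u \<in> V"
    using u span_mono[of "e ` {a \<in> K. row a \<in> A}" "e ` K"] spanV by auto
  have "finite {a \<in> K. row a \<in> A}" using finK by simp
  then obtain c where c: "u = (\<Sum>a\<in>{a \<in> K. row a \<in> A}. c a *\<^sub>R e a)"
    using u in_span_image_iff by blast
  have "u = (\<Sum>a\<in>K. (if row a \<in> A then c a else 0) *\<^sub>R e a)"
    unfolding c sum.inter_filter[OF finK] by (rule sum.cong) auto
  then have "g u (e b) = (if row b \<in> A then c b else 0)" if "b \<in> K" for b
    using sum_coord[OF that] by simp
  then show "u \<in> V \<and> (\<forall>a\<in>K. row a \<notin> A \<longrightarrow> g u (e a) = 0)"
    using uV by simp
next
  assume u: "u \<in> V \<and> (\<forall>a\<in>K. row a \<notin> A \<longrightarrow> g u (e a) = 0)"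
  then have "u = (\<Sum>a\<in>K. g u (e a) *\<^sub>R e a)"
    using expand by blast
  also have "\<dots> = (\<Sum>a\<in>{a \<in> K. row a \<in> A}. g u (e a) *\<^sub>R e a)"
    unfolding sum.inter_filter[OF finK] using u by (intro sum.cong) auto
  also have "\<dots> \<in> span (e ` {a \<in> K. row a \<in> A})"
    by (intro span_sum span_scale span_base) auto
  finally show "u \<in> span (e ` {a \<in> K. row a \<in> A})" .
qed

lemma in_box: "u \<in> box k \<longleftrightarrow> u \<in> V \<and> (\<forall>a\<in>K. row a \<noteq> k \<longrightarrow> g u (e a) = 0)"
  using in_span_rows[of u "{k}"] by (simp add: box_def)

lemma in_span_boxes:
  "u \<in> span (\<Union>k\<in>A. box k) \<longleftrightarrow> u \<in> V \<and> (\<forall>a\<in>K. row a \<notin> A \<longrightarrow> g u (e a) = 0)"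
  unfolding span_boxes by (rule in_span_rows)

definition proj :: "nat \<Rightarrow> 'e \<Rightarrow> 'e" where
  "proj k u = (\<Sum>a\<in>K. (if row a = k then g u (e a) else 0) *\<^sub>R e a)"

lemma proj_in: "proj k u \<in> V"
  unfolding proj_def by (intro subspace_sum subspace_scale sub e_in)

lemma proj_coord: "a \<in> K \<Longrightarrow> g (proj k u) (e a) = (if row a = k then g u (e a) else 0)"
  unfolding proj_def by (rule sum_coord) auto

text \<open>The two conditions prescribe every coordinate of w: zero outside row k, those of u
  inside it.\<close>

lemma proj_the:
  assumes u: "u \<in> V"
  shows "(THE w. w \<in> box k \<and> u - w \<in> span (\<Union>i\<in>{1..m} - {k}. box i)) = proj k u"
proof (rule the_equality)
  show "proj k u \<in> box k \<and> u - proj k u \<in> span (\<Union>i\<in>{1..m} - {k}. box i)"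
    unfolding in_box in_span_boxes using u row
    by (auto simp: proj_in proj_coord g_diff e_in subspace_diff[OF sub])
  fix w assume "w \<in> box k \<and> u - w \<in> span (\<Union>i\<in>{1..m} - {k}. box i)"
  then have w: "w \<in> V" "\<And>a. a \<in> K \<Longrightarrow> row a \<noteq> k \<Longrightarrow> g w (e a) = 0"
    "\<And>a. a \<in> K \<Longrightarrow> row a = k \<Longrightarrow> g (u - w) (e a) = 0"
    unfolding in_box in_span_boxes by auto
  show "w = proj k u"
    by (rule coords_eqI) (use w u in \<open>auto simp: proj_in proj_coord g_diff e_in\<close>)
qed

lemma endo_proj: "endo_on V (proj k)"
  by (rule endo_onI; (rule proj_in)?; rule coords_eqI)
    (auto simp: proj_in proj_coord g_add g_scale e_in subspace_add[OF sub] subspace_scale[OF sub])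

lemma proj_e: "a \<in> K \<Longrightarrow> proj k (e a) = (if row a = k then e a else 0)"
proof (rule coords_eqI)
  assume a: "a \<in> K"
  have g0: "g 0 (e b) = 0" if "b \<in> K" for b
    using g_scale[of "e b" "e b" 0] e_in that by simp
  show "g (proj k (e a)) (e b) = g (if row a = k then e a else 0) (e b)" if "b \<in> K" for b
    using a that by (auto simp: proj_coord orth g0)
qed (auto simp: proj_in e_in subspace_0[OF sub])

definition dual :: "('e \<Rightarrow> 'e) \<Rightarrow> 'e \<Rightarrow> 'e" where
  "dual f v = (\<Sum>a\<in>K. g (f (e a)) v *\<^sub>R e a)"

lemma dual_in: "dual f v \<in> V"
  unfolding dual_def by (intro subspace_sum subspace_scale sub e_in)

lemma dual_coord: "a \<in> K \<Longrightarrow> g (dual f v) (e a) = g (f (e a)) v"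
  unfolding dual_def by (rule sum_coord) auto

lemma endo_dual:
  assumes "endo_on V f"
  shows "endo_on V (dual f)"
proof -
  have fe: "f (e a) \<in> V" if "a \<in> K" for a
    using endo_onD(1)[OF assms] e_in that by blast
  have r: "g w (u + v) = g w u + g w v" "g w (c *\<^sub>R u) = c * g w u" if "u \<in> V" "v \<in> V" "w \<in> V" for u v w c
    using that g_sym[of w "u + v"] g_sym[of w "c *\<^sub>R u"] g_sym[of w u] g_sym[of w v]
    by (simp_all add: g_add g_scale subspace_add[OF sub] subspace_scale[OF sub])
  show ?thesis
  proof (rule endo_onI)
    show "dual f u \<in> V" for u by (rule dual_in)
    show "dual f (u + v) = dual f u + dual f v" if "u \<in> V" "v \<in> V" for u v
      unfolding dual_def using that fe by (simp add: r scaleR_add_left sum.distrib cong: sum.cong)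
    show "dual f (c *\<^sub>R u) = c *\<^sub>R dual f u" if "u \<in> V" for c u
      unfolding dual_def using that fe r(2)[OF that that] by (simp add: scaleR_sum_right cong: sum.cong)
  qed
qed

end

section \<open>Canonical frames and twist polynomials\<close>

locale canonical_curve = subriemannian_connection M nabla
  for M :: "('m::{second_countable_topology,t2_space}, 'e::euclidean_space) subriem"
    and nabla :: "('m, 'e) conn" +
  fixes I :: "real set" and lam :: "real \<Rightarrow> 'm \<times> 'e"
    and S :: "real \<Rightarrow> 'e \<Rightarrow> 'e \<Rightarrow> real" and X :: "nat \<Rightarrow> nat \<Rightarrow> real \<Rightarrow> 'e"
  assumes interval: "is_interval I" "interior I \<noteq> {}" "0 \<in> I"
    and extremal: "integral_curve M I lam"
    and equiregular: "equiregular M I lam"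
    and canonical: "canonical_frame M nabla I lam S X"
begin

abbreviation gam :: "real \<Rightarrow> 'm" where "gam \<equiv> \<lambda>t. fst (lam t)"

abbreviation ch :: "real \<Rightarrow> ('m, 'e) chart" where "ch t \<equiv> chart_at M (gam t)"

abbreviation d :: nat where "d \<equiv> dcol M I lam 1"

abbreviation n :: "nat \<Rightarrow> nat" where "n \<equiv> rowlen M I lam"

abbreviation E :: "real \<Rightarrow> 'e set" where "E t \<equiv> distr M (gam t)"

abbreviation D :: "(real \<Rightarrow> 'e) \<Rightarrow> real \<Rightarrow> 'e" where "D \<equiv> cov_deriv M nabla I gam"

abbreviation tw :: "nat \<Rightarrow> real \<Rightarrow> 'e \<Rightarrow> 'e" where "tw k t \<equiv> twist M nabla k (lam t)"

text \<open>Differentiability of a field along the curve at t, with the chart frozen at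
  \<open>gam t\<close>: the form in which all product rules below are available.\<close>

definition vder :: "(real \<Rightarrow> 'e) \<Rightarrow> real \<Rightarrow> 'e \<Rightarrow> bool" where
  "vder V t v' \<longleftrightarrow> ((\<lambda>s. vcoord M (ch t) (gam s) (V s)) has_vector_derivative v') (at t within I)"

lemma nb: "t \<in> I \<Longrightarrow> at t within I \<noteq> bot"
  by (rule at_within_interval_nontrivial[OF interval(1,2)])

lemma gam_continuous: "continuous_on I gam"
  using extremal by (simp add: integral_curve_def)

lemma gam_tendsto: "t \<in> I \<Longrightarrow> (gam \<longlongrightarrow> gam t) (at t within I)"
  using gam_continuous by (simp add: continuous_on_def)

lemma eventually_dom: "t \<in> I \<Longrightarrow> \<forall>\<^sub>F s in at t within I. gam s \<in> fst (ch t)"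
  by (rule eventually_in_chart[OF chart_at_atlas gam_tendsto chart_at_dom])

lemma zder:
  "t \<in> I \<Longrightarrow> ((\<lambda>s. cchart M (ch t) (lam s)) has_vector_derivative hv (ch t) (cchart M (ch t) (lam t))) (at t within I)"
  using extremal by (simp add: integral_curve_def ham_field_eq)

lemma fst_hv_lam: "fst (hv (ch t) (cchart M (ch t) (lam t))) = csharp M (lam t)"
  using fst_hv[OF chart_at_atlas cchart_in[OF chart_at_dom], of "lam t"]
  by (simp add: cchart_inv_cchart)

lemma xder: "t \<in> I \<Longrightarrow> ((\<lambda>s. snd (ch t) (gam s)) has_vector_derivative csharp M (lam t)) (at t within I)"
  using bounded_linear.has_vector_derivative[OF bounded_linear_fst zder] by (simp add: fst_hv_lam)

lemma velocity_eq: "t \<in> I \<Longrightarrow> velocity M I gam t = csharp M (lam t)"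
  unfolding velocity_def by (rule vector_derivative_within[OF nb xder])

lemma D_eq:
  assumes t: "t \<in> I" and V: "vder V t v'"
  shows "D V t = v' + Gam (ch t) (snd (ch t) (gam t)) (csharp M (lam t)) (V t)"
  using cov_deriv_chart[OF chart_at_atlas chart_at_dom t nb[OF t] gam_tendsto[OF t] xder[OF t] V[unfolded vder_def]]
  by simp

lemma Gam_linear: "linear (Gam (ch t) (snd (ch t) (gam t)) u)"
  by (rule Gam_linear_right) auto

lemma vder_diff:
  assumes t: "t \<in> I" and "vder V t v'" "vder W t w'"
  shows "vder (\<lambda>s. V s - W s) t (v' - w')" "D (\<lambda>s. V s - W s) t = D V t - D W t"
proof -
  show *: "vder (\<lambda>s. V s - W s) t (v' - w')"
    unfolding vder_def
  proof (rule has_vector_derivative_transform_eventually[OF _ _ t])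
    show "((\<lambda>s. vcoord M (ch t) (gam s) (V s) - vcoord M (ch t) (gam s) (W s)) has_vector_derivative v' - w') (at t within I)"
      using assms(2,3) unfolding vder_def by (rule has_vector_derivative_diff)
    show "\<forall>\<^sub>F s in at t within I. vcoord M (ch t) (gam s) (V s) - vcoord M (ch t) (gam s) (W s) = vcoord M (ch t) (gam s) (V s - W s)"
      using eventually_dom[OF t] by eventually_elim (simp add: linear_diff[OF linear_vcoord])
  qed simp
  show "D (\<lambda>s. V s - W s) t = D V t - D W t"
    by (simp add: D_eq[OF t *] D_eq[OF t assms(2)] D_eq[OF t assms(3)] linear_diff[OF Gam_linear])
qed

lemma vder_sum:
  assumes t: "t \<in> I" and Y: "\<And>i. i \<in> K \<Longrightarrow> vder (Y i) t (y' i)"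
  shows "vder (\<lambda>s. \<Sum>i\<in>K. r i *\<^sub>R Y i s) t (\<Sum>i\<in>K. r i *\<^sub>R y' i)"
    "D (\<lambda>s. \<Sum>i\<in>K. r i *\<^sub>R Y i s) t = (\<Sum>i\<in>K. r i *\<^sub>R D (Y i) t)"
proof -
  show *: "vder (\<lambda>s. \<Sum>i\<in>K. r i *\<^sub>R Y i s) t (\<Sum>i\<in>K. r i *\<^sub>R y' i)"
    unfolding vder_def
  proof (rule has_vector_derivative_transform_eventually[OF _ _ t])
    show "((\<lambda>s. \<Sum>i\<in>K. r i *\<^sub>R vcoord M (ch t) (gam s) (Y i s)) has_vector_derivative (\<Sum>i\<in>K. r i *\<^sub>R y' i)) (at t within I)"
      by (intro has_vector_derivative_sum bounded_linear.has_vector_derivative[OF bounded_linear_scaleR_right]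
          Y[unfolded vder_def])
    show "\<forall>\<^sub>F s in at t within I. (\<Sum>i\<in>K. r i *\<^sub>R vcoord M (ch t) (gam s) (Y i s)) = vcoord M (ch t) (gam s) (\<Sum>i\<in>K. r i *\<^sub>R Y i s)"
      using eventually_dom[OF t]
      by eventually_elim (simp add: linear_sum[OF linear_vcoord] linear_cmul[OF linear_vcoord])
  qed simp
  have "D (\<lambda>s. \<Sum>i\<in>K. r i *\<^sub>R Y i s) t = (\<Sum>i\<in>K. r i *\<^sub>R (y' i + Gam (ch t) (snd (ch t) (gam t)) (csharp M (lam t)) (Y i t)))"
    by (simp add: D_eq[OF t *] linear_sum[OF Gam_linear] linear_cmul[OF Gam_linear] scaleR_add_right sum.distrib)
  also have "\<dots> = (\<Sum>i\<in>K. r i *\<^sub>R D (Y i) t)"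
    by (rule sum.cong) (simp_all add: D_eq[OF t Y])
  finally show "D (\<lambda>s. \<Sum>i\<in>K. r i *\<^sub>R Y i s) t = (\<Sum>i\<in>K. r i *\<^sub>R D (Y i) t)" .
qed

lemma vder_zero: "t \<in> I \<Longrightarrow> vder (\<lambda>_. 0) t 0 \<and> D (\<lambda>_. 0) t = 0"
  using vder_sum[of t "{}" undefined undefined undefined] by simp

text \<open>The covariant derivative of the adjoint connection along the geodesic, since P_1
  subtracts the torsion with the velocity.\<close>

definition L :: "(real \<Rightarrow> 'e) \<Rightarrow> real \<Rightarrow> 'e" where
  "L V t = D V t + tw (Suc 0) t (V t)"

text \<open>Along an extremal \<open>vpartial\<close> is the derivative of the endomorphism part, so
  D_t obeys the product rule on P_k V. The term P_1 P_k supplied by \<open>L\<close> completes the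
  recursion for P_{k+1}.\<close>

lemma twist_curve:
  assumes t: "t \<in> I" and V: "vder V t v'"
  shows "\<exists>w'. vder (\<lambda>s. tw k s (V s)) t w'"
    and "L (\<lambda>s. tw k s (V s)) t = tw (Suc k) t (V t) + tw k t (D V t)"
proof -
  let ?c = "ch t" and ?F = "ec (twist M nabla k) (ch t)"
  let ?z = "\<lambda>s. cchart M ?c (lam s)"
  have z: "?z t \<in> cdom ?c"
    by (rule cchart_in) simp
  have at_t: "tw k t u = ?F (?z t) u" for u
    using vcoord_endo[OF chart_at_atlas chart_at_dom, of "lam t" "twist M nabla k" u] by simp
  let ?h = "hv ?c (?z t)"
  let ?w' = "frechet_derivative (\<lambda>y. ?F y (V t)) (at (?z t)) ?h + ?F (?z t) v'"
  have w': "vder (\<lambda>s. tw k s (V s)) t ?w'"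
    unfolding vder_def
  proof (rule has_vector_derivative_transform_eventually[OF _ _ t])
    have "\<forall>\<^sub>F y in nhds (?z t). linear (?F y)"
      using eventually_nhds_in_open[OF open_cdom[OF chart_at_atlas] z]
      by eventually_elim (rule smooth_endo_linear[OF smooth_endo_twist chart_at_atlas])
    from has_vector_derivative_linear_apply[where z = ?z, OF this t nb[OF t] _ zder[OF t] V[unfolded vder_def]]
    show "((\<lambda>s. ?F (?z s) (vcoord M ?c (gam s) (V s))) has_vector_derivative ?w') (at t within I)"
      using smooth_on_differentiable[OF smooth_endo_smooth[OF smooth_endo_twist chart_at_atlas] z] by simp
    show "\<forall>\<^sub>F s in at t within I. ?F (?z s) (vcoord M ?c (gam s) (V s)) = vcoord M ?c (gam s) (tw k s (V s))"
      using eventually_dom[OF t] by eventually_elim (simp add: vcoord_endo[OF chart_at_atlas])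
  qed (simp add: at_t)
  then show "\<exists>w'. vder (\<lambda>s. tw k s (V s)) t w'" ..
  let ?G = "Gam ?c (snd ?c (gam t)) (csharp M (lam t))"
  have lF: "linear (?F (?z t))"
    by (rule smooth_endo_linear[OF smooth_endo_twist chart_at_atlas z])
  have D: "D (\<lambda>s. tw k s (V s)) t = vpartial M nabla (twist M nabla k) (lam t) (V t) + tw k t (D V t)"
    unfolding D_eq[OF t w'] D_eq[OF t V] vpartial_chart_at chart_vpartial_def fst_hv_lam
    by (simp add: at_t linear_add[OF lF])
  show "L (\<lambda>s. tw k s (V s)) t = tw (Suc k) t (V t) + tw k t (D V t)"
  \<comment> \<open>For k = 0 the recursion of \<open>twist\<close> does not apply, as P_1 is given
    separately; there the claim is the definition of \<open>L\<close>.\<close>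
  proof (cases k)
    case 0
    then show ?thesis by (simp add: L_def)
  next
    case (Suc j)
    show ?thesis
      unfolding L_def D unfolding Suc by simp
  qed
qed

section \<open>The canonical frame, its structural equations and the flag spanned by its
  columns\<close>

lemma young_iff: "(a, b) \<in> young M I lam \<longleftrightarrow> a \<in> {1..d} \<and> 1 \<le> b \<and> b \<le> n a"
  by (rule young_row[OF interval equiregular])

lemma finite_young: "finite (young M I lam)"
  by (rule finite_subset[of _ "Sigma {1..d} (\<lambda>a. {1..n a})"]) (auto simp: young_iff)

lemma frame: "frame_along M I lam X"
  using canonical by (simp add: canonical_frame_def)

lemma frame_independent:
  assumes "t \<in> I"
  shows "inj_on (\<lambda>(a, b). X a b t) (young M I lam)" "independent ((\<lambda>(a, b). X a b t) ` young M I lam)"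
    "span ((\<lambda>(a, b). X a b t) ` young M I lam) = UNIV"
  using frame assms unfolding frame_along_def by blast+

lemma frame_smooth: "(a, b) \<in> young M I lam \<Longrightarrow> smooth_along M I gam (X a b)"
  using frame unfolding frame_along_def by blast

lemma onb:
  assumes "t \<in> I"
  shows "span ((\<lambda>a. X a 1 t) ` {1..d}) = E t"
    "a \<in> {1..d} \<Longrightarrow> b \<in> {1..d} \<Longrightarrow> gmet M (gam t) (X a 1 t) (X b 1 t) = (if a = b then 1 else 0)"
proof -
  have "orthonormal_basis_of M (gam t) (E t) {1..d} (\<lambda>a. X a 1 t)"
    using canonical assms unfolding canonical_frame_def by blast
  then show "span ((\<lambda>a. X a 1 t) ` {1..d}) = E t"
    "a \<in> {1..d} \<Longrightarrow> b \<in> {1..d} \<Longrightarrow> gmet M (gam t) (X a 1 t) (X b 1 t) = (if a = b then 1 else 0)"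
    by (simp_all add: orthonormal_basis_of_def)
qed

lemma d_pos: "1 \<le> d"
proof (rule ccontr)
  assume "\<not> 1 \<le> d"
  then have "young M I lam = {}"
    using young_iff by auto
  then have "span {} = (UNIV :: 'e set)"
    using frame_independent(3)[OF interval(3)] by simp
  then show False
    using nonempty_Basis nonzero_Basis by fastforce
qed

lemma n_pos: "a \<in> {1..d} \<Longrightarrow> 1 \<le> n a"
proof -
  assume a: "a \<in> {1..d}"
  have "1 \<le> ncols M I lam"
  proof (rule ccontr)
    assume "\<not> 1 \<le> ncols M I lam"
    then have "young M I lam = {}" by (auto simp: young_def)
    then have "span {} = (UNIV :: 'e set)"
      using frame_independent(3)[OF interval(3)] by simp
    then show False
      using nonempty_Basis nonzero_Basis by fastforce
  qed
  then have "(a, 1) \<in> young M I lam"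
    using a by (simp add: young_def)
  then show ?thesis by (simp add: young_iff)
qed

lemma X1_in: "t \<in> I \<Longrightarrow> a \<in> {1..d} \<Longrightarrow> X a 1 t \<in> E t"
  using span_base[of "X a 1 t" "(\<lambda>a. X a 1 t) ` {1..d}"] onb(1)[of t] by simp

lemma frame_vder:
  assumes t: "t \<in> I" and ab: "(a, b) \<in> young M I lam"
  shows "\<exists>v'. vder (X a b) t v'"
proof -
  let ?J = "{s \<in> I. gam s \<in> fst (ch t)}"
  have "smooth_curve ?J (\<lambda>s. vcoord M (ch t) (gam s) (X a b s))"
    using frame_smooth[OF ab] unfolding smooth_along_def by simp
  then have "\<forall>u\<in>?J. ((vderiv ?J ^^ 0) (\<lambda>s. vcoord M (ch t) (gam s) (X a b s))) differentiable (at u within ?J)"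
    unfolding smooth_curve_def by (rule spec)
  then have d: "(\<lambda>s. vcoord M (ch t) (gam s) (X a b s)) differentiable (at t within ?J)"
    using t by simp
  \<comment> \<open>\<open>smooth_along\<close> differentiates within the set of parameters that the
    chart covers. This set is relatively open in \<open>I\<close>, so the two derivatives at t
    agree.\<close>
  obtain T where T: "open T" "?J = I \<inter> T"
  proof -
    have "openin (top_of_set I) (I \<inter> gam -` fst (ch t))"
      by (rule continuous_openin_preimage_gen[OF gam_continuous open_chart[OF chart_at_atlas]])
    moreover have "I \<inter> gam -` fst (ch t) = ?J" by auto
    ultimately show ?thesis using that by (auto simp: openin_open)
  qed
  have "at t within ?J = at t within I"
  proof (rule at_within_nhd[OF _ T(1)])
    have "t \<in> ?J" using t by simp
    then show "t \<in> T" unfolding T(2) by blast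
    show "?J \<inter> T - {t} = I \<inter> T - {t}" unfolding T(2) by blast
  qed
  then have "(\<lambda>s. vcoord M (ch t) (gam s) (X a b s)) differentiable (at t within I)"
    using d by (simp only:)
  then show ?thesis
    unfolding vder_def vector_derivative_works by (rule exI)
qed

definition Vop :: "real \<Rightarrow> 'e \<Rightarrow> 'e" where
  "Vop t u = asharp M nabla (lam t) u + ssharp M lam S t u"

lemma S_bilinear: "t \<in> I \<Longrightarrow> bilinear (S t)" and S_sym: "t \<in> I \<Longrightarrow> S t v w = S t w v"
  using canonical unfolding canonical_frame_def symmetric_tensor_along_def by blast+

lemma sharp_linear:
  fixes p :: "'e \<Rightarrow> 'e \<Rightarrow> real"
  assumes "\<And>u. linear (p u)" "\<And>v. linear (\<lambda>u. p u v)"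
  shows "linear (\<lambda>u. sharp M q (p u))"
proof (rule linearI)
  note s = sharp_works[where q = q, OF assms(1)]
  show "sharp M q (p (u + v)) = sharp M q (p u) + sharp M q (p v)" for u v
    by (rule s(3)[symmetric])
      (simp_all add: s(1,2) subspace_add[OF subspace_distr] gmet_add_left linear_add[OF assms(2)])
  show "sharp M q (p (r *\<^sub>R u)) = r *\<^sub>R sharp M q (p u)" for r u
    by (rule s(3)[symmetric])
      (simp_all add: s(1,2) subspace_scale[OF subspace_distr] gmet_scale_left linear_cmul[OF assms(2)])
qed

lemma torsion_pairing_linear:
  "linear (\<lambda>w. (snd p \<bullet> torsion M nabla q v w) / 2)" "linear (\<lambda>v. (snd p \<bullet> torsion M nabla q v w) / 2)"
proof -
  have 1: "linear (\<lambda>w. (snd p \<bullet> torsion M nabla q v w) / 2)" for v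
    by (rule linearI) (simp_all add: linear_add[OF torsion_linear] linear_cmul[OF torsion_linear] inner_add_right add_divide_distrib)
  show "linear (\<lambda>w. (snd p \<bullet> torsion M nabla q v w) / 2)" by (rule 1)
  have "(\<lambda>v. (snd p \<bullet> torsion M nabla q v w) / 2) = (\<lambda>v. - ((snd p \<bullet> torsion M nabla q w v) / 2))"
    by (rule ext) (subst torsion_antisym, simp)
  then show "linear (\<lambda>v. (snd p \<bullet> torsion M nabla q v w) / 2)"
    using linear_compose_neg[OF 1] by simp
qed

lemma asharp_linear: "linear (asharp M nabla p)"
  unfolding asharp_def[abs_def] by (rule sharp_linear) (rule torsion_pairing_linear)+

lemma asharp_in: "asharp M nabla p u \<in> distr M (fst p)"
  unfolding asharp_def by (rule sharp_in[OF torsion_pairing_linear(1)])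

lemma asharp_antisym:
  assumes "u \<in> distr M (fst p)" "v \<in> distr M (fst p)"
  shows "gmet M (fst p) (asharp M nabla p u) v = - gmet M (fst p) (asharp M nabla p v) u"
  unfolding asharp_def sharp_eq[OF torsion_pairing_linear(1) assms(2)] sharp_eq[OF torsion_pairing_linear(1) assms(1)]
  by (subst torsion_antisym) simp

lemma S_linear: "t \<in> I \<Longrightarrow> linear (S t u)" "t \<in> I \<Longrightarrow> linear (\<lambda>u. S t u v)"
  using S_bilinear by (auto simp: bilinear_def)

lemma ssharp_linear: "t \<in> I \<Longrightarrow> linear (ssharp M lam S t)"
  unfolding ssharp_def[abs_def] by (rule sharp_linear) (rule S_linear, assumption)+

lemma ssharp_in: "t \<in> I \<Longrightarrow> ssharp M lam S t u \<in> E t"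
  unfolding ssharp_def by (rule sharp_in[OF S_linear(1)])

lemma ssharp_sym:
  assumes "t \<in> I" "u \<in> E t" "v \<in> E t"
  shows "gmet M (gam t) (ssharp M lam S t u) v = gmet M (gam t) (ssharp M lam S t v) u"
  unfolding ssharp_def using sharp_eq[OF S_linear(1)[OF assms(1)]] assms S_sym[OF assms(1)] by simp

lemma Vop_linear: "t \<in> I \<Longrightarrow> linear (Vop t)"
  unfolding Vop_def[abs_def] by (intro linear_compose_add asharp_linear ssharp_linear)

lemma Vop_in: "t \<in> I \<Longrightarrow> Vop t u \<in> E t"
  unfolding Vop_def by (intro subspace_add subspace_distr asharp_in ssharp_in)

text \<open>Rewrites the structural operator through \<open>L\<close> and an operator with values in
  the distribution; the latter will disappear in all remainders.\<close>

lemma DS_eq: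
  assumes t: "t \<in> I"
  shows "DS M nabla I lam S Y t = L Y t + Vop t (Y t)"
proof -
  have "const_field M (ch t) (Y t) (gam t) = Y t"
    by (simp add: const_field_def)
  then have "cov_deriv M (adjoint_conn M nabla) I gam Y t = D Y t - torsion M nabla (gam t) (csharp M (lam t)) (Y t)"
    by (simp add: cov_deriv_def Let_def adjoint_conn_def velocity_eq[OF t])
  then show ?thesis
    by (simp add: DS_def L_def Vop_def)
qed

text \<open>Continuing each row by zero merges the equations inside a row and at its end into the
  single rule of \<open>X'_frame\<close>.\<close>

definition X' :: "nat \<Rightarrow> nat \<Rightarrow> real \<Rightarrow> 'e" where
  "X' a b t = (if b \<le> n a then X a b t else 0)"

lemma X'_1: "a \<in> {1..d} \<Longrightarrow> X' a 1 t = X a 1 t"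
  using n_pos by (simp add: X'_def)

lemma X'_frame:
  assumes t: "t \<in> I" and a: "a \<in> {1..d}" and b: "1 \<le> b"
  shows "\<exists>v'. vder (X' a b) t v'" "L (X' a b) t = X' a (Suc b) t - Vop t (X' a b t)"
proof -
  have "(\<exists>v'. vder (X' a b) t v') \<and> L (X' a b) t = X' a (Suc b) t - Vop t (X' a b t)"
  proof (cases "b \<le> n a")
    case True
    then have e: "X' a b = X a b" by (auto simp: X'_def)
    have y: "(a, b) \<in> young M I lam" using True a b by (simp add: young_iff)
    have "DS M nabla I lam S (X a b) t = X' a (Suc b) t"
    proof (cases "b = n a")
      case True
      then show ?thesis
        using canonical t a unfolding canonical_frame_def by (simp add: X'_def)
    next
      case False
      then have "b < n a" using \<open>b \<le> n a\<close> by simp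
      then show ?thesis
        using canonical t a b unfolding canonical_frame_def by (simp add: X'_def)
    qed
    then have "L (X a b) t = X' a (Suc b) t - Vop t (X a b t)"
      unfolding DS_eq[OF t] by (simp add: eq_diff_eq)
    then show ?thesis
      using frame_vder[OF t y] unfolding e by blast
  next
    case False
    then have e: "X' a b = (\<lambda>_. 0)" "X' a (Suc b) t = 0" by (auto simp: X'_def)
    show ?thesis
      using vder_zero[OF t] unfolding e L_def
      by (simp add: linear_0[OF Vop_linear[OF t]] linear_0[OF torsion_linear]) blast
  qed
  then show "\<exists>v'. vder (X' a b) t v'" "L (X' a b) t = X' a (Suc b) t - Vop t (X' a b t)"
    by blast+
qed

text \<open>The span of the first i columns of the frame. It contains the flag of the twist
  polynomials and serves as the space of remainders in its place.\<close>

definition F :: "nat \<Rightarrow> real \<Rightarrow> 'e set" where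
  "F i t = span ((\<lambda>(a, b). X a b t) ` {(a, b) \<in> young M I lam. b \<le> i})"

lemma subspace_F: "subspace (F i t)"
  by (simp add: F_def)

lemma F_mono: "i \<le> j \<Longrightarrow> F i t \<subseteq> F j t"
  unfolding F_def by (rule span_mono) auto

lemma X'_in_F: "a \<in> {1..d} \<Longrightarrow> 1 \<le> b \<Longrightarrow> b \<le> i \<Longrightarrow> X' a b t \<in> F i t"
proof (cases "b \<le> n a")
  case True
  assume "a \<in> {1..d}" "1 \<le> b" "b \<le> i"
  then have "(a, b) \<in> {(a, b) \<in> young M I lam. b \<le> i}"
    using True by (simp add: young_iff)
  then have "(\<lambda>(a, b). X a b t) (a, b) \<in> F i t"
    unfolding F_def by (intro span_base imageI)
  then show ?thesis using True by (simp add: X'_def)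
qed (simp add: X'_def subspace_0[OF subspace_F])

lemma E_subset_F:
  assumes "t \<in> I" "1 \<le> i"
  shows "E t \<subseteq> F i t"
  unfolding onb(1)[OF assms(1), symmetric]
proof (rule span_minimal[OF _ subspace_F])
  show "(\<lambda>a. X a 1 t) ` {1..d} \<subseteq> F i t"
  proof (rule image_subsetI)
    fix a assume a: "a \<in> {1..d}"
    show "X a 1 t \<in> F i t"
      using X'_in_F[OF a order_refl assms(2), of t] unfolding X'_1[OF a] .
  qed
qed

lemma F_expand:
  assumes "f \<in> F i t"
  obtains r where "f = (\<Sum>p\<in>{1..d} \<times> {1..i}. r p *\<^sub>R X' (fst p) (snd p) t)"
proof -
  let ?Y = "{(a, b) \<in> young M I lam. b \<le> i}"
  have fin: "finite ?Y" by (rule finite_subset[OF _ finite_young]) auto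
  obtain r where r: "f = (\<Sum>p\<in>?Y. r p *\<^sub>R (\<lambda>(a, b). X a b t) p)"
    using assms unfolding F_def in_span_image_iff[OF fin] by blast
  have "f = (\<Sum>p\<in>{1..d} \<times> {1..i}. (if p \<in> ?Y then r p else 0) *\<^sub>R X' (fst p) (snd p) t)"
    unfolding r by (rule sum.mono_neutral_cong_left) (auto simp: young_iff X'_def)
  then show ?thesis by (rule that)
qed

text \<open>Transported to the chart at t, the section lies in the span of an independent continuous
  family, so \<open>vector_derivative_in_span\<close> applies; the Christoffel term vanishes
  together with the section at t.\<close>

lemma F_derivative:
  assumes t: "t \<in> I" and W: "vder W t w'" "W t = 0" "\<And>s. s \<in> I \<Longrightarrow> W s \<in> F i s"
  shows "D W t \<in> F i t"
proof -
  let ?Y = "{(a, b) \<in> young M I lam. b \<le> i}"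
  let ?f = "\<lambda>p s. vcoord M (ch t) (gam s) (case p of (a, b) \<Rightarrow> X a b s)"
  have fin: "finite ?Y" by (rule finite_subset[OF _ finite_young]) auto
  have sub: "?Y \<subseteq> young M I lam" by auto
  have at: "(\<lambda>p. ?f p t) = (\<lambda>(a, b). X a b t)" by auto
  have "w' \<in> span ((\<lambda>p. ?f p t) ` ?Y)"
  proof (rule vector_derivative_in_span[where Y = ?f, OF fin _ _ _ W(1)[unfolded vder_def] _ _ nb[OF t]])
    show "inj_on (\<lambda>p. ?f p t) ?Y"
      unfolding at using frame_independent(1)[OF t] sub by (rule inj_on_subset)
    show "independent ((\<lambda>p. ?f p t) ` ?Y)"
      unfolding at using frame_independent(2)[OF t] by (rule independent_mono) (use sub in blast)
    fix p assume "p \<in> ?Y"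
    then obtain a b where p: "p = (a, b)" "(a, b) \<in> young M I lam" by auto
    obtain v' where "vder (X a b) t v'" using frame_vder[OF t p(2)] by blast
    then show "(?f p \<longlongrightarrow> ?f p t) (at t within I)"
      using has_vector_derivative_continuous continuous_within unfolding vder_def p by fastforce
  next
    have "linear (vcoord M (ch t) (gam t))" by (rule linear_vcoord) auto
    then show "vcoord M (ch t) (gam t) (W t) = 0"
      by (simp add: W(2) linear_0)
    show "\<forall>\<^sub>F s in at t within I. vcoord M (ch t) (gam s) (W s) \<in> span ((\<lambda>p. ?f p s) ` ?Y)"
    proof -
      have "\<forall>\<^sub>F s in at t within I. s \<in> I" by (simp add: eventually_at_filter)
      with eventually_dom[OF t] show ?thesis
      proof eventually_elim
        fix s assume s: "gam s \<in> fst (ch t)" "s \<in> I"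
        have "vcoord M (ch t) (gam s) (W s) \<in> vcoord M (ch t) (gam s) ` span ((\<lambda>(a, b). X a b s) ` ?Y)"
          using W(3)[OF s(2)] by (simp add: F_def)
        also have "\<dots> = span (vcoord M (ch t) (gam s) ` ((\<lambda>(a, b). X a b s) ` ?Y))"
          by (rule linear_span_image[OF linear_vcoord[OF chart_at_atlas s(1)], symmetric])
        finally show "vcoord M (ch t) (gam s) (W s) \<in> span ((\<lambda>p. ?f p s) ` ?Y)"
          by (simp add: image_image)
      qed
    qed
  qed
  then show ?thesis
    unfolding at using D_eq[OF t W(1)] by (simp add: F_def W(2) linear_0[OF Gam_linear])
qed

text \<open>The coefficients of \<open>R\<close> in the frame are frozen at \<open>t\<close>: this changes \<open>R\<close> by a section of the flag
  that vanishes at \<open>t\<close>, whose derivative stays in the flag. So no derivative of the coefficients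
  is needed.\<close>

lemma L_flag_section:
  assumes t: "t \<in> I" and k: "1 \<le> k" and R: "vder R t R'" "\<And>s. s \<in> I \<Longrightarrow> R s \<in> F k s"
    and Rt: "R t = (\<Sum>i\<in>{1..d}. h i *\<^sub>R X' i k t) + f" "f \<in> F (k - 1) t"
  shows "L R t - (\<Sum>i\<in>{1..d}. h i *\<^sub>R X' i (Suc k) t) \<in> F k t"
proof -
  obtain r where r: "f = (\<Sum>p\<in>{1..d} \<times> {1..k - 1}. r p *\<^sub>R X' (fst p) (snd p) t)"
    using F_expand[OF Rt(2)] by blast
  let ?K = "{1..d} \<times> {1..k - 1}"
  let ?R1 = "\<lambda>s. \<Sum>i\<in>{1..d}. h i *\<^sub>R X' i k s" and ?R2 = "\<lambda>s. \<Sum>p\<in>?K. r p *\<^sub>R X' (fst p) (snd p) s"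
  obtain y1 where y1: "\<And>i. i \<in> {1..d} \<Longrightarrow> vder (X' i k) t (y1 i)"
    using X'_frame(1)[OF t _ k] by metis
  have "\<forall>p\<in>?K. \<exists>v'. vder (X' (fst p) (snd p)) t v'"
    using X'_frame(1)[OF t] by auto
  then obtain y2 where y2: "\<And>p. p \<in> ?K \<Longrightarrow> vder (X' (fst p) (snd p)) t (y2 p)"
    by metis
  note v1 = vder_sum[of t "{1..d}" "\<lambda>i. X' i k" y1 h, OF t y1]
  note v2 = vder_sum[of t ?K "\<lambda>p. X' (fst p) (snd p)" y2 r, OF t y2]
  note w1 = vder_diff[OF t R(1) v1(1)]
  note w2 = vder_diff[OF t w1(1) v2(1)]
  let ?W = "\<lambda>s. R s - ?R1 s - ?R2 s"
  have DW: "D ?W t \<in> F k t"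
  proof (rule F_derivative[OF t w2(1)])
    show "?W t = 0" by (simp add: Rt(1) r)
    show "?W s \<in> F k s" if "s \<in> I" for s
      using k by (intro subspace_diff subspace_sum subspace_scale subspace_F R(2) that X'_in_F) auto
  qed simp_all
  have D1: "D ?R1 t = (\<Sum>i\<in>{1..d}. h i *\<^sub>R D (X' i k) t)" "D ?R2 t = (\<Sum>p\<in>?K. r p *\<^sub>R D (X' (fst p) (snd p)) t)"
    by (rule v1(2), assumption, rule v2(2), assumption)
  have "D ?W t = D R t - D ?R1 t - D ?R2 t"
    using w2(2) w1(2) by simp
  then have "D R t = D ?W t + D ?R1 t + D ?R2 t"
    by (simp add: algebra_simps)
  then have DR: "D R t = D ?W t + (\<Sum>i\<in>{1..d}. h i *\<^sub>R D (X' i k) t) + (\<Sum>p\<in>?K. r p *\<^sub>R D (X' (fst p) (snd p)) t)"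
    unfolding D1 .
  note lt = linear_twist[of "Suc 0" "lam t"]
  have "L R t = D ?W t + (\<Sum>i\<in>{1..d}. h i *\<^sub>R L (X' i k) t) + (\<Sum>p\<in>?K. r p *\<^sub>R L (X' (fst p) (snd p)) t)"
    unfolding L_def DR Rt(1) r
    by (simp only: linear_add[OF lt] linear_sum[OF lt] linear_cmul[OF lt] scaleR_add_right sum.distrib) (simp only: add_ac)
  also have "(\<Sum>i\<in>{1..d}. h i *\<^sub>R L (X' i k) t) = (\<Sum>i\<in>{1..d}. h i *\<^sub>R X' i (Suc k) t) - (\<Sum>i\<in>{1..d}. h i *\<^sub>R Vop t (X' i k t))"
    unfolding sum_subtractf[symmetric] scaleR_diff_right[symmetric]
    by (rule sum.cong) (use X'_frame(2)[OF t _ k] in auto)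
  also have "(\<Sum>p\<in>?K. r p *\<^sub>R L (X' (fst p) (snd p)) t) = (\<Sum>p\<in>?K. r p *\<^sub>R (X' (fst p) (Suc (snd p)) t - Vop t (X' (fst p) (snd p) t)))"
    by (rule sum.cong) (use X'_frame(2)[OF t] in auto)
  finally have "L R t - (\<Sum>i\<in>{1..d}. h i *\<^sub>R X' i (Suc k) t)
      = D ?W t - (\<Sum>i\<in>{1..d}. h i *\<^sub>R Vop t (X' i k t)) + (\<Sum>p\<in>?K. r p *\<^sub>R (X' (fst p) (Suc (snd p)) t - Vop t (X' (fst p) (snd p) t)))"
    by (simp add: algebra_simps)
  also have "\<dots> \<in> F k t"
    using k E_subset_F[OF t k] Vop_in[OF t]
    by (intro subspace_add subspace_diff subspace_sum subspace_scale subspace_F DW X'_in_F) auto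
  finally show ?thesis .
qed

text \<open>The linear map taking X_{i,1} to X_{i,k}, through the coordinates of \<open>w\<close>.
  Rows shorter than k are killed, as \<open>X'\<close> vanishes there.\<close>

definition Sh :: "nat \<Rightarrow> real \<Rightarrow> 'e \<Rightarrow> 'e" where
  "Sh k t w = (\<Sum>i\<in>{1..d}. gmet M (gam t) w (X i 1 t) *\<^sub>R X' i k t)"

lemma Sh_add: "t \<in> I \<Longrightarrow> u \<in> E t \<Longrightarrow> v \<in> E t \<Longrightarrow> Sh k t (u + v) = Sh k t u + Sh k t v"
  unfolding Sh_def sum.distrib[symmetric]
  by (rule sum.cong) (simp_all add: gmet_add_left X1_in[unfolded One_nat_def] X1_in scaleR_add_left)

lemma Sh_in_F: "1 \<le> k \<Longrightarrow> k \<le> i \<Longrightarrow> Sh k t w \<in> F i t"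
  unfolding Sh_def by (intro subspace_sum subspace_scale subspace_F X'_in_F) auto

lemma graded: "t \<in> I \<Longrightarrow> graded_orthonormal (E t) (gmet M (gam t)) {1..d} (\<lambda>a. X a 1 t) (redrow M I lam) (nred M I lam)"
proof
  assume t: "t \<in> I"
  show "gmet M (gam t) (\<Sum>i\<in>{1..d}. c i *\<^sub>R u i) v = (\<Sum>i\<in>{1..d}. c i * gmet M (gam t) (u i) v)"
    if "\<And>i. i \<in> {1..d} \<Longrightarrow> u i \<in> E t" "v \<in> E t" for c u v
    by (rule gmet_sum_left) (use that in auto)
  show "gmet M (gam t) (u + v) w = gmet M (gam t) u w + gmet M (gam t) v w" if "u \<in> E t" "v \<in> E t" "w \<in> E t" for u v w
    by (rule gmet_add_left[OF that])
  show "span ((\<lambda>a. X a 1 t) ` {1..d}) = E t"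
    by (rule onb(1)[OF t])
  show "gmet M (gam t) (X a 1 t) (X b 1 t) = (if a = b then 1 else 0)" if "a \<in> {1..d}" "b \<in> {1..d}" for a b
    by (rule onb(2)[OF t that])
  show "redrow M I lam a \<in> {1..nred M I lam}" if "a \<in> {1..d}" for a
    by (rule redrow_works(1)[OF that])
  show "gmet M (gam t) u v = gmet M (gam t) v u" if "u \<in> E t" "v \<in> E t" for u v
    by (rule gmet_sym[OF that])
  show "gmet M (gam t) (c *\<^sub>R u) v = c * gmet M (gam t) u v" if "u \<in> E t" "v \<in> E t" for c u v
    by (rule gmet_scale_left[OF that])
qed (simp_all add: subspace_distr)

end

section \<open>Expansion of the twist polynomials in the canonical frame\<close>

context canonical_curve
begin

lemma metric_along:
  assumes t: "t \<in> I" and V: "vder V t v'" "\<And>s. s \<in> I \<Longrightarrow> V s \<in> E s" and W: "vder W t w'" "\<And>s. s \<in> I \<Longrightarrow> W s \<in> E s"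
  shows "D V t \<in> E t"
    and "((\<lambda>s. gmet M (gam s) (V s) (W s)) has_vector_derivative
      gmet M (gam t) (D V t) (W t) + gmet M (gam t) (V t) (D W t)) (at t within I)"
  by (rule cov_deriv_metric[where \<gamma> = gam and c = "ch t", OF chart_at_atlas chart_at_dom t nb[OF t] gam_tendsto[OF t]
        xder[OF t] V(1)[unfolded vder_def] W(1)[unfolded vder_def]], erule V(2), erule W(2))+

lemma X1_young: "a \<in> {1..d} \<Longrightarrow> (a, 1) \<in> young M I lam"
  using n_pos by (simp add: young_iff)

lemma D_X1_in:
  assumes "t \<in> I" "a \<in> {1..d}"
  shows "D (X a 1) t \<in> E t"
proof -
  obtain v' where v: "vder (X a 1) t v'"
    using frame_vder[OF assms(1) X1_young[OF assms(2)]] by blast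
  show ?thesis
    by (rule metric_along(1)[OF assms(1) v _ v]) (erule X1_in[OF _ assms(2)])+
qed

lemma D_X1_antisym:
  assumes t: "t \<in> I" and ab: "a \<in> {1..d}" "b \<in> {1..d}"
  shows "gmet M (gam t) (D (X a 1) t) (X b 1 t) = - gmet M (gam t) (D (X b 1) t) (X a 1 t)"
proof -
  obtain v' where v: "vder (X a 1) t v'"
    using frame_vder[OF t X1_young[OF ab(1)]] by blast
  obtain w' where w: "vder (X b 1) t w'"
    using frame_vder[OF t X1_young[OF ab(2)]] by blast
  have "((\<lambda>s. gmet M (gam s) (X a 1 s) (X b 1 s)) has_vector_derivative
      gmet M (gam t) (D (X a 1) t) (X b 1 t) + gmet M (gam t) (X a 1 t) (D (X b 1) t)) (at t within I)"
    by (rule metric_along(2)[OF t v _ w]) (erule X1_in[OF _ ab(1)], erule X1_in[OF _ ab(2)])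
  then have "((\<lambda>s. if a = b then 1 else 0 :: real) has_vector_derivative
      gmet M (gam t) (D (X a 1) t) (X b 1 t) + gmet M (gam t) (X a 1 t) (D (X b 1) t)) (at t within I)"
    by (rule has_vector_derivative_transform[OF t, rotated 1]) (rule onb(2)[OF _ ab, symmetric])
  from vector_derivative_unique_within[OF nb[OF t] this has_vector_derivative_const]
  have "gmet M (gam t) (D (X a 1) t) (X b 1 t) + gmet M (gam t) (X a 1 t) (D (X b 1) t) = 0" .
  then show ?thesis
    using gmet_sym[OF X1_in[OF t ab(1)] D_X1_in[OF t ab(2)]] by linarith
qed

lemma Sh_1: "t \<in> I \<Longrightarrow> w \<in> E t \<Longrightarrow> Sh 1 t w = w"
proof -
  assume t: "t \<in> I" and w: "w \<in> E t"
  have "Sh 1 t w = (\<Sum>a\<in>{1..d}. gmet M (gam t) w (X a 1 t) *\<^sub>R X a 1 t)"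
    unfolding Sh_def by (rule sum.cong[OF refl]) (simp only: X'_1)
  also have "\<dots> = w"
    by (rule graded_orthonormal.expand[OF graded[OF t] w, symmetric])
  finally show ?thesis .
qed

lemma Sh_diff: "t \<in> I \<Longrightarrow> u \<in> E t \<Longrightarrow> v \<in> E t \<Longrightarrow> Sh k t (u - v) = Sh k t u - Sh k t v"
  using Sh_add[of t "u - v" v k] subspace_diff[OF subspace_distr] by (simp add: eq_diff_eq)

lemma twist_shift_step:
  assumes t: "t \<in> I" and w: "w \<in> E t"
    and H: "\<And>i. i \<in> {1..d} \<Longrightarrow> tw k t (X i 1 t) - X' i (Suc k) t \<in> F k t"
  shows "tw k t w - Sh (Suc k) t w \<in> F k t"
proof -
  have we: "w = (\<Sum>a\<in>{1..d}. gmet M (gam t) w (X a 1 t) *\<^sub>R X a 1 t)"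
    by (rule graded_orthonormal.expand[OF graded[OF t] w])
  have "tw k t w = (\<Sum>a\<in>{1..d}. gmet M (gam t) w (X a 1 t) *\<^sub>R tw k t (X a 1 t))"
    by (subst we) (simp only: linear_sum[OF linear_twist] linear_cmul[OF linear_twist])
  then have "tw k t w - Sh (Suc k) t w
      = (\<Sum>a\<in>{1..d}. gmet M (gam t) w (X a 1 t) *\<^sub>R (tw k t (X a 1 t) - X' a (Suc k) t))"
    by (simp only: Sh_def sum_subtractf scaleR_diff_right)
  also have "\<dots> \<in> F k t"
    by (intro subspace_sum subspace_scale subspace_F H)
  finally show ?thesis .
qed

text \<open>The index is shifted: the claim concerns P_{k+1}. Every step contributes one more D_t
  X_{a,1}, from P_{k+1} applied to D_t u, hence the factor \<open>real (Suc k)\<close>. The operator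
  V contributes to the leading term at k = 0 only, where the remainder space is zero; later its
  values are absorbed in the remainder.\<close>

lemma twist_frame:
  assumes "t \<in> I" "a \<in> {1..d}"
  shows "tw (Suc k) t (X a 1 t) - X' a (Suc (Suc k)) t
    + Sh (Suc k) t (real (Suc k) *\<^sub>R D (X a 1) t + Vop t (X a 1 t)) \<in> F k t"
  using assms
proof (induction k arbitrary: a t)
  case 0
  note t = 0(1) and a = 0(2)
  have X1: "X' a 1 = X a 1"
    by (rule ext) (rule X'_1[OF a])
  have "D (X a 1) t + tw (Suc 0) t (X a 1 t) = X' a (Suc 1) t - Vop t (X a 1 t)"
    using X'_frame(2)[OF t a order_refl] unfolding X1 L_def .
  moreover have "D (X a 1) t + Vop t (X a 1 t) \<in> E t"
    by (intro subspace_add subspace_distr D_X1_in Vop_in t a)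
  ultimately have "tw (Suc 0) t (X a 1 t) - X' a (Suc (Suc 0)) t + Sh 1 t (real (Suc 0) *\<^sub>R D (X a 1) t + Vop t (X a 1 t)) = 0"
    using Sh_1[OF t] by (simp add: algebra_simps)
  then show ?case
    using subspace_0[OF subspace_F] by (simp only: One_nat_def)
next
  case (Suc k)
  note t = Suc.prems(1) and a = Suc.prems(2)
  define u where "u = X a 1"
  define Du where "Du = D u t"
  define h where "h = real (Suc k) *\<^sub>R Du + Vop t (u t)"
  have DuE: "Du \<in> E t"
    unfolding Du_def u_def by (rule D_X1_in[OF t a])
  have hE: "h \<in> E t"
    unfolding h_def by (intro subspace_add subspace_scale subspace_distr DuE Vop_in t)
  \<comment> \<open>Required at all times s, since the section \<open>?R\<close> is about to be
    differentiated; hence the induction hypothesis quantifies over t.\<close>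
  have low: "tw (Suc k) s (X i 1 s) - X' i (Suc (Suc k)) s \<in> F (Suc k) s" if s: "s \<in> I" and i: "i \<in> {1..d}" for s i
  proof -
    let ?g = "Sh (Suc k) s (real (Suc k) *\<^sub>R D (X i 1) s + Vop s (X i 1 s))"
    have "(tw (Suc k) s (X i 1 s) - X' i (Suc (Suc k)) s + ?g) - ?g \<in> F (Suc k) s"
      using Suc.IH[OF s i] F_mono[of k "Suc k" s] by (intro subspace_diff subspace_F Sh_in_F) auto
    then show ?thesis by simp
  qed
  let ?R = "\<lambda>s. tw (Suc k) s (u s) - X' a (Suc (Suc k)) s"
  obtain u' where u': "vder u t u'"
    unfolding u_def using frame_vder[OF t X1_young[OF a]] by blast
  obtain w1 where w1: "vder (\<lambda>s. tw (Suc k) s (u s)) t w1"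
    using twist_curve(1)[OF t u'] by blast
  obtain w2 where w2: "vder (X' a (Suc (Suc k))) t w2"
    using X'_frame(1)[OF t a] by fastforce
  note dR = vder_diff[OF t w1 w2]
  \<comment> \<open>By the induction hypothesis \<open>?R\<close> has the coefficients of -h in
    column k + 1 modulo earlier columns; applying \<open>L\<close> moves them to column k +
    2.\<close>
  have "L ?R t - (\<Sum>i\<in>{1..d}. (- gmet M (gam t) h (X i 1 t)) *\<^sub>R X' i (Suc (Suc k)) t) \<in> F (Suc k) t"
  proof (rule L_flag_section[OF t _ dR(1)])
    show "?R s \<in> F (Suc k) s" if "s \<in> I" for s
      unfolding u_def by (rule low[OF that a])
    show "?R t + Sh (Suc k) t h \<in> F (Suc k - 1) t"
      using Suc.IH[OF t a] by (simp only: h_def Du_def u_def diff_Suc_1)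
    show "?R t = (\<Sum>i\<in>{1..d}. (- gmet M (gam t) h (X i 1 t)) *\<^sub>R X' i (Suc k) t) + (?R t + Sh (Suc k) t h)"
      unfolding Sh_def by (simp only: scaleR_minus_left sum_negf) simp
  qed simp
  then have A: "L ?R t + Sh (Suc (Suc k)) t h \<in> F (Suc k) t"
    unfolding Sh_def by (simp only: scaleR_minus_left sum_negf diff_minus_eq_add)
  have LR: "L ?R t = (tw (Suc (Suc k)) t (u t) + tw (Suc k) t Du) - (X' a (Suc (Suc (Suc k))) t - Vop t (X' a (Suc (Suc k)) t))"
  proof -
    have "L ?R t = L (\<lambda>s. tw (Suc k) s (u s)) t - L (X' a (Suc (Suc k))) t"
      by (simp only: L_def dR(2) linear_diff[OF linear_twist]) (simp only: algebra_simps)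
    moreover have "L (X' a (Suc (Suc k))) t = X' a (Suc (Suc (Suc k))) t - Vop t (X' a (Suc (Suc k)) t)"
      by (rule X'_frame(2)[OF t a]) simp
    ultimately show ?thesis
      by (simp only: twist_curve(2)[OF t u'] Du_def)
  qed
  have B: "tw (Suc k) t Du - Sh (Suc (Suc k)) t Du \<in> F (Suc k) t"
    by (rule twist_shift_step[OF t DuE low[OF t]])
  \<comment> \<open>V takes values in the distribution, the span of the first column.\<close>
  have C: "Vop t (X' a (Suc (Suc k)) t) \<in> F (Suc k) t"
    using E_subset_F[OF t, of "Suc k"] Vop_in[OF t] by auto
  have "real (Suc (Suc k)) *\<^sub>R Du + Vop t (u t) = h + Du"
  proof -
    have "real (Suc (Suc k)) = real (Suc k) + 1" by simp
    then show ?thesis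
      unfolding h_def by (simp only: scaleR_add_left scaleR_one add_ac)
  qed
  then have "Sh (Suc (Suc k)) t (real (Suc (Suc k)) *\<^sub>R Du + Vop t (u t)) = Sh (Suc (Suc k)) t h + Sh (Suc (Suc k)) t Du"
    by (simp only: Sh_add[OF t hE DuE])
  then have "tw (Suc (Suc k)) t (u t) - X' a (Suc (Suc (Suc k))) t
      + Sh (Suc (Suc k)) t (real (Suc (Suc k)) *\<^sub>R Du + Vop t (u t))
    = (L ?R t + Sh (Suc (Suc k)) t h) - (tw (Suc k) t Du - Sh (Suc (Suc k)) t Du) - Vop t (X' a (Suc (Suc k)) t)"
    unfolding LR by (simp only:) (simp only: algebra_simps)
  also have "\<dots> \<in> F (Suc k) t"
    by (intro subspace_diff subspace_F A B C)
  finally show ?case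
    by (simp only: Du_def u_def)
qed

text \<open>Keeps of the expansion only its leading column: the correction term of
  \<open>twist_frame\<close> lies in column k and falls into the remainder.\<close>

lemma twist_shift:
  assumes t: "t \<in> I" and w: "w \<in> E t"
  shows "tw k t w - Sh (Suc k) t w \<in> F k t"
proof (cases k)
  case 0
  then show ?thesis
    using Sh_1[OF t w] subspace_0[OF subspace_F] by simp
next
  case (Suc j)
  show ?thesis
  proof (rule twist_shift_step[OF t w])
    fix i assume i: "i \<in> {1..d}"
    let ?g = "Sh (Suc j) t (real (Suc j) *\<^sub>R D (X i 1) t + Vop t (X i 1 t))"
    have "(tw (Suc j) t (X i 1 t) - X' i (Suc (Suc j)) t + ?g) - ?g \<in> F (Suc j) t"
      using twist_frame[OF t i, of j] F_mono[of j "Suc j" t] by (intro subspace_diff subspace_F Sh_in_F) auto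
    then show "tw k t (X i 1 t) - X' i (Suc k) t \<in> F k t"
      unfolding Suc by simp
  qed
qed

lemma twist_flag_subset:
  assumes t: "t \<in> I"
  shows "twist_flag M nabla i (lam t) \<subseteq> F i t"
  unfolding twist_flag_def
proof (rule span_minimal[OF _ subspace_F], rule subsetI)
  fix x assume "x \<in> {twist M nabla j (lam t) v |j v. j < i \<and> v \<in> distr M (gam t)}"
  then obtain j v where x: "x = tw j t v" "j < i" "v \<in> E t" by blast
  have "(tw j t v - Sh (Suc j) t v) + Sh (Suc j) t v \<in> F i t"
    using twist_shift[OF t x(3), of j] F_mono[of j i t] x(2)
    by (intro subspace_add subspace_F Sh_in_F) auto
  then show "x \<in> F i t" by (simp add: x(1))
qed

text \<open>The frame vectors of column k are independent modulo the earlier columns. Only rows that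
  reach column k are seen by the shift, hence the condition on \<open>n i\<close>. This is how
  congruences become equations between coordinates.\<close>

lemma Sh_independent:
  assumes t: "t \<in> I" and k: "1 \<le> k" and Sh: "Sh k t w \<in> F (k - 1) t" and i: "i \<in> {1..d}" "k \<le> n i"
  shows "gmet M (gam t) w (X i 1 t) = 0"
proof -
  let ?Y = "young M I lam" and ?Z = "{(a, b) \<in> young M I lam. b \<le> k - 1}"
  let ?g = "\<lambda>a. gmet M (gam t) w (X a 1 t)"
  let ?f = "\<lambda>(a, b). X a b t"
  have fZ: "finite ?Z" by (rule finite_subset[OF _ finite_young]) auto
  obtain r where r: "Sh k t w = (\<Sum>p\<in>?Z. r p *\<^sub>R ?f p)"
    using Sh unfolding F_def in_span_image_iff[OF fZ] by blast
  \<comment> \<open>The shift minus its expansion, as one coefficient family on the whole diagram: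
    column k carries the coordinates of w, earlier columns the negative expansion, later columns
    0.\<close>
  define c where "c p = (if snd p = k then ?g (fst p) else if p \<in> ?Z then - r p else 0)" for p
  let ?A = "{a \<in> {1..d}. k \<le> n a}"
  let ?Yk = "(\<lambda>a. (a, k)) ` ?A"
  have "(\<Sum>p\<in>?Y. c p *\<^sub>R ?f p) = (\<Sum>p\<in>?Yk \<union> ?Z. c p *\<^sub>R ?f p)"
    by (rule sum.mono_neutral_right[OF finite_young]) (use k in \<open>auto simp: young_iff c_def image_iff\<close>)
  also have "\<dots> = (\<Sum>p\<in>?Yk. c p *\<^sub>R ?f p) + (\<Sum>p\<in>?Z. c p *\<^sub>R ?f p)"
    by (rule sum.union_disjoint) (use fZ k in auto)
  also have "(\<Sum>p\<in>?Yk. c p *\<^sub>R ?f p) = (\<Sum>a\<in>?A. ?g a *\<^sub>R X a k t)"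
    by (subst sum.reindex) (auto simp: inj_on_def c_def)
  also have "\<dots> = Sh k t w"
    unfolding Sh_def by (rule sum.mono_neutral_cong_left) (auto simp: X'_def)
  also have "(\<Sum>p\<in>?Z. c p *\<^sub>R ?f p) = (\<Sum>p\<in>?Z. - (r p *\<^sub>R ?f p))"
    by (rule sum.cong[OF refl]) (use k in \<open>auto simp: c_def\<close>)
  also have "Sh k t w + (\<Sum>p\<in>?Z. - (r p *\<^sub>R ?f p)) = 0"
    by (simp only: sum_negf r) simp
  finally have "(\<Sum>p\<in>?Y. c p *\<^sub>R ?f p) = 0" .
  moreover have "\<forall>c. (\<Sum>p\<in>?Y. c p *\<^sub>R ?f p) = 0 \<longrightarrow> (\<forall>p\<in>?Y. c p = 0)"
    using frame_independent(1,2)[OF t] unfolding indexed_independent_iff[OF finite_young, symmetric] by blast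
  ultimately have "\<forall>p\<in>?Y. c p = 0" by blast
  moreover have "(i, k) \<in> ?Y"
    using i k by (simp add: young_iff)
  ultimately have "c (i, k) = 0" by blast
  then show ?thesis by (simp add: c_def)
qed

lemma shortest_row: "\<exists>a\<in>{1..d}. n a = 1"
proof -
  define t where "t = (0::real)"
  have t: "t \<in> I" using interval(3) by (simp add: t_def)
  let ?w = "csharp M (lam t)"
  have w: "?w \<in> E t" by (rule csharp_in)
  have tors0: "torsion M nabla q v v = 0" for q v
  proof -
    have "2 *\<^sub>R torsion M nabla q v v = 0"
      unfolding scaleR_2 by (subst torsion_antisym) simp
    then show ?thesis by simp
  qed
  show ?thesis
  proof (rule ccontr)
    assume H: "\<not> (\<exists>a\<in>{1..d}. n a = 1)"
    have n2: "2 \<le> n a" if "a \<in> {1..d}" for a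
    proof -
      have "n a \<noteq> 1" using H that by blast
      then show ?thesis using n_pos[OF that] by linarith
    qed
    \<comment> \<open>If P_1 u = 0, the shift of u to column 2 lies in column 1. With a second box
      in every row this forces all coordinates of u to vanish, so P_1 would be injective on the
      distribution.\<close>
    have z: "gmet M (gam t) u (X a 1 t) = 0" if u: "u \<in> E t" "tw (Suc 0) t u = 0" and a: "a \<in> {1..d}" for u a
    proof (rule Sh_independent[OF t _ _ a n2[OF a]])
      have "- (tw (Suc 0) t u - Sh (Suc (Suc 0)) t u) \<in> F (Suc 0) t"
        by (rule subspace_neg[OF subspace_F twist_shift[OF t u(1)]])
      then show "Sh 2 t u \<in> F (2 - 1) t"
        unfolding u(2) by (simp add: numeral_2_eq_2)
    qed simp
    \<comment> \<open>The velocity lies in the kernel and must vanish; but then P_1 is zero, which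
      contradicts injectivity because the distribution is nonzero.\<close>
    have w0: "gmet M (gam t) ?w (X a 1 t) = 0" if "a \<in> {1..d}" for a
      by (rule z[OF w _ that]) (simp add: tors0)
    have "?w = 0"
      by (rule graded_orthonormal.coords_eqI[OF graded[OF t] w subspace_0[OF subspace_distr]])
        (simp only: w0 gmet_zero_left[OF X1_in[OF t]])
    then have "tw (Suc 0) t u = 0" for u
      using torsion_antisym[of "gam t" 0 u] linear_0[OF torsion_linear, of "gam t" u] by simp
    moreover have 1: "1 \<in> {1..d}" using d_pos by simp
    ultimately have "gmet M (gam t) (X 1 1 t) (X 1 1 t) = 0"
      using z[OF X1_in[OF t 1] _ 1] by blast
    then show False
      using onb(2)[OF t 1 1] by simp
  qed
qed

end

section \<open>The formulas for the canonical frame and the canonical tensor\<close>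

locale canonical_twist = canonical_curve M nabla I lam S X
  for M :: "('m::{second_countable_topology,t2_space}, 'e::euclidean_space) subriem"
    and nabla :: "('m, 'e) conn" and I :: "real set" and lam :: "real \<Rightarrow> 'm \<times> 'e"
    and S :: "real \<Rightarrow> 'e \<Rightarrow> 'e \<Rightarrow> real" and X :: "nat \<Rightarrow> nat \<Rightarrow> real \<Rightarrow> 'e" +
  fixes B0 Bp C :: "real \<Rightarrow> 'e \<Rightarrow> 'e"
  assumes coeffs: "twist_coeffs M nabla I lam X B0 Bp C"
begin

abbreviation row :: "nat \<Rightarrow> nat" where "row \<equiv> redrow M I lam"

abbreviation Q :: "real \<Rightarrow> 'e \<Rightarrow> 'e" where "Q \<equiv> Qmap M nabla I lam X B0 Bp C"

text \<open>The first index is the argument, the second the component of the value, so dualizing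
  exchanges the indices. \<open>Dentry\<close> is separate, because D_t acts on fields and becomes
  an endomorphism only after \<open>D_X1_eq_Q\<close>.\<close>

definition entry :: "real \<Rightarrow> ('e \<Rightarrow> 'e) \<Rightarrow> nat \<Rightarrow> nat \<Rightarrow> real" where
  "entry t f a b = gmet M (gam t) (f (X a 1 t)) (X b 1 t)"

definition Dentry :: "real \<Rightarrow> nat \<Rightarrow> nat \<Rightarrow> real" where
  "Dentry t a b = gmet M (gam t) (D (X a 1) t) (X b 1 t)"

section \<open>Linear equations for the matrix entries at a fixed time\<close>

context
  fixes t assumes t: "t \<in> I"
begin

interpretation g: graded_orthonormal "E t" "gmet M (gam t)" "{1..d}" "\<lambda>a. X a 1 t" row "nred M I lam"
  by (rule graded[OF t])

lemma Box_eq: "Box M I lam X k 1 t = g.box k"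
proof -
  have "{X a 1 t |a. (a, 1) \<in> young M I lam \<and> row a = k} = (\<lambda>a. X a 1 t) ` {a \<in> {1..d}. row a = k}"
    using X1_young young_iff by blast
  then show ?thesis
    by (simp only: Box_def g.box_def)
qed

lemma pr_eq: "u \<in> E t \<Longrightarrow> pr M I lam X k t u = g.proj k u"
  unfolding pr_def Box_eq by (rule g.proj_the)

lemma gdual_eq: "endo_on (E t) f \<Longrightarrow> v \<in> E t \<Longrightarrow> gdual M lam t f v = g.dual f v"
  unfolding gdual_def Let_def g.dual_def by (rule g.dual_unique)

lemma X1_box: "a \<in> {1..d} \<Longrightarrow> X a 1 t \<in> g.box (row a)"
  unfolding g.box_def by (rule span_base) auto

lemma endo_coeffs: "endo_on (E t) (B0 t)" "endo_on (E t) (Bp t)" "endo_on (E t) (C t)"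
  using coeffs t unfolding twist_coeffs_def by blast+

lemma coeffs_row:
  assumes a: "a \<in> {1..d}"
  shows "B0 t (X a 1 t) \<in> g.box (row a)"
    "Bp t (X a 1 t) \<in> span (\<Union>i\<in>{1..<row a}. g.box i)" "C t (X a 1 t) \<in> span (\<Union>i\<in>{1..<row a}. g.box i)"
    "tw (n a) t (X a 1 t) + tw (n a - 1) t (B0 t (X a 1 t) + Bp t (X a 1 t)) \<in> twist_flag M nabla (n a - 1) (lam t)"
    "tw (n a + 1) t (X a 1 t) + tw (n a) t (C t (X a 1 t)) \<in> twist_flag M nabla (n a) (lam t)"
proof -
  note r = redrow_works[OF a]
  have "let n = redlen M I lam (row a); p = lam t
           in B0 t (X a 1 t) \<in> Box M I lam X (row a) 1 t \<and>
              Bp t (X a 1 t) \<in> span (\<Union>i\<in>{1..<row a}. Box M I lam X i 1 t) \<and>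
              C t (X a 1 t) \<in> span (\<Union>i\<in>{1..<row a}. Box M I lam X i 1 t) \<and>
              twist M nabla n p (X a 1 t) + twist M nabla (n - 1) p (B0 t (X a 1 t) + Bp t (X a 1 t))
                \<in> twist_flag M nabla (n - 1) p \<and>
              twist M nabla (n + 1) p (X a 1 t) + twist M nabla n p (C t (X a 1 t)) \<in> twist_flag M nabla n p"
    using coeffs t r(1) X1_box[OF a] unfolding twist_coeffs_def Box_eq[symmetric] by blast
  then show "B0 t (X a 1 t) \<in> g.box (row a)"
    "Bp t (X a 1 t) \<in> span (\<Union>i\<in>{1..<row a}. g.box i)" "C t (X a 1 t) \<in> span (\<Union>i\<in>{1..<row a}. g.box i)"
    "tw (n a) t (X a 1 t) + tw (n a - 1) t (B0 t (X a 1 t) + Bp t (X a 1 t)) \<in> twist_flag M nabla (n a - 1) (lam t)"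
    "tw (n a + 1) t (X a 1 t) + tw (n a) t (C t (X a 1 t)) \<in> twist_flag M nabla (n a) (lam t)"
    unfolding Let_def r(2) Box_eq by blast+
qed

lemma coeff_entries:
  assumes "a \<in> {1..d}" "b \<in> {1..d}"
  shows "row b \<noteq> row a \<Longrightarrow> entry t (B0 t) a b = 0"
    "\<not> row b < row a \<Longrightarrow> entry t (Bp t) a b = 0" "\<not> row b < row a \<Longrightarrow> entry t (C t) a b = 0"
  using coeffs_row(1-3)[OF assms(1)] assms(2) unfolding entry_def g.in_box g.in_span_boxes by auto

text \<open>Comparison of \<open>twist_frame\<close> with a congruence for P_{m+1} X_{a,1}. The
  bound on \<open>n a\<close> makes the term X_{a,m+2} vanish; the bound on \<open>n b\<close> makes
  the coordinate along X_{b,1} readable from column m + 1. The congruences for B and for C are the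
  cases m + 1 = n_a and m = n_a.\<close>

lemma entry_equation:
  assumes a: "a \<in> {1..d}" and b: "b \<in> {1..d}" and m: "Suc m \<le> n b" "n a \<le> Suc m"
    and w: "w \<in> E t" and tw: "tw (Suc m) t (X a 1 t) + tw m t w \<in> twist_flag M nabla m (lam t)"
  shows "real (Suc m) * Dentry t a b + gmet M (gam t) (Vop t (X a 1 t)) (X b 1 t) = gmet M (gam t) w (X b 1 t)"
proof -
  note DE = D_X1_in[OF t a] and VE = Vop_in[OF t, of "X a 1 t"]
  let ?h = "real (Suc m) *\<^sub>R D (X a 1) t + Vop t (X a 1 t)"
  have hE: "?h \<in> E t"
    by (intro subspace_add subspace_scale subspace_distr DE VE)
  have "X' a (Suc (Suc m)) t = 0"
    using m(2) by (simp add: X'_def)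
  then have A: "tw (Suc m) t (X a 1 t) + Sh (Suc m) t ?h \<in> F m t"
    using twist_frame[OF t a, of m] by simp
  have B: "tw (Suc m) t (X a 1 t) + tw m t w \<in> F m t"
    using tw twist_flag_subset[OF t] by blast
  have "Sh (Suc m) t (?h - w) = (tw (Suc m) t (X a 1 t) + Sh (Suc m) t ?h)
      - (tw (Suc m) t (X a 1 t) + tw m t w) + (tw m t w - Sh (Suc m) t w)"
    by (simp only: Sh_diff[OF t hE w]) (simp only: algebra_simps)
  also have "\<dots> \<in> F (Suc m - 1) t"
    unfolding diff_Suc_1 by (intro subspace_add subspace_diff subspace_F A B twist_shift t w)
  finally have Sh: "Sh (Suc m) t (?h - w) \<in> F (Suc m - 1) t" .
  have "gmet M (gam t) (?h - w) (X b 1 t) = 0"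
    by (rule Sh_independent[OF t _ Sh b m(1)]) simp
  then show ?thesis
    using gmet_diff_left[OF hE w X1_in[OF t b]]
      gmet_add_left[OF subspace_scale[OF subspace_distr DE] VE X1_in[OF t b], of "real (Suc m)"]
      gmet_scale_left[OF DE X1_in[OF t b], of "real (Suc m)"]
    unfolding Dentry_def by linarith
qed

abbreviation A :: "'e \<Rightarrow> 'e" where "A \<equiv> asharp M nabla (lam t)"

abbreviation Ss :: "'e \<Rightarrow> 'e" where "Ss \<equiv> ssharp M lam S t"

lemma Vop_entry: "a \<in> {1..d} \<Longrightarrow> b \<in> {1..d} \<Longrightarrow> gmet M (gam t) (Vop t (X a 1 t)) (X b 1 t) = entry t A a b + entry t Ss a b"
  unfolding Vop_def entry_def by (intro gmet_add_left asharp_in ssharp_in X1_in t)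

text \<open>The congruence for B lives in column n_a, which is reached by the rows at least as long
  as row a, that is, those of reduced index at most \<open>row a\<close>.\<close>

lemma entry_le:
  assumes a: "a \<in> {1..d}" and b: "b \<in> {1..d}" and ab: "row b \<le> row a"
  shows "real (n a) * Dentry t a b + entry t A a b + entry t Ss a b = entry t (B0 t) a b + entry t (Bp t) a b"
proof -
  obtain m where m: "n a = Suc m"
    using n_pos[OF a] by (metis Suc_le_D One_nat_def)
  have BE: "B0 t (X a 1 t) \<in> E t" "Bp t (X a 1 t) \<in> E t"
    by (rule endo_onD(1)[OF endo_coeffs(1) X1_in[OF t a]], rule endo_onD(1)[OF endo_coeffs(2) X1_in[OF t a]])
  have "real (Suc m) * Dentry t a b + gmet M (gam t) (Vop t (X a 1 t)) (X b 1 t)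
      = gmet M (gam t) (B0 t (X a 1 t) + Bp t (X a 1 t)) (X b 1 t)"
  proof (rule entry_equation[OF a b])
    show "Suc m \<le> n b"
      using ab rowlen_le_iff[OF a b] m by simp
    show "B0 t (X a 1 t) + Bp t (X a 1 t) \<in> E t"
      by (intro subspace_add subspace_distr BE)
    show "tw (Suc m) t (X a 1 t) + tw m t (B0 t (X a 1 t) + Bp t (X a 1 t)) \<in> twist_flag M nabla m (lam t)"
      using coeffs_row(4)[OF a] unfolding m diff_Suc_1 .
  qed (simp add: m)
  then show ?thesis
    unfolding Vop_entry[OF a b] m gmet_add_left[OF BE X1_in[OF t b]] by (simp add: entry_def)
qed

text \<open>The congruence for C lives one column further, in n_a + 1, and is therefore readable
  only on strictly longer rows.\<close>

lemma entry_less: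
  assumes a: "a \<in> {1..d}" and b: "b \<in> {1..d}" and ab: "row b < row a"
  shows "(real (n a) + 1) * Dentry t a b + entry t A a b + entry t Ss a b = entry t (C t) a b"
proof -
  have CE: "C t (X a 1 t) \<in> E t"
    by (rule endo_onD(1)[OF endo_coeffs(3) X1_in[OF t a]])
  have "real (Suc (n a)) * Dentry t a b + gmet M (gam t) (Vop t (X a 1 t)) (X b 1 t)
      = gmet M (gam t) (C t (X a 1 t)) (X b 1 t)"
  proof (rule entry_equation[OF a b _ _ CE])
    show "Suc (n a) \<le> n b"
      using ab rowlen_le_iff[OF b a] by simp
    show "tw (Suc (n a)) t (X a 1 t) + tw (n a) t (C t (X a 1 t)) \<in> twist_flag M nabla (n a) (lam t)"
      using coeffs_row(5)[OF a] by (simp only: Suc_eq_plus1)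
  qed simp
  then show ?thesis
    unfolding Vop_entry[OF a b] by (simp add: entry_def add.commute)
qed

lemma A_antisym: "a \<in> {1..d} \<Longrightarrow> b \<in> {1..d} \<Longrightarrow> entry t A a b = - entry t A b a"
  unfolding entry_def by (intro asharp_antisym X1_in t)

lemma S_symmetric: "a \<in> {1..d} \<Longrightarrow> b \<in> {1..d} \<Longrightarrow> entry t Ss a b = entry t Ss b a"
  unfolding entry_def by (intro ssharp_sym X1_in t)

lemma Dentry_antisym: "a \<in> {1..d} \<Longrightarrow> b \<in> {1..d} \<Longrightarrow> Dentry t a b = - Dentry t b a"
  unfolding Dentry_def by (rule D_X1_antisym[OF t])

lemma endo_A: "endo_on (E t) A"
  by (rule endo_onI) (simp_all add: asharp_in linear_add[OF asharp_linear] linear_cmul[OF asharp_linear])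

lemma endo_S: "endo_on (E t) Ss"
  by (rule endo_onI) (simp_all add: ssharp_in[OF t] linear_add[OF ssharp_linear[OF t]] linear_cmul[OF ssharp_linear[OF t]])

lemma endo_CB: "endo_on (E t) (\<lambda>v. C t v - Bp t v)"
  by (intro endo_on_diff subspace_distr endo_coeffs)

section \<open>The antisymmetric map Q\<close>

definition W :: "'e \<Rightarrow> 'e" where "W v = B0 t v - g.dual (B0 t) v - 2 *\<^sub>R A v"

lemma endo_W: "endo_on (E t) W"
  unfolding W_def by (intro endo_on_diff endo_on_scale subspace_distr endo_coeffs g.endo_dual endo_A)

definition Qg :: "'e \<Rightarrow> 'e" where
  "Qg u = (1 / 2) *\<^sub>R (\<Sum>k\<in>{1..nred M I lam}. (1 / real (redlen M I lam k)) *\<^sub>R g.proj k (W (g.proj k u)))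
     + (C t u - Bp t u) - g.dual (\<lambda>v. C t v - Bp t v) u"

lemma endo_Qg: "endo_on (E t) Qg"
  unfolding Qg_def
  by (intro endo_on_diff[OF subspace_distr] endo_on_add[OF subspace_distr] endo_on_scale[OF subspace_distr]
      endo_on_sum[OF subspace_distr] endo_on_compose[OF g.endo_proj endo_on_compose[OF endo_W g.endo_proj]]
      endo_coeffs g.endo_dual endo_CB)

lemma Q_eq: "u \<in> E t \<Longrightarrow> Q t u = Qg u"
proof -
  assume u: "u \<in> E t"
  have "pr M I lam X k t (B0 t v - gdual M lam t (B0 t) v - 2 *\<^sub>R A v) = g.proj k (W v)" if "v \<in> E t" for k v
    by (simp only: gdual_eq[OF endo_coeffs(1) that] W_def[symmetric] pr_eq[OF endo_onD(1)[OF endo_W that]])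
  then show ?thesis
    by (simp only: Qmap_def Qg_def Let_def pr_eq[OF u] gdual_eq[OF endo_CB u] g.proj_in)
qed

lemma endo_Q: "endo_on (E t) (Q t)"
  by (rule endo_on_cong[OF Q_eq[symmetric] subspace_distr endo_Qg])

lemma dual_entry:
  assumes "b \<in> {1..d}"
  shows "entry t (g.dual f) a b = entry t f b a"
  unfolding entry_def by (rule g.dual_coord[OF assms])

lemma entry_arith:
  assumes "a \<in> {1..d}" "b \<in> {1..d}"
  shows "endo_on (E t) f \<Longrightarrow> endo_on (E t) h \<Longrightarrow> entry t (\<lambda>v. f v + h v) a b = entry t f a b + entry t h a b"
    "endo_on (E t) f \<Longrightarrow> endo_on (E t) h \<Longrightarrow> entry t (\<lambda>v. f v - h v) a b = entry t f a b - entry t h a b"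
    "endo_on (E t) f \<Longrightarrow> entry t (\<lambda>v. r *\<^sub>R f v) a b = r * entry t f a b"
proof -
  note Xa = X1_in[OF t assms(1)] and Xb = X1_in[OF t assms(2)]
  show "entry t (\<lambda>v. f v + h v) a b = entry t f a b + entry t h a b" if "endo_on (E t) f" "endo_on (E t) h"
    unfolding entry_def by (rule gmet_add_left[OF endo_onD(1)[OF that(1) Xa] endo_onD(1)[OF that(2) Xa] Xb])
  show "entry t (\<lambda>v. f v - h v) a b = entry t f a b - entry t h a b" if "endo_on (E t) f" "endo_on (E t) h"
    unfolding entry_def by (rule gmet_diff_left[OF endo_onD(1)[OF that(1) Xa] endo_onD(1)[OF that(2) Xa] Xb])
  show "entry t (\<lambda>v. r *\<^sub>R f v) a b = r * entry t f a b" if "endo_on (E t) f"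
    unfolding entry_def by (rule gmet_scale_left[OF endo_onD(1)[OF that Xa] Xb])
qed

lemma entry_cong: "f (X a 1 t) = h (X a 1 t) \<Longrightarrow> entry t f a b = entry t h a b"
  by (simp only: entry_def)

text \<open>The projections of X_{a,1} to other rows are 0, where the summands vanish by assumption;
  so the sums over reduced rows in Q and in S collapse to one term.\<close>

lemma sum_rows:
  assumes a: "a \<in> {1..d}" and z: "\<And>k. f k 0 = (0 :: 'e)"
  shows "(\<Sum>k\<in>{1..nred M I lam}. f k (g.proj k (X a 1 t))) = f (row a) (X a 1 t)"
proof -
  have "(\<Sum>k\<in>{1..nred M I lam}. f k (g.proj k (X a 1 t)))
      = (\<Sum>k\<in>{1..nred M I lam}. if k = row a then f (row a) (X a 1 t) else 0)"
    by (rule sum.cong[OF refl]) (use g.proj_e[OF a] z in auto)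
  also have "\<dots> = f (row a) (X a 1 t)"
    using redrow_works(1)[OF a] by (simp only: sum.delta[OF finite_atLeastAtMost] if_True)
  finally show ?thesis .
qed

lemma Q_entry:
  assumes a: "a \<in> {1..d}" and b: "b \<in> {1..d}"
  shows "entry t (Q t) a b = Dentry t a b"
proof -
  let ?h = "\<lambda>u. (1 / 2) *\<^sub>R (1 / real (n a)) *\<^sub>R g.proj (row a) (W u)"
  have z: "(1 / real (redlen M I lam k)) *\<^sub>R g.proj k (W 0) = 0" for k
    by (simp only: endo_on_0[OF subspace_distr endo_W] endo_on_0[OF subspace_distr g.endo_proj] scaleR_zero_right)
  have eh: "endo_on (E t) ?h"
    by (intro endo_on_scale[OF subspace_distr] endo_on_compose[OF g.endo_proj endo_W])
  note ed = g.endo_dual[OF endo_CB]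
  have "entry t (Q t) a b = entry t (\<lambda>u. (?h u + (C t u - Bp t u)) - g.dual (\<lambda>v. C t v - Bp t v) u) a b"
    by (rule entry_cong)
      (simp only: Q_eq[OF X1_in[OF t a]] Qg_def redrow_works(2)[OF a]
        sum_rows[OF a, where f = "\<lambda>k u. (1 / real (redlen M I lam k)) *\<^sub>R g.proj k (W u)", OF z])
  also have "\<dots> = entry t ?h a b + (entry t (C t) a b - entry t (Bp t) a b) - (entry t (C t) b a - entry t (Bp t) b a)"
    by (simp only: entry_arith(1)[OF a b eh endo_CB] entry_arith(2)[OF a b endo_on_add[OF subspace_distr eh endo_CB] ed]
        dual_entry[OF b] entry_arith(2)[OF a b endo_coeffs(3,2)] entry_arith(2)[OF b a endo_coeffs(3,2)])
  also have "entry t ?h a b = (if row b = row a then (entry t (B0 t) a b - entry t (B0 t) b a - 2 * entry t A a b) / (2 * real (n a)) else 0)"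
  proof -
    have "entry t ?h a b = (1 / 2) * ((1 / real (n a)) * entry t (\<lambda>u. g.proj (row a) (W u)) a b)"
      by (simp only: entry_arith(3)[OF a b] endo_on_scale[OF subspace_distr] endo_on_compose[OF g.endo_proj endo_W])
    also have "entry t (\<lambda>u. g.proj (row a) (W u)) a b = (if row b = row a then entry t W a b else 0)"
      unfolding entry_def by (rule g.proj_coord[OF b])
    also have "entry t W a b = entry t (B0 t) a b - entry t (B0 t) b a - 2 * entry t A a b"
    proof -
      note e0 = endo_coeffs(1)
      note e1 = g.endo_dual[OF e0] and e2 = endo_on_scale[OF subspace_distr endo_A, of 2]
      have "entry t W a b = entry t (\<lambda>v. (B0 t v - g.dual (B0 t) v) - 2 *\<^sub>R A v) a b"
        by (simp only: W_def entry_def)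
      also have "\<dots> = entry t (B0 t) a b - entry t (B0 t) b a - 2 * entry t A a b"
        by (simp only: entry_arith(2)[OF a b endo_on_diff[OF subspace_distr e0 e1] e2] entry_arith(2)[OF a b e0 e1]
            entry_arith(3)[OF a b endo_A] dual_entry[OF b])
      finally show ?thesis .
    qed
    finally show ?thesis by simp
  qed
  also have "(if row b = row a then (entry t (B0 t) a b - entry t (B0 t) b a - 2 * entry t A a b) / (2 * real (n a)) else 0)
      + (entry t (C t) a b - entry t (Bp t) a b) - (entry t (C t) b a - entry t (Bp t) b a) = Dentry t a b"
  proof (cases "row b" "row a" rule: linorder_cases)
    \<comment> \<open>Subtracting the transposed equation removes the symmetric S and leaves 2 n D +
      2 A equal to B_0 minus its transpose.\<close>
    case equal
    have "n b = n a"
      using rowlen_le_iff[OF a b] rowlen_le_iff[OF b a] equal by simp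
    then have "real (n a) * Dentry t a b + entry t A a b + entry t Ss a b = entry t (B0 t) a b"
      "real (n a) * Dentry t b a + entry t A b a + entry t Ss b a = entry t (B0 t) b a"
      using entry_le[OF a b] entry_le[OF b a] coeff_entries(2)[OF a b] coeff_entries(2)[OF b a] equal by simp_all
    then have "entry t (B0 t) a b - entry t (B0 t) b a - 2 * entry t A a b = 2 * real (n a) * Dentry t a b"
      using A_antisym[OF a b] S_symmetric[OF a b] Dentry_antisym[OF a b] by simp
    moreover have "real (n a) \<noteq> 0" using n_pos[OF a] by simp
    ultimately show ?thesis
      using coeff_entries(2,3)[OF a b] coeff_entries(2,3)[OF b a] equal by simp
  next
    \<comment> \<open>The equations for B and for C differ by one D; their difference eliminates A
      and S at once.\<close>
    case less
    have "Dentry t a b = entry t (C t) a b - entry t (Bp t) a b"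
      using entry_le[OF a b] entry_less[OF a b] coeff_entries(1)[OF a b] less by (simp add: algebra_simps)
    then show ?thesis
      using coeff_entries(2,3)[OF b a] less by simp
  next
    \<comment> \<open>The previous case for the transposed entry; the dual of C - B_+ in the
      definition of Q supplies its negative.\<close>
    case greater
    have "Dentry t b a = entry t (C t) b a - entry t (Bp t) b a"
      using entry_le[OF b a] entry_less[OF b a] coeff_entries(1)[OF b a] greater by (simp add: algebra_simps)
    then show ?thesis
      using coeff_entries(2,3)[OF a b] greater Dentry_antisym[OF a b] by simp
  qed
  finally show ?thesis .
qed

lemma D_X1_eq_Q:
  assumes a: "a \<in> {1..d}"
  shows "D (X a 1) t = Q t (X a 1 t)"
proof (rule g.coords_eqI[OF D_X1_in[OF t a] endo_onD(1)[OF endo_Q X1_in[OF t a]]])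
  show "gmet M (gam t) (D (X a 1) t) (X b 1 t) = gmet M (gam t) (Q t (X a 1 t)) (X b 1 t)" if "b \<in> {1..d}" for b
    using Q_entry[OF a that] by (simp only: entry_def Dentry_def)
qed

text \<open>The matrix of Q is that of D_t by \<open>Q_entry\<close>, whose antisymmetry expresses
  that X_{a,1} remain orthonormal; \<open>g_endo\<close> extends it from the basis to the
  fibre.\<close>

lemma Q_antisym:
  assumes "v \<in> E t" "w \<in> E t"
  shows "gmet M (gam t) (Q t v) w = - gmet M (gam t) v (Q t w)"
proof -
  let ?c = "\<lambda>v a. gmet M (gam t) v (X a 1 t)"
  have e: "gmet M (gam t) (Q t v) w = (\<Sum>a\<in>{1..d}. \<Sum>b\<in>{1..d}. ?c v a * ?c w b * Dentry t a b)"
    if "v \<in> E t" "w \<in> E t" for v w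
    unfolding g.g_endo[OF endo_Q that]
    by (intro sum.cong refl arg_cong2[where f = times]) (rule Q_entry[unfolded entry_def])
  have "gmet M (gam t) (Q t w) v = (\<Sum>b\<in>{1..d}. \<Sum>a\<in>{1..d}. ?c w b * ?c v a * Dentry t b a)"
    by (rule e[OF assms(2,1)])
  also have "\<dots> = (\<Sum>a\<in>{1..d}. \<Sum>b\<in>{1..d}. - (?c v a * ?c w b * Dentry t a b))"
    by (subst sum.swap, intro sum.cong refl, subst Dentry_antisym) (assumption, assumption, simp)
  also have "\<dots> = - gmet M (gam t) (Q t v) w"
    unfolding e[OF assms] by (simp only: sum_negf)
  finally show ?thesis
    using gmet_sym[OF assms(1) endo_onD(1)[OF endo_Q assms(2)]] by simp
qed

section \<open>The canonical tensor restricted to the distribution\<close>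

definition Sg :: "'e \<Rightarrow> 'e" where
  "Sg u = (\<Sum>k\<in>{1..nred M I lam}. real (redlen M I lam k) *\<^sub>R (C t (g.proj k u) - Bp t (g.proj k u))
      + (\<Sum>i\<in>{1..<k}. g.proj i (A (g.proj k u))))"

lemma endo_Sg: "endo_on (E t) Sg"
  unfolding Sg_def
  by (intro endo_on_sum[OF subspace_distr] endo_on_add[OF subspace_distr] endo_on_scale[OF subspace_distr]
      endo_on_compose[OF endo_CB g.endo_proj] endo_on_compose[OF g.endo_proj endo_on_compose[OF endo_A g.endo_proj]])

lemma Smap_eq: "u \<in> E t \<Longrightarrow> Smap M nabla I lam X Bp C t u = Sg u"
  unfolding Smap_def Sg_def Let_def pr_less_def
  by (intro sum.cong refl arg_cong2[where f = "(+)"])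
    (simp_all add: pr_eq g.proj_in asharp_in)

lemma endo_Smap: "endo_on (E t) (Smap M nabla I lam X Bp C t)"
  by (rule endo_on_cong[OF Smap_eq[symmetric] subspace_distr endo_Sg])

lemma Smap_entry:
  assumes a: "a \<in> {1..d}" and b: "b \<in> {1..d}"
  shows "entry t (Smap M nabla I lam X Bp C t) a b
    = (if row b < row a then real (n a) * (entry t (C t) a b - entry t (Bp t) a b) + entry t A a b else 0)"
proof -
  let ?p = "\<lambda>u. \<Sum>i\<in>{1..<row a}. g.proj i (A u)"
  have ep: "endo_on (E t) ?p"
    by (intro endo_on_sum[OF subspace_distr] endo_on_compose[OF g.endo_proj endo_A])
  have z: "real (redlen M I lam k) *\<^sub>R (C t 0 - Bp t 0) + (\<Sum>i\<in>{1..<k}. g.proj i (A 0)) = 0" for k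
    by (simp only: endo_on_0[OF subspace_distr endo_CB] linear_0[OF asharp_linear] endo_on_0[OF subspace_distr g.endo_proj]
        scaleR_zero_right sum.neutral_const add_0_right)
  have "entry t (Smap M nabla I lam X Bp C t) a b = entry t (\<lambda>u. real (n a) *\<^sub>R (C t u - Bp t u) + ?p u) a b"
    by (rule entry_cong)
      (simp only: Smap_eq[OF X1_in[OF t a]] Sg_def redrow_works(2)[OF a]
        sum_rows[OF a, where f = "\<lambda>k u. real (redlen M I lam k) *\<^sub>R (C t u - Bp t u) + (\<Sum>i\<in>{1..<k}. g.proj i (A u))", OF z])
  also have "\<dots> = real (n a) * (entry t (C t) a b - entry t (Bp t) a b) + entry t ?p a b"
    by (simp only: entry_arith(1)[OF a b endo_on_scale[OF subspace_distr endo_CB] ep] entry_arith(3)[OF a b endo_CB]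
        entry_arith(2)[OF a b endo_coeffs(3,2)])
  also have "entry t ?p a b = (if row b < row a then entry t A a b else 0)"
  proof -
    have "entry t ?p a b = (\<Sum>i\<in>{1..<row a}. gmet M (gam t) (g.proj i (A (X a 1 t))) (X b 1 t))"
      unfolding entry_def
      using gmet_sum_left[of "{1..<row a}" "\<lambda>i. g.proj i (A (X a 1 t))" "gam t" "X b 1 t" "\<lambda>_. 1", OF g.proj_in X1_in[OF t b]]
      by (simp only: scaleR_one mult_1)
    also have "\<dots> = (\<Sum>i\<in>{1..<row a}. if i = row b then entry t A a b else 0)"
      by (rule sum.cong[OF refl]) (simp only: g.proj_coord[OF b] entry_def eq_commute)
    also have "\<dots> = (if row b < row a then entry t A a b else 0)"
      using redrow_works(1)[OF b] by (simp only: sum.delta[OF finite_atLeastLessThan]) simp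
    finally show ?thesis .
  qed
  finally show ?thesis
    using coeff_entries(2,3)[OF a b] by simp
qed

lemma S_formula:
  assumes v: "v \<in> E t"
  shows "Ss v = (1 / 2) *\<^sub>R (B0 t v + gdual M lam t (B0 t) v) + Bp t v + gdual M lam t (Bp t) v
      - Smap M nabla I lam X Bp C t v - gdual M lam t (Smap M nabla I lam X Bp C t) v"
proof -
  let ?Sm = "Smap M nabla I lam X Bp C t"
  let ?r = "\<lambda>v. (1 / 2) *\<^sub>R (B0 t v + g.dual (B0 t) v) + Bp t v + g.dual (Bp t) v - ?Sm v - g.dual ?Sm v"
  note e0 = endo_coeffs(1) and e0d = g.endo_dual[OF endo_coeffs(1)] and e1 = endo_coeffs(2) and e1d = g.endo_dual[OF endo_coeffs(2)]
    and es = endo_Smap and esd = g.endo_dual[OF endo_Smap]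
  note ea = endo_on_add[OF subspace_distr]
  note s1 = ea[OF e0 e0d]
  note s2 = endo_on_scale[OF subspace_distr s1, of "1/2"]
  note s3 = ea[OF s2 e1]
  note s4 = ea[OF s3 e1d]
  note s5 = endo_on_diff[OF subspace_distr s4 es]
  note s6 = endo_on_diff[OF subspace_distr s5 esd]
  have "Ss v = ?r v"
  proof (rule g.endo_eqI[OF endo_S s6 _ v])
    fix a b assume a: "a \<in> {1..d}" and b: "b \<in> {1..d}"
    note ar = entry_arith[OF a b]
    have re: "entry t ?r a b = (1 / 2) * (entry t (B0 t) a b + entry t (B0 t) b a) + entry t (Bp t) a b + entry t (Bp t) b a
        - entry t ?Sm a b - entry t ?Sm b a"
      by (simp only: ar(2)[OF s5 esd] ar(2)[OF s4 es] ar(1)[OF s3 e1d] ar(1)[OF s2 e1] ar(3)[OF s1] ar(1)[OF e0 e0d]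
          dual_entry[OF b])
    have "entry t Ss a b = entry t ?r a b"
    proof (cases "row b" "row a" rule: linorder_cases)
      \<comment> \<open>Adding the transposed equation cancels D and A, leaving twice the entry of
        S; the sum \<open>Smap\<close> has no entries between rows of equal length.\<close>
      case equal
      have "n b = n a"
        using rowlen_le_iff[OF a b] rowlen_le_iff[OF b a] equal by simp
      then have "real (n a) * Dentry t a b + entry t A a b + entry t Ss a b = entry t (B0 t) a b"
        "real (n a) * Dentry t b a + entry t A b a + entry t Ss b a = entry t (B0 t) b a"
        using entry_le[OF a b] entry_le[OF b a] coeff_entries(2)[OF a b] coeff_entries(2)[OF b a] equal by simp_all
      then have "entry t (B0 t) a b + entry t (B0 t) b a = 2 * entry t Ss a b"
        using A_antisym[OF a b] S_symmetric[OF a b] Dentry_antisym[OF a b] by simp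
      then show ?thesis
        unfolding re Smap_entry[OF a b] Smap_entry[OF b a]
        using coeff_entries(2)[OF a b] coeff_entries(2)[OF b a] equal by simp
    next
      \<comment> \<open>With D = C - B_+ inserted, the equation for B reads S = B_+ - n (C - B_+) -
        A; all transposed entries vanish.\<close>
      case less
      have "Dentry t a b = entry t (C t) a b - entry t (Bp t) a b"
        using entry_le[OF a b] entry_less[OF a b] coeff_entries(1)[OF a b] less by (simp add: algebra_simps)
      then show ?thesis
        unfolding re Smap_entry[OF a b] Smap_entry[OF b a]
        using entry_le[OF a b] coeff_entries(1)[OF a b] coeff_entries(1,2)[OF b a] less by simp
    next
      \<comment> \<open>S is symmetric, so the formula is that of the previous case for the
        transposed entry; here the duals carry it.\<close>
      case greater
      have "Dentry t b a = entry t (C t) b a - entry t (Bp t) b a"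
        using entry_le[OF b a] entry_less[OF b a] coeff_entries(1)[OF b a] greater by (simp add: algebra_simps)
      then show ?thesis
        unfolding re Smap_entry[OF a b] Smap_entry[OF b a] S_symmetric[OF a b]
        using entry_le[OF b a] coeff_entries(1)[OF b a] coeff_entries(1,2)[OF a b] greater by simp
    qed
    then show "gmet M (gam t) (Ss (X a 1 t)) (X b 1 t) = gmet M (gam t) (?r (X a 1 t)) (X b 1 t)"
      by (simp only: entry_def)
  qed
  then show ?thesis
    by (simp only: gdual_eq[OF e0 v] gdual_eq[OF e1 v] gdual_eq[OF es v])
qed

section \<open>The map wp_1 and uniqueness for the frame equation\<close>

lemma wp1_frame:
  assumes a: "a \<in> {1..d}"
  shows "wp1 M nabla I lam S X B0 Bp C t (X a 1 t) = X' a 2 t"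
proof -
  have X1: "X' a 1 = X a 1"
    by (rule ext) (rule X'_1[OF a])
  \<comment> \<open>Once Q X_{a,1} is replaced by D_t X_{a,1}, the map wp_1 on X_{a,1} is exactly
    the structural operator, which gives X_{a,2}, or 0 at the end of a row.\<close>
  have "L (X a 1) t + Vop t (X a 1 t) = X' a (Suc 1) t"
    using X'_frame(2)[OF t a order_refl] unfolding X1 by simp
  then show ?thesis
    unfolding wp1_def L_def Vop_def D_X1_eq_Q[OF a] by (simp only: add_ac One_nat_def numeral_2_eq_2)
qed

lemma wp1_shortest:
  assumes v: "v \<in> Box M I lam X (nred M I lam) 1 t"
  shows "wp1 M nabla I lam S X B0 Bp C t v = 0"
proof -
  let ?p = "wp1 M nabla I lam S X B0 Bp C t"
  \<comment> \<open>The kernel is taken inside the fibre, because linearity of Q is available only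
    there; it is a subspace that contains the generators of the box.\<close>
  let ?Z = "{v \<in> E t. ?p v = 0}"
  have eq: "?p u = tw 1 t u + Vop t u + Q t u" for u
    by (simp add: wp1_def Vop_def)
  have "subspace ?Z"
  proof (rule subspaceI)
    show "0 \<in> ?Z"
      using subspace_0[OF subspace_distr]
      by (simp only: mem_Collect_eq eq linear_0[OF linear_twist] linear_0[OF Vop_linear[OF t]]
          endo_on_0[OF subspace_distr endo_Q] add_0_right simp_thms)
    fix u v assume u: "u \<in> ?Z"
    have uE: "u \<in> E t" and pu: "?p u = 0"
      using u by auto
    have "?p (r *\<^sub>R u) = r *\<^sub>R ?p u" for r
      by (simp only: eq linear_cmul[OF linear_twist] linear_cmul[OF Vop_linear[OF t]] endo_onD(3)[OF endo_Q uE] scaleR_add_right)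
    then show "r *\<^sub>R u \<in> ?Z" for r
      using pu uE subspace_scale[OF subspace_distr] by simp
    assume v: "v \<in> ?Z"
    have vE: "v \<in> E t" and pv: "?p v = 0"
      using v by auto
    have "?p (u + v) = ?p u + ?p v"
      by (simp only: eq linear_add[OF linear_twist] linear_add[OF Vop_linear[OF t]] endo_onD(2)[OF endo_Q uE vE])
        (simp only: add_ac)
    then show "u + v \<in> ?Z"
      using pu pv uE vE subspace_add[OF subspace_distr] by simp
  qed
  moreover have "(\<lambda>a. X a 1 t) ` {a \<in> {1..d}. row a = nred M I lam} \<subseteq> ?Z"
  proof (rule image_subsetI)
    fix a assume "a \<in> {a \<in> {1..d}. row a = nred M I lam}"
    then have a: "a \<in> {1..d}" "row a = nred M I lam" by auto
    obtain a0 where a0: "a0 \<in> {1..d}" "n a0 = 1"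
      using shortest_row by blast
    have "row a0 \<le> row a"
      using redrow_works(1)[OF a0(1)] a(2) by simp
    then have "n a \<le> 1"
      using rowlen_le_iff[OF a(1) a0(1)] a0(2) by simp
    then show "X a 1 t \<in> ?Z"
      using wp1_frame[OF a(1)] X1_in[OF t a(1)] by (simp add: X'_def)
  qed
  ultimately have "g.box (nred M I lam) \<subseteq> ?Z"
    unfolding g.box_def by (intro span_minimal)
  then show ?thesis
    using v unfolding Box_eq by blast
qed

end

text \<open>Energy argument: Q is antisymmetric and D_t is metric, so the squared length of the
  difference of two solutions is constant along the interval, and it is zero at time 0.\<close>

lemma solution_unique:
  assumes a: "a \<in> {1..d}" and Y: "differentiable_along M I gam Y" "\<And>t. t \<in> I \<Longrightarrow> Y t \<in> E t"
    "\<And>t. t \<in> I \<Longrightarrow> D Y t = Q t (Y t)" "Y 0 = X a 1 0" and t: "t \<in> I"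
  shows "Y t = X a 1 t"
proof -
  let ?W = "\<lambda>s. Y s - X a 1 s"
  have WE: "?W s \<in> E s" if "s \<in> I" for s
    by (intro subspace_diff subspace_distr Y(2) X1_in that a)
  have "((\<lambda>s. gmet M (gam s) (?W s) (?W s)) has_vector_derivative 0) (at s within I)" if s: "s \<in> I" for s
  proof -
    have "(\<lambda>r. vcoord M (ch s) (gam r) (Y r)) differentiable (at s within I)"
      using Y(1) s unfolding differentiable_along_def by blast
    then have y: "vder Y s (vector_derivative (\<lambda>r. vcoord M (ch s) (gam r) (Y r)) (at s within I))"
      unfolding vder_def vector_derivative_works .
    obtain x' where x: "vder (X a 1) s x'"
      using frame_vder[OF s X1_young[OF a]] by blast
    note w = vder_diff[OF s y x]
    have "D ?W s = Q s (Y s) - Q s (X a 1 s)"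
      unfolding w(2) Y(3)[OF s] D_X1_eq_Q[OF s a] ..
    also have "\<dots> = Q s (?W s)"
      using endo_onD(2)[OF endo_Q[OF s] WE[OF s] X1_in[OF s a]] by simp
    finally have DW: "D ?W s = Q s (?W s)" .
    show ?thesis
      using metric_along(2)[OF s w(1) WE w(1) WE] unfolding DW Q_antisym[OF s WE[OF s] WE[OF s]] by simp
  qed
  then obtain c where c: "\<And>s. s \<in> I \<Longrightarrow> gmet M (gam s) (?W s) (?W s) = c"
    using has_vector_derivative_zero_constant[OF is_interval_convex[OF interval(1)]] by blast
  have "c = 0"
    using c[OF interval(3)] gmet_zero_left[OF subspace_0[OF subspace_distr]] by (simp add: Y(4))
  then have "gmet M (gam t) (?W t) (?W t) = 0"
    using c[OF t] by simp
  then have "?W t = 0"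
    using gmet_pos[OF WE[OF t] WE[OF t]] by force
  then show ?thesis by simp
qed

end

theorem theorem5p13:
  fixes M :: "('m::{second_countable_topology,t2_space}, 'e::euclidean_space) subriem"
    and nabla :: "('m, 'e) conn"
    and I :: "real set"
    and lam :: "real \<Rightarrow> 'm \<times> 'e"
    and \<gamma> :: "real \<Rightarrow> 'm"
    and S :: "real \<Rightarrow> 'e \<Rightarrow> 'e \<Rightarrow> real"
    and X :: "nat \<Rightarrow> nat \<Rightarrow> real \<Rightarrow> 'e"
    and B0 Bp C :: "real \<Rightarrow> 'e \<Rightarrow> 'e"
    and u :: "nat \<Rightarrow> 'e"
  assumes M: "sub_riemannian M"
    and I: "is_interval I" "interior I \<noteq> {}" "0 \<in> I"
    and extremal: "integral_curve M I lam"
    and gamma: "\<gamma> = (\<lambda>t. fst (lam t))"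
    and ample: "ample M I lam"
    and equiregular: "equiregular M I lam"
    and nabla: "is_connection M nabla" "compatible M nabla"
    and canonical: "canonical_frame M nabla I lam S X"
    and initial: "\<And>a. a \<in> {1..dcol M I lam 1} \<Longrightarrow> X a 1 0 = u a"
      "\<And>k. k \<in> {1..nred M I lam} \<Longrightarrow>
         orthonormal_basis_of M (\<gamma> 0) (Box M I lam X k 1 0)
           {a \<in> {1..dcol M I lam 1}. redrow M I lam a = k} u"
    and BC: "twist_coeffs M nabla I lam X B0 Bp C"
  shows
    \<comment> \<open>\<open>Q\<close> is an anti-symmetric endomorphism\<close>
    "(\<forall>t\<in>I. endo_on (distr M (\<gamma> t)) (Qmap M nabla I lam X B0 Bp C t) \<and>
        (\<forall>v\<in>distr M (\<gamma> t). \<forall>w\<in>distr M (\<gamma> t).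
           gmet M (\<gamma> t) (Qmap M nabla I lam X B0 Bp C t v) w
             = - gmet M (\<gamma> t) v (Qmap M nabla I lam X B0 Bp C t w))) \<and>
    \<comment> \<open>the \<open>X a 1\<close> are the solutions of the initial value problems\<close>
     (\<forall>a\<in>{1..dcol M I lam 1}.
        (\<forall>t\<in>I. cov_deriv M nabla I \<gamma> (X a 1) t = Qmap M nabla I lam X B0 Bp C t (X a 1 t)) \<and>
        (\<forall>Y. differentiable_along M I \<gamma> Y \<and> (\<forall>t\<in>I. Y t \<in> distr M (\<gamma> t)) \<and>
             (\<forall>t\<in>I. cov_deriv M nabla I \<gamma> Y t = Qmap M nabla I lam X B0 Bp C t (Y t)) \<and>
             Y 0 = u a
           \<longrightarrow> (\<forall>t\<in>I. Y t = X a 1 t))) \<and>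
    \<comment> \<open>the restriction of \<open>S\<close> to the distribution\<close>
     (\<forall>t\<in>I. \<forall>v\<in>distr M (\<gamma> t).
        ssharp M lam S t v =
          (1 / 2) *\<^sub>R (B0 t v + gdual M lam t (B0 t) v) + Bp t v + gdual M lam t (Bp t) v
          - Smap M nabla I lam X Bp C t v
          - gdual M lam t (Smap M nabla I lam X Bp C t) v) \<and>
    \<comment> \<open>the map \<open>\<wp>\<^sub>1\<close>\<close>
     (\<forall>t\<in>I. \<forall>v\<in>Box M I lam X (nred M I lam) 1 t. wp1 M nabla I lam S X B0 Bp C t v = 0) \<and>
     (\<forall>t\<in>I. \<forall>a\<in>{1..dcol M I lam 1}. rowlen M I lam a > 1
        \<longrightarrow> wp1 M nabla I lam S X B0 Bp C t (X a 1 t) = X a 2 t)"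
proof -
  interpret canonical_twist M nabla I lam S X B0 Bp C
  proof
    show "smooth_atlas (atlas M)" "smooth_subbundle M" "metric_on_distr M"
      using M by (simp_all add: sub_riemannian_def)
  qed (fact I extremal equiregular nabla canonical BC)+
  show ?thesis
    unfolding gamma
  proof (intro conjI ballI allI impI)
    fix t assume t: "t \<in> I"
    show "endo_on (distr M (fst (lam t))) (Qmap M nabla I lam X B0 Bp C t)"
      by (rule endo_Q[OF t])
    show "gmet M (fst (lam t)) (Qmap M nabla I lam X B0 Bp C t v) w
        = - gmet M (fst (lam t)) v (Qmap M nabla I lam X B0 Bp C t w)"
      if "v \<in> distr M (fst (lam t))" "w \<in> distr M (fst (lam t))" for v w
      by (rule Q_antisym[OF t that])
    show "ssharp M lam S t v =
          (1 / 2) *\<^sub>R (B0 t v + gdual M lam t (B0 t) v) + Bp t v + gdual M lam t (Bp t) v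
          - Smap M nabla I lam X Bp C t v
          - gdual M lam t (Smap M nabla I lam X Bp C t) v" if "v \<in> distr M (fst (lam t))" for v
      by (rule S_formula[OF t that])
    show "wp1 M nabla I lam S X B0 Bp C t v = 0" if "v \<in> Box M I lam X (nred M I lam) 1 t" for v
      by (rule wp1_shortest[OF t that])
    fix a assume a: "a \<in> {1..dcol M I lam 1}"
    show "cov_deriv M nabla I (\<lambda>t. fst (lam t)) (X a 1) t = Qmap M nabla I lam X B0 Bp C t (X a 1 t)"
      by (rule D_X1_eq_Q[OF t a])
    show "wp1 M nabla I lam S X B0 Bp C t (X a 1 t) = X a 2 t" if "rowlen M I lam a > 1"
      using wp1_frame[OF t a] that by (simp add: X'_def)
  next
    fix a Y t assume a: "a \<in> {1..dcol M I lam 1}" and t: "t \<in> I"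
      and Y: "differentiable_along M I (\<lambda>t. fst (lam t)) Y \<and> (\<forall>t\<in>I. Y t \<in> distr M (fst (lam t))) \<and>
         (\<forall>t\<in>I. cov_deriv M nabla I (\<lambda>t. fst (lam t)) Y t = Qmap M nabla I lam X B0 Bp C t (Y t)) \<and> Y 0 = u a"
    show "Y t = X a 1 t"
      by (rule solution_unique[OF a _ _ _ _ t]) (use Y initial(1)[OF a] in auto)
  qed
qed

end
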